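(* The functor $\mathrm{sSpec}$ from the opposite of the category of $C^\infty$-superrings to the category of locally $C^\infty$-ringed superspaces is full and faithful when restricted to the (opposite of the) category of fair $C^\infty$-superrings. That is, for any pair of fair $C^\infty$-superrings $R$ and $S$, there is a natural bijection $$\mathrm{Hom}_{C^\infty\text{-Superrings}}(R,S)\;\cong\;\mathrm{Hom}_{\mathrm{LC^\infty SRS}}(\mathrm{sSpec}(S),\mathrm{sSpec}(R)).$$
   Context: **$C^\infty$-rings.** A $C^\infty$-ring is a set $C$ with operations $\phi_f:C^n\to C$ for all $n$ and all $f\in C^\infty(\mathbb{R}^n)$, such that projections act as projections and $\phi_{g(h_1,\dots,h_n)}(c)=\phi_g(\phi_{h_1}(c),\dots,\phi_{h_n}(c))$. Morphisms are maps commuting with all operations. A $C^\infty$-ring is in particular a commutative $\mathbb{R}$-algebra. A $C^\infty$-ring is local if it has a unique maximal ideal and the residue field is $\mathbb{R}$. **$C^\infty$-superrings.** A superring is a unital $\mathbb{Z}_2$-graded ring $R=R_{\bar0}\oplus R_{\bar1}$ with $xy=(-1)^{|x||y|}yx$ for homogeneous $x,y$. A $C^\infty$-superring is a superring whose even part $R_{\bar0}$ carries a $C^\infty$-ring structure compatible with its ring structure. Morphisms are grade-preserving ring homomorphisms whose restriction to even parts is a morphism of $C^\infty$-rings. With $J_R$ the ideal generated by $R_{\bar1}$, the superreduced ring is $\overline R=R/J_R\cong R_{\bar0}/R_{\bar1}^2$, a $C^\infty$-ring; $R$ is local if $\overline R$ is a local $C^\infty$-ring. **Finitely generated.** $C^\infty(\mathbb{R}^{m|n})=C^\infty(\mathbb{R}^m)\otimes_{\mathbb{R}}\bigwedge(\theta^1,\dots,\theta^n)$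 is a $C^\infty$-superring, with the $C^\infty$-operations on even elements defined by Taylor expansion in the nilpotent part. $R$ is finitely generated if there is a surjective morphism $C^\infty(\mathbb{R}^{m|n})\to R$ for some $m,n\ge 0$. **$\mathbb{R}$-points and localization.** $X_R$ is the set of $C^\infty$-ring morphisms $x:R_{\bar0}\to\mathbb{R}$, with topology generated by the basis $U_c=\{x: x(c)\neq0\}$, $c\in R_{\bar0}$. For $x\in X_R$, $\mathcal L_x:R\to R_x$ is the localization of $R$ at $\{r\in R_{\bar0}: x(r)\ne0\}$: the universal morphism of $C^\infty$-superrings making these elements invertible. One has $R_x=(R_{\bar0})_x\oplus(R_{\bar1}\otimes_{R_{\bar0}}(R_{\bar0})_x)$, where $(R_{\bar0})_x$ is the $C^\infty$-ring localization. **Fair.** $R$ is fair if it is finitely generated and any $a\in R$ with $\mathcal L_x(a)=0$ for all $x\in X_R$ is $0$. Fair $C^\infty$-superrings form a full subcategory. **Superspaces.** A locally $C^\infty$-ringed superspace is a topological space $X$ with a sheaf $\mathcal O_X$ of $C^\infty$-superrings all of whose stalks are local. A morphism $(X,\mathcal O_X)\to(Y,\mathcal O_Y)$ is a pair $(f,f^\#)$ with $f:X\to Y$ continuous and $f^\#:\mathcal O_Y\to f_*\mathcal O_X$ a morphism of sheaves of $C^\infty$-superrings. The category is denoted $\mathrm{LC^\infty SRS}$. **The functor $\mathrm{sSpec}$.** $\mathrm{sSpec}(R)=(X_R,\mathcal O_R)$ with $\mathcal O_R(U)=\mathcal O_{X_{R_{\bar0}}}(U)\oplus(\mathrm{MSpec}\,R_{\bar1})(U)$.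 Here $\mathcal O_{X_{R_{\bar0}}}(U)$ is the set of $s:U\to\bigsqcup_{x\in U}(R_{\bar0})_x$ such that each $x\in U$ has an open neighbourhood $V\subseteq U$ and some $c\in R_{\bar0}$ with $s(y)$ equal to the image of $c$ in $(R_{\bar0})_y$ for all $y\in V$. Likewise $(\mathrm{MSpec}\,R_{\bar1})(U)$ is the set of $e:U\to\bigsqcup_{x\in U}R_{\bar1}\otimes_{R_{\bar0}}(R_{\bar0})_x$ that are locally of the form $y\mapsto m\otimes1$ with $m\in R_{\bar1}$ fixed. All operations are pointwise (in $R_x$). For $\varphi:R\to S$, $\mathrm{sSpec}(\varphi)=(f_\varphi,f_\varphi^\#):\mathrm{sSpec}(S)\to\mathrm{sSpec}(R)$ with $f_\varphi(x)=x\circ\varphi|_{R_{\bar0}}$, and $f_\varphi^\#$ induced by the localized morphisms $\varphi_x:R_{f_\varphi(x)}\to S_x$. *)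

theory Defs
  imports "HOL-Analysis.Analysis" "HOL-Algebra.QuotRing" "HOL-Algebra.Module"
begin

section \<open>Smooth functions\<close>

text \<open>
  A function on R^n, with n a natural number, is a function on \<^typ>\<open>nat \<Rightarrow> real\<close> that depends only
  on the coordinates below n.  The type \<^typ>\<open>nat \<Rightarrow> real\<close> carries the product topology, for which
  such a function is continuous iff it is continuous on R^n.
\<close>

definition pderiv_at :: "nat \<Rightarrow> ((nat \<Rightarrow> real) \<Rightarrow> real) \<Rightarrow> (nat \<Rightarrow> real) \<Rightarrow> real" where
  "pderiv_at i f = (\<lambda>x. deriv (\<lambda>t. f (x(i := t))) (x i))"

definition pderivs :: "nat list \<Rightarrow> ((nat \<Rightarrow> real) \<Rightarrow> real) \<Rightarrow> (nat \<Rightarrow> real) \<Rightarrow> real" where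
  "pderivs is f = foldr pderiv_at is f"

definition Cinf :: "nat \<Rightarrow> ((nat \<Rightarrow> real) \<Rightarrow> real) set" where
  "Cinf n = {f.
     (\<forall>x y. (\<forall>i<n. x i = y i) \<longrightarrow> f x = f y) \<and>
     (\<forall>is. set is \<subseteq> {..<n} \<longrightarrow>
        continuous_on UNIV (pderivs is f) \<and>
        (\<forall>i<n. \<forall>x. (\<lambda>t. pderivs is f (x(i := t))) field_differentiable at (x i)))}"


inductive_set polyfun :: "nat \<Rightarrow> ((nat \<Rightarrow> real) \<Rightarrow> real) set" for n where
  polyfun_const: "(\<lambda>_. r) \<in> polyfun n"
| polyfun_proj: "i < n \<Longrightarrow> (\<lambda>x. x i) \<in> polyfun n"
| polyfun_add: "\<lbrakk>f \<in> polyfun n; g \<in> polyfun n\<rbrakk> \<Longrightarrow> (\<lambda>x. f x + g x) \<in> polyfun n"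
| polyfun_mult: "\<lbrakk>f \<in> polyfun n; g \<in> polyfun n\<rbrakk> \<Longrightarrow> (\<lambda>x. f x * g x) \<in> polyfun n"

lemma polyfun_depends: "f \<in> polyfun n \<Longrightarrow> (\<forall>i<n. x i = y i) \<Longrightarrow> f x = f y"
  by (induction rule: polyfun.induct) auto

lemma polyfun_continuous: "f \<in> polyfun n \<Longrightarrow> continuous_on UNIV f"
  by (induction rule: polyfun.induct) (auto intro!: continuous_intros continuous_on_product_coordinates)

lemma polyfun_deriv:
  "f \<in> polyfun n \<Longrightarrow>
    \<exists>g\<in>polyfun n. \<forall>x. ((\<lambda>t. f (x(i := t))) has_field_derivative g x) (at (x i))"
proof (induction rule: polyfun.induct)
  case (polyfun_const r)
  show ?case by (rule bexI[of _ "\<lambda>_. 0"]) (auto intro: polyfun.polyfun_const)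
next
  case (polyfun_proj j)
  show ?case
    by (rule bexI[of _ "\<lambda>_. if i = j then 1 else 0"]) (auto intro: polyfun.polyfun_const)
next
  case (polyfun_add f g)
  then obtain f' g' where "f' \<in> polyfun n" "g' \<in> polyfun n"
    "\<And>x. ((\<lambda>t. f (x(i := t))) has_field_derivative f' x) (at (x i))"
    "\<And>x. ((\<lambda>t. g (x(i := t))) has_field_derivative g' x) (at (x i))" by blast
  then show ?case
    by (intro bexI[of _ "\<lambda>x. f' x + g' x"] ballI allI DERIV_add polyfun.polyfun_add)
next
  case (polyfun_mult f g)
  then obtain f' g' where *: "f' \<in> polyfun n" "g' \<in> polyfun n"
    "\<And>x. ((\<lambda>t. f (x(i := t))) has_field_derivative f' x) (at (x i))"
    "\<And>x. ((\<lambda>t. g (x(i := t))) has_field_derivative g' x) (at (x i))" by blast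
  have "((\<lambda>t. f (x(i := t)) * g (x(i := t))) has_field_derivative f' x * g x + g' x * f x) (at (x i))" for x
    using DERIV_mult[OF *(3)[of x] *(4)[of x]] by simp
  then show ?case
    using *(1,2) polyfun_mult(1,2)
    by (intro bexI[of _ "\<lambda>x. f' x * g x + g' x * f x"] ballI allI polyfun.polyfun_add polyfun.polyfun_mult)
qed

lemma pderiv_at_polyfun: assumes "f \<in> polyfun n" shows "pderiv_at i f \<in> polyfun n"
proof -
  obtain g where g: "g \<in> polyfun n"
    "\<And>x. ((\<lambda>t. f (x(i := t))) has_field_derivative g x) (at (x i))"
    using polyfun_deriv[OF assms] by blast
  have "pderiv_at i f = g" unfolding pderiv_at_def using DERIV_imp_deriv[OF g(2)] by auto
  with g show ?thesis by simp
qed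

lemma pderivs_polyfun: "f \<in> polyfun n \<Longrightarrow> pderivs is f \<in> polyfun n"
  by (induction "is") (auto simp: pderivs_def pderiv_at_polyfun)

lemma polyfun_subset_Cinf: "f \<in> polyfun n \<Longrightarrow> f \<in> Cinf n"
  unfolding Cinf_def
proof (intro CollectI conjI allI impI)
  fix "is" i x assume "f \<in> polyfun n"
  then obtain g where "((\<lambda>t. pderivs is f (x(i := t))) has_field_derivative g x) (at (x i))"
    using polyfun_deriv[OF pderivs_polyfun] by blast
  then show "(\<lambda>t. pderivs is f (x(i := t))) field_differentiable at (x i)"
    by (auto simp: field_differentiable_def)
qed (auto intro: polyfun_depends polyfun_continuous[OF pderivs_polyfun])

lemmas Cinf_polyI = polyfun_subset_Cinf polyfun.intros

lemma Cinf_ring_ops: "(\<lambda>x. x 0 + x 1) \<in> Cinf 2" "(\<lambda>x. x 0 * x 1) \<in> Cinf 2"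
  by (rule polyfun_subset_Cinf, intro polyfun.intros; simp)+


section \<open>C-infinity rings\<close>

text \<open>
  The operation of \<open>f \<in> Cinf n\<close> is applied to lists of length n, so the length of the argument list
  determines the arity.
\<close>

record 'a cinf_ring = "'a partial_object" +
  cop :: "((nat \<Rightarrow> real) \<Rightarrow> real) \<Rightarrow> 'a list \<Rightarrow> 'a"

locale cinf_ring =
  fixes C :: "'a cinf_ring"
  assumes cop_closed:
      "\<lbrakk>set cs \<subseteq> carrier C; f \<in> Cinf (length cs)\<rbrakk> \<Longrightarrow> cop C f cs \<in> carrier C"
    and cop_proj:
      "\<lbrakk>set cs \<subseteq> carrier C; i < length cs\<rbrakk> \<Longrightarrow> cop C (\<lambda>x. x i) cs = cs ! i"
    and cop_comp:
      "\<lbrakk>set cs \<subseteq> carrier C; g \<in> Cinf (length hs); set hs \<subseteq> Cinf (length cs)\<rbrakk>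
        \<Longrightarrow> cop C (\<lambda>x. g (\<lambda>i. (hs ! i) x)) cs = cop C g (map (\<lambda>h. cop C h cs) hs)"

text \<open>
  Maps between algebraic structures are \<^const>\<open>extensional\<close>, so that equality of morphisms is
  equality in HOL.
\<close>

definition cinf_hom :: "'a cinf_ring \<Rightarrow> 'b cinf_ring \<Rightarrow> ('a \<Rightarrow> 'b) set" where
  "cinf_hom C D = {\<phi> \<in> carrier C \<rightarrow>\<^sub>E carrier D.
     \<forall>f cs. set cs \<subseteq> carrier C \<longrightarrow> f \<in> Cinf (length cs) \<longrightarrow>
       \<phi> (cop C f cs) = cop D f (map \<phi> cs)}"

definition real_cinf :: "real cinf_ring" where
  "real_cinf = \<lparr>carrier = UNIV, cop = (\<lambda>f cs. f (\<lambda>i. cs ! i))\<rparr>"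

definition cconst :: "'a cinf_ring \<Rightarrow> real \<Rightarrow> 'a" where
  "cconst C r = cop C (\<lambda>_. r) []"

definition ring_of :: "'a cinf_ring \<Rightarrow> 'a ring" where
  "ring_of C = \<lparr>carrier = carrier C,
     mult = (\<lambda>a b. cop C (\<lambda>x. x 0 * x 1) [a, b]), one = cconst C 1,
     zero = cconst C 0, add = (\<lambda>a b. cop C (\<lambda>x. x 0 + x 1) [a, b])\<rparr>"

text \<open>The residue field is R if the structure map from R to it is bijective.\<close>

definition local_cinf_ring :: "'a cinf_ring \<Rightarrow> bool" where
  "local_cinf_ring C \<longleftrightarrow>
     (\<exists>M. maximalideal M (ring_of C) \<and>
          (\<forall>M'. maximalideal M' (ring_of C) \<longrightarrow> M' = M) \<and>
          bij_betw (\<lambda>r. M +>\<^bsub>ring_of C\<^esub> cconst C r) UNIV (carrier (ring_of C Quot M)))"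


context cinf_ring begin

abbreviation (input) "rng \<equiv> ring_of C"

lemma ring_of_carrier [simp]: "carrier rng = carrier C" by (simp add: ring_of_def)

lemma cconst_closed: "cconst C r \<in> carrier C"
  unfolding cconst_def by (rule cop_closed) (auto intro: Cinf_polyI)

definition ev :: "'a list \<Rightarrow> ((nat\<Rightarrow>real)\<Rightarrow>real) \<Rightarrow> 'a" where "ev cs f = cop C f cs"


lemma ev_add: assumes "set cs \<subseteq> carrier C" "f \<in> polyfun (length cs)" "g \<in> polyfun (length cs)"
  shows "ev cs f \<oplus>\<^bsub>rng\<^esub> ev cs g = ev cs (\<lambda>x. f x + g x)"
  using cop_comp[of cs "\<lambda>x. x 0 + x 1" "[f, g]"] Cinf_ring_ops assms polyfun_subset_Cinf
  by (auto simp: ring_of_def ev_def numeral_2_eq_2)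

lemma ev_mult: assumes "set cs \<subseteq> carrier C" "f \<in> polyfun (length cs)" "g \<in> polyfun (length cs)"
  shows "ev cs f \<otimes>\<^bsub>rng\<^esub> ev cs g = ev cs (\<lambda>x. f x * g x)"
  using cop_comp[of cs "\<lambda>x. x 0 * x 1" "[f, g]"] Cinf_ring_ops assms polyfun_subset_Cinf
  by (auto simp: ring_of_def ev_def numeral_2_eq_2)

lemma ev_const: assumes "set cs \<subseteq> carrier C" shows "ev cs (\<lambda>_. r) = cconst C r"
  using cop_comp[of cs "\<lambda>_. r" "[]"] assms
  by (auto simp: cconst_def ev_def intro: Cinf_polyI)

lemma ev_proj: "\<lbrakk>set cs \<subseteq> carrier C; i < length cs\<rbrakk> \<Longrightarrow> ev cs (\<lambda>x. x i) = cs ! i"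
  by (simp add: ev_def cop_proj)

lemma ev_closed: "\<lbrakk>set cs \<subseteq> carrier C; f \<in> polyfun (length cs)\<rbrakk> \<Longrightarrow> ev cs f \<in> carrier C"
  unfolding ev_def by (auto intro: cop_closed Cinf_polyI)

lemma as_ev:
  assumes "set cs \<subseteq> carrier C" "length cs = 3"
  obtains f g h where "f \<in> polyfun 3" "g \<in> polyfun 3" "h \<in> polyfun 3"
    "cs!0 = ev cs f" "cs!1 = ev cs g" "cs!2 = ev cs h"
  using assms by (auto simp: ev_proj intro!: that[of "\<lambda>x. x 0" "\<lambda>x. x 1" "\<lambda>x. x 2"] polyfun.polyfun_proj)

lemma cring_ring_of: "cring rng"
proof -
  have z: "\<zero>\<^bsub>rng\<^esub> = cconst C 0" "\<one>\<^bsub>rng\<^esub> = cconst C 1" by (simp_all add: ring_of_def)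
  have laws: "(a \<oplus>\<^bsub>rng\<^esub> b) \<oplus>\<^bsub>rng\<^esub> c = a \<oplus>\<^bsub>rng\<^esub> (b \<oplus>\<^bsub>rng\<^esub> c) \<and>
     a \<oplus>\<^bsub>rng\<^esub> b = b \<oplus>\<^bsub>rng\<^esub> a \<and> \<zero>\<^bsub>rng\<^esub> \<oplus>\<^bsub>rng\<^esub> a = a \<and>
     (a \<otimes>\<^bsub>rng\<^esub> b) \<otimes>\<^bsub>rng\<^esub> c = a \<otimes>\<^bsub>rng\<^esub> (b \<otimes>\<^bsub>rng\<^esub> c) \<and>
     a \<otimes>\<^bsub>rng\<^esub> b = b \<otimes>\<^bsub>rng\<^esub> a \<and> \<one>\<^bsub>rng\<^esub> \<otimes>\<^bsub>rng\<^esub> a = a \<and>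
     (a \<oplus>\<^bsub>rng\<^esub> b) \<otimes>\<^bsub>rng\<^esub> c = (a \<otimes>\<^bsub>rng\<^esub> c) \<oplus>\<^bsub>rng\<^esub> (b \<otimes>\<^bsub>rng\<^esub> c) \<and>
     a \<oplus>\<^bsub>rng\<^esub> b \<in> carrier C \<and> a \<otimes>\<^bsub>rng\<^esub> b \<in> carrier C \<and>
     (\<exists>d\<in>carrier C. d \<oplus>\<^bsub>rng\<^esub> a = \<zero>\<^bsub>rng\<^esub>)"
    if "a \<in> carrier C" "b \<in> carrier C" "c \<in> carrier C" for a b c
  proof -
    define l where "l = [a,b,c]"
    have l: "set l \<subseteq> carrier C" "length l = 3" using that by (auto simp: l_def)
    obtain f g h where fgh: "f \<in> polyfun 3" "g \<in> polyfun 3" "h \<in> polyfun 3"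
      and abc: "l!0 = ev l f" "l!1 = ev l g" "l!2 = ev l h"
      using as_ev[OF l] by blast
    have e: "a = ev l f" "b = ev l g" "c = ev l h" using abc by (simp_all add: l_def)
    have e0: "cconst C r = ev l (\<lambda>_. r)" for r using ev_const[OF l(1)] by simp
    have m: "(\<lambda>x. (-1) * f x) \<in> polyfun 3" by (intro polyfun.intros fgh)
    note ev = ev_add[OF l(1), unfolded l(2)] ev_mult[OF l(1), unfolded l(2)]
      ev_closed[OF l(1), unfolded l(2)]
    show ?thesis
      unfolding z e0 e
      apply (intro conjI)
               apply (simp_all add: ev fgh polyfun.intros algebra_simps)
      apply (rule bexI[of _ "ev l (\<lambda>x. (-1) * f x)"])
       apply (simp_all only: ev fgh m)
      apply simp
      done
  qed
  have zc: "\<zero>\<^bsub>rng\<^esub> \<in> carrier C" "\<one>\<^bsub>rng\<^esub> \<in> carrier C" by (simp_all add: z cconst_closed)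
  show ?thesis
  proof (rule cringI)
    show "abelian_group rng"
    proof (rule abelian_groupI, unfold ring_of_carrier)
      show "x \<oplus>\<^bsub>rng\<^esub> y = y \<oplus>\<^bsub>rng\<^esub> x" "x \<oplus>\<^bsub>rng\<^esub> y \<in> carrier C"
        if "x \<in> carrier C" "y \<in> carrier C" for x y using laws that by blast+
    qed (use laws zc in blast)+
    show "comm_monoid rng"
    proof (rule comm_monoidI, unfold ring_of_carrier)
      show "x \<otimes>\<^bsub>rng\<^esub> y = y \<otimes>\<^bsub>rng\<^esub> x" "x \<otimes>\<^bsub>rng\<^esub> y \<in> carrier C"
        if "x \<in> carrier C" "y \<in> carrier C" for x y using laws that by blast+
    qed (use laws zc in blast)+
    show "(x \<oplus>\<^bsub>rng\<^esub> y) \<otimes>\<^bsub>rng\<^esub> w = (x \<otimes>\<^bsub>rng\<^esub> w) \<oplus>\<^bsub>rng\<^esub> (y \<otimes>\<^bsub>rng\<^esub> w)"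
      if "x \<in> carrier rng" "y \<in> carrier rng" "w \<in> carrier rng" for x y w
      using laws that unfolding ring_of_carrier by blast
  qed
qed
end

lemma cinf_homD:
  "\<lbrakk>\<phi> \<in> cinf_hom C D; set cs \<subseteq> carrier C; f \<in> Cinf (length cs)\<rbrakk>
    \<Longrightarrow> \<phi> (cop C f cs) = cop D f (map \<phi> cs)"
  by (simp add: cinf_hom_def)

lemma cinf_hom_ring_hom:
  assumes "cinf_ring C" "cinf_ring D" "\<phi> \<in> cinf_hom C D"
  shows "\<phi> \<in> ring_hom (ring_of C) (ring_of D)"
proof (rule ring_hom_memI)
  have c: "\<phi> (cop C f cs) = cop D f (map \<phi> cs)"
    if "set cs \<subseteq> carrier C" "f \<in> polyfun (length cs)" for f cs
    using assms(3) that polyfun_subset_Cinf unfolding cinf_hom_def by blast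
  show "\<phi> (x \<otimes>\<^bsub>ring_of C\<^esub> y) = \<phi> x \<otimes>\<^bsub>ring_of D\<^esub> \<phi> y"
     "\<phi> (x \<oplus>\<^bsub>ring_of C\<^esub> y) = \<phi> x \<oplus>\<^bsub>ring_of D\<^esub> \<phi> y"
    if "x \<in> carrier (ring_of C)" "y \<in> carrier (ring_of C)" for x y
    using that by (auto simp: ring_of_def intro!: c polyfun.intros trans[OF c])
  show "\<phi> \<one>\<^bsub>ring_of C\<^esub> = \<one>\<^bsub>ring_of D\<^esub>"
    by (auto simp: ring_of_def cconst_def intro!: trans[OF c] polyfun.intros)
  show "\<phi> x \<in> carrier (ring_of D)" if "x \<in> carrier (ring_of C)" for x
    using that assms(3) by (auto simp: ring_of_def cinf_hom_def)
qed


section \<open>C-infinity superrings\<close>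

record 'a csring = "'a ring" +
  even_part :: "'a set"
  odd_part :: "'a set"
  sop :: "((nat \<Rightarrow> real) \<Rightarrow> real) \<Rightarrow> 'a list \<Rightarrow> 'a"

definition even_ring :: "'a csring \<Rightarrow> 'a cinf_ring" where
  "even_ring R = \<lparr>carrier = even_part R, cop = sop R\<rparr>"

locale superring = ring R for R :: "'a csring" (structure) +
  assumes even_subgroup: "additive_subgroup (even_part R) R"
    and odd_subgroup: "additive_subgroup (odd_part R) R"
    and direct_sum: "even_part R <+> odd_part R = carrier R" "even_part R \<inter> odd_part R = {\<zero>}"
    and even_even: "\<lbrakk>a \<in> even_part R; b \<in> even_part R\<rbrakk> \<Longrightarrow> a \<otimes> b \<in> even_part R"
    and even_odd: "\<lbrakk>a \<in> even_part R; m \<in> odd_part R\<rbrakk> \<Longrightarrow> a \<otimes> m \<in> odd_part R"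
    and odd_even: "\<lbrakk>m \<in> odd_part R; a \<in> even_part R\<rbrakk> \<Longrightarrow> m \<otimes> a \<in> odd_part R"
    and odd_odd: "\<lbrakk>m \<in> odd_part R; n \<in> odd_part R\<rbrakk> \<Longrightarrow> m \<otimes> n \<in> even_part R"
    and even_comm: "\<lbrakk>a \<in> even_part R; b \<in> even_part R \<union> odd_part R\<rbrakk> \<Longrightarrow> a \<otimes> b = b \<otimes> a"
    and odd_anticomm: "\<lbrakk>m \<in> odd_part R; n \<in> odd_part R\<rbrakk> \<Longrightarrow> m \<otimes> n = \<ominus> (n \<otimes> m)"

locale cinf_superring = superring R + even: cinf_ring "even_ring R" for R :: "'a csring" (structure) +
  assumes compatible:
      "\<lbrakk>a \<in> even_part R; b \<in> even_part R\<rbrakk> \<Longrightarrow> a \<oplus>\<^bsub>ring_of (even_ring R)\<^esub> b = a \<oplus> b"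
      "\<lbrakk>a \<in> even_part R; b \<in> even_part R\<rbrakk> \<Longrightarrow> a \<otimes>\<^bsub>ring_of (even_ring R)\<^esub> b = a \<otimes> b"
      "\<zero>\<^bsub>ring_of (even_ring R)\<^esub> = \<zero>"
      "\<one>\<^bsub>ring_of (even_ring R)\<^esub> = \<one>"

definition csring_hom :: "'a csring \<Rightarrow> 'b csring \<Rightarrow> ('a \<Rightarrow> 'b) set" where
  "csring_hom R S = {\<phi> \<in> extensional (carrier R). \<phi> \<in> ring_hom R S \<and>
     \<phi> ` even_part R \<subseteq> even_part S \<and> \<phi> ` odd_part R \<subseteq> odd_part S \<and>
     restrict \<phi> (even_part R) \<in> cinf_hom (even_ring R) (even_ring S)}"

definition even_comp :: "'a csring \<Rightarrow> 'a \<Rightarrow> 'a" where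
  "even_comp R a = (THE b. b \<in> even_part R \<and> (\<exists>m\<in>odd_part R. a = b \<oplus>\<^bsub>R\<^esub> m))"

definition odd_comp :: "'a csring \<Rightarrow> 'a \<Rightarrow> 'a" where
  "odd_comp R a = (THE m. m \<in> odd_part R \<and> (\<exists>b\<in>even_part R. a = b \<oplus>\<^bsub>R\<^esub> m))"

text \<open>
  Every coset of the ideal generated by the odd part has an even representative; the operations of
  the superreduced ring are computed on such representatives.
\<close>

definition superreduced :: "'a csring \<Rightarrow> 'a set cinf_ring" where
  "superreduced R = (let J = Idl\<^bsub>R\<^esub> (odd_part R) in
     \<lparr>carrier = carrier (R Quot J),
      cop = (\<lambda>f Ks. J +>\<^bsub>R\<^esub> sop R f (map (\<lambda>K. SOME c. c \<in> K \<inter> even_part R) Ks))\<rparr>)"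

definition local_csring :: "'a csring \<Rightarrow> bool" where
  "local_csring R \<longleftrightarrow> local_cinf_ring (superreduced R)"


section \<open>Smooth functions on R(m|n) and finite generation\<close>

text \<open>
  An element of the tensor product of the smooth functions on R^m with the exterior algebra on n
  generators is given by its coefficients F I at the ordered monomials
  \<open>\<theta>\<^sub>I = \<theta>\<^sub>i \<dots> \<theta>\<^sub>j\<close>, \<open>I = {i < \<dots> < j} \<subseteq> {..<n}\<close>.  One has
  \<open>\<theta>\<^sub>I \<theta>\<^sub>J = reorder_sign I J \<theta>\<^sub>K\<close> if K is the disjoint union of I and J.
\<close>

type_synonym grassmann = "nat set \<Rightarrow> (nat \<Rightarrow> real) \<Rightarrow> real"

definition reorder_sign :: "nat set \<Rightarrow> nat set \<Rightarrow> real" where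
  "reorder_sign I J = (- 1) ^ card {(i, j). i \<in> I \<and> j \<in> J \<and> j < i}"

definition gmult :: "grassmann \<Rightarrow> grassmann \<Rightarrow> grassmann" where
  "gmult F G = (\<lambda>K x. \<Sum>I\<in>Pow K. reorder_sign I (K - I) * F I x * G (K - I) x)"

definition gone :: grassmann where
  "gone = (\<lambda>K x. if K = {} then 1 else 0)"

text \<open>
  The Taylor expansion of f at the body \<open>F\<^sub>i {}\<close> of the arguments \<open>F\<^sub>i\<close>, in powers of their
  nilpotent parts \<open>N\<^sub>i\<close>:  the sum over k of 1/k! times the sum over all index sequences
  \<open>i\<^sub>1, \<dots>, i\<^sub>k\<close> of the k-th partial derivatives times \<open>N\<^sub>i\<^sub>1 \<dots> N\<^sub>i\<^sub>k\<close>.  Products of more than n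
  factors vanish.
\<close>

definition gtaylor :: "nat \<Rightarrow> ((nat \<Rightarrow> real) \<Rightarrow> real) \<Rightarrow> grassmann list \<Rightarrow> grassmann" where
  "gtaylor n f Fs = (\<lambda>K x.
     \<Sum>is | set is \<subseteq> {..<length Fs} \<and> length is \<le> n.
       pderivs is f (\<lambda>i. (Fs ! i) {} x) / fact (length is) *
       foldr (\<lambda>i. gmult ((Fs ! i)({} := (\<lambda>_. 0)))) is gone K x)"

definition Cinf_super :: "nat \<Rightarrow> nat \<Rightarrow> grassmann csring" where
  "Cinf_super m n = (let A = {F. (\<forall>I. F I \<in> Cinf m) \<and> (\<forall>I. \<not> I \<subseteq> {..<n} \<longrightarrow> F I = (\<lambda>_. 0))} in
     \<lparr>carrier = A, mult = gmult, one = gone,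
      zero = (\<lambda>K x. 0), add = (\<lambda>F G K x. F K x + G K x),
      even_part = {F \<in> A. \<forall>I. odd (card I) \<longrightarrow> F I = (\<lambda>_. 0)},
      odd_part = {F \<in> A. \<forall>I. even (card I) \<longrightarrow> F I = (\<lambda>_. 0)},
      sop = gtaylor n\<rparr>)"

definition finitely_generated :: "'a csring \<Rightarrow> bool" where
  "finitely_generated R \<longleftrightarrow>
     (\<exists>m n. \<exists>\<phi> \<in> csring_hom (Cinf_super m n) R. \<phi> ` carrier (Cinf_super m n) = carrier R)"


section \<open>Localization of C-infinity rings\<close>

text \<open>
  The localization of C at S is the quotient of the term algebra over C and formal inverses of the
  elements of S by the least congruence that enforces the laws of C-infinity rings, makes the
  inclusion of C a morphism and makes the formal inverses inverse.  Its universal property is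
  \<open>cloc_universal\<close> below.
\<close>

datatype 'a lterm = Img 'a | Inv 'a | App "(nat \<Rightarrow> real) \<Rightarrow> real" "'a lterm list"

inductive_set lterms :: "'a cinf_ring \<Rightarrow> 'a set \<Rightarrow> 'a lterm set" for C S where
  "c \<in> carrier C \<Longrightarrow> Img c \<in> lterms C S"
| "s \<in> S \<Longrightarrow> Inv s \<in> lterms C S"
| "\<lbrakk>\<forall>t\<in>set ts. t \<in> lterms C S; f \<in> Cinf (length ts)\<rbrakk> \<Longrightarrow> App f ts \<in> lterms C S"

inductive lterm_eq :: "'a cinf_ring \<Rightarrow> 'a set \<Rightarrow> 'a lterm \<Rightarrow> 'a lterm \<Rightarrow> bool" for C S where
  lterm_refl: "t \<in> lterms C S \<Longrightarrow> lterm_eq C S t t"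
| lterm_sym: "lterm_eq C S t u \<Longrightarrow> lterm_eq C S u t"
| lterm_trans: "\<lbrakk>lterm_eq C S t u; lterm_eq C S u v\<rbrakk> \<Longrightarrow> lterm_eq C S t v"
| lterm_cong: "list_all2 (lterm_eq C S) ts us \<Longrightarrow> lterm_eq C S (App f ts) (App f us)"
| lterm_proj: "\<lbrakk>set ts \<subseteq> lterms C S; i < length ts\<rbrakk> \<Longrightarrow> lterm_eq C S (App (\<lambda>x. x i) ts) (ts ! i)"
| lterm_comp: "\<lbrakk>set ts \<subseteq> lterms C S; g \<in> Cinf (length hs); set hs \<subseteq> Cinf (length ts)\<rbrakk>
    \<Longrightarrow> lterm_eq C S (App (\<lambda>x. g (\<lambda>i. (hs ! i) x)) ts) (App g (map (\<lambda>h. App h ts) hs))"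
| lterm_img: "\<lbrakk>set cs \<subseteq> carrier C; f \<in> Cinf (length cs)\<rbrakk>
    \<Longrightarrow> lterm_eq C S (App f (map Img cs)) (Img (cop C f cs))"
| lterm_inv: "s \<in> S \<Longrightarrow> lterm_eq C S (App (\<lambda>x. x 0 * x 1) [Img s, Inv s]) (App (\<lambda>_. 1) [])"

definition lclass :: "'a cinf_ring \<Rightarrow> 'a set \<Rightarrow> 'a lterm \<Rightarrow> 'a lterm set" where
  "lclass C S t = {u. lterm_eq C S t u}"

definition cloc :: "'a cinf_ring \<Rightarrow> 'a set \<Rightarrow> 'a lterm set cinf_ring" where
  "cloc C S = \<lparr>carrier = lclass C S ` lterms C S,
     cop = (\<lambda>f Ks. lclass C S (App f (map (\<lambda>K. SOME t. t \<in> K) Ks)))\<rparr>"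

definition cloc_map :: "'a cinf_ring \<Rightarrow> 'a set \<Rightarrow> 'a \<Rightarrow> 'a lterm set" where
  "cloc_map C S = (\<lambda>c\<in>carrier C. lclass C S (Img c))"


lemma lclass_eqI: "lterm_eq C S t u \<Longrightarrow> lclass C S t = lclass C S u"
  by (auto simp: lclass_def intro: lterm_eq.lterm_sym lterm_eq.lterm_trans)

lemma lclass_rep: "t \<in> lterms C S \<Longrightarrow> lterm_eq C S t (SOME u. u \<in> lclass C S t)"
  using someI[of "\<lambda>u. u \<in> lclass C S t" t] by (auto simp: lclass_def intro: lterm_eq.lterm_refl)

lemma lclass_eqD: "\<lbrakk>lclass C S t = lclass C S u; u \<in> lterms C S\<rbrakk> \<Longrightarrow> lterm_eq C S t u"
  using lterm_eq.lterm_refl[of u C S] by (auto simp: lclass_def)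

lemma cloc_cop:
  assumes "set ts \<subseteq> lterms C S"
  shows "cop (cloc C S) f (map (lclass C S) ts) = lclass C S (App f ts)"
proof -
  have "list_all2 (lterm_eq C S) ts (map (\<lambda>K. SOME t. t \<in> K) (map (lclass C S) ts))"
    using assms by (auto simp: list_all2_conv_all_nth intro!: lclass_rep)
  from lclass_eqI[OF lterm_eq.lterm_cong[OF this]] show ?thesis
    by (simp add: cloc_def)
qed

lemma cloc_carrier: "carrier (cloc C S) = lclass C S ` lterms C S"
  by (simp add: cloc_def)

lemma cloc_list:
  assumes "set Ks \<subseteq> carrier (cloc C S)"
  obtains ts where "set ts \<subseteq> lterms C S" "Ks = map (lclass C S) ts"
proof -
  have "\<forall>K\<in>set Ks. \<exists>t. t \<in> lterms C S \<and> K = lclass C S t" using assms by (auto simp: cloc_def)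
  then obtain r where r: "\<forall>K\<in>set Ks. r K \<in> lterms C S \<and> K = lclass C S (r K)" by metis
  have "Ks = map (lclass C S) (map r Ks)" using r by (auto intro!: map_idI[symmetric])
  with r show ?thesis by (intro that[of "map r Ks"]) auto
qed

lemma cinf_ring_cloc: "cinf_ring (cloc C S)"
proof
  fix cs f assume cs: "set cs \<subseteq> carrier (cloc C S)"
  obtain ts where ts: "set ts \<subseteq> lterms C S" "cs = map (lclass C S) ts" using cloc_list[OF cs] .
  { assume "f \<in> Cinf (length cs)"
    with ts show "cop (cloc C S) f cs \<in> carrier (cloc C S)"
      by (simp add: cloc_cop) (auto simp: cloc_carrier intro!: imageI lterms.intros) }
  { fix i assume "i < length cs"
    with ts show "cop (cloc C S) (\<lambda>x. x i) cs = cs ! i"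
      by (simp add: cloc_cop) (auto intro!: lclass_eqI lterm_eq.lterm_proj) }
  { fix g hs assume g: "g \<in> Cinf (length hs)" "set hs \<subseteq> Cinf (length cs)"
    have *: "map (\<lambda>h. cop (cloc C S) h cs) hs = map (lclass C S) (map (\<lambda>h. App h ts) hs)"
      using ts by (simp add: cloc_cop)
    have "set (map (\<lambda>h. App h ts) hs) \<subseteq> lterms C S"
      using ts g by (auto intro!: lterms.intros)
    then show "cop (cloc C S) (\<lambda>x. g (\<lambda>i. (hs ! i) x)) cs
      = cop (cloc C S) g (map (\<lambda>h. cop (cloc C S) h cs) hs)"
      unfolding * using lclass_eqI[OF lterm_eq.lterm_comp[of ts C S g hs]] g ts
      by (simp only: cloc_cop) simp }
qed

lemma cloc_map_hom: "cinf_ring C \<Longrightarrow> cloc_map C S \<in> cinf_hom C (cloc C S)"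
proof -
  assume C: "cinf_ring C"
  have "cloc_map C S (cop C f cs) = cop (cloc C S) f (map (cloc_map C S) cs)"
    if "set cs \<subseteq> carrier C" "f \<in> Cinf (length cs)" for f cs
  proof -
    have "map (cloc_map C S) cs = map (lclass C S) (map Img cs)"
      using that by (auto simp: cloc_map_def)
    then have "cop (cloc C S) f (map (cloc_map C S) cs) = lclass C S (App f (map Img cs))"
      using that by (simp only:) (subst cloc_cop, auto intro: lterms.intros)
    also have "\<dots> = lclass C S (Img (cop C f cs))" by (intro lclass_eqI lterm_eq.lterm_img that)
    also have "\<dots> = cloc_map C S (cop C f cs)"
      using cinf_ring.cop_closed[OF C] that by (simp add: cloc_map_def)
    finally show ?thesis ..
  qed
  then show ?thesis
    by (auto simp: cinf_hom_def cloc_carrier cloc_map_def intro!: imageI lterms.intros)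
qed

lemma cloc_map_unit:
  assumes "s \<in> S" "S \<subseteq> carrier C"
  shows "lclass C S (Inv s) \<in> carrier (cloc C S)"
    "cloc_map C S s \<otimes>\<^bsub>ring_of (cloc C S)\<^esub> lclass C S (Inv s) = \<one>\<^bsub>ring_of (cloc C S)\<^esub>"
proof -
  show "lclass C S (Inv s) \<in> carrier (cloc C S)"
    using assms by (auto simp: cloc_carrier intro!: imageI lterms.intros)
  have "cop (cloc C S) (\<lambda>x. x 0 * x 1) (map (lclass C S) [Img s, Inv s])
     = lclass C S (App (\<lambda>_. 1) [])"
    using assms
    by (subst cloc_cop) (auto intro!: lclass_eqI lterm_eq.lterm_inv[unfolded One_nat_def] lterms.intros)
  moreover have "lclass C S (App (\<lambda>_. 1) []) = cop (cloc C S) (\<lambda>_. 1) []"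
    using cloc_cop[of "[]" C S "\<lambda>_. 1"] by simp
  ultimately show "cloc_map C S s \<otimes>\<^bsub>ring_of (cloc C S)\<^esub> lclass C S (Inv s) = \<one>\<^bsub>ring_of (cloc C S)\<^esub>"
    using assms by (auto simp: ring_of_def cconst_def cloc_map_def)
qed

primrec lterm_val :: "'b cinf_ring \<Rightarrow> ('a \<Rightarrow> 'b) \<Rightarrow> 'a lterm \<Rightarrow> 'b" where
  "lterm_val D \<psi> (Img c) = \<psi> c"
| "lterm_val D \<psi> (Inv s) = (SOME d. d \<in> carrier D \<and> \<psi> s \<otimes>\<^bsub>ring_of D\<^esub> d = \<one>\<^bsub>ring_of D\<^esub>)"
| "lterm_val D \<psi> (App f ts) = cop D f (map (lterm_val D \<psi>) ts)"

theorem cloc_universal: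
  fixes C :: "'a cinf_ring" and D :: "'b cinf_ring"
  assumes C: "cinf_ring C" and S: "S \<subseteq> carrier C" and D: "cinf_ring D"
    and psi: "\<psi> \<in> cinf_hom C D"
    and inv: "\<And>s. s \<in> S \<Longrightarrow> \<exists>d\<in>carrier D. \<psi> s \<otimes>\<^bsub>ring_of D\<^esub> d = \<one>\<^bsub>ring_of D\<^esub>"
  shows "\<exists>!\<xi>. \<xi> \<in> cinf_hom (cloc C S) D \<and> (\<forall>c\<in>carrier C. \<xi> (cloc_map C S c) = \<psi> c)"
proof (rule ex_ex1I)
  interpret D: cinf_ring D by fact
  let ?v = "lterm_val D \<psi>"
  have vinv: "?v (Inv s) \<in> carrier D \<and> \<psi> s \<otimes>\<^bsub>ring_of D\<^esub> ?v (Inv s) = \<one>\<^bsub>ring_of D\<^esub>" if "s \<in> S" for s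
    using someI_ex[of "\<lambda>d. d \<in> carrier D \<and> \<psi> s \<otimes>\<^bsub>ring_of D\<^esub> d = \<one>\<^bsub>ring_of D\<^esub>"] inv[OF that]
    by auto
  have wf: "?v t \<in> carrier D" if "t \<in> lterms C S" for t
    using that
  proof induction
    case (1 c) then show ?case using psi by (auto simp: cinf_hom_def)
  next
    case (2 s) then show ?case using vinv by blast
  next
    case (3 ts f) then show ?case by (auto intro!: D.cop_closed)
  qed
  have eq: "?v t = ?v u" if "lterm_eq C S t u" for t u
    using that
  proof induction
    case (lterm_cong ts us f)
    then have "map ?v ts = map ?v us" by (auto simp: list_all2_conv_all_nth intro!: nth_equalityI)
    then show ?case by simp
  next
    case (lterm_proj ts i)
    then show ?case using D.cop_proj[of "map ?v ts" i] wf by auto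
  next
    case (lterm_comp ts g hs)
    then show ?case using D.cop_comp[of "map ?v ts" g hs] wf by (auto simp: o_def)
  next
    case (lterm_img cs f)
    then show ?case using psi by (auto simp: cinf_hom_def o_def)
  next
    case (lterm_inv s)
    then show ?case using vinv[OF lterm_inv] by (auto simp: ring_of_def cconst_def)
  qed auto
  define \<xi> where "\<xi> = (\<lambda>K\<in>carrier (cloc C S). ?v (SOME t. t \<in> K))"
  have chi: "\<xi> (lclass C S t) = ?v t" if "t \<in> lterms C S" for t
    using eq[OF lclass_rep[OF that]] that by (simp add: \<xi>_def cloc_carrier)
  have "\<xi> (cop (cloc C S) f cs) = cop D f (map \<xi> cs)"
    if cs: "set cs \<subseteq> carrier (cloc C S)" "f \<in> Cinf (length cs)" for f cs
  proof -
    obtain ts where ts: "set ts \<subseteq> lterms C S" "cs = map (lclass C S) ts" using cloc_list[OF cs(1)] .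
    have "App f ts \<in> lterms C S" using ts cs by (auto intro!: lterms.intros)
    then have "\<xi> (cop (cloc C S) f cs) = cop D f (map ?v ts)"
      using ts by (simp add: cloc_cop chi)
    also have "map ?v ts = map \<xi> cs" using ts chi by auto
    finally show ?thesis .
  qed
  moreover have "\<xi> \<in> carrier (cloc C S) \<rightarrow>\<^sub>E carrier D"
    using chi wf by (auto simp: cloc_carrier PiE_def) (auto simp: \<xi>_def cloc_carrier)
  moreover have "\<xi> (cloc_map C S c) = \<psi> c" if "c \<in> carrier C" for c
    using that chi[of "Img c"] by (auto simp: cloc_map_def intro: lterms.intros)
  ultimately show "\<exists>\<xi>. \<xi> \<in> cinf_hom (cloc C S) D \<and> (\<forall>c\<in>carrier C. \<xi> (cloc_map C S c) = \<psi> c)"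
    unfolding cinf_hom_def by blast
next
  fix \<xi> \<xi>'
  assume a: "\<xi> \<in> cinf_hom (cloc C S) D \<and> (\<forall>c\<in>carrier C. \<xi> (cloc_map C S c) = \<psi> c)"
    and b: "\<xi>' \<in> cinf_hom (cloc C S) D \<and> (\<forall>c\<in>carrier C. \<xi>' (cloc_map C S c) = \<psi> c)"
  interpret D: cring "ring_of D" by (rule cinf_ring.cring_ring_of[OF D])
  have rh: "\<xi> \<in> ring_hom (ring_of (cloc C S)) (ring_of D)" "\<xi>' \<in> ring_hom (ring_of (cloc C S)) (ring_of D)"
    using a b cinf_hom_ring_hom cinf_ring_cloc D by blast+
  have car: "carrier (ring_of E) = carrier E" for E by (simp add: ring_of_def)
  have "\<xi> (lclass C S t) = \<xi>' (lclass C S t)" if "t \<in> lterms C S" for t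
    using that
  proof induction
    case (1 c) then show ?case using a b by (auto simp: cloc_map_def)
  next
    case (2 s)
    let ?i = "lclass C S (Inv s)" and ?s = "cloc_map C S s"
    have sc: "s \<in> carrier C" using S 2 by auto
    have st: "?s \<in> carrier (cloc C S)" using cloc_map_hom[OF C] sc by (auto simp: cinf_hom_def)
    note u = cloc_map_unit[OF 2 S]
    have "\<psi> s \<otimes>\<^bsub>ring_of D\<^esub> \<xi> ?i = \<one>\<^bsub>ring_of D\<^esub>"
      using ring_hom_mult[OF rh(1), of ?s ?i] u st a sc ring_hom_one[OF rh(1)] by (auto simp: car)
    moreover have "\<psi> s \<otimes>\<^bsub>ring_of D\<^esub> \<xi>' ?i = \<one>\<^bsub>ring_of D\<^esub>"
      using ring_hom_mult[OF rh(2), of ?s ?i] u st b sc ring_hom_one[OF rh(2)] by (auto simp: car)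
    moreover have "\<psi> s \<in> carrier (ring_of D)" "\<xi> ?i \<in> carrier (ring_of D)" "\<xi>' ?i \<in> carrier (ring_of D)"
      using psi sc ring_hom_closed[OF rh(1)] ring_hom_closed[OF rh(2)] u by (auto simp: cinf_hom_def car)
    ultimately show ?case by (metis D.inv_unique D.m_comm)
  next
    case (3 ts f)
    have "set ts \<subseteq> lterms C S" using 3 by auto
    then have "set (map (lclass C S) ts) \<subseteq> carrier (cloc C S)" "f \<in> Cinf (length (map (lclass C S) ts))"
      using 3 by (auto simp: cloc_carrier)
    with \<open>set ts \<subseteq> lterms C S\<close>
    have "\<xi> (lclass C S (App f ts)) = cop D f (map \<xi> (map (lclass C S) ts))"
      "\<xi>' (lclass C S (App f ts)) = cop D f (map \<xi>' (map (lclass C S) ts))"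
      using conjunct1[OF a] conjunct1[OF b] cloc_cop[of ts C S f]
      by (metis (no_types, lifting) cinf_homD)+
    moreover have "map \<xi> (map (lclass C S) ts) = map \<xi>' (map (lclass C S) ts)" using 3 by auto
    ultimately show ?case by (simp only:)
  qed
  then show "\<xi> = \<xi>'" using a b
    by (intro PiE_ext[of \<xi> "carrier (cloc C S)" "\<lambda>_. carrier D"]) (auto simp: cinf_hom_def cloc_carrier)
qed


section \<open>Tensor products of modules\<close>

text \<open>A list of pairs stands for the sum of the corresponding pure tensors.\<close>

inductive tensor_eq ::
    "('k, 'x) ring_scheme \<Rightarrow> ('k, 'm, 'y) module_scheme \<Rightarrow> ('k, 'n, 'z) module_scheme
      \<Rightarrow> ('m \<times> 'n) list \<Rightarrow> ('m \<times> 'n) list \<Rightarrow> bool" for K M N where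
  tensor_refl: "set us \<subseteq> carrier M \<times> carrier N \<Longrightarrow> tensor_eq K M N us us"
| tensor_sym: "tensor_eq K M N us vs \<Longrightarrow> tensor_eq K M N vs us"
| tensor_trans: "\<lbrakk>tensor_eq K M N us vs; tensor_eq K M N vs ws\<rbrakk> \<Longrightarrow> tensor_eq K M N us ws"
| tensor_cong: "\<lbrakk>tensor_eq K M N us us'; tensor_eq K M N vs vs'\<rbrakk>
    \<Longrightarrow> tensor_eq K M N (us @ vs) (us' @ vs')"
| tensor_comm: "\<lbrakk>set us \<subseteq> carrier M \<times> carrier N; set vs \<subseteq> carrier M \<times> carrier N\<rbrakk>
    \<Longrightarrow> tensor_eq K M N (us @ vs) (vs @ us)"
| tensor_zero: "n \<in> carrier N \<Longrightarrow> tensor_eq K M N [(\<zero>\<^bsub>M\<^esub>, n)] []"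
| tensor_add_left: "\<lbrakk>m \<in> carrier M; m' \<in> carrier M; n \<in> carrier N\<rbrakk>
    \<Longrightarrow> tensor_eq K M N [(m \<oplus>\<^bsub>M\<^esub> m', n)] [(m, n), (m', n)]"
| tensor_add_right: "\<lbrakk>m \<in> carrier M; n \<in> carrier N; n' \<in> carrier N\<rbrakk>
    \<Longrightarrow> tensor_eq K M N [(m, n \<oplus>\<^bsub>N\<^esub> n')] [(m, n), (m, n')]"
| tensor_balanced: "\<lbrakk>k \<in> carrier K; m \<in> carrier M; n \<in> carrier N\<rbrakk>
    \<Longrightarrow> tensor_eq K M N [(k \<odot>\<^bsub>M\<^esub> m, n)] [(m, k \<odot>\<^bsub>N\<^esub> n)]"

definition tclass ::
    "('k, 'x) ring_scheme \<Rightarrow> ('k, 'm, 'y) module_scheme \<Rightarrow> ('k, 'n, 'z) module_scheme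
      \<Rightarrow> ('m \<times> 'n) list \<Rightarrow> ('m \<times> 'n) list set" where
  "tclass K M N us = {vs. tensor_eq K M N us vs}"

definition tensor ::
    "('k, 'x) ring_scheme \<Rightarrow> ('k, 'm, 'y) module_scheme \<Rightarrow> ('k, 'n, 'z) module_scheme
      \<Rightarrow> ('k, ('m \<times> 'n) list set) module" where
  "tensor K M N = \<lparr>carrier = tclass K M N ` {us. set us \<subseteq> carrier M \<times> carrier N},
     mult = undefined, one = undefined, zero = tclass K M N [],
     add = (\<lambda>u v. tclass K M N ((SOME us. us \<in> u) @ (SOME vs. vs \<in> v))),
     smult = (\<lambda>k u. tclass K M N (map (\<lambda>(m, n). (k \<odot>\<^bsub>M\<^esub> m, n)) (SOME us. us \<in> u)))\<rparr>"


section \<open>Localization of C-infinity superrings\<close>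

text \<open>
  The localization of R at a set S of even elements is built on the direct sum of the localization
  of the even part and the tensor product of the odd part with it.  That this is the universal
  morphism of C-infinity superrings inverting S is proved in \<open>Q_cinf_superring\<close>, \<open>map_hom\<close>,
  \<open>map_unit\<close> and \<open>sloc_universal\<close> below.
\<close>

definition odd_module :: "'a csring \<Rightarrow> ('a, 'a) module" where
  "odd_module R = \<lparr>carrier = odd_part R, mult = undefined, one = undefined,
     zero = \<zero>\<^bsub>R\<^esub>, add = add R, smult = mult R\<rparr>"

definition loc_module :: "'a csring \<Rightarrow> 'a set \<Rightarrow> ('a, 'a lterm set) module" where
  "loc_module R S = (let A = ring_of (cloc (even_ring R) S) in
     \<lparr>carrier = carrier A, mult = mult A, one = one A, zero = zero A, add = add A,
      smult = (\<lambda>c a. cloc_map (even_ring R) S c \<otimes>\<^bsub>A\<^esub> a)\<rparr>)"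

type_synonym 'a odd_loc = "('a \<times> 'a lterm set) list set"

definition odd_loc :: "'a csring \<Rightarrow> 'a set \<Rightarrow> ('a, 'a odd_loc) module" where
  "odd_loc R S = tensor (ring_of (even_ring R)) (odd_module R) (loc_module R S)"

definition odd_class :: "'a csring \<Rightarrow> 'a set \<Rightarrow> ('a \<times> 'a lterm set) list \<Rightarrow> 'a odd_loc" where
  "odd_class R S = tclass (ring_of (even_ring R)) (odd_module R) (loc_module R S)"

text \<open>\<open>a \<cdot> \<Sum> m\<^sub>i \<otimes> b\<^sub>i = \<Sum> m\<^sub>i \<otimes> a b\<^sub>i\<close>\<close>

definition odd_loc_smult ::
    "'a csring \<Rightarrow> 'a set \<Rightarrow> 'a lterm set \<Rightarrow> 'a odd_loc \<Rightarrow> 'a odd_loc" where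
  "odd_loc_smult R S a u = odd_class R S
     (map (\<lambda>(m, b). (m, a \<otimes>\<^bsub>ring_of (cloc (even_ring R) S)\<^esub> b)) (SOME us. us \<in> u))"

text \<open>\<open>(\<Sum> m\<^sub>i \<otimes> a\<^sub>i) (\<Sum> n\<^sub>j \<otimes> b\<^sub>j) = \<Sum> m\<^sub>i n\<^sub>j a\<^sub>i b\<^sub>j\<close>\<close>

definition odd_loc_mult ::
    "'a csring \<Rightarrow> 'a set \<Rightarrow> 'a odd_loc \<Rightarrow> 'a odd_loc \<Rightarrow> 'a lterm set" where
  "odd_loc_mult R S u v = (let A = ring_of (cloc (even_ring R) S) in
     foldr (add A)
       (map (\<lambda>((m, a), (n, b)). cloc_map (even_ring R) S (m \<otimes>\<^bsub>R\<^esub> n) \<otimes>\<^bsub>A\<^esub> (a \<otimes>\<^bsub>A\<^esub> b))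
          (List.product (SOME us. us \<in> u) (SOME vs. vs \<in> v)))
       \<zero>\<^bsub>A\<^esub>)"

type_synonym 'a sloc = "'a lterm set \<times> 'a odd_loc"

definition sloc :: "'a csring \<Rightarrow> 'a set \<Rightarrow> 'a sloc csring" where
  "sloc R S = (let C = cloc (even_ring R) S; A = ring_of C; T = odd_loc R S in
     \<lparr>carrier = carrier C \<times> carrier T,
      mult = (\<lambda>(a, u) (b, v).
        (a \<otimes>\<^bsub>A\<^esub> b \<oplus>\<^bsub>A\<^esub> odd_loc_mult R S u v,
         odd_loc_smult R S a v \<oplus>\<^bsub>T\<^esub> odd_loc_smult R S b u)),
      one = (\<one>\<^bsub>A\<^esub>, \<zero>\<^bsub>T\<^esub>), zero = (\<zero>\<^bsub>A\<^esub>, \<zero>\<^bsub>T\<^esub>),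
      add = (\<lambda>(a, u) (b, v). (a \<oplus>\<^bsub>A\<^esub> b, u \<oplus>\<^bsub>T\<^esub> v)),
      even_part = carrier C \<times> {\<zero>\<^bsub>T\<^esub>}, odd_part = {\<zero>\<^bsub>A\<^esub>} \<times> carrier T,
      sop = (\<lambda>f cs. (cop C f (map fst cs), \<zero>\<^bsub>T\<^esub>))\<rparr>)"

definition sloc_map :: "'a csring \<Rightarrow> 'a set \<Rightarrow> 'a \<Rightarrow> 'a sloc" where
  "sloc_map R S = (\<lambda>a\<in>carrier R.
     (cloc_map (even_ring R) S (even_comp R a),
      odd_class R S [(odd_comp R a, \<one>\<^bsub>loc_module R S\<^esub>)]))"


locale superloc = cinf_superring R for R :: "'a csring" (structure) +
  fixes S :: "'a set"
  assumes S_even: "S \<subseteq> even_part R"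
begin

definition "A = ring_of (cloc (even_ring R) S)"
definition "L = cloc_map (even_ring R) S"
definition "te = tensor_eq (ring_of (even_ring R)) (odd_module R) (loc_module R S)"
abbreviation (input) "oc \<equiv> odd_class R S"
definition "W = {us. set us \<subseteq> odd_part R \<times> carrier A}"
abbreviation (input) "T \<equiv> odd_loc R S"

lemma car_A: "carrier A = carrier (cloc (even_ring R) S)" by (simp add: A_def ring_of_def)

sublocale A: cring A
  unfolding A_def by (rule cinf_ring.cring_ring_of[OF cinf_ring_cloc])

lemma car_even [simp]: "carrier (even_ring R) = even_part R" by (simp add: even_ring_def)

lemma L_hom: "L \<in> ring_hom (ring_of (even_ring R)) A"
  unfolding L_def A_def
  by (intro cinf_hom_ring_hom cloc_map_hom cinf_ring_cloc even.cinf_ring_axioms)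

lemma L_closed [simp]: "a \<in> even_part R \<Longrightarrow> L a \<in> carrier A"
  using ring_hom_closed[OF L_hom] by (simp add: ring_of_def)
lemma L_add: "\<lbrakk>a \<in> even_part R; b \<in> even_part R\<rbrakk> \<Longrightarrow> L (a \<oplus> b) = L a \<oplus>\<^bsub>A\<^esub> L b"
  using ring_hom_add[OF L_hom, of a b] compatible(1)[of a b] by (simp add: ring_of_def)
lemma L_mult: "\<lbrakk>a \<in> even_part R; b \<in> even_part R\<rbrakk> \<Longrightarrow> L (a \<otimes> b) = L a \<otimes>\<^bsub>A\<^esub> L b"
  using ring_hom_mult[OF L_hom, of a b] compatible(2)[of a b] by (simp add: ring_of_def)
lemma L_one: "L \<one> = \<one>\<^bsub>A\<^esub>" using ring_hom_one[OF L_hom] compatible(4) by simp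
lemma L_zero: "L \<zero> = \<zero>\<^bsub>A\<^esub>"
  using ring_hom_zero[OF L_hom] compatible(3) A.ring_axioms
    cring.axioms(1)[OF even.cring_ring_of] by simp

sublocale even: additive_subgroup "even_part R" R by (rule even_subgroup)
sublocale odd: additive_subgroup "odd_part R" R by (rule odd_subgroup)

lemma even_carr [simp]: "a \<in> even_part R \<Longrightarrow> a \<in> carrier R" using even.a_subset by auto
lemma odd_carr [simp]: "a \<in> odd_part R \<Longrightarrow> a \<in> carrier R" using odd.a_subset by auto
lemmas [simp] = even_even even_odd odd_even odd_odd

lemma module_simps [simp]:
  "carrier (odd_module R) = odd_part R" "\<zero>\<^bsub>odd_module R\<^esub> = \<zero>"
  "add (odd_module R) = add R" "smult (odd_module R) = mult R"
  "carrier (loc_module R S) = carrier A" "add (loc_module R S) = add A" "\<one>\<^bsub>loc_module R S\<^esub> = \<one>\<^bsub>A\<^esub>"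
  "smult (loc_module R S) = (\<lambda>c a. L c \<otimes>\<^bsub>A\<^esub> a)"
  "carrier (ring_of (even_ring R)) = even_part R"
  by (simp_all add: odd_module_def loc_module_def Let_def A_def L_def)

lemma W_simps [simp]: "[] \<in> W" "(x # us) \<in> W \<longleftrightarrow> fst x \<in> odd_part R \<and> snd x \<in> carrier A \<and> us \<in> W"
  "us @ vs \<in> W \<longleftrightarrow> us \<in> W \<and> vs \<in> W"
  by (auto simp: W_def mem_Times_iff)

lemma te_refl: "us \<in> W \<Longrightarrow> te us us"
  by (auto simp: te_def W_def intro!: tensor_eq.tensor_refl)
lemma te_sym: "te us vs \<Longrightarrow> te vs us" unfolding te_def by (rule tensor_eq.tensor_sym)
lemma te_trans: "te us vs \<Longrightarrow> te vs ws \<Longrightarrow> te us ws" unfolding te_def by (rule tensor_eq.tensor_trans)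
lemma te_cong: "te us us' \<Longrightarrow> te vs vs' \<Longrightarrow> te (us @ vs) (us' @ vs')"
  unfolding te_def by (rule tensor_eq.tensor_cong)
lemma te_comm: "us \<in> W \<Longrightarrow> vs \<in> W \<Longrightarrow> te (us @ vs) (vs @ us)"
  by (auto simp: te_def W_def intro!: tensor_eq.tensor_comm)
lemma te_zero: "a \<in> carrier A \<Longrightarrow> te [(\<zero>, a)] []"
  using tensor_eq.tensor_zero[of a "loc_module R S" "ring_of (even_ring R)" "odd_module R"] by (simp add: te_def)
lemma te_add_left: "\<lbrakk>m \<in> odd_part R; n \<in> odd_part R; a \<in> carrier A\<rbrakk> \<Longrightarrow> te [(m \<oplus> n, a)] [(m, a), (n, a)]"
  using tensor_eq.tensor_add_left[of m "odd_module R" n a "loc_module R S"] by (simp add: te_def)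
lemma te_add_right: "\<lbrakk>m \<in> odd_part R; a \<in> carrier A; b \<in> carrier A\<rbrakk> \<Longrightarrow> te [(m, a \<oplus>\<^bsub>A\<^esub> b)] [(m, a), (m, b)]"
  using tensor_eq.tensor_add_right[of m "odd_module R" a "loc_module R S" b] by (simp add: te_def)
lemma te_balanced: "\<lbrakk>k \<in> even_part R; m \<in> odd_part R; a \<in> carrier A\<rbrakk> \<Longrightarrow> te [(k \<otimes> m, a)] [(m, L k \<otimes>\<^bsub>A\<^esub> a)]"
  using tensor_eq.tensor_balanced[of k "ring_of (even_ring R)" m "odd_module R" a "loc_module R S"] by (simp add: te_def)

lemma te_induct [consumes 1, case_names refl sym trans cong comm zero add_left add_right balanced]:
  assumes "te us vs"
    and "\<And>us. us \<in> W \<Longrightarrow> P us us"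
    and "\<And>us vs. te us vs \<Longrightarrow> P us vs \<Longrightarrow> P vs us"
    and "\<And>us vs ws. te us vs \<Longrightarrow> P us vs \<Longrightarrow> te vs ws \<Longrightarrow> P vs ws \<Longrightarrow> P us ws"
    and "\<And>us us' vs vs'. te us us' \<Longrightarrow> P us us' \<Longrightarrow> te vs vs' \<Longrightarrow> P vs vs' \<Longrightarrow> P (us @ vs) (us' @ vs')"
    and "\<And>us vs. us \<in> W \<Longrightarrow> vs \<in> W \<Longrightarrow> P (us @ vs) (vs @ us)"
    and "\<And>a. a \<in> carrier A \<Longrightarrow> P [(\<zero>, a)] []"
    and "\<And>m n a. \<lbrakk>m \<in> odd_part R; n \<in> odd_part R; a \<in> carrier A\<rbrakk> \<Longrightarrow> P [(m \<oplus> n, a)] [(m, a), (n, a)]"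
    and "\<And>m a b. \<lbrakk>m \<in> odd_part R; a \<in> carrier A; b \<in> carrier A\<rbrakk> \<Longrightarrow> P [(m, a \<oplus>\<^bsub>A\<^esub> b)] [(m, a), (m, b)]"
    and "\<And>k m a. \<lbrakk>k \<in> even_part R; m \<in> odd_part R; a \<in> carrier A\<rbrakk> \<Longrightarrow> P [(k \<otimes> m, a)] [(m, L k \<otimes>\<^bsub>A\<^esub> a)]"
  shows "P us vs"
  using assms(1) unfolding te_def
proof (induction rule: tensor_eq.induct)
qed (use assms(2-) in \<open>auto simp: W_def te_def\<close>)

lemma te_W: "te us vs \<Longrightarrow> us \<in> W \<and> vs \<in> W"
  by (induction rule: te_induct) (auto)

lemma oc_eq: "us \<in> W \<Longrightarrow> oc us = oc vs \<longleftrightarrow> te us vs"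
  using te_refl te_sym te_trans unfolding odd_class_def tclass_def te_def[symmetric] by blast

lemma oc_eqI: "te us vs \<Longrightarrow> oc us = oc vs" using oc_eq te_W by blast

lemma oc_rep: "us \<in> W \<Longrightarrow> te us (SOME vs. vs \<in> oc us)"
  using someI[of "\<lambda>vs. vs \<in> oc us" us] te_refl
  unfolding odd_class_def tclass_def te_def[symmetric] by blast

lemma T_carrier: "carrier T = oc ` W"
  by (simp add: odd_loc_def tensor_def odd_class_def W_def)

lemma T_zero: "\<zero>\<^bsub>T\<^esub> = oc []" by (simp add: odd_loc_def tensor_def odd_class_def)

lemma T_add: "\<lbrakk>us \<in> W; vs \<in> W\<rbrakk> \<Longrightarrow> oc us \<oplus>\<^bsub>T\<^esub> oc vs = oc (us @ vs)"
  using oc_eqI[OF te_cong[OF oc_rep oc_rep]] 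
  by (simp add: odd_loc_def tensor_def odd_class_def)

definition sc where "sc a us = map (\<lambda>(m, b). (m, a \<otimes>\<^bsub>A\<^esub> b)) us"

lemma sc_simps [simp]: "sc a [] = []" "sc a ((m, b) # us) = (m, a \<otimes>\<^bsub>A\<^esub> b) # sc a us"
  "sc a (us @ vs) = sc a us @ sc a vs"
  by (auto simp: sc_def)

lemma sc_W [simp]: "a \<in> carrier A \<Longrightarrow> us \<in> W \<Longrightarrow> sc a us \<in> W"
  by (induction us) auto

lemma te_sc: assumes a: "a \<in> carrier A" shows "te us vs \<Longrightarrow> te (sc a us) (sc a vs)"
proof (induction rule: te_induct)
  case (balanced k m b)
  then have "a \<otimes>\<^bsub>A\<^esub> (L k \<otimes>\<^bsub>A\<^esub> b) = L k \<otimes>\<^bsub>A\<^esub> (a \<otimes>\<^bsub>A\<^esub> b)"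
    using a by (simp add: A.m_lcomm)
  then show ?case using te_balanced[of k m "a \<otimes>\<^bsub>A\<^esub> b"] balanced a by simp
next
  case (add_right m b c)
  then show ?case using te_add_right[of m "a \<otimes>\<^bsub>A\<^esub> b" "a \<otimes>\<^bsub>A\<^esub> c"] a by (simp add: A.r_distr)
qed (use a in \<open>auto intro: te_refl te_sym te_trans te_cong te_comm te_zero te_add_left\<close>)

abbreviation (input) "sm \<equiv> odd_loc_smult R S"

lemma sm_oc: "\<lbrakk>a \<in> carrier A; us \<in> W\<rbrakk> \<Longrightarrow> sm a (oc us) = oc (sc a us)"
  using oc_eqI[OF te_sc[OF _ oc_rep]] by (simp add: odd_loc_smult_def sc_def A_def)

lemma T_cases: assumes "u \<in> carrier T" obtains us where "us \<in> W" "u = oc us"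
  using assms by (auto simp: T_carrier)

lemma te_null: "m \<in> odd_part R \<Longrightarrow> te [(m, \<zero>\<^bsub>A\<^esub>)] []"
  using te_sym[OF te_balanced[of \<zero> m "\<one>\<^bsub>A\<^esub>"]] te_trans[OF _ te_zero, of _ "\<one>\<^bsub>A\<^esub>"]
  by (simp add: L_zero)

lemma sc_zero: "us \<in> W \<Longrightarrow> te (sc \<zero>\<^bsub>A\<^esub> us) []"
proof (induction us)
  case (Cons x us)
  then show ?case using te_cong[OF te_null[of "fst x"], of "sc \<zero>\<^bsub>A\<^esub> us" "[]"] by (cases x) auto
qed (simp add: te_refl)

lemma te_swap: assumes "as \<in> W" "bs \<in> W" "cs \<in> W" "ds \<in> W"
  shows "te ((as @ bs) @ (cs @ ds)) ((as @ cs) @ (bs @ ds))"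
  using te_cong[OF te_cong[OF te_refl te_comm] te_refl, of as bs cs ds] assms by simp

lemma sc_add: "\<lbrakk>us \<in> W; a \<in> carrier A; b \<in> carrier A\<rbrakk> \<Longrightarrow> te (sc (a \<oplus>\<^bsub>A\<^esub> b) us) (sc a us @ sc b us)"
proof (induction us)
  case (Cons x us)
  obtain m c where x: "x = (m, c)" by (cases x)
  have "te ([(m, (a \<oplus>\<^bsub>A\<^esub> b) \<otimes>\<^bsub>A\<^esub> c)] @ sc (a \<oplus>\<^bsub>A\<^esub> b) us)
     (([(m, a \<otimes>\<^bsub>A\<^esub> c)] @ [(m, b \<otimes>\<^bsub>A\<^esub> c)]) @ (sc a us @ sc b us))"
    using Cons x te_add_right[of m "a \<otimes>\<^bsub>A\<^esub> c" "b \<otimes>\<^bsub>A\<^esub> c"]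
    by (intro te_cong) (auto simp: A.l_distr)
  also have "te \<dots> (([(m, a \<otimes>\<^bsub>A\<^esub> c)] @ sc a us) @ ([(m, b \<otimes>\<^bsub>A\<^esub> c)] @ sc b us))"
    using Cons x by (intro te_swap) auto
  finally (te_trans) show ?case by (simp add: x)
qed (simp add: te_refl)

lemma sc_sc: "\<lbrakk>us \<in> W; a \<in> carrier A; b \<in> carrier A\<rbrakk> \<Longrightarrow> sc a (sc b us) = sc (a \<otimes>\<^bsub>A\<^esub> b) us"
  by (induction us) (auto simp: A.m_assoc)
lemma sc_one: "us \<in> W \<Longrightarrow> sc \<one>\<^bsub>A\<^esub> us = us" by (induction us) auto


lemma oc_closed [simp]: "us \<in> W \<Longrightarrow> oc us \<in> carrier T" by (auto simp: T_carrier)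


definition TM :: "('a lterm set, 'a odd_loc) module" where
  "TM = \<lparr>carrier = carrier T, mult = undefined, one = undefined, zero = \<zero>\<^bsub>T\<^esub>, add = add T, smult = sm\<rparr>"

lemma TM_simps [simp]: "carrier TM = carrier T" "\<zero>\<^bsub>TM\<^esub> = \<zero>\<^bsub>T\<^esub>" "add TM = add T" "smult TM = sm"
  by (simp_all add: TM_def)

lemma TM_module: "module A TM"
proof (rule moduleI)
  show "cring A" by (rule A.cring_axioms)
  show "abelian_group TM"
  proof (rule abelian_groupI; (unfold TM_simps)?)
    show "\<zero>\<^bsub>T\<^esub> \<in> carrier T" by (simp add: T_zero)
    fix u assume "u \<in> carrier T"
    then obtain us where us: "us \<in> W" "u = oc us" by (rule T_cases)
    then show "\<zero>\<^bsub>T\<^esub> \<oplus>\<^bsub>T\<^esub> u = u" by (simp add: T_zero T_add)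
    show "\<exists>y\<in>carrier T. y \<oplus>\<^bsub>T\<^esub> u = \<zero>\<^bsub>T\<^esub>"
    proof (rule bexI[of _ "oc (sc (\<ominus>\<^bsub>A\<^esub> \<one>\<^bsub>A\<^esub>) us)"])
      have "te (sc (\<ominus>\<^bsub>A\<^esub> \<one>\<^bsub>A\<^esub>) us @ sc \<one>\<^bsub>A\<^esub> us) []"
        using te_trans[OF te_sym[OF sc_add[OF us(1), of "\<ominus>\<^bsub>A\<^esub> \<one>\<^bsub>A\<^esub>" "\<one>\<^bsub>A\<^esub>"]]] sc_zero[OF us(1)]
        by (simp add: A.l_neg)
      then show "oc (sc (\<ominus>\<^bsub>A\<^esub> \<one>\<^bsub>A\<^esub>) us) \<oplus>\<^bsub>T\<^esub> u = \<zero>\<^bsub>T\<^esub>"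
        using us by (simp add: T_add sc_one T_zero oc_eqI)
    qed (use us in simp)
    fix v assume "v \<in> carrier T"
    then obtain vs where vs: "vs \<in> W" "v = oc vs" by (rule T_cases)
    then show "u \<oplus>\<^bsub>T\<^esub> v \<in> carrier T" using us by (simp add: T_add)
    show "u \<oplus>\<^bsub>T\<^esub> v = v \<oplus>\<^bsub>T\<^esub> u" using us vs by (simp add: T_add oc_eqI te_comm)
    fix w assume "w \<in> carrier T"
    then obtain ws where ws: "ws \<in> W" "w = oc ws" by (rule T_cases)
    then show "u \<oplus>\<^bsub>T\<^esub> v \<oplus>\<^bsub>T\<^esub> w = u \<oplus>\<^bsub>T\<^esub> (v \<oplus>\<^bsub>T\<^esub> w)" using us vs by (simp add: T_add)
  qed
next
  fix u assume "u \<in> carrier TM"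
  then obtain us where us: "us \<in> W" "u = oc us" by (auto elim: T_cases)
  then show "\<one>\<^bsub>A\<^esub> \<odot>\<^bsub>TM\<^esub> u = u" by (simp add: sm_oc sc_one)
next
  fix a u assume a: "a \<in> carrier A" and "u \<in> carrier TM"
  then obtain us where us: "us \<in> W" "u = oc us" by (auto elim: T_cases)
  show "a \<odot>\<^bsub>TM\<^esub> u \<in> carrier TM" using a us by (simp add: sm_oc)
  { fix v assume "v \<in> carrier TM"
    then obtain vs where vs: "vs \<in> W" "v = oc vs" by (auto elim: T_cases)
    then show "a \<odot>\<^bsub>TM\<^esub> (u \<oplus>\<^bsub>TM\<^esub> v) = a \<odot>\<^bsub>TM\<^esub> u \<oplus>\<^bsub>TM\<^esub> a \<odot>\<^bsub>TM\<^esub> v"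
      using a us by (simp add: T_add sm_oc) }
  fix b assume b: "b \<in> carrier A"
  show "(a \<oplus>\<^bsub>A\<^esub> b) \<odot>\<^bsub>TM\<^esub> u = a \<odot>\<^bsub>TM\<^esub> u \<oplus>\<^bsub>TM\<^esub> b \<odot>\<^bsub>TM\<^esub> u"
    using a b us by (simp add: T_add sm_oc oc_eqI sc_add)
  show "a \<otimes>\<^bsub>A\<^esub> b \<odot>\<^bsub>TM\<^esub> u = a \<odot>\<^bsub>TM\<^esub> (b \<odot>\<^bsub>TM\<^esub> u)"
    using a b us by (simp add: sm_oc sc_sc)
qed

sublocale TM: module A TM by (rule TM_module)

lemmas T_laws = TM.a_closed[unfolded TM_simps] TM.smult_closed[unfolded TM_simps]
  TM.a_ac[unfolded TM_simps] TM.smult_l_distr[unfolded TM_simps] TM.smult_r_distr[unfolded TM_simps]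
  TM.l_zero[unfolded TM_simps] TM.r_zero[unfolded TM_simps]
  TM.zero_closed[unfolded TM_simps] TM.smult_one[unfolded TM_simps]
  TM.smult_l_null[unfolded TM_simps] TM.smult_r_null[unfolded TM_simps]

lemma T_smult_assoc: "\<lbrakk>a \<in> carrier A; b \<in> carrier A; u \<in> carrier T\<rbrakk> \<Longrightarrow> sm a (sm b u) = sm (a \<otimes>\<^bsub>A\<^esub> b) u"
  using TM.smult_assoc1[of a b u] by simp

definition pr :: "('a \<times> 'a lterm set) \<Rightarrow> ('a \<times> 'a lterm set) \<Rightarrow> 'a lterm set" where
  "pr x y = L (fst x \<otimes> fst y) \<otimes>\<^bsub>A\<^esub> (snd x \<otimes>\<^bsub>A\<^esub> snd y)"

definition pm where
  "pm us vs = foldr (add A) (map (\<lambda>(x, y). pr x y) (List.product us vs)) \<zero>\<^bsub>A\<^esub>"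

abbreviation (input) "wd x \<equiv> fst x \<in> odd_part R \<and> snd x \<in> carrier A"

lemma pr_closed [simp]: "wd x \<Longrightarrow> wd y \<Longrightarrow> pr x y \<in> carrier A"
  by (auto simp: pr_def)

lemma foldr_add: "set xs \<subseteq> carrier A \<Longrightarrow> set ys \<subseteq> carrier A \<Longrightarrow>
  foldr (add A) (xs @ ys) \<zero>\<^bsub>A\<^esub> = foldr (add A) xs \<zero>\<^bsub>A\<^esub> \<oplus>\<^bsub>A\<^esub> foldr (add A) ys \<zero>\<^bsub>A\<^esub> \<and>
  foldr (add A) xs \<zero>\<^bsub>A\<^esub> \<in> carrier A \<and> foldr (add A) ys \<zero>\<^bsub>A\<^esub> \<in> carrier A"
proof (induction xs)
  case Nil then show ?case by (induction ys) auto
qed (auto simp: A.a_assoc)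

lemma W_D: "us \<in> W \<Longrightarrow> x \<in> set us \<Longrightarrow> wd x" by (auto simp: W_def)

lemma pm_set: "us \<in> W \<Longrightarrow> vs \<in> W \<Longrightarrow> set (map (\<lambda>(x, y). pr x y) (List.product us vs)) \<subseteq> carrier A"
  using W_D pr_closed by auto

lemma pm_closed [simp]: "us \<in> W \<Longrightarrow> vs \<in> W \<Longrightarrow> pm us vs \<in> carrier A"
  using foldr_add[OF pm_set] unfolding pm_def by (metis empty_subsetI list.set(1))

lemma pm_Nil [simp]: "pm [] vs = \<zero>\<^bsub>A\<^esub>" "pm us [] = \<zero>\<^bsub>A\<^esub>"
  by (simp add: pm_def) (induction us; simp add: pm_def)

lemma product_append: "List.product (us @ us') vs = List.product us vs @ List.product us' vs"
  by (induction us) auto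

lemma pm_append_left: "\<lbrakk>us \<in> W; us' \<in> W; vs \<in> W\<rbrakk> \<Longrightarrow> pm (us @ us') vs = pm us vs \<oplus>\<^bsub>A\<^esub> pm us' vs"
  using foldr_add[OF pm_set pm_set, of us vs us' vs] by (simp add: pm_def product_append)

lemma pm_Cons: "\<lbrakk>wd x; us \<in> W; vs \<in> W\<rbrakk> \<Longrightarrow> pm (x # us) vs = pm [x] vs \<oplus>\<^bsub>A\<^esub> pm us vs"
  using pm_append_left[of "[x]" us vs] by simp

lemma pm_single: "\<lbrakk>wd x; wd y; vs \<in> W\<rbrakk> \<Longrightarrow> pm [x] (y # vs) = pr x y \<oplus>\<^bsub>A\<^esub> pm [x] vs"
  by (simp add: pm_def)

lemma pm_pr [simp]: "wd x \<Longrightarrow> wd y \<Longrightarrow> pm [x] [y] = pr x y" by (simp add: pm_def)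

lemma L_neg: "a \<in> even_part R \<Longrightarrow> L (\<ominus> a) = \<ominus>\<^bsub>A\<^esub> L a"
  using L_add[of "\<ominus> a" a] L_zero A.minus_equality[of "L (\<ominus> a)" "L a"] by (simp add: l_neg)

lemma pr_anti: "wd x \<Longrightarrow> wd y \<Longrightarrow> pr x y = \<ominus>\<^bsub>A\<^esub> pr y x"
  using odd_anticomm[of "fst x" "fst y"]
  by (simp add: pr_def L_neg A.l_minus A.m_comm[of "snd x"])

lemma pm_append_right: "\<lbrakk>us \<in> W; vs \<in> W; vs' \<in> W\<rbrakk> \<Longrightarrow> pm us (vs @ vs') = pm us vs \<oplus>\<^bsub>A\<^esub> pm us vs'"
proof (induction us)
  case (Cons x us)
  have "pm [x] (vs @ vs') = pm [x] vs \<oplus>\<^bsub>A\<^esub> pm [x] vs'" using Cons.prems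
  proof (induction vs)
    case (Cons y vs)
    then show ?case by (simp add: pm_single A.a_assoc)
  qed simp
  then show ?case using Cons by (simp add: pm_Cons[of x us] A.a_ac)
qed simp

lemma pm_anti: "\<lbrakk>us \<in> W; vs \<in> W\<rbrakk> \<Longrightarrow> pm us vs = \<ominus>\<^bsub>A\<^esub> pm vs us"
proof (induction us)
  case (Cons x us)
  have "pm [x] vs = \<ominus>\<^bsub>A\<^esub> pm vs [x]" using Cons.prems
  proof (induction vs)
    case (Cons y vs)
    then show ?case using pr_anti[of x y]
      by (simp add: pm_single pm_Cons[of y vs "[x]"] A.minus_add)
  qed simp
  then show ?case using Cons pm_append_right[of vs "[x]" us]
    by (simp add: pm_Cons[of x us] A.minus_add)
qed simp

lemma pm_te_left: "te us us' \<Longrightarrow> vs \<in> W \<Longrightarrow> pm us vs = pm us' vs"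
proof (induction rule: te_induct)
  case (cong us us' ws ws')
  then show ?case using te_W by (metis pm_append_left)
next
  case (comm us ws)
  then show ?case by (simp add: pm_append_left A.a_comm)
next
  case (zero a)
  have "pr (\<zero>, a) y = \<zero>\<^bsub>A\<^esub>" if "wd y" for y using that zero by (simp add: pr_def L_zero)
  then show ?case using zero(2) zero(1) by (induction vs) (auto simp: pm_single)
next
  case (add_left m n a)
  have "pr (m \<oplus> n, a) y = pr (m, a) y \<oplus>\<^bsub>A\<^esub> pr (n, a) y" if "wd y" for y
    using that add_left by (simp add: pr_def l_distr L_add A.l_distr)
  then have "pm [(m \<oplus> n, a)] vs = pm [(m, a)] vs \<oplus>\<^bsub>A\<^esub> pm [(n, a)] vs"
    using add_left(4,1-3) by (induction vs) (auto simp: pm_single A.a_ac)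
  then show ?case using add_left by (simp add: pm_Cons[of "(m, a)" "[(n, a)]"])
next
  case (add_right m a b)
  have "pr (m, a \<oplus>\<^bsub>A\<^esub> b) y = pr (m, a) y \<oplus>\<^bsub>A\<^esub> pr (m, b) y" if "wd y" for y
    using that add_right by (simp add: pr_def A.l_distr A.r_distr)
  then have "pm [(m, a \<oplus>\<^bsub>A\<^esub> b)] vs = pm [(m, a)] vs \<oplus>\<^bsub>A\<^esub> pm [(m, b)] vs"
    using add_right(4,1-3) by (induction vs) (auto simp: pm_single A.a_ac)
  then show ?case using add_right by (simp add: pm_Cons[of "(m, a)" "[(m, b)]"])
next
  case (balanced k m a)
  have "pr (k \<otimes> m, a) y = pr (m, L k \<otimes>\<^bsub>A\<^esub> a) y" if "wd y" for y
    using that balanced by (simp add: pr_def m_assoc L_mult A.m_ac)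
  then show ?case using balanced(4,1-3) by (induction vs) (auto simp: pm_single)
qed auto

lemma pm_te: assumes "te us us'" "te vs vs'" shows "pm us vs = pm us' vs'"
proof -
  have "us \<in> W" "us' \<in> W" "vs \<in> W" "vs' \<in> W" using assms te_W by auto
  then show ?thesis using pm_te_left[OF assms(1), of vs] pm_te_left[OF assms(2), of us']
      pm_anti[of us' vs] pm_anti[of us' vs'] by simp
qed

lemma odd_mult_oc: "\<lbrakk>us \<in> W; vs \<in> W\<rbrakk> \<Longrightarrow> odd_loc_mult R S (oc us) (oc vs) = pm us vs"
  using pm_te[OF oc_rep oc_rep, of us vs]
  by (simp add: odd_loc_mult_def Let_def pm_def pr_def A_def[symmetric] L_def[symmetric] case_prod_unfold)

lemma pr_sc: "wd x \<Longrightarrow> wd y \<Longrightarrow> a \<in> carrier A \<Longrightarrow> pr (fst x, a \<otimes>\<^bsub>A\<^esub> snd x) y = a \<otimes>\<^bsub>A\<^esub> pr x y"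
  by (simp add: pr_def A.m_ac)

lemma pm_sc_left: "\<lbrakk>us \<in> W; vs \<in> W; a \<in> carrier A\<rbrakk> \<Longrightarrow> pm (sc a us) vs = a \<otimes>\<^bsub>A\<^esub> pm us vs"
proof (induction us)
  case (Cons x us)
  obtain m b where x: "x = (m, b)" by (cases x)
  have "pm [(m, a \<otimes>\<^bsub>A\<^esub> b)] vs = a \<otimes>\<^bsub>A\<^esub> pm [x] vs" using Cons.prems
  proof (induction vs)
    case (Cons y vs)
    then show ?case using pr_sc[of x y a] x by (simp add: pm_single A.r_distr)
  qed simp
  then show ?case using Cons x by (simp add: pm_Cons[of _ "sc a us"] pm_Cons[of _ us] A.r_distr)
qed simp

lemma pm_sc_right: "\<lbrakk>us \<in> W; vs \<in> W; a \<in> carrier A\<rbrakk> \<Longrightarrow> pm us (sc a vs) = a \<otimes>\<^bsub>A\<^esub> pm us vs"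
  using pm_anti[of us "sc a vs"] pm_anti[of us vs] by (simp add: pm_sc_left A.r_minus)


abbreviation (input) "om \<equiv> odd_loc_mult R S"

lemma om_closed [simp]: "\<lbrakk>u \<in> carrier T; v \<in> carrier T\<rbrakk> \<Longrightarrow> om u v \<in> carrier A"
  by (auto elim!: T_cases simp: odd_mult_oc)
lemma om_add_left: "\<lbrakk>u \<in> carrier T; u' \<in> carrier T; v \<in> carrier T\<rbrakk> \<Longrightarrow> om (u \<oplus>\<^bsub>T\<^esub> u') v = om u v \<oplus>\<^bsub>A\<^esub> om u' v"
  by (auto elim!: T_cases simp: odd_mult_oc T_add pm_append_left)
lemma om_add_right: "\<lbrakk>u \<in> carrier T; v' \<in> carrier T; v \<in> carrier T\<rbrakk> \<Longrightarrow> om u (v \<oplus>\<^bsub>T\<^esub> v') = om u v \<oplus>\<^bsub>A\<^esub> om u v'"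
  by (auto elim!: T_cases simp: odd_mult_oc T_add pm_append_right)
lemma om_sm_left: "\<lbrakk>a \<in> carrier A; u \<in> carrier T; v \<in> carrier T\<rbrakk> \<Longrightarrow> om (sm a u) v = a \<otimes>\<^bsub>A\<^esub> om u v"
  by (auto elim!: T_cases simp: odd_mult_oc sm_oc pm_sc_left)
lemma om_sm_right: "\<lbrakk>a \<in> carrier A; u \<in> carrier T; v \<in> carrier T\<rbrakk> \<Longrightarrow> om u (sm a v) = a \<otimes>\<^bsub>A\<^esub> om u v"
  by (auto elim!: T_cases simp: odd_mult_oc sm_oc pm_sc_right)
lemma om_anti: "\<lbrakk>u \<in> carrier T; v \<in> carrier T\<rbrakk> \<Longrightarrow> om u v = \<ominus>\<^bsub>A\<^esub> om v u"
  by (elim T_cases) (simp add: odd_mult_oc, rule pm_anti)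
lemma om_zero: "u \<in> carrier T \<Longrightarrow> om \<zero>\<^bsub>T\<^esub> u = \<zero>\<^bsub>A\<^esub>" "u \<in> carrier T \<Longrightarrow> om u \<zero>\<^bsub>T\<^esub> = \<zero>\<^bsub>A\<^esub>"
  by (auto elim!: T_cases simp: odd_mult_oc T_zero)

lemma T_induct [consumes 1, case_names zero add]:
  assumes "u \<in> carrier T" "P \<zero>\<^bsub>T\<^esub>"
    and "\<And>m a u. \<lbrakk>m \<in> odd_part R; a \<in> carrier A; u \<in> carrier T; P u\<rbrakk> \<Longrightarrow> P (oc [(m, a)] \<oplus>\<^bsub>T\<^esub> u)"
  shows "P u"
proof -
  obtain us where "us \<in> W" "u = oc us" using assms(1) by (rule T_cases)
  then show ?thesis
  proof (induction us arbitrary: u)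
    case (Cons x us)
    then show ?case using assms(3)[of "fst x" "snd x" "oc us"] by (simp add: T_add)
  qed (use assms(2) in \<open>simp add: T_zero\<close>)
qed

lemma om_cyc1: assumes "m \<in> odd_part R" "a \<in> carrier A" "n \<in> odd_part R" "b \<in> carrier A" "p \<in> odd_part R" "c \<in> carrier A"
  shows "sm (om (oc [(m, a)]) (oc [(n, b)])) (oc [(p, c)]) = sm (om (oc [(n, b)]) (oc [(p, c)])) (oc [(m, a)])"
proof -
  have *: "oc [(k \<otimes> q, e)] = sm (L k) (oc [(q, e)])" if "k \<in> even_part R" "q \<in> odd_part R" "e \<in> carrier A" for k q e
    using that te_balanced[of k q e] by (simp add: oc_eqI sm_oc)
  have s: "sm (f \<otimes>\<^bsub>A\<^esub> g) (oc [(q, e)]) = sm f (oc [(q, g \<otimes>\<^bsub>A\<^esub> e)])"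
    if "q \<in> odd_part R" "e \<in> carrier A" "f \<in> carrier A" "g \<in> carrier A" for f g q e
    using that by (simp add: sm_oc A.m_assoc)
  have "sm (om (oc [(m, a)]) (oc [(n, b)])) (oc [(p, c)]) = oc [((m \<otimes> n) \<otimes> p, a \<otimes>\<^bsub>A\<^esub> b \<otimes>\<^bsub>A\<^esub> c)]"
    using assms by (simp add: odd_mult_oc pr_def s *)
  also have "(m \<otimes> n) \<otimes> p = (n \<otimes> p) \<otimes> m"
    using assms even_comm[of "n \<otimes> p" m] by (simp add: m_assoc)
  also have "oc [((n \<otimes> p) \<otimes> m, a \<otimes>\<^bsub>A\<^esub> b \<otimes>\<^bsub>A\<^esub> c)] = sm (om (oc [(n, b)]) (oc [(p, c)])) (oc [(m, a)])"
  proof -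
    have "a \<otimes>\<^bsub>A\<^esub> b \<otimes>\<^bsub>A\<^esub> c = b \<otimes>\<^bsub>A\<^esub> c \<otimes>\<^bsub>A\<^esub> a" using assms by (simp add: A.m_ac)
    then show ?thesis using assms by (simp add: odd_mult_oc pr_def s *)
  qed
  finally show ?thesis .
qed

lemma om_cyc: assumes "u \<in> carrier T" "v \<in> carrier T" "w \<in> carrier T"
  shows "sm (om u v) w = sm (om v w) u"
  using assms(1)
proof (induction u rule: T_induct)
  case zero then show ?case using assms by (simp add: om_zero T_laws)
next
  case (add m a u)
  have "sm (om (oc [(m, a)]) v) w = sm (om v w) (oc [(m, a)])" using assms(2)
  proof (induction v rule: T_induct)
    case zero then show ?case using assms add by (simp add: om_zero T_laws)
  next
    case (add n b v)
    have "sm (om (oc [(m, a)]) (oc [(n, b)])) w = sm (om (oc [(n, b)]) w) (oc [(m, a)])" using assms(3)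
    proof (induction w rule: T_induct)
      case zero then show ?case using \<open>m \<in> _\<close> \<open>a \<in> _\<close> add by (simp add: om_zero T_laws)
    next
      case (add p c w)
      then show ?case using \<open>m \<in> _\<close> \<open>a \<in> _\<close> \<open>n \<in> _\<close> \<open>b \<in> _\<close> om_cyc1[of m a n b p c]
        by (simp add: om_add_right T_laws)
    qed
    then show ?case using \<open>m \<in> _\<close> \<open>a \<in> _\<close> add assms by (simp add: om_add_left om_add_right T_laws)
  qed
  then show ?case using add assms by (simp add: om_add_left T_laws)
qed

abbreviation (input) "Q \<equiv> sloc R S"

lemma Q_simps:
  "carrier Q = carrier A \<times> carrier T"
  "(a, u) \<otimes>\<^bsub>Q\<^esub> (b, v) = (a \<otimes>\<^bsub>A\<^esub> b \<oplus>\<^bsub>A\<^esub> om u v, sm a v \<oplus>\<^bsub>T\<^esub> sm b u)"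
  "(a, u) \<oplus>\<^bsub>Q\<^esub> (b, v) = (a \<oplus>\<^bsub>A\<^esub> b, u \<oplus>\<^bsub>T\<^esub> v)"
  "\<one>\<^bsub>Q\<^esub> = (\<one>\<^bsub>A\<^esub>, \<zero>\<^bsub>T\<^esub>)" "\<zero>\<^bsub>Q\<^esub> = (\<zero>\<^bsub>A\<^esub>, \<zero>\<^bsub>T\<^esub>)"
  "even_part Q = carrier A \<times> {\<zero>\<^bsub>T\<^esub>}" "odd_part Q = {\<zero>\<^bsub>A\<^esub>} \<times> carrier T"
  "sop Q f cs = (cop (cloc (even_ring R) S) f (map fst cs), \<zero>\<^bsub>T\<^esub>)"
  by (simp_all add: sloc_def Let_def A_def[symmetric] car_A)

lemma T_neg_ex: "u \<in> carrier T \<Longrightarrow> \<exists>v\<in>carrier T. v \<oplus>\<^bsub>T\<^esub> u = \<zero>\<^bsub>T\<^esub>"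
  using TM.a_inv_closed[of u] TM.l_neg[of u] by auto

lemma Q_ring: "ring Q"
proof (rule ringI)
  show "abelian_group Q"
  proof (rule abelian_groupI)
    fix x assume "x \<in> carrier Q"
    then obtain a u where x: "x = (a, u)" "a \<in> carrier A" "u \<in> carrier T" by (auto simp: Q_simps)
    then obtain v where "v \<in> carrier T" "v \<oplus>\<^bsub>T\<^esub> u = \<zero>\<^bsub>T\<^esub>" using T_neg_ex by blast
    then show "\<exists>y\<in>carrier Q. y \<oplus>\<^bsub>Q\<^esub> x = \<zero>\<^bsub>Q\<^esub>"
      using x by (intro bexI[of _ "(\<ominus>\<^bsub>A\<^esub> a, v)"]) (auto simp: Q_simps A.l_neg)
  qed (auto simp: Q_simps T_laws A.a_ac)
  show "monoid Q"
  proof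
    fix x y z assume "x \<in> carrier Q" "y \<in> carrier Q" "z \<in> carrier Q"
    then obtain a u b v c w where xyz: "x = (a, u)" "y = (b, v)" "z = (c, w)"
      "a \<in> carrier A" "u \<in> carrier T" "b \<in> carrier A" "v \<in> carrier T" "c \<in> carrier A" "w \<in> carrier T"
      by (auto simp: Q_simps)
    have "sm (om u v) w = sm (om v w) u" using om_cyc xyz by blast
    moreover have "b \<otimes>\<^bsub>A\<^esub> om u w \<oplus>\<^bsub>A\<^esub> c \<otimes>\<^bsub>A\<^esub> om u v = c \<otimes>\<^bsub>A\<^esub> om u v \<oplus>\<^bsub>A\<^esub> b \<otimes>\<^bsub>A\<^esub> om u w" using xyz by (simp add: A.a_comm)
    ultimately show "x \<otimes>\<^bsub>Q\<^esub> y \<otimes>\<^bsub>Q\<^esub> z = x \<otimes>\<^bsub>Q\<^esub> (y \<otimes>\<^bsub>Q\<^esub> z)"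
      using xyz by (simp add: Q_simps om_add_left om_add_right om_sm_left om_sm_right T_laws
        T_smult_assoc A.l_distr A.r_distr A.m_ac A.a_ac)
  qed (auto simp: Q_simps T_laws om_zero)
  fix x y z assume "x \<in> carrier Q" "y \<in> carrier Q" "z \<in> carrier Q"
  then obtain a u b v c w where xyz: "x = (a, u)" "y = (b, v)" "z = (c, w)"
    "a \<in> carrier A" "u \<in> carrier T" "b \<in> carrier A" "v \<in> carrier T" "c \<in> carrier A" "w \<in> carrier T"
    by (auto simp: Q_simps)
  then show "(x \<oplus>\<^bsub>Q\<^esub> y) \<otimes>\<^bsub>Q\<^esub> z = x \<otimes>\<^bsub>Q\<^esub> z \<oplus>\<^bsub>Q\<^esub> y \<otimes>\<^bsub>Q\<^esub> z"
    "z \<otimes>\<^bsub>Q\<^esub> (x \<oplus>\<^bsub>Q\<^esub> y) = z \<otimes>\<^bsub>Q\<^esub> x \<oplus>\<^bsub>Q\<^esub> z \<otimes>\<^bsub>Q\<^esub> y"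
    by (simp_all add: Q_simps om_add_left om_add_right T_laws A.l_distr A.r_distr A.a_ac)
qed

sublocale Q: ring Q by (rule Q_ring)

lemma Q_minus: assumes "a \<in> carrier A" "u \<in> carrier T" "v \<in> carrier T" "v \<oplus>\<^bsub>T\<^esub> u = \<zero>\<^bsub>T\<^esub>"
  shows "\<ominus>\<^bsub>Q\<^esub> (a, u) = (\<ominus>\<^bsub>A\<^esub> a, v)"
  using assms by (intro Q.minus_equality) (auto simp: Q_simps A.l_neg)


lemma Q_cinf: "cinf_ring (even_ring Q)"
proof -
  interpret C: cinf_ring "cloc (even_ring R) S" by (rule cinf_ring_cloc)
  have er: "carrier (even_ring Q) = carrier A \<times> {\<zero>\<^bsub>T\<^esub>}"
    "cop (even_ring Q) = (\<lambda>f cs. (cop (cloc (even_ring R) S) f (map fst cs), \<zero>\<^bsub>T\<^esub>))"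
    by (simp_all add: even_ring_def Q_simps fun_eq_iff)
  have f: "set (map fst cs) \<subseteq> carrier (cloc (even_ring R) S)" if "set cs \<subseteq> carrier A \<times> {\<zero>\<^bsub>T\<^esub>}" for cs
    using that by (auto simp: car_A)
  show ?thesis
  proof
    fix cs f assume "set cs \<subseteq> carrier (even_ring Q)" "f \<in> Cinf (length cs)"
    then show "cop (even_ring Q) f cs \<in> carrier (even_ring Q)"
      using C.cop_closed[OF f, of cs f] by (simp add: er car_A)
  next
    fix cs i assume cs: "set cs \<subseteq> carrier (even_ring Q)" "i < length cs"
    then have "cs ! i \<in> carrier A \<times> {\<zero>\<^bsub>T\<^esub>}" using nth_mem[OF cs(2)] unfolding er by blast
    then have "snd (cs ! i) = \<zero>\<^bsub>T\<^esub>" by (simp add: mem_Times_iff)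
    then show "cop (even_ring Q) (\<lambda>x. x i) cs = cs ! i"
      using C.cop_proj[OF f, of cs i] cs by (simp add: er prod_eq_iff)
  next
    fix cs g hs assume cs: "set cs \<subseteq> carrier (even_ring Q)" "g \<in> Cinf (length hs)" "set hs \<subseteq> Cinf (length cs)"
    then show "cop (even_ring Q) (\<lambda>x. g (\<lambda>i. (hs ! i) x)) cs
        = cop (even_ring Q) g (map (\<lambda>h. cop (even_ring Q) h cs) hs)"
      using C.cop_comp[OF f, of cs g hs] by (simp add: er o_def)
  qed
qed

lemma Q_superring: "superring Q"
proof (intro superring.intro Q_ring superring_axioms.intro)
  have neg: "\<exists>v\<in>carrier T. \<ominus>\<^bsub>Q\<^esub> (a, u) = (\<ominus>\<^bsub>A\<^esub> a, v) \<and> v \<oplus>\<^bsub>T\<^esub> u = \<zero>\<^bsub>T\<^esub>" if "a \<in> carrier A" "u \<in> carrier T" for a u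
    using Q_minus[OF that] T_neg_ex[OF that(2)] by blast
  have neg0: "\<ominus>\<^bsub>Q\<^esub> (a, \<zero>\<^bsub>T\<^esub>) = (\<ominus>\<^bsub>A\<^esub> a, \<zero>\<^bsub>T\<^esub>)" if "a \<in> carrier A" for a
    using Q_minus[OF that, of "\<zero>\<^bsub>T\<^esub>" "\<zero>\<^bsub>T\<^esub>"] by (simp add: T_laws)
  have inv: "inv\<^bsub>add_monoid Q\<^esub> x = \<ominus>\<^bsub>Q\<^esub> x" for x by (simp add: a_inv_def)
  show "additive_subgroup (even_part Q) Q"
  proof (intro additive_subgroup.intro subgroup.intro)
    fix x assume "x \<in> even_part Q"
    then show "inv\<^bsub>add_monoid Q\<^esub> x \<in> even_part Q"
      unfolding inv using neg0[of "fst x"] by (auto simp: Q_simps)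
  qed (auto simp: Q_simps T_laws)
  show "additive_subgroup (odd_part Q) Q"
  proof (intro additive_subgroup.intro subgroup.intro)
    fix x assume "x \<in> odd_part Q"
    then show "inv\<^bsub>add_monoid Q\<^esub> x \<in> odd_part Q"
      unfolding inv using neg[of "\<zero>\<^bsub>A\<^esub>" "snd x"] by (auto simp: Q_simps)
  qed (auto simp: Q_simps T_laws)
  show "even_part Q <+>\<^bsub>Q\<^esub> odd_part Q = carrier Q"
    by (force simp: set_add_def' Q_simps T_laws)
  show "even_part Q \<inter> odd_part Q = {\<zero>\<^bsub>Q\<^esub>}" by (auto simp: Q_simps T_laws)
  fix m n assume "m \<in> odd_part Q" "n \<in> odd_part Q"
  then obtain u v where "m = (\<zero>\<^bsub>A\<^esub>, u)" "n = (\<zero>\<^bsub>A\<^esub>, v)" "u \<in> carrier T" "v \<in> carrier T"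
    by (auto simp: Q_simps)
  then show "m \<otimes>\<^bsub>Q\<^esub> n = \<ominus>\<^bsub>Q\<^esub> (n \<otimes>\<^bsub>Q\<^esub> m)" using om_anti[of u v] by (simp add: Q_simps T_laws neg0)
qed (auto simp: Q_simps T_laws om_zero A.m_comm)

lemma Q_cinf_superring: "cinf_superring Q"
proof (intro cinf_superring.intro Q_superring Q_cinf cinf_superring_axioms.intro)
  have s: "sop Q = (\<lambda>f cs. (cop (cloc (even_ring R) S) f (map fst cs), \<zero>\<^bsub>T\<^esub>))"
    by (simp add: Q_simps fun_eq_iff)
  have A: "a \<oplus>\<^bsub>A\<^esub> b = cop (cloc (even_ring R) S) (\<lambda>x. x 0 + x 1) [a, b]"
    "a \<otimes>\<^bsub>A\<^esub> b = cop (cloc (even_ring R) S) (\<lambda>x. x 0 * x 1) [a, b]"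
    "\<zero>\<^bsub>A\<^esub> = cop (cloc (even_ring R) S) (\<lambda>_. 0) []" "\<one>\<^bsub>A\<^esub> = cop (cloc (even_ring R) S) (\<lambda>_. 1) []" for a b
    by (simp_all add: A_def ring_of_def cconst_def)
  show "\<zero>\<^bsub>ring_of (even_ring Q)\<^esub> = \<zero>\<^bsub>Q\<^esub>" "\<one>\<^bsub>ring_of (even_ring Q)\<^esub> = \<one>\<^bsub>Q\<^esub>"
    by (simp_all add: Q_simps(4,5) A ring_of_def cconst_def even_ring_def[of Q] s)
  fix x y assume "x \<in> even_part Q" "y \<in> even_part Q"
  then obtain a b where xy: "x = (a, \<zero>\<^bsub>T\<^esub>)" "y = (b, \<zero>\<^bsub>T\<^esub>)" "a \<in> carrier A" "b \<in> carrier A"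
    by (auto simp: Q_simps)
  have "x \<oplus>\<^bsub>Q\<^esub> y = (a \<oplus>\<^bsub>A\<^esub> b, \<zero>\<^bsub>T\<^esub>)" "x \<otimes>\<^bsub>Q\<^esub> y = (a \<otimes>\<^bsub>A\<^esub> b, \<zero>\<^bsub>T\<^esub>)"
    using xy by (simp_all add: Q_simps T_laws om_zero)
  then show "x \<oplus>\<^bsub>ring_of (even_ring Q)\<^esub> y = x \<oplus>\<^bsub>Q\<^esub> y" "x \<otimes>\<^bsub>ring_of (even_ring Q)\<^esub> y = x \<otimes>\<^bsub>Q\<^esub> y"
    by (simp_all only: A) (simp_all add: xy ring_of_def even_ring_def[of Q] s)
qed

lemma decomp_ex: assumes "a \<in> carrier R"
  obtains b m where "b \<in> even_part R" "m \<in> odd_part R" "a = b \<oplus> m"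
proof -
  have "a \<in> (\<Union>h\<in>even_part R. \<Union>k\<in>odd_part R. {h \<oplus> k})"
    using assms direct_sum(1) by (simp only: set_add_def')
  then show ?thesis using that by blast
qed

lemma decomp_unique:
  assumes "b \<in> even_part R" "m \<in> odd_part R" "b' \<in> even_part R" "m' \<in> odd_part R" "b \<oplus> m = b' \<oplus> m'"
  shows "b = b' \<and> m = m'"
proof -
  have c: "b \<in> carrier R" "m \<in> carrier R" "b' \<in> carrier R" "m' \<in> carrier R" using assms by auto
  have "b \<ominus> b' = m' \<ominus> m"
  proof -
    have "b \<ominus> b' = (b \<oplus> m) \<ominus> m \<ominus> b'" using c by (simp add: minus_eq a_assoc r_neg)
    also have "\<dots> = (b' \<oplus> m') \<ominus> m \<ominus> b'" using assms by simp
    also have "\<dots> = (b' \<oplus> \<ominus> b') \<oplus> (m' \<ominus> m)" using c unfolding minus_eq by (simp add: a_ac)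
    also have "\<dots> = m' \<ominus> m" using c by (simp add: r_neg)
    finally show ?thesis .
  qed
  moreover have "b \<ominus> b' \<in> even_part R" "m' \<ominus> m \<in> odd_part R"
    using assms by (auto simp: minus_eq)
  ultimately have "b \<ominus> b' = \<zero>" "m' \<ominus> m = \<zero>" using direct_sum(2) by auto
  moreover have "b = (b \<ominus> b') \<oplus> b'" "m' = (m' \<ominus> m) \<oplus> m" using c by (simp_all add: minus_eq a_assoc l_neg)
  ultimately show ?thesis using c by simp
qed

lemma comps: "\<lbrakk>b \<in> even_part R; m \<in> odd_part R\<rbrakk> \<Longrightarrow> even_comp R (b \<oplus> m) = b \<and> odd_comp R (b \<oplus> m) = m"
  unfolding even_comp_def odd_comp_def using decomp_unique by blast

lemma map_decomp: "\<lbrakk>b \<in> even_part R; m \<in> odd_part R\<rbrakk> \<Longrightarrow> sloc_map R S (b \<oplus> m) = (L b, oc [(m, \<one>\<^bsub>A\<^esub>)])"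
  by (simp add: sloc_map_def comps L_def)

lemma oc_null: "oc [(\<zero>, \<one>\<^bsub>A\<^esub>)] = \<zero>\<^bsub>T\<^esub>" by (simp add: T_zero oc_eqI te_zero)

lemma map_even: "b \<in> even_part R \<Longrightarrow> sloc_map R S b = (L b, \<zero>\<^bsub>T\<^esub>)"
  using map_decomp[of b \<zero>] by (simp add: oc_null)
lemma map_odd: "m \<in> odd_part R \<Longrightarrow> sloc_map R S m = (\<zero>\<^bsub>A\<^esub>, oc [(m, \<one>\<^bsub>A\<^esub>)])"
  using map_decomp[of \<zero> m] by (simp add: L_zero)

lemma map_hom: "sloc_map R S \<in> csring_hom R Q"
proof -
  have add: "oc [(m, \<one>\<^bsub>A\<^esub>)] \<oplus>\<^bsub>T\<^esub> oc [(n, \<one>\<^bsub>A\<^esub>)] = oc [(m \<oplus> n, \<one>\<^bsub>A\<^esub>)]" if "m \<in> odd_part R" "n \<in> odd_part R" for m n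
    using that te_add_left[of m n "\<one>\<^bsub>A\<^esub>"] by (simp add: T_add oc_eqI)
  have smult: "sm (L b) (oc [(m, \<one>\<^bsub>A\<^esub>)]) = oc [(b \<otimes> m, \<one>\<^bsub>A\<^esub>)]" if "m \<in> odd_part R" "b \<in> even_part R" for m b
    using that te_balanced[of b m "\<one>\<^bsub>A\<^esub>"] by (simp add: sm_oc oc_eqI)
  have "sloc_map R S \<in> ring_hom R Q"
  proof (rule ring_hom_memI)
    fix x y assume "x \<in> carrier R" "y \<in> carrier R"
    then obtain b m c n where xy: "x = b \<oplus> m" "y = c \<oplus> n" and [simp]: "b \<in> even_part R" "m \<in> odd_part R"
      "c \<in> even_part R" "n \<in> odd_part R" by (metis decomp_ex)
    have "x \<otimes> y = (b \<otimes> c \<oplus> m \<otimes> n) \<oplus> (b \<otimes> n \<oplus> c \<otimes> m)"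
      using even_comm[of c m] unfolding xy by (simp add: l_distr r_distr a_ac)
    then show "sloc_map R S (x \<otimes> y) = sloc_map R S x \<otimes>\<^bsub>Q\<^esub> sloc_map R S y"
      unfolding xy
      by (simp add: map_decomp Q_simps odd_mult_oc pr_def L_add L_mult smult add)
    have "x \<oplus> y = (b \<oplus> c) \<oplus> (m \<oplus> n)" unfolding xy by (simp add: a_ac)
    then show "sloc_map R S (x \<oplus> y) = sloc_map R S x \<oplus>\<^bsub>Q\<^esub> sloc_map R S y"
      unfolding xy by (simp add: map_decomp Q_simps L_add add)
    show "sloc_map R S x \<in> carrier Q" unfolding xy by (simp add: map_decomp Q_simps)
  next
    have "\<one> \<in> even_part R"
      using even.cring_ring_of[THEN cring.axioms(1), THEN ring.ring_simprules(6)] compatible(4) by simp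
    then show "sloc_map R S \<one> = \<one>\<^bsub>Q\<^esub>" by (simp add: map_even L_one Q_simps)
  qed
  moreover have "restrict (sloc_map R S) (even_part R) \<in> cinf_hom (even_ring R) (even_ring Q)"
  proof -
    have L: "L \<in> cinf_hom (even_ring R) (cloc (even_ring R) S)"
      unfolding L_def by (rule cloc_map_hom[OF even.cinf_ring_axioms])
    { fix f cs assume cs: "set cs \<subseteq> even_part R" "f \<in> Cinf (length cs)"
      have eq: "map (fst \<circ> restrict (sloc_map R S) (even_part R)) cs = map L cs"
        using cs by (auto simp: map_even subset_iff)
      have "cop (even_ring R) f cs \<in> even_part R" using even.cop_closed[of cs f] cs by simp
      then have "restrict (sloc_map R S) (even_part R) (cop (even_ring R) f cs)
        = cop (even_ring Q) f (map (restrict (sloc_map R S) (even_part R)) cs)"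
        using cinf_homD[OF L, of cs f] cs
        by (simp add: map_even even_ring_def[of Q] Q_simps eq del: map_eq_conv) }
    then show ?thesis
      by (auto simp: cinf_hom_def map_even even_ring_def[of Q] Q_simps)
  qed
  moreover have "sloc_map R S \<in> extensional (carrier R)" by (simp add: sloc_map_def)
  moreover have "sloc_map R S ` even_part R \<subseteq> even_part Q" "sloc_map R S ` odd_part R \<subseteq> odd_part Q"
    by (auto simp: map_even map_odd Q_simps)
  ultimately show ?thesis by (simp add: csring_hom_def)
qed


lemma map_unit:
  assumes "s \<in> S" shows "\<exists>d\<in>carrier Q. sloc_map R S s \<otimes>\<^bsub>Q\<^esub> d = \<one>\<^bsub>Q\<^esub>"
proof -
  have "s \<in> even_part R" using assms S_even by auto
  with cloc_map_unit[of s S "even_ring R"] assms S_even show ?thesis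
    by (intro bexI[of _ "(lclass (even_ring R) S (Inv s), \<zero>\<^bsub>T\<^esub>)"])
      (auto simp: map_even Q_simps A_def[symmetric] L_def[symmetric] car_A[symmetric] T_laws om_zero)
qed

end

theorem sloc_universal:
  fixes R :: "'a csring" (structure) and P :: "'b csring"
  assumes "cinf_superring R" "S \<subseteq> even_part R" "cinf_superring P" and psi: "\<psi> \<in> csring_hom R P"
    and unit: "\<And>s. s \<in> S \<Longrightarrow> \<exists>d\<in>carrier P. \<psi> s \<otimes>\<^bsub>P\<^esub> d = \<one>\<^bsub>P\<^esub>"
  shows "\<exists>!\<xi>. \<xi> \<in> csring_hom (sloc R S) P \<and> (\<forall>a\<in>carrier R. \<xi> (sloc_map R S a) = \<psi> a)"
proof -
  interpret superloc R S using assms by (simp add: superloc_def superloc_axioms_def)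
  interpret P: superloc P "{}" using assms by (simp add: superloc_def superloc_axioms_def)
  have psi_ring: "\<psi> \<in> ring_hom R P"
    and psi_even [simp]: "\<And>a. a \<in> even_part R \<Longrightarrow> \<psi> a \<in> even_part P"
    and psi_odd [simp]: "\<And>a. a \<in> odd_part R \<Longrightarrow> \<psi> a \<in> odd_part P"
    and psi_cinf: "restrict \<psi> (even_part R) \<in> cinf_hom (even_ring R) (even_ring P)"
    using psi by (auto simp: csring_hom_def)
  note psi_add = ring_hom_add[OF psi_ring] and psi_mult = ring_hom_mult[OF psi_ring]
  have psi_zero: "\<psi> \<zero> = \<zero>\<^bsub>P\<^esub>" using ring_hom_zero[OF psi_ring] ring_axioms P.ring_axioms by blast
  have unit_even: "\<exists>d\<in>carrier (even_ring P). restrict \<psi> (even_part R) s \<otimes>\<^bsub>ring_of (even_ring P)\<^esub> d = \<one>\<^bsub>ring_of (even_ring P)\<^esub>"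
    if "s \<in> S" for s
  proof -
    have s: "s \<in> even_part R" using that S_even by auto
    obtain d where d: "d \<in> carrier P" "\<psi> s \<otimes>\<^bsub>P\<^esub> d = \<one>\<^bsub>P\<^esub>" using unit[OF \<open>s \<in> S\<close>] by auto
    obtain e m where em: "e \<in> even_part P" "m \<in> odd_part P" "d = e \<oplus>\<^bsub>P\<^esub> m" using P.decomp_ex[OF d(1)] .
    have o: "\<one>\<^bsub>P\<^esub> \<in> even_part P"
      using P.even.cring_ring_of[THEN cring.axioms(1), THEN ring.ring_simprules(6)] P.compatible(4) by simp
    have "(\<psi> s \<otimes>\<^bsub>P\<^esub> e) \<oplus>\<^bsub>P\<^esub> (\<psi> s \<otimes>\<^bsub>P\<^esub> m) = \<one>\<^bsub>P\<^esub> \<oplus>\<^bsub>P\<^esub> \<zero>\<^bsub>P\<^esub>"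
      using d(2) s em by (simp add: P.r_distr)
    then have "\<psi> s \<otimes>\<^bsub>P\<^esub> e = \<one>\<^bsub>P\<^esub>"
      using P.decomp_unique[of "\<psi> s \<otimes>\<^bsub>P\<^esub> e" "\<psi> s \<otimes>\<^bsub>P\<^esub> m" "\<one>\<^bsub>P\<^esub>" "\<zero>\<^bsub>P\<^esub>"] s em o by simp
    then show ?thesis using s em P.compatible(2)[of "\<psi> s" e] P.compatible(4) by auto
  qed
  have ex1: "\<exists>!\<eta>. \<eta> \<in> cinf_hom (cloc (even_ring R) S) (even_ring P) \<and>
      (\<forall>c\<in>carrier (even_ring R). \<eta> (cloc_map (even_ring R) S c) = restrict \<psi> (even_part R) c)"
    by (rule cloc_universal[OF even.cinf_ring_axioms _ P.even.cinf_ring_axioms psi_cinf unit_even])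
      (use S_even in simp_all)
  then obtain h where h: "h \<in> cinf_hom (cloc (even_ring R) S) (even_ring P)"
    and hL: "\<And>c. c \<in> even_part R \<Longrightarrow> h (L c) = \<psi> c" by (auto simp: L_def)
  have h_ring: "h \<in> ring_hom A (ring_of (even_ring P))"
    unfolding A_def by (intro cinf_hom_ring_hom cinf_ring_cloc P.even.cinf_ring_axioms h)
  have h_closed [simp]: "h a \<in> even_part P" if "a \<in> carrier A" for a
    using ring_hom_closed[OF h_ring that] by simp
  have h_add: "h (a \<oplus>\<^bsub>A\<^esub> b) = h a \<oplus>\<^bsub>P\<^esub> h b" and h_mult: "h (a \<otimes>\<^bsub>A\<^esub> b) = h a \<otimes>\<^bsub>P\<^esub> h b"
    if "a \<in> carrier A" "b \<in> carrier A" for a b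
    using ring_hom_add[OF h_ring that] ring_hom_mult[OF h_ring that] that P.compatible by simp_all
  have h_one: "h \<one>\<^bsub>A\<^esub> = \<one>\<^bsub>P\<^esub>" using ring_hom_one[OF h_ring] P.compatible(4) by simp
  have h_zero: "h \<zero>\<^bsub>A\<^esub> = \<zero>\<^bsub>P\<^esub>" using hL[of \<zero>] psi_zero by (simp add: L_zero)

  define k where "k us = foldr (\<lambda>(m, a) y. (\<psi> m \<otimes>\<^bsub>P\<^esub> h a) \<oplus>\<^bsub>P\<^esub> y) us \<zero>\<^bsub>P\<^esub>" for us
  have k_simps [simp]: "k [] = \<zero>\<^bsub>P\<^esub>" "k ((m, a) # us) = (\<psi> m \<otimes>\<^bsub>P\<^esub> h a) \<oplus>\<^bsub>P\<^esub> k us" for m a us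
    by (simp_all add: k_def)
  have k_closed [simp]: "k us \<in> odd_part P" if "us \<in> W" for us
    using that by (induction us) auto
  have k_append: "k (us @ vs) = k us \<oplus>\<^bsub>P\<^esub> k vs" if "us \<in> W" "vs \<in> W" for us vs
    using that by (induction us) (auto simp: P.a_assoc)
  have k_te: "te us vs \<Longrightarrow> k us = k vs" for us vs
  proof (induction rule: te_induct)
    case (cong us us' vs vs') then show ?case using te_W by (simp add: k_append)
  next
    case (comm us vs) then show ?case by (simp add: k_append P.a_comm)
  next
    case (balanced e m a)
    then show ?case using P.even_comm[of "\<psi> e" "\<psi> m"] by (simp add: psi_mult h_mult hL P.m_assoc[symmetric])
  qed (simp_all add: psi_zero psi_add h_add P.l_distr P.r_distr)
  define kk where "kk u = k (SOME us. us \<in> u)" for u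
  have kk: "kk (oc us) = k us" if "us \<in> W" for us
    using k_te[OF oc_rep[OF that]] by (simp add: kk_def)
  have kk_closed [simp]: "kk u \<in> odd_part P" if "u \<in> carrier T" for u
    using that by (auto elim!: T_cases simp: kk)
  have kk_add: "kk (u \<oplus>\<^bsub>T\<^esub> v) = kk u \<oplus>\<^bsub>P\<^esub> kk v" if "u \<in> carrier T" "v \<in> carrier T" for u v
    using that by (auto elim!: T_cases simp: kk T_add k_append)
  have kk_zero: "kk \<zero>\<^bsub>T\<^esub> = \<zero>\<^bsub>P\<^esub>" by (simp add: T_zero kk)
  have kk_sm: "kk (sm a u) = h a \<otimes>\<^bsub>P\<^esub> kk u" if a: "a \<in> carrier A" and u: "u \<in> carrier T" for a u
    using u
  proof (induction u rule: T_induct)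
    case (add m b u)
    have "\<psi> m \<otimes>\<^bsub>P\<^esub> (h a \<otimes>\<^bsub>P\<^esub> h b) = h a \<otimes>\<^bsub>P\<^esub> (\<psi> m \<otimes>\<^bsub>P\<^esub> h b)"
      using P.even_comm[of "h a" "\<psi> m"] a add by (simp add: P.m_assoc[symmetric])
    then have "kk (sm a (oc [(m, b)])) = h a \<otimes>\<^bsub>P\<^esub> kk (oc [(m, b)])"
      using a add by (simp add: sm_oc kk h_mult)
    then show ?case using a add by (simp add: T_laws kk_add P.r_distr)
  qed (use a in \<open>simp add: T_laws kk_zero\<close>)
  have kk_om1: "h (om (oc [(m, a)]) (oc [(n, b)])) = kk (oc [(m, a)]) \<otimes>\<^bsub>P\<^esub> kk (oc [(n, b)])"
    if "m \<in> odd_part R" "a \<in> carrier A" "n \<in> odd_part R" "b \<in> carrier A" for m a n b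
  proof -
    have "\<psi> m \<otimes>\<^bsub>P\<^esub> h a \<otimes>\<^bsub>P\<^esub> (\<psi> n \<otimes>\<^bsub>P\<^esub> h b) = \<psi> m \<otimes>\<^bsub>P\<^esub> (h a \<otimes>\<^bsub>P\<^esub> \<psi> n) \<otimes>\<^bsub>P\<^esub> h b"
      using that by (simp add: P.m_assoc)
    also have "\<dots> = \<psi> m \<otimes>\<^bsub>P\<^esub> \<psi> n \<otimes>\<^bsub>P\<^esub> (h a \<otimes>\<^bsub>P\<^esub> h b)"
      using that P.even_comm[of "h a" "\<psi> n"] by (simp add: P.m_assoc)
    finally show ?thesis using that by (simp add: odd_mult_oc kk pr_def h_mult hL psi_mult)
  qed
  have kk_om2: "h (om (oc [(m, a)]) v) = kk (oc [(m, a)]) \<otimes>\<^bsub>P\<^esub> kk v"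
    if m: "m \<in> odd_part R" "a \<in> carrier A" and v: "v \<in> carrier T" for m a v
    using v
  proof (induction v rule: T_induct)
    case (add n b v)
    then show ?case using m kk_om1[of m a n b] by (simp add: om_add_right kk_add h_add P.r_distr)
  qed (use m in \<open>simp add: om_zero h_zero kk_zero\<close>)
  have kk_om: "h (om u v) = kk u \<otimes>\<^bsub>P\<^esub> kk v" if u: "u \<in> carrier T" and v: "v \<in> carrier T" for u v
    using u
  proof (induction u rule: T_induct)
    case (add m a u)
    then show ?case using v kk_om2[of m a v] by (simp add: om_add_left kk_add h_add P.l_distr)
  qed (use v in \<open>simp add: om_zero h_zero kk_zero\<close>)

  define \<xi> where "\<xi> = (\<lambda>x\<in>carrier Q. h (fst x) \<oplus>\<^bsub>P\<^esub> kk (snd x))"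
  have xi: "\<xi> (a, u) = h a \<oplus>\<^bsub>P\<^esub> kk u" if "a \<in> carrier A" "u \<in> carrier T" for a u
    using that by (simp add: \<xi>_def Q_simps)
  have xi_ring: "\<xi> \<in> ring_hom Q P"
  proof (rule ring_hom_memI)
    fix x y assume "x \<in> carrier Q" "y \<in> carrier Q"
    then obtain a u b v where xy: "x = (a, u)" "y = (b, v)" and [simp]: "a \<in> carrier A" "u \<in> carrier T"
      "b \<in> carrier A" "v \<in> carrier T" by (auto simp: Q_simps)
    show "\<xi> x \<in> carrier P" by (simp add: xy xi)
    show "\<xi> (x \<oplus>\<^bsub>Q\<^esub> y) = \<xi> x \<oplus>\<^bsub>P\<^esub> \<xi> y" by (simp add: xy Q_simps xi T_laws h_add kk_add P.a_ac)
    have "kk u \<otimes>\<^bsub>P\<^esub> h b = h b \<otimes>\<^bsub>P\<^esub> kk u" using P.even_comm[of "h b" "kk u"] by simp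
    then show "\<xi> (x \<otimes>\<^bsub>Q\<^esub> y) = \<xi> x \<otimes>\<^bsub>P\<^esub> \<xi> y"
      by (simp add: xy Q_simps xi T_laws h_add h_mult kk_add kk_sm kk_om P.l_distr P.r_distr P.a_ac)
  next
    show "\<xi> \<one>\<^bsub>Q\<^esub> = \<one>\<^bsub>P\<^esub>" by (simp add: Q_simps xi T_laws h_one kk_zero)
  qed
  have xi_even: "\<xi> x = h (fst x)" if "x \<in> even_part Q" for x
    using that by (auto simp: Q_simps xi T_laws kk_zero)
  have xi_cinf: "restrict \<xi> (even_part Q) \<in> cinf_hom (even_ring Q) (even_ring P)"
  proof -
    { fix f cs assume cs: "set cs \<subseteq> even_part Q" "f \<in> Cinf (length cs)"
      have c: "set (map fst cs) \<subseteq> carrier (cloc (even_ring R) S)" using cs by (auto simp: Q_simps car_A)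
      have m: "map (restrict \<xi> (even_part Q)) cs = map h (map fst cs)"
        using cs by (auto simp: xi_even)
      have "sop Q f cs \<in> even_part Q"
        using cinf_ring.cop_closed[OF Q_cinf, of cs f] cs by (simp add: even_ring_def)
      then have "restrict \<xi> (even_part Q) (sop Q f cs) = cop (even_ring P) f (map (restrict \<xi> (even_part Q)) cs)"
        unfolding m using cinf_homD[OF h c, of f] cs by (simp add: xi_even) (simp add: Q_simps) }
    moreover have "restrict \<xi> (even_part Q) \<in> even_part Q \<rightarrow>\<^sub>E even_part P"
      by (auto simp: xi_even Q_simps)
    ultimately show ?thesis by (simp add: cinf_hom_def even_ring_def)
  qed
  have xi_hom: "\<xi> \<in> csring_hom Q P"
    using xi_ring xi_cinf
    by (auto simp: csring_hom_def xi_even) (auto simp: \<xi>_def Q_simps h_zero)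
  have xi_map: "\<xi> (sloc_map R S a) = \<psi> a" if a: "a \<in> carrier R" for a
  proof -
    obtain b m where "b \<in> even_part R" "m \<in> odd_part R" "a = b \<oplus> m" using decomp_ex[OF a] .
    then show ?thesis by (simp add: map_decomp xi hL kk h_one psi_add)
  qed
  have uniq: "\<eta> = \<xi>" if chi: "\<eta> \<in> csring_hom Q P" and chi_map: "\<And>a. a \<in> carrier R \<Longrightarrow> \<eta> (sloc_map R S a) = \<psi> a" for \<eta>
  proof -
    have chi_ring: "\<eta> \<in> ring_hom Q P" and chi_ext: "\<eta> \<in> extensional (carrier Q)"
      and chi_ev: "\<And>x. x \<in> even_part Q \<Longrightarrow> \<eta> x \<in> even_part P"
      and chi_cinf: "restrict \<eta> (even_part Q) \<in> cinf_hom (even_ring Q) (even_ring P)"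
      using chi by (auto simp: csring_hom_def)
    define h' where "h' = (\<lambda>a\<in>carrier A. \<eta> (a, \<zero>\<^bsub>T\<^esub>))"
    have "h' \<in> cinf_hom (cloc (even_ring R) S) (even_ring P)"
    proof -
      { fix f cs assume cs: "set cs \<subseteq> carrier (cloc (even_ring R) S)" "f \<in> Cinf (length cs)"
        let ?cs = "map (\<lambda>a. (a, \<zero>\<^bsub>T\<^esub>)) cs"
        have c: "set ?cs \<subseteq> carrier (even_ring Q)" using cs by (auto simp: even_ring_def[of Q] Q_simps car_A)
        have m: "map (restrict \<eta> (even_part Q)) ?cs = map h' cs"
          using cs by (auto simp: h'_def Q_simps car_A subset_iff)
        have cl: "cop (cloc (even_ring R) S) f cs \<in> carrier A"
          using cinf_ring.cop_closed[OF cinf_ring_cloc cs] by (simp add: car_A)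
        have "cop (even_ring Q) f ?cs = (cop (cloc (even_ring R) S) f cs, \<zero>\<^bsub>T\<^esub>)"
          by (simp add: even_ring_def[of Q] Q_simps o_def)
        then have "h' (cop (cloc (even_ring R) S) f cs) = cop (even_ring P) f (map h' cs)"
          using cinf_homD[OF chi_cinf c, of f] cl cs(2) unfolding m by (simp add: h'_def Q_simps) }
      moreover have "h' \<in> carrier (cloc (even_ring R) S) \<rightarrow>\<^sub>E carrier (even_ring P)"
        using chi_ev by (auto simp: h'_def car_A[symmetric] Q_simps)
      ultimately show ?thesis by (simp add: cinf_hom_def)
    qed
    moreover have "h' (L c) = \<psi> c" if "c \<in> even_part R" for c
      using chi_map[of c] that by (simp add: h'_def map_even)
    ultimately have hh: "h' = h" using ex1 h hL by (auto simp: L_def)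
    have c0: "\<eta> (a, \<zero>\<^bsub>T\<^esub>) = h a" if "a \<in> carrier A" for a
      using that hh by (auto simp: h'_def dest: fun_cong[of _ _ a])
    have c1: "\<eta> (\<zero>\<^bsub>A\<^esub>, u) = kk u" if "u \<in> carrier T" for u
      using that
    proof (induction u rule: T_induct)
      case zero then show ?case by (simp add: c0 h_zero kk_zero)
    next
      case (add m a u)
      have "(\<zero>\<^bsub>A\<^esub>, oc [(m, a)]) = (\<zero>\<^bsub>A\<^esub>, oc [(m, \<one>\<^bsub>A\<^esub>)]) \<otimes>\<^bsub>Q\<^esub> (a, \<zero>\<^bsub>T\<^esub>)"
        using add by (simp add: Q_simps om_zero T_laws sm_oc)
      also have "\<eta> \<dots> = \<psi> m \<otimes>\<^bsub>P\<^esub> h a"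
        using add ring_hom_mult[OF chi_ring, of "(\<zero>\<^bsub>A\<^esub>, oc [(m, \<one>\<^bsub>A\<^esub>)])" "(a, \<zero>\<^bsub>T\<^esub>)"] chi_map[of m]
        by (simp add: Q_simps(1) c0 map_odd T_laws)
      finally have "\<eta> (\<zero>\<^bsub>A\<^esub>, oc [(m, a)]) = kk (oc [(m, a)])" using add by (simp add: kk)
      then show ?case
        using add ring_hom_add[OF chi_ring, of "(\<zero>\<^bsub>A\<^esub>, oc [(m, a)])" "(\<zero>\<^bsub>A\<^esub>, u)"]
        by (simp add: Q_simps kk_add)
    qed
    show ?thesis
    proof (rule extensionalityI[OF chi_ext])
      show "\<xi> \<in> extensional (carrier Q)" by (simp add: \<xi>_def)
      fix x assume "x \<in> carrier Q"
      then obtain a u where x: "x = (a, u)" "a \<in> carrier A" "u \<in> carrier T" by (auto simp: Q_simps)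
      then show "\<eta> x = \<xi> x"
        using ring_hom_add[OF chi_ring, of "(a, \<zero>\<^bsub>T\<^esub>)" "(\<zero>\<^bsub>A\<^esub>, u)"]
        by (simp add: Q_simps T_laws c0 c1 xi)
    qed
  qed
  show ?thesis using xi_hom xi_map uniq by blast
qed


section \<open>Points and fair superrings\<close>

definition points :: "'a csring \<Rightarrow> ('a \<Rightarrow> real) set" where
  "points R = cinf_hom (even_ring R) real_cinf"

definition points_topology :: "'a csring \<Rightarrow> ('a \<Rightarrow> real) topology" where
  "points_topology R = topology_generated_by ((\<lambda>c. {x \<in> points R. x c \<noteq> 0}) ` even_part R)"

definition nonvanishing :: "'a csring \<Rightarrow> ('a \<Rightarrow> real) \<Rightarrow> 'a set" where
  "nonvanishing R x = {r \<in> even_part R. x r \<noteq> 0}"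

abbreviation loc_at :: "'a csring \<Rightarrow> ('a \<Rightarrow> real) \<Rightarrow> 'a sloc csring" where
  "loc_at R x \<equiv> sloc R (nonvanishing R x)"

abbreviation loc_at_map :: "'a csring \<Rightarrow> ('a \<Rightarrow> real) \<Rightarrow> 'a \<Rightarrow> 'a sloc" where
  "loc_at_map R x \<equiv> sloc_map R (nonvanishing R x)"

definition fair :: "'a csring \<Rightarrow> bool" where
  "fair R \<longleftrightarrow> cinf_superring R \<and> finitely_generated R \<and>
     (\<forall>a\<in>carrier R. (\<forall>x\<in>points R. loc_at_map R x a = \<zero>\<^bsub>loc_at R x\<^esub>) \<longrightarrow> a = \<zero>\<^bsub>R\<^esub>)"


section \<open>Locally C-infinity ringed superspaces\<close>

record ('p, 's) superspace =
  topo :: "'p topology"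
  sec :: "'p set \<Rightarrow> 's csring"
  res :: "'p set \<Rightarrow> 'p set \<Rightarrow> 's \<Rightarrow> 's"

locale csring_sheaf =
  fixes X :: "('p, 's) superspace"
  assumes sec_csring: "openin (topo X) U \<Longrightarrow> cinf_superring (sec X U)"
    and res_hom: "\<lbrakk>openin (topo X) U; openin (topo X) V; V \<subseteq> U\<rbrakk>
      \<Longrightarrow> res X U V \<in> csring_hom (sec X U) (sec X V)"
    and res_id: "\<lbrakk>openin (topo X) U; s \<in> carrier (sec X U)\<rbrakk> \<Longrightarrow> res X U U s = s"
    and res_res: "\<lbrakk>openin (topo X) U; openin (topo X) V; openin (topo X) W; W \<subseteq> V; V \<subseteq> U;
        s \<in> carrier (sec X U)\<rbrakk> \<Longrightarrow> res X V W (res X U V s) = res X U W s"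
    and locality: "\<lbrakk>\<And>V. V \<in> \<V> \<Longrightarrow> openin (topo X) V; s \<in> carrier (sec X (\<Union>\<V>));
        t \<in> carrier (sec X (\<Union>\<V>)); \<And>V. V \<in> \<V> \<Longrightarrow> res X (\<Union>\<V>) V s = res X (\<Union>\<V>) V t\<rbrakk> \<Longrightarrow> s = t"
    and gluing: "\<lbrakk>\<And>V. V \<in> \<V> \<Longrightarrow> openin (topo X) V; \<And>V. V \<in> \<V> \<Longrightarrow> \<sigma> V \<in> carrier (sec X V);
        \<And>V W. \<lbrakk>V \<in> \<V>; W \<in> \<V>\<rbrakk> \<Longrightarrow> res X V (V \<inter> W) (\<sigma> V) = res X W (V \<inter> W) (\<sigma> W)\<rbrakk>
      \<Longrightarrow> \<exists>t\<in>carrier (sec X (\<Union>\<V>)). \<forall>V\<in>\<V>. res X (\<Union>\<V>) V t = \<sigma> V"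

definition germ :: "('p, 's) superspace \<Rightarrow> 'p \<Rightarrow> 'p set \<Rightarrow> 's \<Rightarrow> ('p set \<times> 's) set" where
  "germ X x U s = {(V, t). openin (topo X) V \<and> x \<in> V \<and> t \<in> carrier (sec X V) \<and>
     (\<exists>W. openin (topo X) W \<and> x \<in> W \<and> W \<subseteq> U \<inter> V \<and> res X U W s = res X V W t)}"

text \<open>
  The germ obtained by applying F to sections, taken from the subsets P U of the section rings, that
  represent the given germs on a common neighbourhood.
\<close>

definition germ_op ::
    "('p, 's) superspace \<Rightarrow> 'p \<Rightarrow> ('s csring \<Rightarrow> 's set) \<Rightarrow> ('s csring \<Rightarrow> 's list \<Rightarrow> 's)
      \<Rightarrow> ('p set \<times> 's) set list \<Rightarrow> ('p set \<times> 's) set" where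
  "germ_op X x P F gs = (THE g. \<exists>U ss. openin (topo X) U \<and> x \<in> U \<and> set ss \<subseteq> P (sec X U) \<and>
     gs = map (germ X x U) ss \<and> g = germ X x U (F (sec X U) ss))"

definition germs ::
    "('p, 's) superspace \<Rightarrow> 'p \<Rightarrow> ('s csring \<Rightarrow> 's set) \<Rightarrow> ('p set \<times> 's) set set" where
  "germs X x P = {germ X x U s | U s. openin (topo X) U \<and> x \<in> U \<and> s \<in> P (sec X U)}"

definition stalk :: "('p, 's) superspace \<Rightarrow> 'p \<Rightarrow> ('p set \<times> 's) set csring" where
  "stalk X x = \<lparr>carrier = germs X x carrier,
     mult = (\<lambda>g h. germ_op X x carrier (\<lambda>R ss. ss ! 0 \<otimes>\<^bsub>R\<^esub> ss ! 1) [g, h]),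
     one = germ_op X x carrier (\<lambda>R ss. \<one>\<^bsub>R\<^esub>) [],
     zero = germ_op X x carrier (\<lambda>R ss. \<zero>\<^bsub>R\<^esub>) [],
     add = (\<lambda>g h. germ_op X x carrier (\<lambda>R ss. ss ! 0 \<oplus>\<^bsub>R\<^esub> ss ! 1) [g, h]),
     even_part = germs X x even_part, odd_part = germs X x odd_part,
     sop = (\<lambda>f. germ_op X x even_part (\<lambda>R. sop R f))\<rparr>"

locale lc_superspace = csring_sheaf X for X :: "('p, 's) superspace" +
  assumes local_stalks: "x \<in> topspace (topo X) \<Longrightarrow> local_csring (stalk X x)"

definition preim :: "('p, 's) superspace \<Rightarrow> ('p \<Rightarrow> 'q) \<Rightarrow> 'q set \<Rightarrow> 'p set" where
  "preim X f V = {x \<in> topspace (topo X). f x \<in> V}"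

text \<open>The second component of a morphism is indexed by the open subsets of the target.\<close>

definition superspace_hom ::
    "('p, 's) superspace \<Rightarrow> ('q, 't) superspace
      \<Rightarrow> (('p \<Rightarrow> 'q) \<times> ('q set \<Rightarrow> 't \<Rightarrow> 's)) set" where
  "superspace_hom X Y = {(f, fs).
     f \<in> extensional (topspace (topo X)) \<and> continuous_map (topo X) (topo Y) f \<and>
     fs \<in> extensional {V. openin (topo Y) V} \<and>
     (\<forall>V. openin (topo Y) V \<longrightarrow> fs V \<in> csring_hom (sec Y V) (sec X (preim X f V))) \<and>
     (\<forall>V W. openin (topo Y) V \<longrightarrow> openin (topo Y) W \<longrightarrow> W \<subseteq> V \<longrightarrow> (\<forall>s\<in>carrier (sec Y V).
        fs W (res Y V W s) = res X (preim X f V) (preim X f W) (fs V s)))}"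

definition superspace_id ::
    "('p, 's) superspace \<Rightarrow> ('p \<Rightarrow> 'p) \<times> ('p set \<Rightarrow> 's \<Rightarrow> 's)" where
  "superspace_id X = ((\<lambda>x\<in>topspace (topo X). x),
     (\<lambda>U\<in>{U. openin (topo X) U}. \<lambda>s\<in>carrier (sec X U). s))"

text \<open>The composite of (f, fs) from X to Y with (g, gs) from Y to Z.\<close>

definition superspace_comp ::
    "('p, 's) superspace \<Rightarrow> ('q, 't) superspace \<Rightarrow> ('r, 'u) superspace
      \<Rightarrow> ('q \<Rightarrow> 'r) \<times> ('r set \<Rightarrow> 'u \<Rightarrow> 't) \<Rightarrow> ('p \<Rightarrow> 'q) \<times> ('q set \<Rightarrow> 't \<Rightarrow> 's)
      \<Rightarrow> ('p \<Rightarrow> 'r) \<times> ('r set \<Rightarrow> 'u \<Rightarrow> 's)" where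
  "superspace_comp X Y Z = (\<lambda>(g, gs) (f, fs).
     (compose (topspace (topo X)) g f,
      \<lambda>W\<in>{W. openin (topo Z) W}. compose (carrier (sec Z W)) (fs (preim Y g W)) (gs W)))"


section \<open>The functor sSpec\<close>

definition struct_sheaf ::
    "'a csring \<Rightarrow> ('a \<Rightarrow> real) set \<Rightarrow> (('a \<Rightarrow> real) \<Rightarrow> 'a lterm set) set" where
  "struct_sheaf R U =
     {s \<in> (\<Pi>\<^sub>E x\<in>U. carrier (cloc (even_ring R) (nonvanishing R x))).
        \<forall>x\<in>U. \<exists>V c. openin (points_topology R) V \<and> x \<in> V \<and> V \<subseteq> U \<and> c \<in> even_part R \<and>
          (\<forall>y\<in>V. s y = cloc_map (even_ring R) (nonvanishing R y) c)}"

definition MSpec_odd ::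
    "'a csring \<Rightarrow> ('a \<Rightarrow> real) set \<Rightarrow> (('a \<Rightarrow> real) \<Rightarrow> 'a odd_loc) set" where
  "MSpec_odd R U =
     {e \<in> (\<Pi>\<^sub>E x\<in>U. carrier (odd_loc R (nonvanishing R x))).
        \<forall>x\<in>U. \<exists>V m. openin (points_topology R) V \<and> x \<in> V \<and> V \<subseteq> U \<and> m \<in> odd_part R \<and>
          (\<forall>y\<in>V. e y = odd_class R (nonvanishing R y)
             [(m, \<one>\<^bsub>loc_module R (nonvanishing R y)\<^esub>)])}"

text \<open>
  The direct sum of \<^const>\<open>struct_sheaf\<close> and \<^const>\<open>MSpec_odd\<close>:  the pair (s, e) is stored as the
  function mapping x to (s x, e x), an element of the localization of R at x.
\<close>

definition sSpec_sec :: "'a csring \<Rightarrow> ('a \<Rightarrow> real) set \<Rightarrow> (('a \<Rightarrow> real) \<Rightarrow> 'a sloc) csring" where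
  "sSpec_sec R U = (let A = {\<lambda>x\<in>U. (s x, e x) | s e. s \<in> struct_sheaf R U \<and> e \<in> MSpec_odd R U} in
     \<lparr>carrier = A,
      mult = (\<lambda>\<sigma> \<tau>. \<lambda>x\<in>U. \<sigma> x \<otimes>\<^bsub>loc_at R x\<^esub> \<tau> x),
      one = (\<lambda>x\<in>U. \<one>\<^bsub>loc_at R x\<^esub>), zero = (\<lambda>x\<in>U. \<zero>\<^bsub>loc_at R x\<^esub>),
      add = (\<lambda>\<sigma> \<tau>. \<lambda>x\<in>U. \<sigma> x \<oplus>\<^bsub>loc_at R x\<^esub> \<tau> x),
      even_part = {\<sigma> \<in> A. \<forall>x\<in>U. \<sigma> x \<in> even_part (loc_at R x)},
      odd_part = {\<sigma> \<in> A. \<forall>x\<in>U. \<sigma> x \<in> odd_part (loc_at R x)},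
      sop = (\<lambda>f \<sigma>s. \<lambda>x\<in>U. sop (loc_at R x) f (map (\<lambda>\<sigma>. \<sigma> x) \<sigma>s))\<rparr>)"

definition sSpec :: "'a csring \<Rightarrow> ('a \<Rightarrow> real, ('a \<Rightarrow> real) \<Rightarrow> 'a sloc) superspace" where
  "sSpec R = \<lparr>topo = points_topology R, sec = sSpec_sec R,
     res = (\<lambda>U V. \<lambda>\<sigma>\<in>carrier (sSpec_sec R U). restrict \<sigma> V)\<rparr>"

definition points_map :: "'a csring \<Rightarrow> 'b csring \<Rightarrow> ('a \<Rightarrow> 'b) \<Rightarrow> ('b \<Rightarrow> real) \<Rightarrow> 'a \<Rightarrow> real" where
  "points_map R S \<phi> = (\<lambda>y\<in>points S. compose (even_part R) y \<phi>)"

definition localized_hom ::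
    "'a csring \<Rightarrow> 'b csring \<Rightarrow> ('a \<Rightarrow> 'b) \<Rightarrow> ('b \<Rightarrow> real) \<Rightarrow> 'a sloc \<Rightarrow> 'b sloc" where
  "localized_hom R S \<phi> y = (let x = points_map R S \<phi> y in
     THE \<psi>. \<psi> \<in> csring_hom (loc_at R x) (loc_at S y) \<and>
       (\<forall>a\<in>carrier R. \<psi> (loc_at_map R x a) = loc_at_map S y (\<phi> a)))"

definition sSpec_map ::
    "'a csring \<Rightarrow> 'b csring \<Rightarrow> ('a \<Rightarrow> 'b)
      \<Rightarrow> (('b \<Rightarrow> real) \<Rightarrow> ('a \<Rightarrow> real)) \<times>
         (('a \<Rightarrow> real) set \<Rightarrow> (('a \<Rightarrow> real) \<Rightarrow> 'a sloc) \<Rightarrow> (('b \<Rightarrow> real) \<Rightarrow> 'b sloc))" where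
  "sSpec_map R S \<phi> = (points_map R S \<phi>,
     \<lambda>U\<in>{U. openin (points_topology R) U}. \<lambda>\<sigma>\<in>carrier (sSpec_sec R U).
       \<lambda>y\<in>preim (sSpec S) (points_map R S \<phi>) U.
         localized_hom R S \<phi> y (\<sigma> (points_map R S \<phi> y)))"

end

theory Submission
  imports Defs
begin

text \<open>
  A morphism \<open>(f, f\<^sup>#)\<close> from \<open>sSpec S\<close> to \<open>sSpec R\<close> is recovered from its effect on global sections.
  Points are determined because an even element with nonzero value at a point is invertible near
  it, and sections are determined because they are locally given by ring elements.  So everything
  rests on the bijectivity of the map from \<open>S\<close> to the global sections of \<open>sSpec S\<close>.  Injectivity is
  fairness.  For surjectivity, a presentation by \<open>C\<^sup>\<infinity>(R\<^bsup>m|n\<^esup>)\<close> identifies the points of \<open>S\<close> with the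
  common zeros in \<open>R\<^sup>m\<close> of its kernel:  local representatives of a section on neighbourhoods of these
  points, together with \<open>0\<close> on their complement, are glued by a smooth partition of unity on \<open>R\<^sup>m\<close>.
\<close>

section \<open>Smooth functions\<close>

text \<open>\<open>S\<close> has no infinite sums, so the gluing takes place in
  \<open>Cinf_super m n\<close>, where a locally finite sum is again an element. The difficulty is
  to compute the image of such a sum in the localization of \<open>S\<close> at a point y. The map
  into this localization inverts every function that is nonzero at the corresponding point p of R^m;
  multiplying by a cut-off around p and cancelling it shows that the map sees only the germ at p,
  and there the sum is finite. The identification of points with zeros has two halves. Nilpotents
  have value 0 in the reals, so a point of \<open>S\<close> evaluates bodies at some p. Conversely,
  evaluation of bodies at a common zero of the kernel descends to \<open>S\<close> as a ring
  homomorphism, and a separate argument shows that it respects all smooth operations. A point q that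
  is not a common zero is separated by an even kernel element whose body is nonzero at q. This body
  vanishes at every point of \<open>S\<close>, so whatever is chosen near q imposes no condition on
  the glued element.\<close>

lemma pderivs_simps [simp]: "pderivs [] f = f" "pderivs (i # is) f = pderiv_at i (pderivs is f)"
  by (simp_all add: pderivs_def)

lemma Cinf_depends: "f \<in> Cinf n \<Longrightarrow> (\<And>i. i < n \<Longrightarrow> x i = y i) \<Longrightarrow> f x = f y"
  by (simp add: Cinf_def)

lemma Cinf_continuous: "f \<in> Cinf n \<Longrightarrow> continuous_on UNIV f"
  unfolding Cinf_def by (auto dest!: spec[of _ "[]"])

section \<open>Derivatives and closure properties of smooth functions\<close>

lemma Cinf_pderiv:
  assumes f: "f \<in> Cinf n" and i: "i < n"
  shows "pderiv_at i f \<in> Cinf n"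
    and "((\<lambda>t. f (x(i := t))) has_field_derivative pderiv_at i f x) (at (x i))"
proof -
  have "(\<lambda>t. f (x(i := t))) field_differentiable at (x i)"
    using f i unfolding Cinf_def by (auto dest!: spec[of _ "[]"])
  then show "((\<lambda>t. f (x(i := t))) has_field_derivative pderiv_at i f x) (at (x i))"
    by (simp add: pderiv_at_def field_differentiable_derivI)
  \<comment> \<open>The new derivative is the innermost one and \<open>pderivs\<close> folds from
    the right, so it goes to the end of the list; smoothness of the derivative is then smoothness of
    \<open>f\<close> along longer lists.\<close>
  have eq: "pderivs is (pderiv_at i f) = pderivs (is @ [i]) f" for "is"
    by (simp add: pderivs_def)
  have dep: "pderiv_at i f x = pderiv_at i f y" if "\<forall>j<n. x j = y j" for x y
  proof -
    have "f (x(i := t)) = f (y(i := t))" for t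
      by (rule Cinf_depends[OF f]) (use that in auto)
    then show ?thesis using that i by (simp add: pderiv_at_def)
  qed
  have pds: "continuous_on UNIV (pderivs (is @ [i]) f) \<and>
      (\<forall>j<n. \<forall>x. (\<lambda>t. pderivs (is @ [i]) f (x(j := t))) field_differentiable at (x j))"
    if "set is \<subseteq> {..<n}" for "is"
    using f i that unfolding Cinf_def by simp
  show "pderiv_at i f \<in> Cinf n"
    unfolding Cinf_def mem_Collect_eq
  proof (intro conjI allI impI)
    fix "is" assume "set is \<subseteq> {..<n}"
    note pds [OF this, folded eq]
    then show "continuous_on UNIV (pderivs is (pderiv_at i f))"
      "\<And>j x. j < n \<Longrightarrow> (\<lambda>t. pderivs is (pderiv_at i f) (x(j := t))) field_differentiable at (x j)"
      by simp_all
  qed (rule dep)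
qed

text \<open>By induction on the list, all iterated partial derivatives stay in \<open>X\<close>,
  where continuity and differentiability are known. Smoothness of products and composites thus
  follows from first derivatives alone, without formulas for the higher ones.\<close>

lemma Cinf_coinduct:
  assumes "f \<in> X"
    and dep: "\<And>f x y. f \<in> X \<Longrightarrow> (\<And>i. i < n \<Longrightarrow> x i = y i) \<Longrightarrow> f x = f y"
    and cont: "\<And>f. f \<in> X \<Longrightarrow> continuous_on UNIV f"
    and der: "\<And>f i. f \<in> X \<Longrightarrow> i < n \<Longrightarrow>
      \<exists>g\<in>X. \<forall>x. ((\<lambda>t. f (x(i := t))) has_field_derivative g x) (at (x i))"
  shows "f \<in> Cinf n"
proof -
  have pd: "pderiv_at i f \<in> X" if *: "f \<in> X" "i < n" for f i
  proof -
    obtain g where g: "g \<in> X" "\<And>x. ((\<lambda>t. f (x(i := t))) has_field_derivative g x) (at (x i))"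
      using der[OF *] by blast
    have "pderiv_at i f = g" unfolding pderiv_at_def using DERIV_imp_deriv[OF g(2)] by auto
    with g show ?thesis by simp
  qed
  have pds: "pderivs is f \<in> X" if "set is \<subseteq> {..<n}" for "is"
    using that by (induction "is") (auto simp: \<open>f \<in> X\<close> pd)
  show ?thesis
    unfolding Cinf_def
  proof (intro CollectI conjI allI impI)
    fix "is" i x assume *: "set is \<subseteq> {..<n}" "i < n"
    show "(\<lambda>t. pderivs is f (x(i := t))) field_differentiable at (x i)"
      using der[OF pds[OF *(1)] *(2)] by (auto simp: field_differentiable_def)
  qed (use dep[OF \<open>f \<in> X\<close>] cont[OF pds] in blast)+
qed

text \<open>
  Partial derivatives do not leave this set, so \<open>Cinf_coinduct\<close> applies to it.  The chain rule is only
  needed for outer functions of one variable.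
\<close>

inductive_set Cinf_closure :: "nat \<Rightarrow> ((nat \<Rightarrow> real) \<Rightarrow> real) set" for n where
  base: "f \<in> Cinf n \<Longrightarrow> f \<in> Cinf_closure n"
| comp: "\<lbrakk>f \<in> Cinf n; \<And>k x. (h k has_field_derivative h (Suc k) (f x)) (at (f x))\<rbrakk>
    \<Longrightarrow> (\<lambda>x. h (k::nat) (f x)) \<in> Cinf_closure n"
| add: "\<lbrakk>f \<in> Cinf_closure n; g \<in> Cinf_closure n\<rbrakk> \<Longrightarrow> (\<lambda>x. f x + g x) \<in> Cinf_closure n"
| mult: "\<lbrakk>f \<in> Cinf_closure n; g \<in> Cinf_closure n\<rbrakk> \<Longrightarrow> (\<lambda>x. f x * g x) \<in> Cinf_closure n"

lemma Cinf_closure_subset: assumes "f \<in> Cinf_closure n" shows "f \<in> Cinf n"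
proof (rule Cinf_coinduct[OF assms])
  fix f and x y :: "nat \<Rightarrow> real"
  assume "f \<in> Cinf_closure n" "\<And>i. i < n \<Longrightarrow> x i = y i"
  then show "f x = f y"
  proof (induction f)
    case (base f) then show ?case using Cinf_depends[of f n x y] by simp
  next
    case (comp f h k)
    then show ?case using Cinf_depends[of f n x y] by simp
  qed simp_all
next
  fix f assume "f \<in> Cinf_closure n"
  then show "continuous_on UNIV f"
  proof (induction f)
    case (comp f h k)
    \<comment> \<open>The functions \<open>h k\<close> are differentiable only at values of
      \<open>f\<close>. This suffices, and it admits outer functions such as 1/t when
      \<open>f\<close> has no zeros.\<close>
    have "continuous_on (range f) (h k)"
      using comp(2) by (intro continuous_at_imp_continuous_on) (auto intro: DERIV_isCont)
    then show ?case by (rule continuous_on_compose2[OF _ Cinf_continuous[OF comp(1)]]) auto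
  qed (rule Cinf_continuous continuous_on_add continuous_on_mult, assumption+)+
next
  fix f i assume "f \<in> Cinf_closure n" "i < n"
  then show "\<exists>g\<in>Cinf_closure n. \<forall>x. ((\<lambda>t. f (x(i := t))) has_field_derivative g x) (at (x i))"
  proof (induction f)
    case (base f)
    then show ?case
      by (intro bexI[of _ "pderiv_at i f"] allI Cinf_pderiv(2) Cinf_closure.base Cinf_pderiv(1))
  next
    case (comp f h k)
    note d = Cinf_pderiv(2)[OF comp(1,3)]
    have "((\<lambda>t. h k (f (x(i := t)))) has_field_derivative h (Suc k) (f x) * pderiv_at i f x) (at (x i))" for x
      using DERIV_chain2[OF _ d, of "h k" "h (Suc k) (f x)" x] comp(2)[of k x] by simp
    moreover have "(\<lambda>x. h (Suc k) (f x) * pderiv_at i f x) \<in> Cinf_closure n"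
      by (rule Cinf_closure.mult[OF Cinf_closure.comp[where h = h, OF comp(1,2)] Cinf_closure.base[OF Cinf_pderiv(1)[OF comp(1,3)]]])
    ultimately show ?case by (intro bexI[of _ "\<lambda>x. h (Suc k) (f x) * pderiv_at i f x"] allI)
  next
    case (add f g)
    then obtain f' g' where "f' \<in> Cinf_closure n" "g' \<in> Cinf_closure n"
      "\<And>x. ((\<lambda>t. f (x(i := t))) has_field_derivative f' x) (at (x i))"
      "\<And>x. ((\<lambda>t. g (x(i := t))) has_field_derivative g' x) (at (x i))" by blast
    then show ?case
      by (intro bexI[of _ "\<lambda>x. f' x + g' x"] ballI allI DERIV_add Cinf_closure.add)
  next
    case (mult f g)
    then obtain f' g' where *: "f' \<in> Cinf_closure n" "g' \<in> Cinf_closure n"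
      "\<And>x. ((\<lambda>t. f (x(i := t))) has_field_derivative f' x) (at (x i))"
      "\<And>x. ((\<lambda>t. g (x(i := t))) has_field_derivative g' x) (at (x i))" by blast
    have "((\<lambda>t. f (x(i := t)) * g (x(i := t))) has_field_derivative f' x * g x + g' x * f x) (at (x i))" for x
      using DERIV_mult[OF *(3)[of x] *(4)[of x]] by simp
    then show ?case
      using *(1,2) mult(1,2)
      by (intro bexI[of _ "\<lambda>x. f' x * g x + g' x * f x"] ballI allI Cinf_closure.add Cinf_closure.mult)
  qed
qed

lemma Cinf_const [simp]: "(\<lambda>_. r) \<in> Cinf n"
  by (intro Cinf_polyI)
lemma Cinf_proj: "i < n \<Longrightarrow> (\<lambda>x. x i) \<in> Cinf n"
  by (intro Cinf_polyI)
lemma Cinf_add: "\<lbrakk>f \<in> Cinf n; g \<in> Cinf n\<rbrakk> \<Longrightarrow> (\<lambda>x. f x + g x) \<in> Cinf n"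
  by (rule Cinf_closure_subset[OF Cinf_closure.add]) (rule Cinf_closure.base, assumption)+
lemma Cinf_mult: "\<lbrakk>f \<in> Cinf n; g \<in> Cinf n\<rbrakk> \<Longrightarrow> (\<lambda>x. f x * g x) \<in> Cinf n"
  by (rule Cinf_closure_subset[OF Cinf_closure.mult]) (rule Cinf_closure.base, assumption)+
lemma Cinf_diff: "\<lbrakk>f \<in> Cinf n; g \<in> Cinf n\<rbrakk> \<Longrightarrow> (\<lambda>x. f x - g x) \<in> Cinf n"
  using Cinf_add[of f n "\<lambda>x. (- 1) * g x"] Cinf_mult[of "\<lambda>_. -1" n g] by simp
lemma Cinf_power: "f \<in> Cinf n \<Longrightarrow> (\<lambda>x. f x ^ k) \<in> Cinf n"
  by (induction k) (auto intro: Cinf_mult)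
lemma Cinf_sum: "(\<And>a. a \<in> A \<Longrightarrow> f a \<in> Cinf n) \<Longrightarrow> (\<lambda>x. \<Sum>a\<in>A. f a x) \<in> Cinf n"
  by (induction A rule: infinite_finite_induct) (auto intro: Cinf_add)

lemma Cinf_comp:
  assumes "f \<in> Cinf n" "\<And>k x. (h k has_field_derivative h (Suc k) (f x)) (at (f x))"
  shows "(\<lambda>x. h 0 (f x)) \<in> Cinf n"
  using Cinf_closure_subset[OF Cinf_closure.comp[of f n h 0]] assms by blast

lemma Cinf_inverse:
  assumes "f \<in> Cinf n" "\<And>x. f x \<noteq> 0" shows "(\<lambda>x. 1 / f x) \<in> Cinf n"
proof -
  \<comment> \<open>These are the successive derivatives of 1/t, with 1/t itself at
    \<open>k = 0\<close>.\<close>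
  have "((\<lambda>t. (- 1) ^ k * fact k * inverse t ^ Suc k) has_field_derivative
      (- 1) ^ Suc k * fact (Suc k) * inverse t ^ Suc (Suc k)) (at t)" if "t \<noteq> 0" for k and t :: real
    using that DERIV_cmult[OF DERIV_power[OF DERIV_inverse[OF that], of "Suc k"], of "(- 1) ^ k * fact k"]
    by (simp add: algebra_simps)
  from Cinf_comp[where h = "\<lambda>k t. (- 1) ^ k * fact k * inverse t ^ Suc k", OF assms(1) this[OF assms(2)]]
  show ?thesis by (simp add: inverse_eq_divide)
qed

text \<open>A partial derivative at \<open>z\<close> depends only on values near \<open>z\<close>,
  so the functions that locally agree with smooth ones are closed under partial derivatives and
  \<open>Cinf_coinduct\<close> applies to them.\<close>

lemma Cinf_local:
  assumes "\<And>q. \<exists>N h. open N \<and> q \<in> N \<and> h \<in> Cinf n \<and> (\<forall>z\<in>N. f z = h z)"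
    and "\<And>x y. (\<And>i. i < n \<Longrightarrow> x i = y i) \<Longrightarrow> f x = f y"
  shows "f \<in> Cinf n"
proof -
  let ?X = "{f. (\<forall>q. \<exists>N h. open N \<and> q \<in> N \<and> h \<in> Cinf n \<and> (\<forall>z\<in>N. f z = h z)) \<and>
    (\<forall>x y. (\<forall>i<n. x i = y i) \<longrightarrow> f x = f y)}"
  have "f \<in> ?X" using assms by blast
  then show ?thesis
  proof (rule Cinf_coinduct)
    fix f and x y :: "nat \<Rightarrow> real" assume "f \<in> ?X" "\<And>i. i < n \<Longrightarrow> x i = y i"
    then show "f x = f y" by blast
  next
    fix f assume continuous: "f \<in> ?X"
    show "continuous_on UNIV f"
    proof (rule continuous_at_imp_continuous_on, rule ballI)
      fix q
      obtain N h where N: "open N" "q \<in> N" "h \<in> Cinf n" "\<forall>z\<in>N. f z = h z" using continuous by blast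
      have "isCont h q" using Cinf_continuous[OF N(3)] by (simp add: continuous_on_eq_continuous_at)
      moreover have "\<forall>\<^sub>F z in nhds q. f z = h z"
        using N by (auto simp: eventually_nhds)
      ultimately show "isCont f q" by (simp add: isCont_cong)
    qed
  next
    fix f i assume deriv: "f \<in> ?X" "i < n"
    have ex: "\<exists>N h. open N \<and> q \<in> N \<and> h \<in> Cinf n \<and> (\<forall>z\<in>N. pderiv_at i f z = pderiv_at i h z \<and>
        ((\<lambda>t. f (z(i := t))) has_field_derivative pderiv_at i f z) (at (z i)))" for q
    proof -
      obtain N h where N: "open N" "q \<in> N" "h \<in> Cinf n" "\<forall>z\<in>N. f z = h z" using deriv by blast
      have "((\<lambda>t. f (z(i := t))) has_field_derivative pderiv_at i h z) (at (z i))" if "z \<in> N" for z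
      proof (rule has_field_derivative_transform_within_open[OF Cinf_pderiv(2)[OF N(3) deriv(2)]])
        \<comment> \<open>The line through \<open>z\<close> in direction \<open>i\<close> is
          continuous for the product topology, so it stays in \<open>N\<close> for \<open>t\<close>
          near \<open>z i\<close>, where \<open>f\<close> may be replaced by
          \<open>h\<close>.\<close>
        have "continuous_on UNIV (\<lambda>t. z(i := t))"
        proof (rule continuous_on_coordinatewise_then_product)
          show "continuous_on UNIV (\<lambda>t. (z(i := t)) j)" for j
            by (cases "j = i") (simp_all add: continuous_on_id)
        qed
        then show "open ((\<lambda>t. z(i := t)) -` N)" using N(1) by (simp add: open_vimage)
      qed (use that N in auto)
      moreover from this have "pderiv_at i f z = pderiv_at i h z" if "z \<in> N" for z
        using DERIV_imp_deriv that unfolding pderiv_at_def[of i f] by blast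
      ultimately show ?thesis using N(1-3) by (intro exI[of _ N] exI[of _ h]) auto
    qed
    have "pderiv_at i f x = pderiv_at i f y" if "\<forall>j<n. x j = y j" for x y
    proof -
      have "f (x(i := t)) = f (y(i := t))" for t
      proof -
        have "\<forall>j<n. (x(i := t)) j = (y(i := t)) j" using that by simp
        then show ?thesis using deriv(1) by blast
      qed
      then show ?thesis using that deriv(2) by (simp add: pderiv_at_def)
    qed
    moreover have "\<exists>N h. open N \<and> q \<in> N \<and> h \<in> Cinf n \<and> (\<forall>z\<in>N. pderiv_at i f z = h z)" for q
      using ex[of q] Cinf_pderiv(1)[OF _ deriv(2)] by meson
    ultimately have "pderiv_at i f \<in> ?X" by blast
    then show "\<exists>g\<in>?X. \<forall>x. ((\<lambda>t. f (x(i := t))) has_field_derivative g x) (at (x i))"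
      using ex by blast
  qed
qed

section \<open>A flat function as the source of all cut-offs\<close>

definition bump :: "real \<Rightarrow> real" where
  "bump t = (if t > 0 then exp (- (1 / t)) else 0)"

lemma bump_simps: "bump t \<ge> 0" "bump t > 0 \<longleftrightarrow> t > 0" "bump t = 0 \<longleftrightarrow> t \<le> 0" "bump t \<noteq> 0 \<longleftrightarrow> t > 0"
  by (auto simp: bump_def)

text \<open>The exponent \<open>k\<close> is arbitrary so that the factor \<open>s\<close> split off
  by \<open>pCons\<close> can be absorbed into the power.\<close>

lemma poly_exp_tendsto_0: "((\<lambda>s. s ^ k * poly p s * exp (- s)) \<longlongrightarrow> (0::real)) at_top"
proof (induction p arbitrary: k)
  case (pCons a p)
  have "((\<lambda>s. a * (s ^ k * exp (- s)) + s ^ Suc k * poly p s * exp (- s)) \<longlongrightarrow> a * 0 + 0) at_top"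
    using tendsto_power_div_exp_0[of k]
    by (intro tendsto_intros pCons) (simp add: exp_minus field_simps)
  then show ?case by (simp add: algebra_simps)
qed simp

text \<open>For t > 0 the k-th derivative of exp(-1/t) is \<open>poly (bump_poly k) (1 / t)\<close>
  times exp(-1/t): with s = 1/t, differentiating p(s) exp(-s) by t gives s^2 (p(s) - p'(s)) exp(-s),
  which is the recursion.\<close>

primrec bump_poly :: "nat \<Rightarrow> real poly" where
  "bump_poly 0 = 1"
| "bump_poly (Suc k) = monom 1 2 * (bump_poly k - pderiv (bump_poly k))"

lemma Cinf_bump: assumes "f \<in> Cinf n" shows "(\<lambda>x. bump (f x)) \<in> Cinf n"
proof -
  define h where "h k t = (if t > 0 then poly (bump_poly k) (1 / t) * exp (- (1 / t)) else 0)" for k and t :: real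
  have pos: "(h k has_field_derivative h (Suc k) t) (at t)" if "t > 0" for k t
  proof (rule has_field_derivative_transform_within_open)
    show "((\<lambda>t. poly (bump_poly k) (1 / t) * exp (- (1 / t))) has_field_derivative h (Suc k) t) (at t)"
      using that
      by (auto intro!: derivative_eq_intros DERIV_chain2[OF poly_DERIV] simp: h_def poly_monom power2_eq_square field_simps)
  qed (use that in \<open>auto simp: h_def intro: open_greaterThan[of 0]\<close>)
  have neg: "(h k has_field_derivative h (Suc k) t) (at t)" if "t < 0" for k t
  proof (rule has_field_derivative_transform_within_open)
    show "((\<lambda>t. 0) has_field_derivative h (Suc k) t) (at t)"
      using that by (auto simp: h_def)
  qed (use that in \<open>auto simp: h_def intro: open_lessThan[of 0]\<close>)
  have zero: "(h k has_field_derivative h (Suc k) 0) (at 0)" for k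
  proof -
    \<comment> \<open>As \<open>h k 0 = 0\<close>, the difference quotient at 0 is
      \<open>h k t / t\<close>. For t > 0 and s = 1/t it equals s p(s) exp(-s), whence the exponent
      1.\<close>
    have "((\<lambda>s. s ^ 1 * poly (bump_poly k) s * exp (- s)) \<longlongrightarrow> 0) at_top"
      by (rule poly_exp_tendsto_0)
    then have "((\<lambda>t. h k t / t) \<longlongrightarrow> 0) (at_right 0)"
      unfolding filterlim_at_right_to_top
      by (rule Lim_transform_eventually)
        (auto simp: h_def field_simps eventually_at_top_linorder intro!: exI[of _ 1])
    moreover have "((\<lambda>t. h k t / t) \<longlongrightarrow> 0) (at_left 0)"
      by (rule Lim_transform_eventually[OF tendsto_const])
        (auto simp: h_def eventually_at_left_field intro: exI[of _ "-1"])
    ultimately have "((\<lambda>t. h k t / t) \<longlongrightarrow> 0) (at 0)"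
      by (simp add: filterlim_at_split)
    then show ?thesis by (simp add: has_field_derivative_iff h_def)
  qed
  have "(h k has_field_derivative h (Suc k) t) (at t)" for k t
    using pos neg zero by (metis linorder_less_linear)
  from Cinf_comp[where h = h, OF assms this] show ?thesis
    by (simp add: h_def bump_def cong: if_cong)
qed

section \<open>Gluing on R(m|n)\<close>

definition body_fun :: "((nat \<Rightarrow> real) \<Rightarrow> real) \<Rightarrow> grassmann" where
  "body_fun f = (\<lambda>K x. if K = {} then f x else 0)"

lemma Cinf_super_simps:
  "F \<in> carrier (Cinf_super m n) \<longleftrightarrow> (\<forall>I. F I \<in> Cinf m) \<and> (\<forall>I. \<not> I \<subseteq> {..<n} \<longrightarrow> F I = (\<lambda>_. 0))"
  "F \<otimes>\<^bsub>Cinf_super m n\<^esub> G = gmult F G"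
  "\<one>\<^bsub>Cinf_super m n\<^esub> = gone"
  "\<zero>\<^bsub>Cinf_super m n\<^esub> = (\<lambda>K x. 0)"
  "F \<oplus>\<^bsub>Cinf_super m n\<^esub> G = (\<lambda>K x. F K x + G K x)"
  "F \<in> even_part (Cinf_super m n) \<longleftrightarrow> F \<in> carrier (Cinf_super m n) \<and> (\<forall>I. odd (card I) \<longrightarrow> F I = (\<lambda>_. 0))"
  "F \<in> odd_part (Cinf_super m n) \<longleftrightarrow> F \<in> carrier (Cinf_super m n) \<and> (\<forall>I. even (card I) \<longrightarrow> F I = (\<lambda>_. 0))"
  "sop (Cinf_super m n) = gtaylor n"
  by (simp_all add: Cinf_super_def Let_def)

lemma body_fun_closed: "f \<in> Cinf m \<Longrightarrow> body_fun f \<in> carrier (Cinf_super m n)"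
  and body_fun_even: "f \<in> Cinf m \<Longrightarrow> body_fun f \<in> even_part (Cinf_super m n)"
proof -
  assume f: "f \<in> Cinf m"
  then have 1: "body_fun f I \<in> Cinf m" for I
    by (cases "I = {}") (auto simp: body_fun_def)
  have 2: "body_fun f I = (\<lambda>_. 0)" if "I \<noteq> {}" for I
    using that by (simp add: body_fun_def)
  show "body_fun f \<in> carrier (Cinf_super m n)" "body_fun f \<in> even_part (Cinf_super m n)"
    unfolding Cinf_super_simps by (intro conjI allI impI 1 2; auto)+
qed

lemma gmult_closed:
  assumes "F \<in> carrier (Cinf_super m n)" "G \<in> carrier (Cinf_super m n)"
  shows "gmult F G \<in> carrier (Cinf_super m n)"
  unfolding Cinf_super_simps(1)
proof (intro conjI allI impI)
  show "gmult F G I \<in> Cinf m" for I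
    using assms unfolding gmult_def Cinf_super_simps(1) by (intro Cinf_sum Cinf_mult) auto
  fix I assume I: "\<not> I \<subseteq> {..<n}"
  have "reorder_sign J (I - J) * F J x * G (I - J) x = 0" if "J \<in> Pow I" for J x
  proof -
    show ?thesis
    proof (cases "J \<subseteq> {..<n}")
      case True
      then have "G (I - J) = (\<lambda>_. 0)" using I assms(2) unfolding Cinf_super_simps(1) by blast
      then show ?thesis by simp
    next
      case False
      then have "F J = (\<lambda>_. 0)" using assms(1) unfolding Cinf_super_simps(1) by blast
      then show ?thesis by simp
    qed
  qed
  then show "gmult F G I = (\<lambda>_. 0)" unfolding gmult_def by (intro ext sum.neutral) blast
qed

lemma gmult_body_fun:
  assumes "G \<in> carrier (Cinf_super m n)"
  shows "gmult (body_fun f) G = (\<lambda>K x. f x * G K x)"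
proof (intro ext)
  fix K x
  show "gmult (body_fun f) G K x = f x * G K x"
  proof (cases "finite K")
    case True
    have "gmult (body_fun f) G K x = (\<Sum>I\<in>Pow K. if I = {} then f x * G K x else 0)"
      unfolding gmult_def by (rule sum.cong) (auto simp: body_fun_def reorder_sign_def)
    then show ?thesis using True by simp
  next
    \<comment> \<open>A sum over an infinite set is 0 by convention. The right-hand side is 0 as
      well, since \<open>G K\<close> vanishes unless \<open>K\<close> is contained in the finite set
      \<open>{..<n}\<close>.\<close>
    case False
    then have "G K = (\<lambda>_. 0)" using assms finite_subset[of K "{..<n}"] by (auto simp: Cinf_super_simps)
    then show ?thesis using False by (simp add: gmult_def)
  qed
qed

lemma body_fun_one: "body_fun (\<lambda>_. 1) = \<one>\<^bsub>Cinf_super m n\<^esub>"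
  by (auto simp: body_fun_def Cinf_super_simps gone_def)

lemma Cinf_super_sum_closed:
  assumes "\<And>a. a \<in> A \<Longrightarrow> w a \<in> Cinf m" "\<And>a. a \<in> A \<Longrightarrow> D a \<in> carrier (Cinf_super m n)"
  shows "(\<lambda>K x. \<Sum>a\<in>A. w a x * D a K x) \<in> carrier (Cinf_super m n)"
  unfolding Cinf_super_simps(1)
proof (intro conjI allI impI)
  show "(\<lambda>x. \<Sum>a\<in>A. w a x * D a I x) \<in> Cinf m" for I
    using assms unfolding Cinf_super_simps(1) by (intro Cinf_sum Cinf_mult) auto
  show "(\<lambda>x. \<Sum>a\<in>A. w a x * D a I x) = (\<lambda>_. 0)" if "\<not> I \<subseteq> {..<n}" for I
    using assms(2) that unfolding Cinf_super_simps(1) by (intro ext sum.neutral) auto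
qed

text \<open>An abstraction of the composite of the presentation of \<open>S\<close> with the
  localization at one of its points: the functions that are nonzero at \<open>p\<close> become
  invertible. This is all that the gluing theorem needs to know about the target.\<close>

locale germ_hom = P: ring P for P :: "('b, 'x) ring_scheme" (structure) +
  fixes m n :: nat and h :: "grassmann \<Rightarrow> 'b" and p :: "nat \<Rightarrow> real"
  assumes hom: "h \<in> ring_hom (Cinf_super m n) P"
    and unit: "\<lbrakk>b \<in> Cinf m; b p \<noteq> 0\<rbrakk> \<Longrightarrow> \<exists>u\<in>carrier P. u \<otimes> h (body_fun b) = \<one>"
begin

lemma h_closed [simp]: "F \<in> carrier (Cinf_super m n) \<Longrightarrow> h F \<in> carrier P"
  by (rule ring_hom_closed[OF hom])

lemma h_mult: "\<lbrakk>F \<in> carrier (Cinf_super m n); G \<in> carrier (Cinf_super m n)\<rbrakk> \<Longrightarrow> h (gmult F G) = h F \<otimes> h G"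
  using ring_hom_mult[OF hom] by (simp add: Cinf_super_simps(2))

lemma h_add: "\<lbrakk>F \<in> carrier (Cinf_super m n); G \<in> carrier (Cinf_super m n)\<rbrakk>
    \<Longrightarrow> h (\<lambda>K x. F K x + G K x) = h F \<oplus> h G"
  using ring_hom_add[OF hom] by (simp add: Cinf_super_simps(5))

lemma h_zero: "h (\<lambda>K x. 0) = \<zero>"
proof -
  have z: "(\<lambda>K x. 0) \<in> carrier (Cinf_super m n)" by (simp add: Cinf_super_simps(1))
  from h_add[OF z z] have "h (\<lambda>K x. 0) = h (\<lambda>K x. 0) \<oplus> h (\<lambda>K x. 0)" by simp
  with h_closed[OF z] show ?thesis by (metis P.add.l_cancel_one')
qed

text \<open>The image of \<open>body_fun b\<close> has a left inverse and can be cancelled. With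
  \<open>b\<close> a cut-off supported near \<open>p\<close>, elements that agree near
  \<open>p\<close> have equal images.\<close>

lemma h_cong:
  assumes b: "b \<in> Cinf m" "b p \<noteq> 0" and F: "F \<in> carrier (Cinf_super m n)" "G \<in> carrier (Cinf_super m n)"
    and eq: "\<And>K x. b x * F K x = b x * G K x"
  shows "h F = h G"
proof -
  obtain u where u: "u \<in> carrier P" "u \<otimes> h (body_fun b) = \<one>" using unit[OF b] by blast
  note bc [simp] = body_fun_closed[OF b(1), of n]
  have "h (body_fun b) \<otimes> h F = h (body_fun b) \<otimes> h G"
    using F by (simp add: h_mult[symmetric] gmult_body_fun eq)
  then have "(u \<otimes> h (body_fun b)) \<otimes> h F = (u \<otimes> h (body_fun b)) \<otimes> h G"
    using u(1) F by (simp only: P.m_assoc h_closed bc)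
  then show ?thesis using u F by simp
qed

text \<open>The comparison of \<open>h (D a)\<close> with \<open>s\<close> is made only after
  multiplication by the weight. This lets in the indices whose weight vanishes near
  \<open>p\<close>, where \<open>D a\<close> is arbitrary.\<close>

lemma h_sum:
  assumes "finite A" "s \<in> carrier P"
    and "\<And>a. a \<in> A \<Longrightarrow> w a \<in> Cinf m" "\<And>a. a \<in> A \<Longrightarrow> D a \<in> carrier (Cinf_super m n)"
    and "\<And>a. a \<in> A \<Longrightarrow> h (body_fun (w a)) \<otimes> h (D a) = h (body_fun (w a)) \<otimes> s"
  shows "h (\<lambda>K x. \<Sum>a\<in>A. w a x * D a K x) = h (body_fun (\<lambda>x. \<Sum>a\<in>A. w a x)) \<otimes> s"
  using assms
proof (induction A)
  case empty
  have "body_fun (\<lambda>x. 0) = (\<lambda>K x. 0)" by (auto simp: body_fun_def)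
  then show ?case using empty by (simp add: h_zero)
next
  case (insert a A)
  have b: "body_fun (w a) \<in> carrier (Cinf_super m n)" "body_fun (\<lambda>x. \<Sum>a\<in>A. w a x) \<in> carrier (Cinf_super m n)"
    using insert by (auto intro!: body_fun_closed Cinf_sum)
  have D: "D a \<in> carrier (Cinf_super m n)" using insert by simp
  have g: "(\<lambda>K x. w a x * D a K x) = gmult (body_fun (w a)) (D a)" by (simp add: gmult_body_fun[OF D])
  have c: "(\<lambda>K x. \<Sum>a\<in>A. w a x * D a K x) \<in> carrier (Cinf_super m n)"
    using insert by (intro Cinf_super_sum_closed) auto
  have e: "body_fun (\<lambda>x. \<Sum>a\<in>insert a A. w a x)
      = (\<lambda>K x. body_fun (w a) K x + body_fun (\<lambda>x. \<Sum>a\<in>A. w a x) K x)"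
    using insert.hyps by (auto simp: body_fun_def fun_eq_iff)
  have "h (\<lambda>K x. \<Sum>a\<in>insert a A. w a x * D a K x)
      = h (\<lambda>K x. w a x * D a K x) \<oplus> h (\<lambda>K x. \<Sum>a\<in>A. w a x * D a K x)"
    using insert.hyps by (simp add: h_add[symmetric] c g gmult_closed b D) (simp add: gmult_body_fun[OF D])
  also have "\<dots> = h (body_fun (w a)) \<otimes> s \<oplus> h (body_fun (\<lambda>x. \<Sum>a\<in>A. w a x)) \<otimes> s"
    using insert.IH insert.prems by (simp add: g h_mult b D)
  also have "\<dots> = h (body_fun (\<lambda>x. \<Sum>a\<in>insert a A. w a x)) \<otimes> s"
    unfolding e using insert.prems(1) by (simp add: h_add b P.l_distr)
  finally show ?case .
qed

end

section \<open>Exhaustion of R^m by balls and locally finite sums\<close>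

definition sq_norm :: "nat \<Rightarrow> (nat \<Rightarrow> real) \<Rightarrow> real" where
  "sq_norm m x = (\<Sum>i<m. (x i)\<^sup>2)"

lemma sq_norm_Cinf: "sq_norm m \<in> Cinf m"
  unfolding sq_norm_def by (intro Cinf_sum Cinf_power Cinf_proj) auto

text \<open>At \<open>x\<close> only indices \<open>j\<close> below \<open>sq_norm m x + 1\<close>
  contribute. The bound on the left varies with \<open>x\<close>, whereas \<open>M\<close> serves a
  whole ball and leaves one fixed finite sum there.\<close>

lemma locally_finite_sum:
  assumes "\<And>j x. sq_norm m x + 1 \<le> real j \<Longrightarrow> f j x = (0::real)" "sq_norm m x \<le> real M"
  shows "(\<Sum>j<nat \<lceil>sq_norm m x\<rceil> + 1. f j x) = (\<Sum>j<Suc M. f j x)"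
proof (rule sum.mono_neutral_left)
  have "nat \<lceil>sq_norm m x\<rceil> \<le> M" using assms(2) by linarith
  then show "{..<nat \<lceil>sq_norm m x\<rceil> + 1} \<subseteq> {..<Suc M}" by auto
  show "\<forall>j\<in>{..<Suc M} - {..<nat \<lceil>sq_norm m x\<rceil> + 1}. f j x = 0"
  proof
    fix j assume "j \<in> {..<Suc M} - {..<nat \<lceil>sq_norm m x\<rceil> + 1}"
    then have "sq_norm m x + 1 \<le> real j" by simp linarith
    then show "f j x = 0" by (rule assms(1))
  qed
qed simp

text \<open>On the open ball of squared radius \<open>M\<close> around the origin, with
  \<open>M\<close> chosen to contain \<open>q\<close>, the number of terms can be made constant;
  smoothness is a local property.\<close>

lemma Cinf_locally_finite_sum:
  assumes f: "\<And>j. f j \<in> Cinf m" and z: "\<And>j x. sq_norm m x + 1 \<le> real j \<Longrightarrow> f j x = 0"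
  shows "(\<lambda>x. \<Sum>j<nat \<lceil>sq_norm m x\<rceil> + 1. f j x) \<in> Cinf m"
proof (rule Cinf_local)
  fix q
  define M where "M = nat \<lceil>sq_norm m q\<rceil> + 1"
  have "open {x. sq_norm m x < real M}"
    using Cinf_continuous[OF sq_norm_Cinf] by (intro open_Collect_less) auto
  moreover have "sq_norm m q < real M" unfolding M_def by linarith
  moreover have "(\<lambda>x. \<Sum>j<Suc M. f j x) \<in> Cinf m" by (intro Cinf_sum f)
  ultimately show "\<exists>N h. open N \<and> q \<in> N \<and> h \<in> Cinf m \<and> (\<forall>x\<in>N. (\<Sum>j<nat \<lceil>sq_norm m x\<rceil> + 1. f j x) = h x)"
    using locally_finite_sum[where f = f, OF z]
    by (intro exI[of _ "{x. sq_norm m x < real M}"] exI[of _ "\<lambda>x. \<Sum>j<Suc M. f j x"]) auto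
next
  fix x y :: "nat \<Rightarrow> real" assume xy: "\<And>i. i < m \<Longrightarrow> x i = y i"
  then have "sq_norm m x = sq_norm m y" by (simp add: sq_norm_def)
  moreover have "f j x = f j y" for j using Cinf_depends[OF f xy] .
  ultimately show "(\<Sum>j<nat \<lceil>sq_norm m x\<rceil> + 1. f j x) = (\<Sum>j<nat \<lceil>sq_norm m y\<rceil> + 1. f j y)" by simp
qed

text \<open>Balls are not compact in this function type, since the coordinates from \<open>m\<close>
  on are free. A compact cube with those coordinates fixed to 0 is covered instead; truncating
  \<open>x\<close> moves it into the cube without changing any \<open>b q\<close>.\<close>

lemma compact_cover_sq_norm:
  assumes b: "\<And>q. b q \<in> Cinf m" "\<And>q. b q q > 0"
  shows "\<exists>Q. finite Q \<and> (\<forall>x. sq_norm m x \<le> r \<longrightarrow> (\<exists>q\<in>Q. b q x > 0))"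
proof -
  \<comment> \<open>The bound \<open>\<bar>r\<bar> + 1\<close> avoids a square root: its square is
    at least \<open>r\<close>, also for negative \<open>r\<close>.\<close>
  define K where "K = PiE UNIV (\<lambda>i. if i < m then {- (\<bar>r\<bar> + 1) .. \<bar>r\<bar> + 1} else {0::real})"
  have "compactin (product_topology (\<lambda>i. euclidean) UNIV) K"
    unfolding K_def by (subst compactin_PiE) auto
  then have K: "compact K" by (simp add: euclidean_product_topology)
  have "\<exists>Q\<subseteq>UNIV. finite Q \<and> K \<subseteq> (\<Union>q\<in>Q. {x. b q x > 0})"
  proof (rule compactE_image[OF K])
    show "open {x. 0 < b q x}" for q
      using Cinf_continuous[OF b(1)] by (intro open_Collect_less) auto
  qed (use b(2) in auto)
  then obtain Q where Q: "finite Q" "K \<subseteq> (\<Union>q\<in>Q. {x. b q x > 0})" by blast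
  have "\<exists>q\<in>Q. b q x > 0" if x: "sq_norm m x \<le> r" for x
  proof -
    define x' where "x' i = (if i < m then x i else 0)" for i
    have "- (\<bar>r\<bar> + 1) \<le> x i \<and> x i \<le> \<bar>r\<bar> + 1" if "i < m" for i
    proof -
      have "(x i)\<^sup>2 \<le> sq_norm m x"
        unfolding sq_norm_def using that by (intro member_le_sum) auto
      also have "\<dots> \<le> (\<bar>r\<bar> + 1)\<^sup>2" using x abs_ge_self[of r] zero_le_power2[of "\<bar>r\<bar>"] abs_ge_zero[of r]
        unfolding power2_sum one_power2 mult_1_right by linarith
      finally show ?thesis using abs_le_square_iff[of "x i" "\<bar>r\<bar> + 1"] by auto
    qed
    then have "x' \<in> K" unfolding K_def x'_def by auto
    then obtain q where "q \<in> Q" "b q x' > 0" using Q by auto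
    moreover have "b q x = b q x'" for q using b(1) by (rule Cinf_depends) (simp add: x'_def)
    ultimately show ?thesis by auto
  qed
  with Q(1) show ?thesis by blast
qed

text \<open>
  The weights \<open>w\<close> below form a locally finite partition of unity, built from shells of the exhaustion by balls.
  Every weight whose germ at \<open>p\<close> does not vanish belongs to a \<open>q\<close> with \<open>B q p \<noteq> 0\<close>.
\<close>

theorem Cinf_super_glue:
  fixes B :: "(nat \<Rightarrow> real) \<Rightarrow> (nat \<Rightarrow> real) \<Rightarrow> real"
  assumes B: "\<And>q. B q \<in> Cinf m" "\<And>q. B q q \<noteq> 0" and C: "\<And>q. C q \<in> carrier (Cinf_super m n)"
  shows "\<exists>F\<in>carrier (Cinf_super m n). \<forall>(P :: ('b, 'x) ring_scheme) h p s. germ_hom P m n h p \<longrightarrow>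
    s \<in> carrier P \<longrightarrow> (\<forall>q. B q p \<noteq> 0 \<longrightarrow> h (C q) = s) \<longrightarrow> h F = s"
proof -
  \<comment> \<open>The threshold at half of \<open>(B q q)\<^sup>2\<close> keeps the support of
    \<open>b q\<close> away from the zeros of \<open>B q\<close>: around such a zero,
    \<open>b q\<close> vanishes on a whole neighbourhood and not just at the zero.\<close>
  define b where "b q x = bump ((B q x)\<^sup>2 - (B q q)\<^sup>2 / 2)" for q x
  \<comment> \<open>Nonzero exactly on the shell where \<open>sq_norm m x\<close> lies strictly
    between j - 1 and j + 2. The shells overlap, so the one with j the integer part of
    \<open>sq_norm m x\<close> contains \<open>x\<close> in its interior.\<close>
  define cut where "cut j x = bump (sq_norm m x - (real j - 1)) * bump (real j + 2 - sq_norm m x)" for j x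
  have b_Cinf: "b q \<in> Cinf m" for q
    unfolding b_def by (intro Cinf_bump Cinf_diff Cinf_power B Cinf_const)
  have b_pos: "b q q > 0" for q using B(2)[of q] by (simp add: b_def bump_simps)
  have b_nonneg: "b q x \<ge> 0" for q x by (simp add: b_def bump_simps)
  have chi_Cinf: "cut j \<in> Cinf m" for j
    unfolding cut_def by (intro Cinf_mult Cinf_bump Cinf_diff sq_norm_Cinf Cinf_const)
  have chi_nonneg: "cut j x \<ge> 0" for j x by (simp add: cut_def bump_simps)
  have chi_zero: "cut j x = 0" if "sq_norm m x + 1 \<le> real j" for j x
    using that by (simp add: cut_def bump_simps)
  \<comment> \<open>Squared radius j + 1 is enough, because the shell used at \<open>x\<close> to
    show \<open>G x > 0\<close> is the one with j the integer part of
    \<open>sq_norm m x\<close>.\<close>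
  have "\<forall>j. \<exists>Q. finite Q \<and> (\<forall>x. sq_norm m x \<le> real j + 1 \<longrightarrow> (\<exists>q\<in>Q. b q x > 0))"
    by (intro allI compact_cover_sq_norm b_Cinf b_pos)
  then obtain Q where Q: "\<And>j. finite (Q j)" "\<And>j x. sq_norm m x \<le> real j + 1 \<Longrightarrow> \<exists>q\<in>Q j. b q x > 0"
    unfolding choice_iff by blast
  define N where "N x = nat \<lceil>sq_norm m x\<rceil> + 1" for x
  define G where "G x = (\<Sum>j<N x. cut j x * (\<Sum>q\<in>Q j. b q x))" for x
  have G_Cinf: "G \<in> Cinf m"
    unfolding G_def N_def
    by (intro Cinf_locally_finite_sum Cinf_mult Cinf_sum chi_Cinf b_Cinf) (simp add: chi_zero)
  have G_pos: "G x > 0" for x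
  proof -
    define j where "j = nat \<lfloor>sq_norm m x\<rfloor>"
    have "sq_norm m x \<ge> 0" by (simp add: sq_norm_def sum_nonneg)
    then have j: "real j \<le> sq_norm m x" "sq_norm m x \<le> real j + 1" "j < N x"
      unfolding j_def N_def by linarith+
    obtain q where "q \<in> Q j" "b q x > 0" using Q(2)[OF j(2)] by blast
    then have "(\<Sum>q\<in>Q j. b q x) > 0" using Q(1) b_nonneg by (intro sum_pos2) auto
    moreover have "cut j x > 0" using j by (simp add: cut_def bump_simps)
    ultimately have "cut j x * (\<Sum>q\<in>Q j. b q x) > 0" by simp
    then show ?thesis unfolding G_def using j(3) chi_nonneg b_nonneg
      by (intro sum_pos2[of _ j]) (auto intro!: mult_nonneg_nonneg sum_nonneg)
  qed
  \<comment> \<open>Division by the strictly positive sum \<open>G\<close> normalizes the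
    weights.\<close>
  define w where "w = (\<lambda>(j, q) x. 1 / G x * (cut j x * b q x))"
  have w_Cinf: "w a \<in> Cinf m" for a
    unfolding w_def case_prod_unfold
    by (intro Cinf_mult Cinf_inverse G_Cinf chi_Cinf b_Cinf) (use G_pos less_irrefl in metis)
  define F where "F K x = (\<Sum>j<N x. \<Sum>q\<in>Q j. w (j, q) x * C q K x)" for K x
  \<comment> \<open>The indices of all weights that can be nonzero on the ball of squared radius
    \<open>M\<close>.\<close>
  define A where "A M = Sigma {..<Suc M} Q" for M
  have fin: "finite (A M)" for M using Q(1) by (simp add: A_def)
  have F_eq: "F K x = (\<Sum>a\<in>A M. w a x * C (snd a) K x)" if "sq_norm m x \<le> real M" for K x M
  proof -
    have "F K x = (\<Sum>j<Suc M. \<Sum>q\<in>Q j. w (j, q) x * C q K x)"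
      unfolding F_def N_def
      by (rule locally_finite_sum[OF _ that]) (simp add: w_def chi_zero)
    also have "\<dots> = (\<Sum>a\<in>A M. w a x * C (snd a) K x)"
      unfolding A_def using Q(1) by (subst sum.Sigma) (auto intro: sum.cong)
    finally show ?thesis .
  qed
  have w_sum: "(\<Sum>a\<in>A M. w a x) = 1" if "sq_norm m x \<le> real M" for x M
  proof -
    have "G x = (\<Sum>j<Suc M. cut j x * (\<Sum>q\<in>Q j. b q x))"
      unfolding G_def N_def by (rule locally_finite_sum[OF _ that]) (simp add: chi_zero)
    then have "1 / G x * (\<Sum>j<Suc M. \<Sum>q\<in>Q j. cut j x * b q x) = 1"
      using G_pos[of x] by (simp add: sum_distrib_left)
    then have "(\<Sum>j<Suc M. \<Sum>q\<in>Q j. w (j, q) x) = 1"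
      by (simp only: w_def sum_distrib_left prod.case)
    then show ?thesis
      unfolding A_def using Q(1) by (subst (asm) sum.Sigma) (auto simp: case_prod_unfold)
  qed
  have F_Cinf: "F K \<in> Cinf m" for K
    unfolding F_def N_def
    by (intro Cinf_locally_finite_sum Cinf_sum Cinf_mult w_Cinf)
       (use C in \<open>auto simp: Cinf_super_simps w_def chi_zero\<close>)
  have F: "F \<in> carrier (Cinf_super m n)"
    unfolding Cinf_super_simps(1)
  proof (intro conjI allI impI F_Cinf)
    show "F I = (\<lambda>_. 0)" if "\<not> I \<subseteq> {..<n}" for I
      unfolding F_def using C that by (intro ext sum.neutral ballI) (auto simp: Cinf_super_simps)
  qed
  \<comment> \<open>\<open>F\<close> is already fixed at this stage, so the same element works for
    all points and all targets.\<close>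
  have "h F = s" if "germ_hom P m n h p" and s: "s \<in> carrier P" and hC: "\<forall>q. B q p \<noteq> 0 \<longrightarrow> h (C q) = s"
    for P :: "('b, 'x) ring_scheme" and h p s
  proof -
    interpret germ_hom P m n h p by fact
    define M where "M = nat \<lceil>sq_norm m p\<rceil> + 1"
    \<comment> \<open>Nonzero at \<open>p\<close> and supported in the ball of squared radius
      \<open>M\<close>, where \<open>F\<close> and the total weight are finite sums over
      \<open>A M\<close>.\<close>
    define e where "e x = bump (real M - sq_norm m x)" for x
    have e: "e \<in> Cinf m" unfolding e_def by (intro Cinf_bump Cinf_diff Cinf_const sq_norm_Cinf)
    have "sq_norm m p < real M" unfolding M_def by linarith
    then have ep: "e p \<noteq> 0" by (simp add: e_def bump_simps)
    have e0: "e x = 0" if "\<not> sq_norm m x \<le> real M" for x using that by (simp add: e_def bump_simps)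
    have "h F = h (\<lambda>K x. \<Sum>a\<in>A M. w a x * C (snd a) K x)"
    proof (rule h_cong[OF e ep F])
      show "(\<lambda>K x. \<Sum>a\<in>A M. w a x * C (snd a) K x) \<in> carrier (Cinf_super m n)"
        by (intro Cinf_super_sum_closed w_Cinf C)
      show "e x * F K x = e x * (\<Sum>a\<in>A M. w a x * C (snd a) K x)" for K x
        using F_eq[of x M K] e0[of x] by (cases "sq_norm m x \<le> real M") auto
    qed
    also have "\<dots> = h (body_fun (\<lambda>x. \<Sum>a\<in>A M. w a x)) \<otimes>\<^bsub>P\<^esub> s"
    proof (rule h_sum[OF fin s w_Cinf C])
      fix a
      show "h (body_fun (w a)) \<otimes>\<^bsub>P\<^esub> h (C (snd a)) = h (body_fun (w a)) \<otimes>\<^bsub>P\<^esub> s"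
      proof (cases "B (snd a) p = 0")
        case False
        then show ?thesis using hC by simp
      next
        case True
        \<comment> \<open>Complementary to \<open>b\<close>: it is positive exactly where
          \<open>B (snd a)\<close> lies below the threshold, in particular at its zero
          \<open>p\<close>, so the product of \<open>e'\<close> with the weight is identically 0.
          Hence the weight has zero image.\<close>
        define e' where "e' x = bump ((B (snd a) (snd a))\<^sup>2 / 2 - (B (snd a) x)\<^sup>2)" for x
        have e': "e' \<in> Cinf m" unfolding e'_def by (intro Cinf_bump Cinf_diff Cinf_power Cinf_const B)
        have e'p: "e' p \<noteq> 0" using True B(2)[of "snd a"] by (simp add: e'_def bump_simps)
        have e'0: "e' x * body_fun (w a) K x = e' x * 0" for K x
        proof -
          have "e' x = 0 \<or> b (snd a) x = 0"
            unfolding e'_def b_def bump_simps(3) by linarith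
          then show ?thesis by (auto simp: body_fun_def w_def case_prod_unfold)
        qed
        have "h (body_fun (w a)) = h (\<lambda>K x. 0)"
          by (rule h_cong[OF e' e'p body_fun_closed[OF w_Cinf] _ e'0]) (simp add: Cinf_super_simps(1))
        then show ?thesis using s C by (simp add: h_zero)
      qed
    qed
    also have "h (body_fun (\<lambda>x. \<Sum>a\<in>A M. w a x)) = h (body_fun (\<lambda>_. 1))"
    proof (rule h_cong[OF e ep])
      show "e x * body_fun (\<lambda>x. \<Sum>a\<in>A M. w a x) K x = e x * body_fun (\<lambda>_. 1) K x" for K x
        using w_sum[of x M] e0[of x] by (cases "sq_norm m x \<le> real M") (auto simp: body_fun_def)
    qed (auto intro!: body_fun_closed Cinf_sum w_Cinf)
    also have "\<dots> = \<one>\<^bsub>P\<^esub>" unfolding body_fun_one[of m n] by (rule ring_hom_one[OF hom])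
    finally show ?thesis using s by simp
  qed
  with F show ?thesis by blast
qed

section \<open>Superrings and their morphisms\<close>

text \<open>Negatives are required only within the two parts, and anticommutativity is the vanishing
  of a sum. No subtraction has to be computed this way, which matters for sections and germs, whose
  negatives are not given explicitly.\<close>

lemma cinf_superringI:
  fixes R :: "'a csring" (structure)
  assumes closed: "\<And>a b. \<lbrakk>a \<in> carrier R; b \<in> carrier R\<rbrakk> \<Longrightarrow> a \<oplus> b \<in> carrier R"
      "\<And>a b. \<lbrakk>a \<in> carrier R; b \<in> carrier R\<rbrakk> \<Longrightarrow> a \<otimes> b \<in> carrier R"
    and assoc: "\<And>a b c. \<lbrakk>a \<in> carrier R; b \<in> carrier R; c \<in> carrier R\<rbrakk> \<Longrightarrow> a \<oplus> b \<oplus> c = a \<oplus> (b \<oplus> c)"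
      "\<And>a b c. \<lbrakk>a \<in> carrier R; b \<in> carrier R; c \<in> carrier R\<rbrakk> \<Longrightarrow> a \<otimes> b \<otimes> c = a \<otimes> (b \<otimes> c)"
    and comm: "\<And>a b. \<lbrakk>a \<in> carrier R; b \<in> carrier R\<rbrakk> \<Longrightarrow> a \<oplus> b = b \<oplus> a"
    and neutral: "\<And>a. a \<in> carrier R \<Longrightarrow> \<zero> \<oplus> a = a" "\<And>a. a \<in> carrier R \<Longrightarrow> \<one> \<otimes> a = a"
      "\<And>a. a \<in> carrier R \<Longrightarrow> a \<otimes> \<one> = a"
    and distr: "\<And>a b c. \<lbrakk>a \<in> carrier R; b \<in> carrier R; c \<in> carrier R\<rbrakk> \<Longrightarrow> (a \<oplus> b) \<otimes> c = a \<otimes> c \<oplus> b \<otimes> c"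
      "\<And>a b c. \<lbrakk>a \<in> carrier R; b \<in> carrier R; c \<in> carrier R\<rbrakk> \<Longrightarrow> c \<otimes> (a \<oplus> b) = c \<otimes> a \<oplus> c \<otimes> b"
    and parts: "even_part R \<subseteq> carrier R" "odd_part R \<subseteq> carrier R"
      "\<And>a. a \<in> carrier R \<Longrightarrow> \<exists>b\<in>even_part R. \<exists>m\<in>odd_part R. a = b \<oplus> m"
      "\<And>a. \<lbrakk>a \<in> even_part R; a \<in> odd_part R\<rbrakk> \<Longrightarrow> a = \<zero>"
    and even: "\<zero> \<in> even_part R" "\<one> \<in> even_part R"
      "\<And>a b. \<lbrakk>a \<in> even_part R; b \<in> even_part R\<rbrakk> \<Longrightarrow> a \<oplus> b \<in> even_part R"
      "\<And>a. a \<in> even_part R \<Longrightarrow> \<exists>b\<in>even_part R. b \<oplus> a = \<zero>"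
    and odd: "\<zero> \<in> odd_part R"
      "\<And>a b. \<lbrakk>a \<in> odd_part R; b \<in> odd_part R\<rbrakk> \<Longrightarrow> a \<oplus> b \<in> odd_part R"
      "\<And>a. a \<in> odd_part R \<Longrightarrow> \<exists>b\<in>odd_part R. b \<oplus> a = \<zero>"
    and parity: "\<And>a b. \<lbrakk>a \<in> even_part R; b \<in> even_part R\<rbrakk> \<Longrightarrow> a \<otimes> b \<in> even_part R"
      "\<And>a b. \<lbrakk>a \<in> even_part R; b \<in> odd_part R\<rbrakk> \<Longrightarrow> a \<otimes> b \<in> odd_part R"
      "\<And>a b. \<lbrakk>a \<in> odd_part R; b \<in> odd_part R\<rbrakk> \<Longrightarrow> a \<otimes> b \<in> even_part R"
      "\<And>a b. \<lbrakk>a \<in> even_part R; b \<in> carrier R\<rbrakk> \<Longrightarrow> a \<otimes> b = b \<otimes> a"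
      "\<And>a b. \<lbrakk>a \<in> odd_part R; b \<in> odd_part R\<rbrakk> \<Longrightarrow> a \<otimes> b \<oplus> b \<otimes> a = \<zero>"
    and sop: "\<And>f cs. \<lbrakk>set cs \<subseteq> even_part R; f \<in> Cinf (length cs)\<rbrakk> \<Longrightarrow> sop R f cs \<in> even_part R"
      "\<And>i cs. \<lbrakk>set cs \<subseteq> even_part R; i < length cs\<rbrakk> \<Longrightarrow> sop R (\<lambda>x. x i) cs = cs ! i"
      "\<And>g hs cs. \<lbrakk>set cs \<subseteq> even_part R; g \<in> Cinf (length hs); set hs \<subseteq> Cinf (length cs)\<rbrakk>
        \<Longrightarrow> sop R (\<lambda>x. g (\<lambda>i. (hs ! i) x)) cs = sop R g (map (\<lambda>h. sop R h cs) hs)"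
    and compat: "\<And>a b. \<lbrakk>a \<in> even_part R; b \<in> even_part R\<rbrakk> \<Longrightarrow> sop R (\<lambda>x. x 0 + x 1) [a, b] = a \<oplus> b"
      "\<And>a b. \<lbrakk>a \<in> even_part R; b \<in> even_part R\<rbrakk> \<Longrightarrow> sop R (\<lambda>x. x 0 * x 1) [a, b] = a \<otimes> b"
      "sop R (\<lambda>_. 0) [] = \<zero>" "sop R (\<lambda>_. 1) [] = \<one>"
  shows "cinf_superring R"
proof -
  have zc: "\<zero> \<in> carrier R" "\<one> \<in> carrier R" using even parts by blast+
  have ex_neg: "\<exists>b\<in>carrier R. b \<oplus> a = \<zero>" if a: "a \<in> carrier R" for a
  proof -
    obtain c m where cm: "c \<in> even_part R" "m \<in> odd_part R" "a = c \<oplus> m" using parts(3)[OF a] by blast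
    obtain c' m' where cm': "c' \<in> even_part R" "c' \<oplus> c = \<zero>" "m' \<in> odd_part R" "m' \<oplus> m = \<zero>"
      using even(4)[OF cm(1)] odd(3)[OF cm(2)] by blast
    have car: "c \<in> carrier R" "m \<in> carrier R" "c' \<in> carrier R" "m' \<in> carrier R"
      using cm cm' parts by blast+
    have "(m' \<oplus> c') \<oplus> a = m' \<oplus> ((c' \<oplus> c) \<oplus> m)" unfolding cm(3) using car by (simp only: assoc closed)
    then have "(m' \<oplus> c') \<oplus> a = \<zero>" using cm' car neutral by simp
    then show ?thesis using car closed by blast
  qed
  interpret R: ring R
  proof (rule ringI)
    show "abelian_group R"
      by (rule abelian_groupI) (use closed assoc comm neutral zc ex_neg in auto)
    show "monoid R"
      by (rule monoidI) (use closed assoc neutral zc in auto)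
  qed (use distr in auto)
  have sub: "additive_subgroup A R"
    if A: "A \<subseteq> carrier R" "\<zero> \<in> A" "\<And>a b. a \<in> A \<Longrightarrow> b \<in> A \<Longrightarrow> a \<oplus> b \<in> A" "\<And>a. a \<in> A \<Longrightarrow> \<exists>b\<in>A. b \<oplus> a = \<zero>" for A
  proof (intro additive_subgroup.intro subgroup.intro)
    fix a assume a: "a \<in> A"
    then obtain b where b: "b \<in> A" "b \<oplus> a = \<zero>" using A(4) by blast
    then have "\<ominus> a = b" using R.minus_equality a A(1) by blast
    then show "inv\<^bsub>add_monoid R\<^esub> a \<in> A" using b(1) by (simp add: a_inv_def)
  qed (use A in auto)
  have subs: "additive_subgroup (even_part R) R" "additive_subgroup (odd_part R) R"
    by (rule sub; fact parts even odd)+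
  have "superring R"
  proof (intro superring.intro R.ring_axioms superring_axioms.intro subs)
    show "even_part R <+>\<^bsub>R\<^esub> odd_part R = carrier R"
    proof (intro equalityI subsetI)
      fix a assume "a \<in> even_part R <+>\<^bsub>R\<^esub> odd_part R"
      then show "a \<in> carrier R" using parts(1,2) closed(1) by (auto simp: set_add_def')
    next
      fix a assume "a \<in> carrier R"
      from parts(3)[OF this] show "a \<in> even_part R <+>\<^bsub>R\<^esub> odd_part R" by (auto simp: set_add_def')
    qed
    show "even_part R \<inter> odd_part R = {\<zero>}" using parts even odd by blast
    show "m \<otimes> a \<in> odd_part R" if "m \<in> odd_part R" "a \<in> even_part R" for m a
    proof -
      have "m \<in> carrier R" using that parts by blast
      then show ?thesis using parity(2)[OF that(2,1)] parity(4)[OF that(2), of m] by simp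
    qed
    show "a \<otimes> b = b \<otimes> a" if "a \<in> even_part R" "b \<in> even_part R \<union> odd_part R" for a b
      using parity(4) that parts by blast
    show "m \<otimes> n = \<ominus> (n \<otimes> m)" if "m \<in> odd_part R" "n \<in> odd_part R" for m n
    proof -
      have "m \<in> carrier R" "n \<in> carrier R" using that parts by blast+
      then show ?thesis using R.minus_equality[OF parity(5)[OF that]] by simp
    qed
  qed (fact parity)+
  moreover have "cinf_ring (even_ring R)"
    by standard (use sop in \<open>auto simp: even_ring_def\<close>)
  ultimately show ?thesis
    by (intro cinf_superring.intro cinf_superring_axioms.intro)
      (use compat in \<open>auto simp: ring_of_def even_ring_def cconst_def\<close>)
qed

context cinf_superring begin

text \<open>Taking the empty set makes the decomposition lemmas of \<open>superloc\<close> available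
  in every superring.\<close>

sublocale base: superloc R "{}" by standard simp

lemma sop_closed [simp]: "\<lbrakk>set cs \<subseteq> even_part R; f \<in> Cinf (length cs)\<rbrakk> \<Longrightarrow> sop R f cs \<in> even_part R"
  using even.cop_closed[of cs f] by (simp add: even_ring_def)
lemma sop_proj: "\<lbrakk>set cs \<subseteq> even_part R; i < length cs\<rbrakk> \<Longrightarrow> sop R (\<lambda>x. x i) cs = cs ! i"
  using even.cop_proj[of cs i] by (simp add: even_ring_def)
lemma sop_comp: "\<lbrakk>set cs \<subseteq> even_part R; g \<in> Cinf (length hs); set hs \<subseteq> Cinf (length cs)\<rbrakk>
    \<Longrightarrow> sop R (\<lambda>x. g (\<lambda>i. (hs ! i) x)) cs = sop R g (map (\<lambda>h. sop R h cs) hs)"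
  using even.cop_comp[of cs g hs] by (simp add: even_ring_def)
lemma sop_add: "\<lbrakk>a \<in> even_part R; b \<in> even_part R\<rbrakk> \<Longrightarrow> sop R (\<lambda>x. x 0 + x 1) [a, b] = a \<oplus> b"
  using compatible(1)[of a b] by (simp add: ring_of_def even_ring_def)
lemma sop_mult: "\<lbrakk>a \<in> even_part R; b \<in> even_part R\<rbrakk> \<Longrightarrow> sop R (\<lambda>x. x 0 * x 1) [a, b] = a \<otimes> b"
  using compatible(2)[of a b] by (simp add: ring_of_def even_ring_def)
lemma sop_zero: "sop R (\<lambda>_. 0) [] = \<zero>" and sop_one: "sop R (\<lambda>_. 1) [] = \<one>"
  using compatible(3,4) by (simp_all add: ring_of_def even_ring_def cconst_def)

lemma one_even [simp]: "\<one> \<in> even_part R" using sop_closed[of "[]" "\<lambda>_. 1"] by (simp add: sop_one)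
lemma zero_odd [simp]: "\<zero> \<in> odd_part R" by simp

lemma even_commute: "\<lbrakk>a \<in> even_part R; b \<in> carrier R\<rbrakk> \<Longrightarrow> a \<otimes> b = b \<otimes> a"
proof -
  assume a: "a \<in> even_part R" and "b \<in> carrier R"
  then obtain c m where "c \<in> even_part R" "m \<in> odd_part R" "b = c \<oplus> m" using base.decomp_ex by blast
  then show ?thesis using a even_comm[of a c] even_comm[of a m] by (simp add: l_distr r_distr)
qed

lemma even_odd_zero: "\<lbrakk>a \<in> even_part R; a \<in> odd_part R\<rbrakk> \<Longrightarrow> a = \<zero>"
  using direct_sum(2) by blast

lemma superloc_nonvanishing: "superloc R (nonvanishing R x)"
  by standard (auto simp: nonvanishing_def)

lemma loc_at_superring: "cinf_superring (loc_at R x)"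
  by (rule superloc.Q_cinf_superring[OF superloc_nonvanishing])

lemma loc_at_map_hom: "loc_at_map R x \<in> csring_hom R (loc_at R x)"
  by (rule superloc.map_hom[OF superloc_nonvanishing])

end

section \<open>Morphisms of C-infinity superrings\<close>

lemma csring_homD:
  assumes "h \<in> csring_hom R S"
  shows "h \<in> extensional (carrier R)" "h \<in> ring_hom R S"
    "a \<in> carrier R \<Longrightarrow> h a \<in> carrier S"
    "\<lbrakk>a \<in> carrier R; b \<in> carrier R\<rbrakk> \<Longrightarrow> h (a \<oplus>\<^bsub>R\<^esub> b) = h a \<oplus>\<^bsub>S\<^esub> h b"
    "\<lbrakk>a \<in> carrier R; b \<in> carrier R\<rbrakk> \<Longrightarrow> h (a \<otimes>\<^bsub>R\<^esub> b) = h a \<otimes>\<^bsub>S\<^esub> h b"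
    "h \<one>\<^bsub>R\<^esub> = \<one>\<^bsub>S\<^esub>"
    "a \<in> even_part R \<Longrightarrow> h a \<in> even_part S" "a \<in> odd_part R \<Longrightarrow> h a \<in> odd_part S"
  using assms unfolding csring_hom_def
  by (auto simp: ring_hom_closed ring_hom_add ring_hom_mult ring_hom_one)

lemma csring_hom_sop:
  assumes "cinf_superring R" "h \<in> csring_hom R S" "set cs \<subseteq> even_part R" "f \<in> Cinf (length cs)"
  shows "h (sop R f cs) = sop S f (map h cs)"
proof -
  interpret cinf_superring R by fact
  have "restrict h (even_part R) \<in> cinf_hom (even_ring R) (even_ring S)"
    using assms(2) by (simp add: csring_hom_def)
  from cinf_homD[OF this, of cs f]
  have "h (sop R f cs) = sop S f (map (restrict h (even_part R)) cs)"
    using assms(3,4) by (simp add: even_ring_def)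
  also have "map (restrict h (even_part R)) cs = map h cs" using assms(3) by auto
  finally show ?thesis .
qed

lemma csring_homI:
  assumes "cinf_superring R" "cinf_superring S" "h \<in> extensional (carrier R)"
    and "\<And>a. a \<in> carrier R \<Longrightarrow> h a \<in> carrier S"
    and "\<And>a b. \<lbrakk>a \<in> carrier R; b \<in> carrier R\<rbrakk> \<Longrightarrow> h (a \<oplus>\<^bsub>R\<^esub> b) = h a \<oplus>\<^bsub>S\<^esub> h b"
    and "\<And>a b. \<lbrakk>a \<in> carrier R; b \<in> carrier R\<rbrakk> \<Longrightarrow> h (a \<otimes>\<^bsub>R\<^esub> b) = h a \<otimes>\<^bsub>S\<^esub> h b"
    and "h \<one>\<^bsub>R\<^esub> = \<one>\<^bsub>S\<^esub>"
    and even: "\<And>a. a \<in> even_part R \<Longrightarrow> h a \<in> even_part S" and "\<And>a. a \<in> odd_part R \<Longrightarrow> h a \<in> odd_part S"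
    and sop: "\<And>f cs. \<lbrakk>set cs \<subseteq> even_part R; f \<in> Cinf (length cs)\<rbrakk> \<Longrightarrow> h (sop R f cs) = sop S f (map h cs)"
  shows "h \<in> csring_hom R S"
proof -
  interpret R: cinf_superring R by fact
  have "restrict h (even_part R) \<in> cinf_hom (even_ring R) (even_ring S)"
    unfolding cinf_hom_def
  proof (intro CollectI conjI allI impI)
    show "restrict h (even_part R) \<in> carrier (even_ring R) \<rightarrow>\<^sub>E carrier (even_ring S)"
      using even by (auto simp: even_ring_def)
    fix f cs assume cs: "set cs \<subseteq> carrier (even_ring R)" "f \<in> Cinf (length cs)"
    then have "map (restrict h (even_part R)) cs = map h cs" by (auto simp: even_ring_def)
    then show "restrict h (even_part R) (cop (even_ring R) f cs)
        = cop (even_ring S) f (map (restrict h (even_part R)) cs)"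
      using cs sop[of cs f] by (simp add: even_ring_def del: map_eq_conv)
  qed
  moreover have "h \<in> ring_hom R S" using assms by (intro ring_hom_memI) auto
  ultimately show ?thesis using assms by (auto simp: csring_hom_def)
qed

lemma csring_hom_zero:
  assumes "cinf_superring R" "cinf_superring S" "h \<in> csring_hom R S"
  shows "h \<zero>\<^bsub>R\<^esub> = \<zero>\<^bsub>S\<^esub>"
proof -
  interpret R: cinf_superring R by fact
  interpret S: cinf_superring S by fact
  show ?thesis using ring_hom_zero[OF csring_homD(2)[OF assms(3)]] R.ring_axioms S.ring_axioms by blast
qed

lemma csring_hom_uminus:
  assumes "cinf_superring R" "cinf_superring S" "h \<in> csring_hom R S" "a \<in> carrier R"
  shows "h (\<ominus>\<^bsub>R\<^esub> a) = \<ominus>\<^bsub>S\<^esub> h a"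
proof -
  interpret R: cinf_superring R by fact
  interpret S: cinf_superring S by fact
  have "h (\<ominus>\<^bsub>R\<^esub> a) \<oplus>\<^bsub>S\<^esub> h a = \<zero>\<^bsub>S\<^esub>"
    using csring_homD(4)[OF assms(3), of "\<ominus>\<^bsub>R\<^esub> a" a] assms(4) csring_hom_zero[OF assms(1-3)]
    by (simp add: R.l_neg)
  then show ?thesis using assms(4) csring_homD(3)[OF assms(3)] by (simp add: S.minus_equality)
qed

lemma csring_hom_compose:
  assumes "cinf_superring R" "cinf_superring S" "cinf_superring T"
    and g: "g \<in> csring_hom S T" and h: "h \<in> csring_hom R S"
  shows "compose (carrier R) g h \<in> csring_hom R T"
proof -
  interpret R: cinf_superring R by fact
  interpret S: cinf_superring S by fact
  show ?thesis
  proof (rule csring_homI[OF assms(1,3)])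
    fix f cs assume cs: "set cs \<subseteq> even_part R" "f \<in> Cinf (length cs)"
    then have "map (compose (carrier R) g h) cs = map g (map h cs)"
      by (auto simp: compose_def)
    moreover have "set (map h cs) \<subseteq> even_part S" using cs csring_homD(7)[OF h] by auto
    ultimately show "compose (carrier R) g h (sop R f cs) = sop T f (map (compose (carrier R) g h) cs)"
      using csring_hom_sop[OF assms(1) h cs] csring_hom_sop[OF assms(2) g, of "map h cs" f] cs
      by (simp add: compose_def del: map_map)
  qed (use csring_homD[OF g] csring_homD[OF h] in \<open>auto simp: compose_def\<close>)
qed

lemma csring_hom_id:
  assumes "cinf_superring R" shows "(\<lambda>a\<in>carrier R. a) \<in> csring_hom R R"
proof -
  interpret R: cinf_superring R by fact
  show ?thesis
  proof (rule csring_homI[OF assms assms])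
    fix f cs assume cs: "set cs \<subseteq> even_part R" "f \<in> Cinf (length cs)"
    then have "map (\<lambda>a\<in>carrier R. a) cs = cs" by (auto intro!: map_idI)
    then show "(\<lambda>a\<in>carrier R. a) (sop R f cs) = sop R f (map (\<lambda>a\<in>carrier R. a) cs)"
      using cs by simp
  qed auto
qed

section \<open>The structure sheaf of sSpec\<close>

text \<open>A generated topology lives on the union of its generators. Every point sends 1 to 1, so
  the set of all points is itself the generator given by 1.\<close>

lemma topspace_points: assumes "cinf_superring R" shows "topspace (points_topology R) = points R"
proof -
  interpret cinf_superring R by fact
  have "x \<one>\<^bsub>R\<^esub> = 1" if "x \<in> points R" for x
  proof -
    have "x (cop (even_ring R) (\<lambda>_. 1) []) = cop real_cinf (\<lambda>_. 1) (map x [])"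
      using that unfolding points_def by (intro cinf_homD) auto
    then show ?thesis by (simp add: even_ring_def real_cinf_def sop_one)
  qed
  then have "points R = {x \<in> points R. x \<one>\<^bsub>R\<^esub> \<noteq> 0}" by fastforce
  then have "points R \<in> (\<lambda>c. {x \<in> points R. x c \<noteq> 0}) ` even_part R" using one_even by blast
  then show ?thesis unfolding points_topology_def topology_generated_by_topspace by blast
qed

text \<open>The parameter \<open>A\<close> is the carrier, the even part or the odd part, so that
  one notion covers all sections, the even ones and the odd ones.\<close>

definition local_sections :: "'a csring \<Rightarrow> 'a set \<Rightarrow> ('a \<Rightarrow> real) set \<Rightarrow> (('a \<Rightarrow> real) \<Rightarrow> 'a sloc) set" where
  "local_sections R A U = {\<sigma> \<in> extensional U. \<forall>x\<in>U. \<exists>V a. openin (points_topology R) V \<and> x \<in> V \<and> V \<subseteq> U \<and>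
     a \<in> A \<and> (\<forall>y\<in>V. \<sigma> y = loc_at_map R y a)}"

lemma local_sectionsD:
  assumes "\<sigma> \<in> local_sections R A U" "x \<in> U"
  obtains V a where "openin (points_topology R) V" "x \<in> V" "V \<subseteq> U" "a \<in> A" "\<forall>y\<in>V. \<sigma> y = loc_at_map R y a"
  using assms unfolding local_sections_def by blast

text \<open>Operations of any arity need one neighbourhood on which all arguments are represented at
  once. The empty list takes \<open>U\<close> itself, which therefore has to be open.\<close>

lemma local_sections_list:
  assumes "set \<sigma>s \<subseteq> local_sections R A U" "x \<in> U" "openin (points_topology R) U"
  shows "\<exists>V as. openin (points_topology R) V \<and> x \<in> V \<and> V \<subseteq> U \<and> set as \<subseteq> A \<and> length as = length \<sigma>s \<and>
    (\<forall>y\<in>V. map (\<lambda>\<sigma>. \<sigma> y) \<sigma>s = map (loc_at_map R y) as)"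
  using assms(1)
proof (induction \<sigma>s)
  case Nil
  then show ?case using assms by (intro exI[of _ U] exI[of _ "[]"]) auto
next
  case (Cons \<sigma> \<sigma>s)
  then obtain V as where V: "openin (points_topology R) V" "x \<in> V" "V \<subseteq> U" "set as \<subseteq> A" "length as = length \<sigma>s"
    "\<forall>y\<in>V. map (\<lambda>\<sigma>. \<sigma> y) \<sigma>s = map (loc_at_map R y) as" by auto
  obtain W a where W: "openin (points_topology R) W" "x \<in> W" "W \<subseteq> U" "a \<in> A"
    "\<forall>y\<in>W. \<sigma> y = loc_at_map R y a"
    using Cons.prems assms(2) by (auto elim!: local_sectionsD)
  show ?case using V W by (intro exI[of _ "V \<inter> W"] exI[of _ "a # as"]) (auto intro: openin_Int)
qed

lemma local_sectionsI:
  assumes "\<sigma> \<in> extensional U"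
    and "\<And>x. x \<in> U \<Longrightarrow> \<exists>V a. openin (points_topology R) V \<and> x \<in> V \<and> V \<subseteq> U \<and>
     a \<in> A \<and> (\<forall>y\<in>V. \<sigma> y = loc_at_map R y a)"
  shows "\<sigma> \<in> local_sections R A U"
  using assms by (auto simp: local_sections_def)

lemma local_sections_map:
  assumes "\<sigma> \<in> local_sections R A U" "\<And>a. a \<in> A \<Longrightarrow> f a \<in> A'"
    and "\<And>y a. \<lbrakk>y \<in> U; a \<in> A; \<sigma> y = loc_at_map R y a\<rbrakk> \<Longrightarrow> F y = loc_at_map R y (f a)"
  shows "(\<lambda>y\<in>U. F y) \<in> local_sections R A' U"
proof (rule local_sectionsI)
  fix x assume "x \<in> U"
  with assms(1) obtain V a where *: "openin (points_topology R) V" "x \<in> V" "V \<subseteq> U" "a \<in> A"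
    "\<forall>y\<in>V. \<sigma> y = loc_at_map R y a" by (rule local_sectionsD)
  moreover have "restrict F U y = loc_at_map R y (f a)" if "y \<in> V" for y
  proof -
    have "y \<in> U" using that * by blast
    then show ?thesis using assms(3)[OF _ *(4) bspec[OF *(5) that]] by simp
  qed
  ultimately show "\<exists>V a. openin (points_topology R) V \<and> x \<in> V \<and> V \<subseteq> U \<and>
     a \<in> A' \<and> (\<forall>y\<in>V. restrict F U y = loc_at_map R y a)"
    using assms(2) by blast
qed simp

lemma local_sections_list_map:
  assumes "set \<sigma>s \<subseteq> local_sections R A U" "openin (points_topology R) U"
    and "\<And>as. \<lbrakk>set as \<subseteq> A; length as = length \<sigma>s\<rbrakk> \<Longrightarrow> f as \<in> A'"
    and "\<And>y as. \<lbrakk>y \<in> U; set as \<subseteq> A; length as = length \<sigma>s; map (\<lambda>\<sigma>. \<sigma> y) \<sigma>s = map (loc_at_map R y) as\<rbrakk>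
      \<Longrightarrow> F y = loc_at_map R y (f as)"
  shows "(\<lambda>y\<in>U. F y) \<in> local_sections R A' U"
proof (rule local_sectionsI)
  fix x assume "x \<in> U"
  from local_sections_list[OF assms(1) this assms(2)]
  obtain V as where *: "openin (points_topology R) V" "x \<in> V" "V \<subseteq> U" "set as \<subseteq> A" "length as = length \<sigma>s"
    "\<forall>y\<in>V. map (\<lambda>\<sigma>. \<sigma> y) \<sigma>s = map (loc_at_map R y) as" by blast
  moreover have "restrict F U y = loc_at_map R y (f as)" if "y \<in> V" for y
  proof -
    have "y \<in> U" using that * by blast
    then show ?thesis using assms(4)[OF _ *(4,5)] * that by simp
  qed
  ultimately show "\<exists>V a. openin (points_topology R) V \<and> x \<in> V \<and> V \<subseteq> U \<and>
     a \<in> A' \<and> (\<forall>y\<in>V. restrict F U y = loc_at_map R y a)"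
    using assms(3) by blast
qed simp

context cinf_superring begin

lemma even_subset: "even_part R \<subseteq> carrier R" and odd_subset: "odd_part R \<subseteq> carrier R"
  by auto

lemmas loc_simps =
  csring_homD(3-8)[OF loc_at_map_hom]

lemma local_sections_mono: "A \<subseteq> B \<Longrightarrow> local_sections R A U \<subseteq> local_sections R B U"
  unfolding local_sections_def by blast

lemma local_sections_in:
  "\<lbrakk>\<sigma> \<in> local_sections R (carrier R) U; x \<in> U\<rbrakk> \<Longrightarrow> \<sigma> x \<in> carrier (loc_at R x)"
  "\<lbrakk>\<sigma> \<in> local_sections R (even_part R) U; x \<in> U\<rbrakk> \<Longrightarrow> \<sigma> x \<in> even_part (loc_at R x)"
  "\<lbrakk>\<sigma> \<in> local_sections R (odd_part R) U; x \<in> U\<rbrakk> \<Longrightarrow> \<sigma> x \<in> odd_part (loc_at R x)"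
  using local_sectionsD loc_simps(1,5,6) by metis+

lemma loc_at_Pair:
  assumes "b \<in> even_part R" "m \<in> odd_part R"
  shows "loc_at_map R y (b \<oplus> m) = (cloc_map (even_ring R) (nonvanishing R y) b,
      odd_class R (nonvanishing R y) [(m, \<one>\<^bsub>loc_module R (nonvanishing R y)\<^esub>)])"
    and "loc_at_map R y b = (fst (loc_at_map R y (b \<oplus> m)), \<zero>\<^bsub>odd_loc R (nonvanishing R y)\<^esub>)"
    and "loc_at_map R y m = (\<zero>\<^bsub>ring_of (cloc (even_ring R) (nonvanishing R y))\<^esub>, snd (loc_at_map R y (b \<oplus> m)))"
proof -
  interpret l: superloc R "nonvanishing R y" by (rule superloc_nonvanishing)
  show "loc_at_map R y (b \<oplus> m) = (cloc_map (even_ring R) (nonvanishing R y) b,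
      odd_class R (nonvanishing R y) [(m, \<one>\<^bsub>loc_module R (nonvanishing R y)\<^esub>)])"
    "loc_at_map R y b = (fst (loc_at_map R y (b \<oplus> m)), \<zero>\<^bsub>odd_loc R (nonvanishing R y)\<^esub>)"
    "loc_at_map R y m = (\<zero>\<^bsub>ring_of (cloc (even_ring R) (nonvanishing R y))\<^esub>, snd (loc_at_map R y (b \<oplus> m)))"
    using assms l.map_decomp l.map_even l.map_odd by (simp_all add: l.L_def l.A_def[symmetric])
qed

lemma loc_at_parts:
  "even_part (loc_at R y) = {q \<in> carrier (loc_at R y). snd q = \<zero>\<^bsub>odd_loc R (nonvanishing R y)\<^esub>}"
  "odd_part (loc_at R y) = {q \<in> carrier (loc_at R y). fst q = \<zero>\<^bsub>ring_of (cloc (even_ring R) (nonvanishing R y))\<^esub>}"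
proof -
  interpret l: superloc R "nonvanishing R y" by (rule superloc_nonvanishing)
  have *: "z \<in> D \<Longrightarrow> C \<times> {z} = {q \<in> C \<times> D. snd q = z}" "y \<in> C \<Longrightarrow> {y} \<times> D = {q \<in> C \<times> D. fst q = y}"
    for C :: "'x set" and D :: "'y set" and y z by auto
  have z: "\<zero>\<^bsub>odd_loc R (nonvanishing R y)\<^esub> \<in> carrier (odd_loc R (nonvanishing R y))"
    using l.TM.zero_closed by (simp only: l.TM_simps)
  have 1: "even_part (loc_at R y) = carrier l.A \<times> {\<zero>\<^bsub>odd_loc R (nonvanishing R y)\<^esub>}"
   by (rule l.Q_simps)
  have 2: "carrier (loc_at R y) = carrier l.A \<times> carrier (odd_loc R (nonvanishing R y))"
   by (rule l.Q_simps)
  have 3: "odd_part (loc_at R y) = {\<zero>\<^bsub>l.A\<^esub>} \<times> carrier (odd_loc R (nonvanishing R y))"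
   by (rule l.Q_simps)
  show "even_part (loc_at R y) = {q \<in> carrier (loc_at R y). snd q = \<zero>\<^bsub>odd_loc R (nonvanishing R y)\<^esub>}"
  unfolding 1 2 by (rule *(1)[OF z])
  show "odd_part (loc_at R y) = {q \<in> carrier (loc_at R y). fst q = \<zero>\<^bsub>ring_of (cloc (even_ring R) (nonvanishing R y))\<^esub>}"
  unfolding 3 2 l.A_def[symmetric] by (rule *(2)[OF l.A.zero_closed])
qed

text \<open>The even component of any local representative is again a representative, because the
  odd coordinate of \<open>\<sigma>\<close> vanishes at each point.\<close>

lemma local_sections_even:
  assumes "\<sigma> \<in> local_sections R (carrier R) U" "\<And>x. x \<in> U \<Longrightarrow> \<sigma> x \<in> even_part (loc_at R x)"
  shows "\<sigma> \<in> local_sections R (even_part R) U"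
proof (rule local_sectionsI)
  show "\<sigma> \<in> extensional U" using assms(1) by (simp add: local_sections_def)
  fix x assume "x \<in> U"
  with assms(1) obtain V a where *: "openin (points_topology R) V" "x \<in> V" "V \<subseteq> U" "a \<in> carrier R"
    "\<forall>y\<in>V. \<sigma> y = loc_at_map R y a" by (rule local_sectionsD)
  obtain b m where bm: "b \<in> even_part R" "m \<in> odd_part R" "a = b \<oplus> m" using base.decomp_ex[OF *(4)] .
  have "\<sigma> y = loc_at_map R y b" if "y \<in> V" for y
  proof -
    have "snd (\<sigma> y) = \<zero>\<^bsub>odd_loc R (nonvanishing R y)\<^esub>" using assms(2)[of y] that * by (auto simp: loc_at_parts)
    then show ?thesis using loc_at_Pair(2)[OF bm(1,2), of y] bspec[OF *(5) that] bm(3) by (simp add: prod_eq_iff)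
  qed
  then show "\<exists>V a. openin (points_topology R) V \<and> x \<in> V \<and> V \<subseteq> U \<and>
     a \<in> even_part R \<and> (\<forall>y\<in>V. \<sigma> y = loc_at_map R y a)" using * bm by blast
qed

lemma local_sections_odd:
  assumes "\<sigma> \<in> local_sections R (carrier R) U" "\<And>x. x \<in> U \<Longrightarrow> \<sigma> x \<in> odd_part (loc_at R x)"
  shows "\<sigma> \<in> local_sections R (odd_part R) U"
proof (rule local_sectionsI)
  show "\<sigma> \<in> extensional U" using assms(1) by (simp add: local_sections_def)
  fix x assume "x \<in> U"
  with assms(1) obtain V a where *: "openin (points_topology R) V" "x \<in> V" "V \<subseteq> U" "a \<in> carrier R"
    "\<forall>y\<in>V. \<sigma> y = loc_at_map R y a" by (rule local_sectionsD)
  obtain b m where bm: "b \<in> even_part R" "m \<in> odd_part R" "a = b \<oplus> m" using base.decomp_ex[OF *(4)] .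
  have "\<sigma> y = loc_at_map R y m" if "y \<in> V" for y
  proof -
    have "fst (\<sigma> y) = \<zero>\<^bsub>ring_of (cloc (even_ring R) (nonvanishing R y))\<^esub>"
      using assms(2)[of y] that * by (auto simp: loc_at_parts)
    then show ?thesis using loc_at_Pair(3)[OF bm(1,2), of y] bspec[OF *(5) that] bm(3) by (simp add: prod_eq_iff)
  qed
  then show "\<exists>V a. openin (points_topology R) V \<and> x \<in> V \<and> V \<subseteq> U \<and>
     a \<in> odd_part R \<and> (\<forall>y\<in>V. \<sigma> y = loc_at_map R y a)" using * bm by blast
qed

text \<open>Representatives \<open>c\<close> and \<open>m\<close> of the two components combine to
  \<open>c \<oplus> m\<close> on the intersection of their neighbourhoods; conversely the
  decomposition of a single representative gives representatives of both components.\<close>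

lemma sections_eq:
  "{\<lambda>x\<in>U. (s x, e x) | s e. s \<in> struct_sheaf R U \<and> e \<in> MSpec_odd R U} = local_sections R (carrier R) U"
    (is "?A = ?B")
proof (intro equalityI subsetI)
  fix \<sigma> assume "\<sigma> \<in> ?A"
  then obtain s e where \<sigma>: "\<sigma> = (\<lambda>x\<in>U. (s x, e x))" and s: "s \<in> struct_sheaf R U" and e: "e \<in> MSpec_odd R U"
    by blast
  show "\<sigma> \<in> ?B"
  proof (rule local_sectionsI)
    fix x assume x: "x \<in> U"
    obtain V c where V: "openin (points_topology R) V" "x \<in> V" "V \<subseteq> U" "c \<in> even_part R"
      "\<forall>y\<in>V. s y = cloc_map (even_ring R) (nonvanishing R y) c"
      using s x unfolding struct_sheaf_def by blast
    obtain W m where W: "openin (points_topology R) W" "x \<in> W" "W \<subseteq> U" "m \<in> odd_part R"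
      "\<forall>y\<in>W. e y = odd_class R (nonvanishing R y) [(m, \<one>\<^bsub>loc_module R (nonvanishing R y)\<^esub>)]"
      using e x unfolding MSpec_odd_def by blast
    have "\<forall>y\<in>V \<inter> W. \<sigma> y = loc_at_map R y (c \<oplus> m)"
      using V W by (auto simp: \<sigma> loc_at_Pair(1))
    moreover have "c \<oplus> m \<in> carrier R" using V W by simp
    ultimately show "\<exists>V a. openin (points_topology R) V \<and> x \<in> V \<and> V \<subseteq> U \<and>
     a \<in> carrier R \<and> (\<forall>y\<in>V. \<sigma> y = loc_at_map R y a)"
      using V W openin_Int[OF V(1) W(1)] by (intro exI[of _ "V \<inter> W"] exI[of _ "c \<oplus> m"]) auto
  qed (simp add: \<sigma>)
next
  fix \<sigma> assume \<sigma>: "\<sigma> \<in> ?B"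
  define s where "s = (\<lambda>x\<in>U. fst (\<sigma> x))"
  define e where "e = (\<lambda>x\<in>U. snd (\<sigma> x))"
  have loc: "\<exists>V b m. openin (points_topology R) V \<and> x \<in> V \<and> V \<subseteq> U \<and> b \<in> even_part R \<and> m \<in> odd_part R \<and>
    (\<forall>y\<in>V. s y = cloc_map (even_ring R) (nonvanishing R y) b \<and>
      e y = odd_class R (nonvanishing R y) [(m, \<one>\<^bsub>loc_module R (nonvanishing R y)\<^esub>)])" if "x \<in> U" for x
  proof -
    from \<sigma> that obtain V a where *: "openin (points_topology R) V" "x \<in> V" "V \<subseteq> U" "a \<in> carrier R"
      "\<forall>y\<in>V. \<sigma> y = loc_at_map R y a" by (rule local_sectionsD)
    obtain b m where bm: "b \<in> even_part R" "m \<in> odd_part R" "a = b \<oplus> m" using base.decomp_ex[OF *(4)] .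
    show ?thesis using * bm loc_at_Pair(1)[OF bm(1,2)]
      by (intro exI[of _ V] exI[of _ b] exI[of _ m]) (auto simp: s_def e_def)
  qed
  have "\<sigma> x \<in> carrier (cloc (even_ring R) (nonvanishing R x)) \<times> carrier (odd_loc R (nonvanishing R x))"
    if "x \<in> U" for x
    using local_sections_in(1)[OF \<sigma> that] by (simp add: sloc_def Let_def)
  then have PiE: "s \<in> (\<Pi>\<^sub>E x\<in>U. carrier (cloc (even_ring R) (nonvanishing R x)))"
    "e \<in> (\<Pi>\<^sub>E x\<in>U. carrier (odd_loc R (nonvanishing R x)))"
    by (auto simp: s_def e_def mem_Times_iff)
  have "s \<in> struct_sheaf R U"
    unfolding struct_sheaf_def
  proof (intro CollectI conjI ballI PiE)
    fix x assume "x \<in> U"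
    from loc[OF this] show "\<exists>V c. openin (points_topology R) V \<and> x \<in> V \<and> V \<subseteq> U \<and> c \<in> even_part R \<and>
          (\<forall>y\<in>V. s y = cloc_map (even_ring R) (nonvanishing R y) c)" by metis
  qed
  moreover have "e \<in> MSpec_odd R U"
    unfolding MSpec_odd_def
  proof (intro CollectI conjI ballI PiE)
    fix x assume "x \<in> U"
    from loc[OF this] show "\<exists>V m. openin (points_topology R) V \<and> x \<in> V \<and> V \<subseteq> U \<and> m \<in> odd_part R \<and>
          (\<forall>y\<in>V. e y = odd_class R (nonvanishing R y) [(m, \<one>\<^bsub>loc_module R (nonvanishing R y)\<^esub>)])" by metis
  qed
  moreover have "\<sigma> = (\<lambda>x\<in>U. (s x, e x))"
    using \<sigma> by (auto simp: local_sections_def s_def e_def extensional_def fun_eq_iff)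
  ultimately show "\<sigma> \<in> ?A" by blast
qed

lemma sSpec_sec_simps:
  "carrier (sSpec_sec R U) = local_sections R (carrier R) U"
  "even_part (sSpec_sec R U) = local_sections R (even_part R) U"
  "odd_part (sSpec_sec R U) = local_sections R (odd_part R) U"
  "\<sigma> \<oplus>\<^bsub>sSpec_sec R U\<^esub> \<tau> = (\<lambda>x\<in>U. \<sigma> x \<oplus>\<^bsub>loc_at R x\<^esub> \<tau> x)"
  "\<sigma> \<otimes>\<^bsub>sSpec_sec R U\<^esub> \<tau> = (\<lambda>x\<in>U. \<sigma> x \<otimes>\<^bsub>loc_at R x\<^esub> \<tau> x)"
  "\<one>\<^bsub>sSpec_sec R U\<^esub> = (\<lambda>x\<in>U. \<one>\<^bsub>loc_at R x\<^esub>)"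
  "\<zero>\<^bsub>sSpec_sec R U\<^esub> = (\<lambda>x\<in>U. \<zero>\<^bsub>loc_at R x\<^esub>)"
  "sop (sSpec_sec R U) f \<sigma>s = (\<lambda>x\<in>U. sop (loc_at R x) f (map (\<lambda>\<sigma>. \<sigma> x) \<sigma>s))"
proof -
  have "{\<sigma> \<in> local_sections R (carrier R) U. \<forall>x\<in>U. \<sigma> x \<in> even_part (loc_at R x)} = local_sections R (even_part R) U"
  proof (intro equalityI subsetI CollectI conjI ballI)
    fix \<sigma> x assume \<sigma>: "\<sigma> \<in> local_sections R (even_part R) U" and x: "x \<in> U"
    show "\<sigma> x \<in> even_part (loc_at R x)"
      using local_sectionsD[OF \<sigma> x] loc_simps(5) by metis
  qed (use local_sections_even local_sections_mono[OF even_subset] in auto)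
  then show "even_part (sSpec_sec R U) = local_sections R (even_part R) U"
    unfolding sSpec_sec_def Let_def sections_eq by simp
  have "{\<sigma> \<in> local_sections R (carrier R) U. \<forall>x\<in>U. \<sigma> x \<in> odd_part (loc_at R x)} = local_sections R (odd_part R) U"
  proof (intro equalityI subsetI CollectI conjI ballI)
    fix \<sigma> x assume \<sigma>: "\<sigma> \<in> local_sections R (odd_part R) U" and x: "x \<in> U"
    show "\<sigma> x \<in> odd_part (loc_at R x)"
      using local_sectionsD[OF \<sigma> x] loc_simps(6) by metis
  qed (use local_sections_odd local_sections_mono[OF odd_subset] in auto)
  then show "odd_part (sSpec_sec R U) = local_sections R (odd_part R) U"
    unfolding sSpec_sec_def Let_def sections_eq by simp
qed (simp_all add: sSpec_sec_def Let_def sections_eq)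

end

section \<open>Pointwise operations on sections\<close>

lemma local_sections_binop:
  assumes "\<sigma> \<in> local_sections R A U" "\<tau> \<in> local_sections R B U"
    and "\<And>a b. \<lbrakk>a \<in> A; b \<in> B\<rbrakk> \<Longrightarrow> f a b \<in> C"
    and "\<And>y a b. \<lbrakk>y \<in> U; a \<in> A; b \<in> B\<rbrakk> \<Longrightarrow> F y (loc_at_map R y a) (loc_at_map R y b) = loc_at_map R y (f a b)"
  shows "(\<lambda>y\<in>U. F y (\<sigma> y) (\<tau> y)) \<in> local_sections R C U"
proof (rule local_sectionsI)
  fix x assume x: "x \<in> U"
  obtain V a where V: "openin (points_topology R) V" "x \<in> V" "V \<subseteq> U" "a \<in> A"
    "\<forall>y\<in>V. \<sigma> y = loc_at_map R y a" using assms(1) x by (rule local_sectionsD)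
  obtain W b where W: "openin (points_topology R) W" "x \<in> W" "W \<subseteq> U" "b \<in> B"
    "\<forall>y\<in>W. \<tau> y = loc_at_map R y b" using assms(2) x by (rule local_sectionsD)
  have "(\<lambda>y\<in>U. F y (\<sigma> y) (\<tau> y)) y = loc_at_map R y (f a b)" if "y \<in> V \<inter> W" for y
  proof -
    have "y \<in> U" "\<sigma> y = loc_at_map R y a" "\<tau> y = loc_at_map R y b" using that V W by blast+
    then show ?thesis using assms(4)[OF _ V(4) W(4)] by simp
  qed
  then show "\<exists>V a. openin (points_topology R) V \<and> x \<in> V \<and> V \<subseteq> U \<and>
     a \<in> C \<and> (\<forall>y\<in>V. (\<lambda>y\<in>U. F y (\<sigma> y) (\<tau> y)) y = loc_at_map R y a)"
    using openin_Int[OF V(1) W(1)] V W assms(3)[OF V(4) W(4)]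
    by (intro exI[of _ "V \<inter> W"] exI[of _ "f a b"]) auto
qed simp

lemma local_sections_const:
  assumes "openin (points_topology R) U" "a \<in> A" "\<And>y. y \<in> U \<Longrightarrow> F y = loc_at_map R y a"
  shows "(\<lambda>y\<in>U. F y) \<in> local_sections R A U"
  using assms by (intro local_sectionsI exI[of _ U] exI[of _ a]) auto

lemma local_sections_ext:
  assumes "\<sigma> \<in> local_sections R A U" "\<tau> \<in> local_sections R B U" "\<And>x. x \<in> U \<Longrightarrow> \<sigma> x = \<tau> x"
  shows "\<sigma> = \<tau>"
  using assms by (intro extensionalityI[of _ U]) (auto simp: local_sections_def)

context cinf_superring begin

lemma loc_zero: "loc_at_map R x \<zero> = \<zero>\<^bsub>loc_at R x\<^esub>"
  by (rule csring_hom_zero[OF cinf_superring_axioms loc_at_superring loc_at_map_hom])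
lemma loc_uminus: "a \<in> carrier R \<Longrightarrow> loc_at_map R x (\<ominus> a) = \<ominus>\<^bsub>loc_at R x\<^esub> loc_at_map R x a"
  by (rule csring_hom_uminus[OF cinf_superring_axioms loc_at_superring loc_at_map_hom])
lemma loc_sop: "\<lbrakk>set cs \<subseteq> even_part R; f \<in> Cinf (length cs)\<rbrakk>
    \<Longrightarrow> loc_at_map R x (sop R f cs) = sop (loc_at R x) f (map (loc_at_map R x) cs)"
  by (rule csring_hom_sop[OF cinf_superring_axioms loc_at_map_hom])

lemma local_sections_add:
  assumes "\<sigma> \<in> local_sections R A U" "\<tau> \<in> local_sections R A U"
    "A \<subseteq> carrier R" "\<And>a b. \<lbrakk>a \<in> A; b \<in> A\<rbrakk> \<Longrightarrow> a \<oplus> b \<in> A"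
  shows "(\<lambda>y\<in>U. \<sigma> y \<oplus>\<^bsub>loc_at R y\<^esub> \<tau> y) \<in> local_sections R A U"
  by (rule local_sections_binop[OF assms(1,2), where f = "\<lambda>a b. a \<oplus> b"])
    (use assms(3,4) in \<open>auto intro!: loc_simps(2)[symmetric]\<close>)

lemma local_sections_mult:
  assumes "\<sigma> \<in> local_sections R A U" "\<tau> \<in> local_sections R B U"
    "A \<subseteq> carrier R" "B \<subseteq> carrier R" "\<And>a b. \<lbrakk>a \<in> A; b \<in> B\<rbrakk> \<Longrightarrow> a \<otimes> b \<in> C"
  shows "(\<lambda>y\<in>U. \<sigma> y \<otimes>\<^bsub>loc_at R y\<^esub> \<tau> y) \<in> local_sections R C U"
  by (rule local_sections_binop[OF assms(1,2), where f = "\<lambda>a b. a \<otimes> b"])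
    (use assms(3-5) in \<open>auto intro!: loc_simps(3)[symmetric]\<close>)

lemma local_sections_uminus:
  assumes "\<sigma> \<in> local_sections R A U" "A \<subseteq> carrier R" "\<And>a. a \<in> A \<Longrightarrow> \<ominus> a \<in> A"
  shows "(\<lambda>y\<in>U. \<ominus>\<^bsub>loc_at R y\<^esub> \<sigma> y) \<in> local_sections R A U"
  by (rule local_sections_map[OF assms(1), where f = "\<lambda>a. \<ominus> a"])
    (use assms(2,3) in \<open>auto simp: loc_uminus\<close>)

text \<open>The equations hold pointwise in the localizations. What remains is closure: each result
  must again be locally induced by an element of \<open>R\<close>, which holds because the
  localization maps are morphisms.\<close>

theorem sSpec_sec_superring:
  assumes U: "openin (points_topology R) U"
  shows "cinf_superring (sSpec_sec R U)"
proof -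
  interpret Q: cinf_superring "loc_at R x" for x by (rule loc_at_superring)
  note car = local_sections_in(1) local_sections_in(1)[OF subsetD[OF local_sections_mono[OF even_subset]]]
     local_sections_in(1)[OF subsetD[OF local_sections_mono[OF odd_subset]]]
  have eqI: "(\<lambda>x\<in>U. F x) = \<sigma>" if "\<sigma> \<in> local_sections R A U" "\<And>x. x \<in> U \<Longrightarrow> F x = \<sigma> x" for F \<sigma> A
    using that by (intro extensionalityI[of _ U]) (auto simp: local_sections_def)
  have zero: "(\<lambda>x\<in>U. \<zero>\<^bsub>loc_at R x\<^esub>) \<in> local_sections R A U" if "\<zero> \<in> A" for A
    using U that by (rule local_sections_const) (simp add: loc_zero)
  have neg: "\<exists>\<tau>\<in>local_sections R A U. (\<lambda>x\<in>U. \<tau> x \<oplus>\<^bsub>loc_at R x\<^esub> \<sigma> x) = (\<lambda>x\<in>U. \<zero>\<^bsub>loc_at R x\<^esub>)"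
    if "\<sigma> \<in> local_sections R A U" "A \<subseteq> carrier R" "\<And>a. a \<in> A \<Longrightarrow> \<ominus> a \<in> A" for A \<sigma>
    using local_sections_uminus[OF that] subsetD[OF local_sections_mono[OF that(2)] that(1)]
    by (intro bexI[of _ "\<lambda>x\<in>U. \<ominus>\<^bsub>loc_at R x\<^esub> \<sigma> x"] restrict_ext) (simp_all add: car Q.l_neg)
  show ?thesis
  proof (rule cinf_superringI, unfold sSpec_sec_simps)
    fix \<sigma> \<tau> assume *: "\<sigma> \<in> local_sections R (carrier R) U" "\<tau> \<in> local_sections R (carrier R) U"
    show "(\<lambda>x\<in>U. \<sigma> x \<oplus>\<^bsub>loc_at R x\<^esub> \<tau> x) \<in> local_sections R (carrier R) U"
      using * by (rule local_sections_add) auto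
    show "(\<lambda>x\<in>U. \<sigma> x \<otimes>\<^bsub>loc_at R x\<^esub> \<tau> x) \<in> local_sections R (carrier R) U"
      using * by (rule local_sections_mult) auto
    show "(\<lambda>x\<in>U. \<sigma> x \<oplus>\<^bsub>loc_at R x\<^esub> \<tau> x) = (\<lambda>x\<in>U. \<tau> x \<oplus>\<^bsub>loc_at R x\<^esub> \<sigma> x)"
      using * by (intro restrict_ext) (simp add: car Q.a_comm)
    fix \<rho> assume \<rho>: "\<rho> \<in> local_sections R (carrier R) U"
    show "(\<lambda>x\<in>U. (\<lambda>x\<in>U. \<sigma> x \<oplus>\<^bsub>loc_at R x\<^esub> \<tau> x) x \<oplus>\<^bsub>loc_at R x\<^esub> \<rho> x)
        = (\<lambda>x\<in>U. \<sigma> x \<oplus>\<^bsub>loc_at R x\<^esub> (\<lambda>x\<in>U. \<tau> x \<oplus>\<^bsub>loc_at R x\<^esub> \<rho> x) x)"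
      "(\<lambda>x\<in>U. (\<lambda>x\<in>U. \<sigma> x \<otimes>\<^bsub>loc_at R x\<^esub> \<tau> x) x \<otimes>\<^bsub>loc_at R x\<^esub> \<rho> x)
        = (\<lambda>x\<in>U. \<sigma> x \<otimes>\<^bsub>loc_at R x\<^esub> (\<lambda>x\<in>U. \<tau> x \<otimes>\<^bsub>loc_at R x\<^esub> \<rho> x) x)"
      "(\<lambda>x\<in>U. (\<lambda>x\<in>U. \<sigma> x \<oplus>\<^bsub>loc_at R x\<^esub> \<tau> x) x \<otimes>\<^bsub>loc_at R x\<^esub> \<rho> x)
        = (\<lambda>x\<in>U. (\<lambda>x\<in>U. \<sigma> x \<otimes>\<^bsub>loc_at R x\<^esub> \<rho> x) x \<oplus>\<^bsub>loc_at R x\<^esub> (\<lambda>x\<in>U. \<tau> x \<otimes>\<^bsub>loc_at R x\<^esub> \<rho> x) x)"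
      "(\<lambda>x\<in>U. \<rho> x \<otimes>\<^bsub>loc_at R x\<^esub> (\<lambda>x\<in>U. \<sigma> x \<oplus>\<^bsub>loc_at R x\<^esub> \<tau> x) x)
        = (\<lambda>x\<in>U. (\<lambda>x\<in>U. \<rho> x \<otimes>\<^bsub>loc_at R x\<^esub> \<sigma> x) x \<oplus>\<^bsub>loc_at R x\<^esub> (\<lambda>x\<in>U. \<rho> x \<otimes>\<^bsub>loc_at R x\<^esub> \<tau> x) x)"
      using * \<rho> by (intro restrict_ext; simp add: car Q.a_assoc Q.m_assoc Q.l_distr Q.r_distr)+
  next
    fix \<sigma> assume \<sigma>: "\<sigma> \<in> local_sections R (carrier R) U"
    show "(\<lambda>x\<in>U. (\<lambda>x\<in>U. \<zero>\<^bsub>loc_at R x\<^esub>) x \<oplus>\<^bsub>loc_at R x\<^esub> \<sigma> x) = \<sigma>"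
      "(\<lambda>x\<in>U. (\<lambda>x\<in>U. \<one>\<^bsub>loc_at R x\<^esub>) x \<otimes>\<^bsub>loc_at R x\<^esub> \<sigma> x) = \<sigma>"
      "(\<lambda>x\<in>U. \<sigma> x \<otimes>\<^bsub>loc_at R x\<^esub> (\<lambda>x\<in>U. \<one>\<^bsub>loc_at R x\<^esub>) x) = \<sigma>"
      using \<sigma> by (intro eqI[OF \<sigma>]; simp add: car)+
    \<comment> \<open>The even part of a section is represented by the even components of its local
      representatives; the odd part is handled in the same way below.\<close>
    have e: "(\<lambda>x\<in>U. (fst (\<sigma> x), \<zero>\<^bsub>odd_loc R (nonvanishing R x)\<^esub>)) \<in> local_sections R (even_part R) U"
    proof (rule local_sections_map[OF \<sigma>, where f = "even_comp R"])
      fix y a assume a: "a \<in> carrier R" "\<sigma> y = loc_at_map R y a"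
      obtain b m where bm: "b \<in> even_part R" "m \<in> odd_part R" "a = b \<oplus> m" using base.decomp_ex[OF a(1)] .
      show "(fst (\<sigma> y), \<zero>\<^bsub>odd_loc R (nonvanishing R y)\<^esub>) = loc_at_map R y (even_comp R a)"
        using bm base.comps[OF bm(1,2)] loc_at_Pair(2)[OF bm(1,2), of y] a(2) by simp
    next
      fix a assume a: "a \<in> carrier R"
      obtain b m where bm: "b \<in> even_part R" "m \<in> odd_part R" "a = b \<oplus> m" using base.decomp_ex[OF a(1)] .
      show "even_comp R a \<in> even_part R" using bm base.comps by simp
    qed
    have o: "(\<lambda>x\<in>U. (\<zero>\<^bsub>ring_of (cloc (even_ring R) (nonvanishing R x))\<^esub>, snd (\<sigma> x))) \<in> local_sections R (odd_part R) U"
    proof (rule local_sections_map[OF \<sigma>, where f = "odd_comp R"])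
      fix y a assume a: "a \<in> carrier R" "\<sigma> y = loc_at_map R y a"
      obtain b m where bm: "b \<in> even_part R" "m \<in> odd_part R" "a = b \<oplus> m" using base.decomp_ex[OF a(1)] .
      show "(\<zero>\<^bsub>ring_of (cloc (even_ring R) (nonvanishing R y))\<^esub>, snd (\<sigma> y)) = loc_at_map R y (odd_comp R a)"
        using bm base.comps[OF bm(1,2)] loc_at_Pair(3)[OF bm(1,2), of y] a(2) by simp
    next
      fix a assume a: "a \<in> carrier R"
      obtain b m where bm: "b \<in> even_part R" "m \<in> odd_part R" "a = b \<oplus> m" using base.decomp_ex[OF a(1)] .
      show "odd_comp R a \<in> odd_part R" using bm base.comps by simp
    qed
    have "\<sigma> x = (fst (\<sigma> x), \<zero>\<^bsub>odd_loc R (nonvanishing R x)\<^esub>) \<oplus>\<^bsub>loc_at R x\<^esub>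
      (\<zero>\<^bsub>ring_of (cloc (even_ring R) (nonvanishing R x))\<^esub>, snd (\<sigma> x))" if "x \<in> U" for x
    proof -
      interpret l: superloc R "nonvanishing R x" by (rule superloc_nonvanishing)
      have "\<sigma> x \<in> carrier l.A \<times> carrier (odd_loc R (nonvanishing R x))"
        using car(1)[OF \<sigma> that] unfolding l.Q_simps(1) .
      then show ?thesis
        unfolding l.Q_simps(3) l.A_def[symmetric] by (simp add: mem_Times_iff l.T_laws(8,9,10))
    qed
    then show "\<exists>b\<in>local_sections R (even_part R) U. \<exists>m\<in>local_sections R (odd_part R) U.
        \<sigma> = (\<lambda>x\<in>U. b x \<oplus>\<^bsub>loc_at R x\<^esub> m x)"
      by (intro bexI[OF _ e] bexI[OF _ o] eqI[OF \<sigma>, symmetric]) simp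
  next
    show "local_sections R (even_part R) U \<subseteq> local_sections R (carrier R) U"
      "local_sections R (odd_part R) U \<subseteq> local_sections R (carrier R) U"
      by (intro local_sections_mono even_subset odd_subset)+
  next
    fix \<sigma> assume \<sigma>: "\<sigma> \<in> local_sections R (even_part R) U" "\<sigma> \<in> local_sections R (odd_part R) U"
    have "\<sigma> x = \<zero>\<^bsub>loc_at R x\<^esub>" if "x \<in> U" for x
      using Q.even_odd_zero local_sections_in(2)[OF \<sigma>(1) that] local_sections_in(3)[OF \<sigma>(2) that] by blast
    then show "\<sigma> = (\<lambda>x\<in>U. \<zero>\<^bsub>loc_at R x\<^esub>)" by (intro eqI[OF \<sigma>(1), symmetric]) simp
  next
    show "(\<lambda>x\<in>U. \<zero>\<^bsub>loc_at R x\<^esub>) \<in> local_sections R (even_part R) U"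
      "(\<lambda>x\<in>U. \<zero>\<^bsub>loc_at R x\<^esub>) \<in> local_sections R (odd_part R) U"
      by (rule zero; simp)+
    show "(\<lambda>x\<in>U. \<one>\<^bsub>loc_at R x\<^esub>) \<in> local_sections R (even_part R) U"
      using U one_even by (rule local_sections_const) (simp add: loc_simps(4))
  next
    fix \<sigma> \<tau> assume *: "\<sigma> \<in> local_sections R (even_part R) U" "\<tau> \<in> local_sections R (even_part R) U"
    show "(\<lambda>x\<in>U. \<sigma> x \<oplus>\<^bsub>loc_at R x\<^esub> \<tau> x) \<in> local_sections R (even_part R) U"
      using * even_subset by (rule local_sections_add) auto
    show "(\<lambda>x\<in>U. \<sigma> x \<otimes>\<^bsub>loc_at R x\<^esub> \<tau> x) \<in> local_sections R (even_part R) U"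
      using * even_subset even_subset by (rule local_sections_mult) auto
    show "(\<lambda>x\<in>U. sop (loc_at R x) (\<lambda>x. x 0 + x 1) (map (\<lambda>\<sigma>. \<sigma> x) [\<sigma>, \<tau>])) = (\<lambda>x\<in>U. \<sigma> x \<oplus>\<^bsub>loc_at R x\<^esub> \<tau> x)"
      "(\<lambda>x\<in>U. sop (loc_at R x) (\<lambda>x. x 0 * x 1) (map (\<lambda>\<sigma>. \<sigma> x) [\<sigma>, \<tau>])) = (\<lambda>x\<in>U. \<sigma> x \<otimes>\<^bsub>loc_at R x\<^esub> \<tau> x)"
      using local_sections_in(2)[OF *(1)] local_sections_in(2)[OF *(2)]
      by (auto intro!: restrict_ext Q.sop_add Q.sop_mult simp del: One_nat_def)
  next
    fix \<sigma> \<tau> assume *: "\<sigma> \<in> local_sections R (odd_part R) U" "\<tau> \<in> local_sections R (odd_part R) U"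
    show "(\<lambda>x\<in>U. \<sigma> x \<oplus>\<^bsub>loc_at R x\<^esub> \<tau> x) \<in> local_sections R (odd_part R) U"
      using * odd_subset by (rule local_sections_add) auto
    show "(\<lambda>x\<in>U. \<sigma> x \<otimes>\<^bsub>loc_at R x\<^esub> \<tau> x) \<in> local_sections R (even_part R) U"
      using * odd_subset odd_subset by (rule local_sections_mult) auto
    show "(\<lambda>x\<in>U. (\<lambda>x\<in>U. \<sigma> x \<otimes>\<^bsub>loc_at R x\<^esub> \<tau> x) x \<oplus>\<^bsub>loc_at R x\<^esub> (\<lambda>x\<in>U. \<tau> x \<otimes>\<^bsub>loc_at R x\<^esub> \<sigma> x) x)
        = (\<lambda>x\<in>U. \<zero>\<^bsub>loc_at R x\<^esub>)"
    proof (intro restrict_ext)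
      fix x assume x: "x \<in> U"
      have "\<sigma> x \<in> odd_part (loc_at R x)" "\<tau> x \<in> odd_part (loc_at R x)"
        using local_sections_in(3)[OF *(1) x] local_sections_in(3)[OF *(2) x] by blast+
      then show "(\<lambda>x\<in>U. \<sigma> x \<otimes>\<^bsub>loc_at R x\<^esub> \<tau> x) x \<oplus>\<^bsub>loc_at R x\<^esub> (\<lambda>x\<in>U. \<tau> x \<otimes>\<^bsub>loc_at R x\<^esub> \<sigma> x) x = \<zero>\<^bsub>loc_at R x\<^esub>"
        using x Q.odd_anticomm[of "\<sigma> x" x "\<tau> x"] by (simp add: Q.l_neg)
    qed
  next
    fix \<sigma> \<tau> assume *: "\<sigma> \<in> local_sections R (even_part R) U" "\<tau> \<in> local_sections R (odd_part R) U"
    show "(\<lambda>x\<in>U. \<sigma> x \<otimes>\<^bsub>loc_at R x\<^esub> \<tau> x) \<in> local_sections R (odd_part R) U"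
      using * even_subset odd_subset by (rule local_sections_mult) auto
  next
    fix \<sigma> \<tau> assume *: "\<sigma> \<in> local_sections R (even_part R) U" "\<tau> \<in> local_sections R (carrier R) U"
    show "(\<lambda>x\<in>U. \<sigma> x \<otimes>\<^bsub>loc_at R x\<^esub> \<tau> x) = (\<lambda>x\<in>U. \<tau> x \<otimes>\<^bsub>loc_at R x\<^esub> \<sigma> x)"
      using local_sections_in(2)[OF *(1)] local_sections_in(1)[OF *(2)]
      by (intro restrict_ext Q.even_commute) auto
  next
    fix \<sigma> assume "\<sigma> \<in> local_sections R (even_part R) U"
    then show "\<exists>b\<in>local_sections R (even_part R) U. (\<lambda>x\<in>U. b x \<oplus>\<^bsub>loc_at R x\<^esub> \<sigma> x) = (\<lambda>x\<in>U. \<zero>\<^bsub>loc_at R x\<^esub>)"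
      by (rule neg[OF _ even_subset]) simp
  next
    fix \<sigma> assume "\<sigma> \<in> local_sections R (odd_part R) U"
    then show "\<exists>b\<in>local_sections R (odd_part R) U. (\<lambda>x\<in>U. b x \<oplus>\<^bsub>loc_at R x\<^esub> \<sigma> x) = (\<lambda>x\<in>U. \<zero>\<^bsub>loc_at R x\<^esub>)"
      by (rule neg[OF _ odd_subset]) simp
  next
    fix f \<sigma>s assume *: "set \<sigma>s \<subseteq> local_sections R (even_part R) U" "f \<in> Cinf (length \<sigma>s)"
    show "(\<lambda>x\<in>U. sop (loc_at R x) f (map (\<lambda>\<sigma>. \<sigma> x) \<sigma>s)) \<in> local_sections R (even_part R) U"
      by (rule local_sections_list_map[OF *(1) U, where f = "sop R f"]) (use *(2) loc_sop in auto)
  next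
    fix i \<sigma>s assume *: "set \<sigma>s \<subseteq> local_sections R (even_part R) U" "i < length \<sigma>s"
    then have "\<sigma>s ! i \<in> local_sections R (even_part R) U" by auto
    moreover have "sop (loc_at R x) (\<lambda>x. x i) (map (\<lambda>\<sigma>. \<sigma> x) \<sigma>s) = (\<sigma>s ! i) x" if "x \<in> U" for x
      using Q.sop_proj[of "map (\<lambda>\<sigma>. \<sigma> x) \<sigma>s" x i] * local_sections_in(2)[OF _ that] by fastforce
    ultimately show "(\<lambda>x\<in>U. sop (loc_at R x) (\<lambda>x. x i) (map (\<lambda>\<sigma>. \<sigma> x) \<sigma>s)) = \<sigma>s ! i"
      by (intro eqI)
  next
    fix g hs \<sigma>s
    assume *: "set \<sigma>s \<subseteq> local_sections R (even_part R) U" "g \<in> Cinf (length hs)" "set hs \<subseteq> Cinf (length \<sigma>s)"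
    show "(\<lambda>x\<in>U. sop (loc_at R x) (\<lambda>x. g (\<lambda>i. (hs ! i) x)) (map (\<lambda>\<sigma>. \<sigma> x) \<sigma>s))
      = (\<lambda>x\<in>U. sop (loc_at R x) g (map (\<lambda>\<sigma>. \<sigma> x) (map (\<lambda>h. \<lambda>x\<in>U. sop (loc_at R x) h (map (\<lambda>\<sigma>. \<sigma> x) \<sigma>s)) hs)))"
    proof (intro restrict_ext)
      fix x assume x: "x \<in> U"
      then have "set (map (\<lambda>\<sigma>. \<sigma> x) \<sigma>s) \<subseteq> even_part (loc_at R x)"
        using * local_sections_in(2)[OF _ x] by auto
      from Q.sop_comp[OF this *(2)] *(3) x
      show "sop (loc_at R x) (\<lambda>x. g (\<lambda>i. (hs ! i) x)) (map (\<lambda>\<sigma>. \<sigma> x) \<sigma>s)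
        = sop (loc_at R x) g (map (\<lambda>\<sigma>. \<sigma> x) (map (\<lambda>h. \<lambda>x\<in>U. sop (loc_at R x) h (map (\<lambda>\<sigma>. \<sigma> x) \<sigma>s)) hs))"
        by (simp add: o_def)
    qed
  next
    show "(\<lambda>x\<in>U. sop (loc_at R x) (\<lambda>_. 0) (map (\<lambda>\<sigma>. \<sigma> x) [])) = (\<lambda>x\<in>U. \<zero>\<^bsub>loc_at R x\<^esub>)"
      "(\<lambda>x\<in>U. sop (loc_at R x) (\<lambda>_. 1) (map (\<lambda>\<sigma>. \<sigma> x) [])) = (\<lambda>x\<in>U. \<one>\<^bsub>loc_at R x\<^esub>)"
      by (simp_all add: Q.sop_zero Q.sop_one)
  qed
qed

lemma sSpec_simps [simp]: "topo (sSpec R) = points_topology R" "sec (sSpec R) = sSpec_sec R"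
  by (simp_all add: sSpec_def)

lemma sSpec_res: "\<sigma> \<in> local_sections R (carrier R) U \<Longrightarrow> res (sSpec R) U V \<sigma> = restrict \<sigma> V"
  by (simp add: sSpec_def sSpec_sec_simps)

lemma local_sections_restrict:
  assumes "\<sigma> \<in> local_sections R A U" "openin (points_topology R) V" "V \<subseteq> U"
  shows "restrict \<sigma> V \<in> local_sections R A V"
proof (rule local_sectionsI)
  fix x assume x: "x \<in> V"
  then have "x \<in> U" using assms by auto
  with assms(1) obtain W a where W: "openin (points_topology R) W" "x \<in> W" "W \<subseteq> U" "a \<in> A"
    "\<forall>y\<in>W. \<sigma> y = loc_at_map R y a" by (rule local_sectionsD)
  then show "\<exists>W a. openin (points_topology R) W \<and> x \<in> W \<and> W \<subseteq> V \<and>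
     a \<in> A \<and> (\<forall>y\<in>W. restrict \<sigma> V y = loc_at_map R y a)"
    using x assms(2) by (intro exI[of _ "V \<inter> W"] exI[of _ a]) auto
qed simp

text \<open>Restriction is restriction of functions. So locality is equality of values, gluing is
  the union of compatible functions, and being induced by a ring element near each point is a local
  condition.\<close>

theorem sSpec_sheaf: "csring_sheaf (sSpec R)"
proof (rule csring_sheaf.intro)
  show "cinf_superring (sec (sSpec R) U)" if "openin (topo (sSpec R)) U" for U
    using that by (simp add: sSpec_sec_superring)
  show "res (sSpec R) U V \<in> csring_hom (sec (sSpec R) U) (sec (sSpec R) V)"
    if "openin (topo (sSpec R)) U" "openin (topo (sSpec R)) V" "V \<subseteq> U" for U V
  proof (rule csring_homI)
    have o: "openin (points_topology R) V" "openin (points_topology R) U" using that by simp_all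
    interpret S: cinf_superring "sSpec_sec R U" by (rule sSpec_sec_superring[OF o(2)])
    show "cinf_superring (sec (sSpec R) U)" "cinf_superring (sec (sSpec R) V)"
      using o by (simp_all add: sSpec_sec_superring)
    show "res (sSpec R) U V \<in> extensional (carrier (sec (sSpec R) U))" by (simp add: sSpec_def)
    have c: "restrict \<sigma> V \<in> local_sections R A V" if "\<sigma> \<in> local_sections R A U" for A \<sigma>
      using local_sections_restrict[OF that o(1)] \<open>V \<subseteq> U\<close> by simp
    have r: "res (sSpec R) U V \<sigma> = restrict \<sigma> V" if "\<sigma> \<in> carrier (sSpec_sec R U)" for \<sigma>
      using that by (simp add: sSpec_def)
    show "res (sSpec R) U V \<sigma> \<in> carrier (sec (sSpec R) V)" if "\<sigma> \<in> carrier (sec (sSpec R) U)" for \<sigma>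
      using that c[of \<sigma> "carrier R"] by (simp add: r) (simp add: sSpec_sec_simps)
    have inter: "V \<inter> U = V" "U \<inter> V = V" using \<open>V \<subseteq> U\<close> by auto
    fix \<sigma> \<tau> assume st: "\<sigma> \<in> carrier (sec (sSpec R) U)" "\<tau> \<in> carrier (sec (sSpec R) U)"
    then show "res (sSpec R) U V (\<sigma> \<oplus>\<^bsub>sec (sSpec R) U\<^esub> \<tau>) = res (sSpec R) U V \<sigma> \<oplus>\<^bsub>sec (sSpec R) V\<^esub> res (sSpec R) U V \<tau>"
      "res (sSpec R) U V (\<sigma> \<otimes>\<^bsub>sec (sSpec R) U\<^esub> \<tau>) = res (sSpec R) U V \<sigma> \<otimes>\<^bsub>sec (sSpec R) V\<^esub> res (sSpec R) U V \<tau>"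
      using S.a_closed[of \<sigma> \<tau>] S.m_closed[of \<sigma> \<tau>]
      by (simp_all add: r) (auto simp: sSpec_sec_simps(4,5) inter intro!: restrict_ext)
  next
    have o: "openin (points_topology R) V" "openin (points_topology R) U" using that by simp_all
    interpret S: cinf_superring "sSpec_sec R U" by (rule sSpec_sec_superring[OF o(2)])
    have c: "restrict \<sigma> V \<in> local_sections R A V" if "\<sigma> \<in> local_sections R A U" for A \<sigma>
      using local_sections_restrict[OF that o(1)] \<open>V \<subseteq> U\<close> by simp
    have r: "res (sSpec R) U V \<sigma> = restrict \<sigma> V" if "\<sigma> \<in> carrier (sSpec_sec R U)" for \<sigma>
      using that by (simp add: sSpec_def)
    have inter: "V \<inter> U = V" "U \<inter> V = V" using \<open>V \<subseteq> U\<close> by auto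
    show "res (sSpec R) U V \<one>\<^bsub>sec (sSpec R) U\<^esub> = \<one>\<^bsub>sec (sSpec R) V\<^esub>"
      using S.one_closed by (simp add: r) (simp add: sSpec_sec_simps inter)
    show "res (sSpec R) U V \<sigma> \<in> even_part (sec (sSpec R) V)" if "\<sigma> \<in> even_part (sec (sSpec R) U)" for \<sigma>
      using that c[of \<sigma> "even_part R"] by (simp add: r) (simp add: sSpec_sec_simps)
    show "res (sSpec R) U V \<sigma> \<in> odd_part (sec (sSpec R) V)" if "\<sigma> \<in> odd_part (sec (sSpec R) U)" for \<sigma>
      using that c[of \<sigma> "odd_part R"] by (simp add: r) (simp add: sSpec_sec_simps)
    fix f \<sigma>s assume *: "set \<sigma>s \<subseteq> even_part (sec (sSpec R) U)" "f \<in> Cinf (length \<sigma>s)"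
    have m: "map (res (sSpec R) U V) \<sigma>s = map (\<lambda>\<sigma>. restrict \<sigma> V) \<sigma>s"
      using * by (auto intro!: r)
    have "sop (sSpec_sec R U) f \<sigma>s \<in> carrier (sSpec_sec R U)" using * by simp
    then have "res (sSpec R) U V (sop (sSpec_sec R U) f \<sigma>s) = restrict (sop (sSpec_sec R U) f \<sigma>s) V" by (rule r)
    also have "\<dots> = sop (sSpec_sec R V) f (map (\<lambda>\<sigma>. restrict \<sigma> V) \<sigma>s)"
      unfolding sSpec_sec_simps(8) using \<open>V \<subseteq> U\<close> by (auto simp: inter o_def intro!: restrict_ext)
    finally show "res (sSpec R) U V (sop (sec (sSpec R) U) f \<sigma>s)
      = sop (sec (sSpec R) V) f (map (res (sSpec R) U V) \<sigma>s)" unfolding m by simp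
  qed
  show "res (sSpec R) U U s = s" if "openin (topo (sSpec R)) U" "s \<in> carrier (sec (sSpec R) U)" for U s
    using that by (simp add: sSpec_sec_simps sSpec_res) (simp add: local_sections_def extensional_restrict)
  show "res (sSpec R) V W (res (sSpec R) U V s) = res (sSpec R) U W s"
    if "openin (topo (sSpec R)) U" "openin (topo (sSpec R)) V" "openin (topo (sSpec R)) W" "W \<subseteq> V" "V \<subseteq> U"
      "s \<in> carrier (sec (sSpec R) U)" for U V W s
  proof -
    have s: "s \<in> local_sections R (carrier R) U" using that by (simp add: sSpec_sec_simps)
    moreover have "restrict s V \<in> local_sections R (carrier R) V"
      using local_sections_restrict[OF s] that by simp
    ultimately show ?thesis using \<open>W \<subseteq> V\<close> by (simp add: sSpec_res Int_absorb1)
  qed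
  show "s = t" if "\<And>V. V \<in> \<V> \<Longrightarrow> openin (topo (sSpec R)) V" "s \<in> carrier (sec (sSpec R) (\<Union>\<V>))"
    "t \<in> carrier (sec (sSpec R) (\<Union>\<V>))" and eq: "\<And>V. V \<in> \<V> \<Longrightarrow> res (sSpec R) (\<Union>\<V>) V s = res (sSpec R) (\<Union>\<V>) V t"
    for \<V> s t
  proof (rule local_sections_ext)
    show st: "s \<in> local_sections R (carrier R) (\<Union>\<V>)" "t \<in> local_sections R (carrier R) (\<Union>\<V>)"
      using that by (simp_all add: sSpec_sec_simps)
    fix x assume "x \<in> \<Union>\<V>"
    then obtain V where V: "V \<in> \<V>" "x \<in> V" by blast
    have "restrict s V = restrict t V" using eq[OF V(1)] st by (simp add: sSpec_res)
    from fun_cong[OF this, of x] show "s x = t x" using V by simp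
  qed
  show "\<exists>t\<in>carrier (sec (sSpec R) (\<Union>\<V>)). \<forall>V\<in>\<V>. res (sSpec R) (\<Union>\<V>) V t = \<sigma> V"
    if o: "\<And>V. V \<in> \<V> \<Longrightarrow> openin (topo (sSpec R)) V" and sc: "\<And>V. V \<in> \<V> \<Longrightarrow> \<sigma> V \<in> carrier (sec (sSpec R) V)"
      and cmp: "\<And>V W. \<lbrakk>V \<in> \<V>; W \<in> \<V>\<rbrakk> \<Longrightarrow> res (sSpec R) V (V \<inter> W) (\<sigma> V) = res (sSpec R) W (V \<inter> W) (\<sigma> W)"
    for \<V> \<sigma>
  proof -
    have s: "\<sigma> V \<in> local_sections R (carrier R) V" if "V \<in> \<V>" for V
      using sc[OF that] by (simp add: sSpec_sec_simps)
    define t where "t = (\<lambda>x\<in>\<Union>\<V>. \<sigma> (SOME V. V \<in> \<V> \<and> x \<in> V) x)"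
    have t: "t x = \<sigma> V x" if V: "V \<in> \<V>" "x \<in> V" for V x
    proof -
      define W where "W = (SOME V. V \<in> \<V> \<and> x \<in> V)"
      have W: "W \<in> \<V> \<and> x \<in> W" unfolding W_def by (rule someI[of _ V]) (use V in simp)
      have "restrict (\<sigma> V) (V \<inter> W) = restrict (\<sigma> W) (V \<inter> W)"
        using cmp[of V W] V W s by (simp add: sSpec_res)
      from fun_cong[OF this, of x] have "\<sigma> V x = \<sigma> W x" using V W by simp
      then show ?thesis using V unfolding t_def W_def by auto
    qed
    have tl: "t \<in> local_sections R (carrier R) (\<Union>\<V>)"
    proof (rule local_sectionsI)
      fix x assume "x \<in> \<Union>\<V>"
      then obtain V where V: "V \<in> \<V>" "x \<in> V" by blast
      from s[OF V(1)] V(2) obtain W a where W: "openin (points_topology R) W" "x \<in> W" "W \<subseteq> V" "a \<in> carrier R"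
        "\<forall>y\<in>W. \<sigma> V y = loc_at_map R y a" by (rule local_sectionsD)
      then show "\<exists>V a. openin (points_topology R) V \<and> x \<in> V \<and> V \<subseteq> \<Union>\<V> \<and>
         a \<in> carrier R \<and> (\<forall>y\<in>V. t y = loc_at_map R y a)"
        using V t by (intro exI[of _ W] exI[of _ a]) auto
    qed (simp add: t_def)
    moreover have "restrict t V = \<sigma> V" if "V \<in> \<V>" for V
      using s[OF that] t[OF that] by (intro extensionalityI[of _ V]) (auto simp: local_sections_def)
    ultimately show ?thesis by (intro bexI[of _ t]) (auto simp: sSpec_res sSpec_sec_simps)
  qed
qed

end

section \<open>Stalks\<close>

context csring_sheaf begin

lemma superring_res:
  assumes "openin (topo X) U" "openin (topo X) V" "V \<subseteq> U"
  shows "s \<in> carrier (sec X U) \<Longrightarrow> res X U V s \<in> carrier (sec X V)"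
    "s \<in> even_part (sec X U) \<Longrightarrow> res X U V s \<in> even_part (sec X V)"
    "s \<in> odd_part (sec X U) \<Longrightarrow> res X U V s \<in> odd_part (sec X V)"
  using csring_homD(3,7,8)[OF res_hom[OF assms]] by blast+

text \<open>Treats germs of arbitrary, even and odd sections uniformly.\<close>

definition stable :: "('s csring \<Rightarrow> 's set) \<Rightarrow> bool" where
  "stable P \<longleftrightarrow> (\<forall>U. openin (topo X) U \<longrightarrow> P (sec X U) \<subseteq> carrier (sec X U)) \<and>
    (\<forall>U V s. openin (topo X) U \<longrightarrow> openin (topo X) V \<longrightarrow> V \<subseteq> U \<longrightarrow> s \<in> P (sec X U) \<longrightarrow> res X U V s \<in> P (sec X V))"

lemma stable: "stable carrier" "stable even_part" "stable odd_part"
proof -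
  have "even_part (sec X U) \<subseteq> carrier (sec X U)" "odd_part (sec X U) \<subseteq> carrier (sec X U)"
    if "openin (topo X) U" for U
  proof -
    interpret cinf_superring "sec X U" by (rule sec_csring[OF that])
    show "even_part (sec X U) \<subseteq> carrier (sec X U)" "odd_part (sec X U) \<subseteq> carrier (sec X U)"
      by (rule even_subset odd_subset)+
  qed
  then show "stable carrier" "stable even_part" "stable odd_part"
    unfolding stable_def using superring_res by blast+
qed

lemma stableD:
  assumes "stable P" "openin (topo X) U" "s \<in> P (sec X U)"
  shows "s \<in> carrier (sec X U)" "\<lbrakk>openin (topo X) V; V \<subseteq> U\<rbrakk> \<Longrightarrow> res X U V s \<in> P (sec X V)"
  using assms unfolding stable_def by blast+

text \<open>\<open>germ\<close> is the class of a section under agreement near \<open>x\<close>;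
  transitivity comes from intersecting the two neighbourhoods of agreement.\<close>

lemma germ_eq:
  assumes U: "openin (topo X) U" "x \<in> U" "s \<in> carrier (sec X U)"
    and V: "openin (topo X) V" "x \<in> V" "t \<in> carrier (sec X V)"
  shows "germ X x U s = germ X x V t \<longleftrightarrow>
    (\<exists>W. openin (topo X) W \<and> x \<in> W \<and> W \<subseteq> U \<inter> V \<and> res X U W s = res X V W t)" (is "?L \<longleftrightarrow> ?R")
proof
  assume ?L
  moreover have "(V, t) \<in> germ X x V t" unfolding germ_def using V by auto
  ultimately have "(V, t) \<in> germ X x U s" by simp
  then show ?R unfolding germ_def by blast
next
  have sub: "germ X x V' t' \<subseteq> germ X x U' s'"
    if U: "openin (topo X) U'" "s' \<in> carrier (sec X U')"
    and V: "openin (topo X) V'" "t' \<in> carrier (sec X V')"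
    and W: "openin (topo X) W" "x \<in> W" "W \<subseteq> U' \<inter> V'" "res X U' W s' = res X V' W t'" for U' V' W s' t'
  proof
    fix z assume "z \<in> germ X x V' t'"
    then obtain V'' t'' W' where z: "z = (V'', t'')" "openin (topo X) V''" "x \<in> V''" "t'' \<in> carrier (sec X V'')"
      "openin (topo X) W'" "x \<in> W'" "W' \<subseteq> V' \<inter> V''" "res X V' W' t' = res X V'' W' t''"
      unfolding germ_def by blast
    have o: "openin (topo X) (W \<inter> W')" using W(1) z(5) by auto
    have WU: "W \<subseteq> U'" and WV: "W \<subseteq> V'" using W(3) by auto
    have "res X U' (W \<inter> W') s' = res X W (W \<inter> W') (res X U' W s')"
      by (rule res_res[OF U(1) W(1) o _ WU U(2), symmetric]) simp
    also have "\<dots> = res X V' (W \<inter> W') t'"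
      unfolding W(4) by (rule res_res[OF V(1) W(1) o _ WV V(2)]) simp
    also have "\<dots> = res X W' (W \<inter> W') (res X V' W' t')"
      by (rule res_res[OF V(1) z(5) o _ _ V(2), symmetric]) (use z(7) in auto)
    also have "\<dots> = res X V'' (W \<inter> W') t''"
      unfolding z(8) by (rule res_res[OF z(2,5) o _ _ z(4)]) (use z(7) in auto)
    finally have "res X U' (W \<inter> W') s' = res X V'' (W \<inter> W') t''" .
    moreover have "x \<in> W \<inter> W'" "W \<inter> W' \<subseteq> U' \<inter> V''" using W z by auto
    ultimately show "z \<in> germ X x U' s'" unfolding germ_def z(1) using z(2-4) o by blast
  qed
  assume ?R
  then obtain W where W: "openin (topo X) W" "x \<in> W" "W \<subseteq> U \<inter> V" "res X U W s = res X V W t" by blast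
  show ?L
  proof (rule equalityI)
    show "germ X x U s \<subseteq> germ X x V t" by (rule sub[OF V(1,3) U(1,3) W(1,2)]) (use W in auto)
    show "germ X x V t \<subseteq> germ X x U s" by (rule sub[OF U(1,3) V(1,3) W])
  qed
qed

lemma germ_res:
  assumes "openin (topo X) U" "openin (topo X) V" "V \<subseteq> U" "x \<in> V" "s \<in> carrier (sec X U)"
  shows "germ X x V (res X U V s) = germ X x U s"
  using assms superring_res(1)[OF assms(1-3,5)] res_id
  by (subst germ_eq) (auto intro!: exI[of _ V])

lemma germs_list_rep:
  assumes P: "stable P" and x: "x \<in> topspace (topo X)" and "set gs \<subseteq> germs X x P"
  shows "\<exists>U ss. openin (topo X) U \<and> x \<in> U \<and> set ss \<subseteq> P (sec X U) \<and> gs = map (germ X x U) ss"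
  using assms(3)
proof (induction gs)
  case Nil
  then show ?case using x by (intro exI[of _ "topspace (topo X)"] exI[of _ "[]"]) auto
next
  case (Cons g gs)
  then obtain U ss where U: "openin (topo X) U" "x \<in> U" "set ss \<subseteq> P (sec X U)" "gs = map (germ X x U) ss" by auto
  obtain V t where V: "openin (topo X) V" "x \<in> V" "t \<in> P (sec X V)" "g = germ X x V t"
    using Cons.prems by (auto simp: germs_def)
  have o: "openin (topo X) (U \<inter> V)" using U V by auto
  have "germ X x (U \<inter> V) (res X V (U \<inter> V) t) = g"
    unfolding V(4) using V U stableD(1)[OF P V(1,3)] by (intro germ_res o) auto
  moreover have "map (germ X x (U \<inter> V)) (map (res X U (U \<inter> V)) ss) = gs"
    unfolding U(4) map_map o_def
    by (rule map_cong[OF refl], rule germ_res[OF U(1) o]) (use U V stableD(1)[OF P U(1)] in auto)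
  moreover have "set (res X V (U \<inter> V) t # map (res X U (U \<inter> V)) ss) \<subseteq> P (sec X (U \<inter> V))"
    using stableD(2)[OF P V(1,3) o] stableD(2)[OF P U(1) _ o] U(3) by auto
  ultimately show ?case
    using U V o by (intro exI[of _ "U \<inter> V"] exI[of _ "res X V (U \<inter> V) t # map (res X U (U \<inter> V)) ss"]) auto
qed

text \<open>A finite intersection gives one neighbourhood that works for all entries, as needed for
  operations of arbitrary arity.\<close>

lemma germ_map_eq:
  assumes "openin (topo X) U" "x \<in> U" "set ss \<subseteq> carrier (sec X U)"
    and "openin (topo X) V" "x \<in> V" "set ts \<subseteq> carrier (sec X V)"
    and "map (germ X x U) ss = map (germ X x V) ts"
  shows "\<exists>W. openin (topo X) W \<and> x \<in> W \<and> W \<subseteq> U \<inter> V \<and> map (res X U W) ss = map (res X V W) ts"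
  using assms(3,6,7)
proof (induction ss arbitrary: ts)
  case Nil
  then show ?case using assms by (intro exI[of _ "U \<inter> V"]) auto
next
  case (Cons s ss)
  then obtain t ts' where ts: "ts = t # ts'" by (cases ts) auto
  with Cons obtain W where W: "openin (topo X) W" "x \<in> W" "W \<subseteq> U \<inter> V" "map (res X U W) ss = map (res X V W) ts'"
    by auto metis
  have st: "s \<in> carrier (sec X U)" "t \<in> carrier (sec X V)" "germ X x U s = germ X x V t"
    using Cons.prems ts by auto
  then obtain W' where W': "openin (topo X) W'" "x \<in> W'" "W' \<subseteq> U \<inter> V" "res X U W' s = res X V W' t"
    using germ_eq[OF assms(1,2) st(1) assms(4,5) st(2)] by blast
  define Z where "Z = W \<inter> W'"
  have Z: "openin (topo X) Z" "x \<in> Z" "Z \<subseteq> U \<inter> V" "Z \<subseteq> W" "Z \<subseteq> W'" using W W' by (auto simp: Z_def)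
  have UV: "W \<subseteq> U" "W \<subseteq> V" "W' \<subseteq> U" "W' \<subseteq> V" using W(3) W'(3) by auto
  have "res X U Z s = res X V Z t"
    using arg_cong[OF W'(4), of "res X W' Z"] res_res[OF assms(1) W'(1) Z(1,5) UV(3) st(1)]
      res_res[OF assms(4) W'(1) Z(1,5) UV(4) st(2)] by simp
  moreover have "map (res X U Z) ss = map (res X V Z) ts'"
  proof -
    have "map (res X U Z) ss = map (res X W Z) (map (res X U W) ss)"
      using res_res[OF assms(1) W(1) Z(1,4) UV(1)] Cons.prems(1) by auto
    also have "\<dots> = map (res X V Z) ts'"
      unfolding W(4) using res_res[OF assms(4) W(1) Z(1,4) UV(2)] Cons.prems(2) ts by auto
    finally show ?thesis .
  qed
  ultimately show ?case using Z ts by (intro exI[of _ Z]) auto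
qed

text \<open>Justifies the definite description in \<open>germ_op\<close>: two lists of
  representatives agree after restriction to a common neighbourhood, and \<open>F\<close> commutes
  with restriction.\<close>

lemma germ_op_eq:
  assumes P: "stable P" and U: "openin (topo X) U" "x \<in> U" "set ss \<subseteq> P (sec X U)"
    and closed: "\<And>V ts. \<lbrakk>openin (topo X) V; set ts \<subseteq> P (sec X V); length ts = length ss\<rbrakk> \<Longrightarrow> F (sec X V) ts \<in> carrier (sec X V)"
    and nat: "\<And>V W ts. \<lbrakk>openin (topo X) V; openin (topo X) W; W \<subseteq> V; set ts \<subseteq> P (sec X V); length ts = length ss\<rbrakk>
      \<Longrightarrow> res X V W (F (sec X V) ts) = F (sec X W) (map (res X V W) ts)"
  shows "germ_op X x P F (map (germ X x U) ss) = germ X x U (F (sec X U) ss)"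
  unfolding germ_op_def
proof (rule the_equality)
  show "\<exists>V ts. openin (topo X) V \<and> x \<in> V \<and> set ts \<subseteq> P (sec X V) \<and> map (germ X x U) ss = map (germ X x V) ts \<and>
      germ X x U (F (sec X U) ss) = germ X x V (F (sec X V) ts)"
    using U by blast
  fix g assume "\<exists>V ts. openin (topo X) V \<and> x \<in> V \<and> set ts \<subseteq> P (sec X V) \<and> map (germ X x U) ss = map (germ X x V) ts \<and>
      g = germ X x V (F (sec X V) ts)"
  then obtain V ts where V: "openin (topo X) V" "x \<in> V" "set ts \<subseteq> P (sec X V)"
    "map (germ X x U) ss = map (germ X x V) ts" "g = germ X x V (F (sec X V) ts)" by blast
  have l: "length ts = length ss" using V(4) by (metis length_map)
  obtain W where W: "openin (topo X) W" "x \<in> W" "W \<subseteq> U \<inter> V" "map (res X U W) ss = map (res X V W) ts"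
    using germ_map_eq[OF U(1,2) _ V(1,2) _ V(4)] U(3) V(3) stableD(1)[OF P U(1)] stableD(1)[OF P V(1)] by blast
  have "res X U W (F (sec X U) ss) = res X V W (F (sec X V) ts)"
    using nat[OF U(1) W(1) _ U(3)] nat[OF V(1) W(1) _ V(3) l] W by simp
  then show "g = germ X x U (F (sec X U) ss)"
    unfolding V(5) using W closed[OF V(1,3) l] closed[OF U(1,3)]
    by (subst germ_eq[OF V(1,2) _ U(1,2)]) (auto intro!: exI[of _ W])
qed

section \<open>The superring structure of a stalk\<close>

lemma stalk_parts:
  "carrier (stalk X x) = germs X x carrier" "even_part (stalk X x) = germs X x even_part"
  "odd_part (stalk X x) = germs X x odd_part"
  by (simp_all add: stalk_def)

lemma stalk_simps:
  assumes U: "openin (topo X) U" "x \<in> U"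
  shows "\<lbrakk>s \<in> carrier (sec X U); t \<in> carrier (sec X U)\<rbrakk> \<Longrightarrow>
      germ X x U s \<oplus>\<^bsub>stalk X x\<^esub> germ X x U t = germ X x U (s \<oplus>\<^bsub>sec X U\<^esub> t)"
    "\<lbrakk>s \<in> carrier (sec X U); t \<in> carrier (sec X U)\<rbrakk> \<Longrightarrow>
      germ X x U s \<otimes>\<^bsub>stalk X x\<^esub> germ X x U t = germ X x U (s \<otimes>\<^bsub>sec X U\<^esub> t)"
    "\<one>\<^bsub>stalk X x\<^esub> = germ X x U \<one>\<^bsub>sec X U\<^esub>"
    "\<zero>\<^bsub>stalk X x\<^esub> = germ X x U \<zero>\<^bsub>sec X U\<^esub>"
proof -
  note sr = sec_csring
  have two: "\<exists>a b. ts = [a, b]" if "length ts = Suc (Suc 0)" for ts :: "'s list"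
    using that by (auto simp: length_Suc_conv)
  have ring: "ring (sec X V)" if "openin (topo X) V" for V
    using sr[OF that] by (simp add: cinf_superring_def superring_def)
  note hom = csring_homD[OF res_hom]
  { assume st: "s \<in> carrier (sec X U)" "t \<in> carrier (sec X U)"
    have "germ_op X x carrier (\<lambda>R ss. ss ! 0 \<oplus>\<^bsub>R\<^esub> ss ! 1) (map (germ X x U) [s, t])
      = germ X x U (s \<oplus>\<^bsub>sec X U\<^esub> t)"
      by (subst germ_op_eq[OF stable(1) U])
        (use st hom(4) ring in \<open>auto dest!: two intro: ring.ring_simprules(1)\<close>)
    then show "germ X x U s \<oplus>\<^bsub>stalk X x\<^esub> germ X x U t = germ X x U (s \<oplus>\<^bsub>sec X U\<^esub> t)"
      by (simp add: stalk_def)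
    have "germ_op X x carrier (\<lambda>R ss. ss ! 0 \<otimes>\<^bsub>R\<^esub> ss ! 1) (map (germ X x U) [s, t])
      = germ X x U (s \<otimes>\<^bsub>sec X U\<^esub> t)"
      by (subst germ_op_eq[OF stable(1) U])
        (use st hom(5) ring in \<open>auto dest!: two intro: ring.ring_simprules(5)\<close>)
    then show "germ X x U s \<otimes>\<^bsub>stalk X x\<^esub> germ X x U t = germ X x U (s \<otimes>\<^bsub>sec X U\<^esub> t)"
      by (simp add: stalk_def) }
  have "germ_op X x carrier (\<lambda>R ss. \<one>\<^bsub>R\<^esub>) (map (germ X x U) []) = germ X x U \<one>\<^bsub>sec X U\<^esub>"
    by (subst germ_op_eq[OF stable(1) U]) (use hom(6) ring in \<open>auto intro: ring.ring_simprules(6)\<close>)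
  then show "\<one>\<^bsub>stalk X x\<^esub> = germ X x U \<one>\<^bsub>sec X U\<^esub>" by (simp add: stalk_def)
  have "germ_op X x carrier (\<lambda>R ss. \<zero>\<^bsub>R\<^esub>) (map (germ X x U) []) = germ X x U \<zero>\<^bsub>sec X U\<^esub>"
    by (subst germ_op_eq[OF stable(1) U])
      (use csring_hom_zero[OF sr sr res_hom] ring in \<open>auto intro: ring.ring_simprules(2)\<close>)
  then show "\<zero>\<^bsub>stalk X x\<^esub> = germ X x U \<zero>\<^bsub>sec X U\<^esub>" by (simp add: stalk_def)
qed

text \<open>
  The operation of a composite is natural because it is a composite of operations, so this does not
  require that composites of smooth functions are smooth.
\<close>

lemma stalk_sop:
  assumes U: "openin (topo X) U" "x \<in> U" and ss: "set ss \<subseteq> even_part (sec X U)"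
    and f: "f \<in> Cinf (length ss) \<or> (\<exists>g hs. f = (\<lambda>x. g (\<lambda>i. (hs ! i) x)) \<and> g \<in> Cinf (length hs) \<and> set hs \<subseteq> Cinf (length ss))"
  shows "sop (stalk X x) f (map (germ X x U) ss) = germ X x U (sop (sec X U) f ss)"
proof -
  have "germ_op X x even_part (\<lambda>R. sop R f) (map (germ X x U) ss) = germ X x U (sop (sec X U) f ss)"
  proof (rule germ_op_eq[OF stable(2) U ss])
    fix V ts assume V: "openin (topo X) V" and ts: "set ts \<subseteq> even_part (sec X V)" "length ts = length ss"
    interpret V: cinf_superring "sec X V" by (rule sec_csring[OF V])
    have hs: "set (map (\<lambda>h. sop (sec X V) h ts) hs) \<subseteq> even_part (sec X V)" if "set hs \<subseteq> Cinf (length ss)" for hs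
      using that ts by auto
    show "sop (sec X V) f ts \<in> carrier (sec X V)"
      using f
    proof (elim disjE exE conjE)
      fix g hs assume *: "f = (\<lambda>x. g (\<lambda>i. (hs ! i) x))" "g \<in> Cinf (length hs)" "set hs \<subseteq> Cinf (length ss)"
      then show ?thesis
        using V.sop_comp[OF ts(1), of g hs] hs[OF *(3)] ts(2) by simp
    qed (use ts in simp)
    fix W assume W: "openin (topo X) W" "W \<subseteq> V"
    interpret W: cinf_superring "sec X W" by (rule sec_csring[OF W(1)])
    have ts': "set (map (res X V W) ts) \<subseteq> even_part (sec X W)"
      using superring_res(2)[OF V W] ts by auto
    note nat = csring_hom_sop[OF sec_csring[OF V] res_hom[OF V W]]
    show "res X V W (sop (sec X V) f ts) = sop (sec X W) f (map (res X V W) ts)"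
      using f
    proof (elim disjE exE conjE)
      fix g hs assume *: "f = (\<lambda>x. g (\<lambda>i. (hs ! i) x))" "g \<in> Cinf (length hs)" "set hs \<subseteq> Cinf (length ss)"
      have m: "map (res X V W) (map (\<lambda>h. sop (sec X V) h ts) hs)
          = map (\<lambda>h. sop (sec X W) h (map (res X V W) ts)) hs"
        using nat[OF ts(1)] *(3) ts(2) by auto
      have "res X V W (sop (sec X V) f ts) = res X V W (sop (sec X V) g (map (\<lambda>h. sop (sec X V) h ts) hs))"
        using V.sop_comp[OF ts(1), of g hs] * ts(2) by simp
      also have "\<dots> = sop (sec X W) g (map (\<lambda>h. sop (sec X W) h (map (res X V W) ts)) hs)"
        using nat[OF hs[OF *(3)], of g] *(2) unfolding m by simp
      also have "\<dots> = sop (sec X W) f (map (res X V W) ts)"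
        using W.sop_comp[OF ts', of g hs] * ts(2) by simp
      finally show ?thesis .
    qed (use nat[OF ts(1)] ts(2) in simp)
  qed
  then show ?thesis by (simp add: stalk_def)
qed

lemma germ_in_germs: "\<lbrakk>openin (topo X) U; x \<in> U; s \<in> P (sec X U)\<rbrakk> \<Longrightarrow> germ X x U s \<in> germs X x P"
  unfolding germs_def by blast

lemma germs_rep:
  assumes "g \<in> germs X x P"
  obtains U s where "openin (topo X) U" "x \<in> U" "s \<in> P (sec X U)" "g = germ X x U s"
  using assms unfolding germs_def by blast

lemma germs_rep2:
  assumes "stable P" "stable P'" "g \<in> germs X x P" "h \<in> germs X x P'"
  obtains U s t where "openin (topo X) U" "x \<in> U" "s \<in> P (sec X U)" "g = germ X x U s"
    "t \<in> P' (sec X U)" "h = germ X x U t"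
proof -
  obtain U s where U: "openin (topo X) U" "x \<in> U" "s \<in> P (sec X U)" "g = germ X x U s"
    using assms(3) by (rule germs_rep)
  obtain V t where V: "openin (topo X) V" "x \<in> V" "t \<in> P' (sec X V)" "h = germ X x V t"
    using assms(4) by (rule germs_rep)
  have o: "openin (topo X) (U \<inter> V)" "x \<in> U \<inter> V" using U V by auto
  show thesis
  proof (rule that[OF o])
    show "res X U (U \<inter> V) s \<in> P (sec X (U \<inter> V))" "res X V (U \<inter> V) t \<in> P' (sec X (U \<inter> V))"
      using stableD(2)[OF assms(1) U(1,3) o(1)] stableD(2)[OF assms(2) V(1,3) o(1)] by auto
    show "g = germ X x (U \<inter> V) (res X U (U \<inter> V) s)" "h = germ X x (U \<inter> V) (res X V (U \<inter> V) t)"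
      unfolding U(4) V(4)
      using germ_res[OF U(1) o(1) _ o(2)] germ_res[OF V(1) o(1) _ o(2)] stableD(1)[OF assms(1) U(1,3)] stableD(1)[OF assms(2) V(1,3)]
      by auto
  qed
qed

lemma germs_rep3:
  assumes "x \<in> topspace (topo X)" "stable P" "a \<in> germs X x P" "b \<in> germs X x P" "c \<in> germs X x P"
  obtains U s t u where "openin (topo X) U" "x \<in> U" "s \<in> P (sec X U)" "a = germ X x U s"
    "t \<in> P (sec X U)" "b = germ X x U t" "u \<in> P (sec X U)" "c = germ X x U u"
proof -
  have "set [a, b, c] \<subseteq> germs X x P" using assms(3-5) by simp
  from germs_list_rep[OF assms(2,1) this] obtain U ss where U: "openin (topo X) U" "x \<in> U"
    and ss: "set ss \<subseteq> P (sec X U)" "[a, b, c] = map (germ X x U) ss" by (elim exE conjE)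
  have "length ss = 3" using arg_cong[OF ss(2), of length] by simp
  then obtain s t u where stu: "ss = [s, t, u]" by (auto simp: numeral_3_eq_3 length_Suc_conv)
  have "a = germ X x U s" "b = germ X x U t" "c = germ X x U u"
    using ss(2) unfolding stu by (simp_all only: list.map list.inject)
  moreover have "s \<in> P (sec X U)" "t \<in> P (sec X U)" "u \<in> P (sec X U)" using ss(1) stu by auto
  ultimately show thesis by (intro that[OF U])
qed

text \<open>Finitely many germs have representatives on a common open set, where the laws hold in
  the ring of sections.\<close>

theorem stalk_superring:
  assumes x: "x \<in> topspace (topo X)"
  shows "cinf_superring (stalk X x)"
proof -
  note P = stable
  have top: "openin (topo X) (topspace (topo X))" by simp
  note sr = sec_csring
  show ?thesis
  proof (rule cinf_superringI, unfold stalk_parts)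
    fix a b assume ab: "a \<in> germs X x carrier" "b \<in> germs X x carrier"
    from ab obtain U s t where U: "openin (topo X) U" "x \<in> U" and st: "s \<in> carrier (sec X U)" "a = germ X x U s"
      "t \<in> carrier (sec X U)" "b = germ X x U t" by (rule germs_rep2[OF P(1) P(1)])
    interpret S: cinf_superring "sec X U" by (rule sr[OF U(1)])
    note simps = stalk_simps[OF U]
    show "a \<oplus>\<^bsub>stalk X x\<^esub> b \<in> germs X x carrier" "a \<otimes>\<^bsub>stalk X x\<^esub> b \<in> germs X x carrier"
      using st by (auto simp: simps intro!: germ_in_germs U)
    show "a \<oplus>\<^bsub>stalk X x\<^esub> b = b \<oplus>\<^bsub>stalk X x\<^esub> a"
      using st by (simp add: simps S.a_comm)
  next
    fix a b c assume abc: "a \<in> germs X x carrier" "b \<in> germs X x carrier" "c \<in> germs X x carrier"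
    from abc obtain U s t u where U: "openin (topo X) U" "x \<in> U" and st: "s \<in> carrier (sec X U)" "a = germ X x U s"
      "t \<in> carrier (sec X U)" "b = germ X x U t" "u \<in> carrier (sec X U)" "c = germ X x U u"
      by (rule germs_rep3[OF x P(1)])
    interpret S: cinf_superring "sec X U" by (rule sr[OF U(1)])
    note simps = stalk_simps[OF U]
    show "a \<oplus>\<^bsub>stalk X x\<^esub> b \<oplus>\<^bsub>stalk X x\<^esub> c = a \<oplus>\<^bsub>stalk X x\<^esub> (b \<oplus>\<^bsub>stalk X x\<^esub> c)"
      "a \<otimes>\<^bsub>stalk X x\<^esub> b \<otimes>\<^bsub>stalk X x\<^esub> c = a \<otimes>\<^bsub>stalk X x\<^esub> (b \<otimes>\<^bsub>stalk X x\<^esub> c)"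
      "(a \<oplus>\<^bsub>stalk X x\<^esub> b) \<otimes>\<^bsub>stalk X x\<^esub> c = a \<otimes>\<^bsub>stalk X x\<^esub> c \<oplus>\<^bsub>stalk X x\<^esub> b \<otimes>\<^bsub>stalk X x\<^esub> c"
      "c \<otimes>\<^bsub>stalk X x\<^esub> (a \<oplus>\<^bsub>stalk X x\<^esub> b) = c \<otimes>\<^bsub>stalk X x\<^esub> a \<oplus>\<^bsub>stalk X x\<^esub> c \<otimes>\<^bsub>stalk X x\<^esub> b"
      using st by (simp_all add: simps S.a_assoc S.m_assoc S.l_distr S.r_distr)
  next
    fix a assume "a \<in> germs X x carrier"
    then obtain U s where U: "openin (topo X) U" "x \<in> U" and s: "s \<in> carrier (sec X U)" "a = germ X x U s"
      by (rule germs_rep)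
    interpret S: cinf_superring "sec X U" by (rule sr[OF U(1)])
    note simps = stalk_simps[OF U]
    show "\<zero>\<^bsub>stalk X x\<^esub> \<oplus>\<^bsub>stalk X x\<^esub> a = a" "\<one>\<^bsub>stalk X x\<^esub> \<otimes>\<^bsub>stalk X x\<^esub> a = a" "a \<otimes>\<^bsub>stalk X x\<^esub> \<one>\<^bsub>stalk X x\<^esub> = a"
      using s by (simp_all add: simps)
    obtain b m where bm: "b \<in> even_part (sec X U)" "m \<in> odd_part (sec X U)" "s = b \<oplus>\<^bsub>sec X U\<^esub> m"
      using S.base.decomp_ex[OF s(1)] .
    then show "\<exists>b\<in>germs X x even_part. \<exists>m\<in>germs X x odd_part. a = b \<oplus>\<^bsub>stalk X x\<^esub> m"
      using s by (intro bexI[of _ "germ X x U b"] bexI[of _ "germ X x U m"]) (auto simp: simps intro!: germ_in_germs U)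
  next
    show "germs X x even_part \<subseteq> germs X x carrier" "germs X x odd_part \<subseteq> germs X x carrier"
      using stableD(1)[OF P(2)] stableD(1)[OF P(3)] by (auto simp: germs_def) blast+
  next
    fix a assume "a \<in> germs X x even_part" "a \<in> germs X x odd_part"
    then obtain U s t where U: "openin (topo X) U" "x \<in> U" and st: "s \<in> even_part (sec X U)" "a = germ X x U s"
      "t \<in> odd_part (sec X U)" "a = germ X x U t" by (rule germs_rep2[OF P(2) P(3)])
    have st': "s \<in> carrier (sec X U)" "t \<in> carrier (sec X U)" using stableD(1)[OF P(2) U(1) st(1)] stableD(1)[OF P(3) U(1) st(3)] by auto
    \<comment> \<open>The even and the odd representative of the same germ agree only after
      shrinking; on \<open>W\<close> the common restriction is both even and odd.\<close>
    obtain W where W: "openin (topo X) W" "x \<in> W" "W \<subseteq> U \<inter> U" "res X U W s = res X U W t"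
      using germ_eq[OF U st'(1) U st'(2)] st by auto
    then have WU: "W \<subseteq> U" by auto
    interpret W: cinf_superring "sec X W" by (rule sr[OF W(1)])
    have "res X U W s = \<zero>\<^bsub>sec X W\<^esub>"
      using W.even_odd_zero superring_res(2)[OF U(1) W(1) WU st(1)] superring_res(3)[OF U(1) W(1) WU st(3)] W(4) by simp
    then show "a = \<zero>\<^bsub>stalk X x\<^esub>"
      using germ_res[OF U(1) W(1) WU W(2) st'(1)] st(2) stalk_simps(4)[OF W(1,2)] by simp
  next
    interpret S: cinf_superring "sec X (topspace (topo X))" by (rule sr[OF top])
    note simps = stalk_simps[OF top x]
    show "\<zero>\<^bsub>stalk X x\<^esub> \<in> germs X x even_part" "\<zero>\<^bsub>stalk X x\<^esub> \<in> germs X x odd_part"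
      "\<one>\<^bsub>stalk X x\<^esub> \<in> germs X x even_part"
      unfolding simps by (intro germ_in_germs top x; simp)+
    show "sop (stalk X x) (\<lambda>_. 0) [] = \<zero>\<^bsub>stalk X x\<^esub>" "sop (stalk X x) (\<lambda>_. 1) [] = \<one>\<^bsub>stalk X x\<^esub>"
      using stalk_sop[OF top x, of "[]" "\<lambda>_. 0"] stalk_sop[OF top x, of "[]" "\<lambda>_. 1"]
      by (simp_all add: S.sop_zero S.sop_one simps(3,4))
  next
    fix a b assume ab: "a \<in> germs X x even_part" "b \<in> germs X x even_part"
    from ab obtain U s t where U: "openin (topo X) U" "x \<in> U" and st: "s \<in> even_part (sec X U)" "a = germ X x U s"
      "t \<in> even_part (sec X U)" "b = germ X x U t" by (rule germs_rep2[OF P(2) P(2)])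
    interpret S: cinf_superring "sec X U" by (rule sr[OF U(1)])
    note simps = stalk_simps[OF U]
    show "a \<oplus>\<^bsub>stalk X x\<^esub> b \<in> germs X x even_part" "a \<otimes>\<^bsub>stalk X x\<^esub> b \<in> germs X x even_part"
      using st by (auto simp: simps intro!: germ_in_germs U)
    have "sop (stalk X x) (\<lambda>x. x 0 + x 1) (map (germ X x U) [s, t]) = germ X x U (sop (sec X U) (\<lambda>x. x 0 + x 1) [s, t])"
      "sop (stalk X x) (\<lambda>x. x 0 * x 1) (map (germ X x U) [s, t]) = germ X x U (sop (sec X U) (\<lambda>x. x 0 * x 1) [s, t])"
      using st Cinf_ring_ops by (intro stalk_sop[OF U]; simp add: numeral_2_eq_2)+
    then show "sop (stalk X x) (\<lambda>x. x 0 + x 1) [a, b] = a \<oplus>\<^bsub>stalk X x\<^esub> b"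
      "sop (stalk X x) (\<lambda>x. x 0 * x 1) [a, b] = a \<otimes>\<^bsub>stalk X x\<^esub> b"
      using st S.sop_add[of s t] S.sop_mult[of s t] by (simp_all add: simps)
  next
    fix a b assume ab: "a \<in> germs X x odd_part" "b \<in> germs X x odd_part"
    from ab obtain U s t where U: "openin (topo X) U" "x \<in> U" and st: "s \<in> odd_part (sec X U)" "a = germ X x U s"
      "t \<in> odd_part (sec X U)" "b = germ X x U t" by (rule germs_rep2[OF P(3) P(3)])
    interpret S: cinf_superring "sec X U" by (rule sr[OF U(1)])
    note simps = stalk_simps[OF U]
    show "a \<oplus>\<^bsub>stalk X x\<^esub> b \<in> germs X x odd_part" "a \<otimes>\<^bsub>stalk X x\<^esub> b \<in> germs X x even_part"
      using st by (auto simp: simps intro!: germ_in_germs U)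
    have "s \<otimes>\<^bsub>sec X U\<^esub> t \<oplus>\<^bsub>sec X U\<^esub> t \<otimes>\<^bsub>sec X U\<^esub> s = \<zero>\<^bsub>sec X U\<^esub>"
      using S.odd_anticomm[of s t] st by (simp add: S.l_neg)
    then show "a \<otimes>\<^bsub>stalk X x\<^esub> b \<oplus>\<^bsub>stalk X x\<^esub> b \<otimes>\<^bsub>stalk X x\<^esub> a = \<zero>\<^bsub>stalk X x\<^esub>"
      using st by (simp add: simps)
  next
    fix a b assume ab: "a \<in> germs X x even_part" "b \<in> germs X x odd_part"
    from ab obtain U s t where U: "openin (topo X) U" "x \<in> U" and st: "s \<in> even_part (sec X U)" "a = germ X x U s"
      "t \<in> odd_part (sec X U)" "b = germ X x U t" by (rule germs_rep2[OF P(2) P(3)])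
    interpret S: cinf_superring "sec X U" by (rule sr[OF U(1)])
    show "a \<otimes>\<^bsub>stalk X x\<^esub> b \<in> germs X x odd_part"
      using st by (auto simp: stalk_simps[OF U] intro!: germ_in_germs U)
  next
    fix a b assume ab: "a \<in> germs X x even_part" "b \<in> germs X x carrier"
    from ab obtain U s t where U: "openin (topo X) U" "x \<in> U" and st: "s \<in> even_part (sec X U)" "a = germ X x U s"
      "t \<in> carrier (sec X U)" "b = germ X x U t" by (rule germs_rep2[OF P(2) P(1)])
    interpret S: cinf_superring "sec X U" by (rule sr[OF U(1)])
    show "a \<otimes>\<^bsub>stalk X x\<^esub> b = b \<otimes>\<^bsub>stalk X x\<^esub> a"
      using st S.even_commute[of s t] by (simp add: stalk_simps[OF U])
  next
    fix a assume "a \<in> germs X x even_part"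
    then obtain U s where U: "openin (topo X) U" "x \<in> U" and s: "s \<in> even_part (sec X U)" "a = germ X x U s"
      by (rule germs_rep)
    interpret S: cinf_superring "sec X U" by (rule sr[OF U(1)])
    show "\<exists>b\<in>germs X x even_part. b \<oplus>\<^bsub>stalk X x\<^esub> a = \<zero>\<^bsub>stalk X x\<^esub>"
      using s by (intro bexI[of _ "germ X x U (\<ominus>\<^bsub>sec X U\<^esub> s)"])
        (auto simp: stalk_simps[OF U] S.l_neg intro!: germ_in_germs U)
  next
    fix a assume "a \<in> germs X x odd_part"
    then obtain U s where U: "openin (topo X) U" "x \<in> U" and s: "s \<in> odd_part (sec X U)" "a = germ X x U s"
      by (rule germs_rep)
    interpret S: cinf_superring "sec X U" by (rule sr[OF U(1)])
    show "\<exists>b\<in>germs X x odd_part. b \<oplus>\<^bsub>stalk X x\<^esub> a = \<zero>\<^bsub>stalk X x\<^esub>"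
      using s by (intro bexI[of _ "germ X x U (\<ominus>\<^bsub>sec X U\<^esub> s)"])
        (auto simp: stalk_simps[OF U] S.l_neg intro!: germ_in_germs U)
  next
    fix f cs assume cs: "set cs \<subseteq> germs X x even_part" "f \<in> Cinf (length cs)"
    obtain U ss where U: "openin (topo X) U" "x \<in> U" and ss: "set ss \<subseteq> even_part (sec X U)" "cs = map (germ X x U) ss"
      using germs_list_rep[OF P(2) x cs(1)] by blast
    interpret S: cinf_superring "sec X U" by (rule sr[OF U(1)])
    show "sop (stalk X x) f cs \<in> germs X x even_part"
      using ss cs by (simp add: stalk_sop[OF U]) (intro germ_in_germs U, simp)
  next
    fix i cs assume cs: "set cs \<subseteq> germs X x even_part" "i < length cs"
    obtain U ss where U: "openin (topo X) U" "x \<in> U" and ss: "set ss \<subseteq> even_part (sec X U)" "cs = map (germ X x U) ss"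
      using germs_list_rep[OF P(2) x cs(1)] by blast
    interpret S: cinf_superring "sec X U" by (rule sr[OF U(1)])
    show "sop (stalk X x) (\<lambda>x. x i) cs = cs ! i"
      using ss cs by (simp add: stalk_sop[OF U] Cinf_proj S.sop_proj)
  next
    fix g hs cs
    assume cs: "set cs \<subseteq> germs X x even_part" "g \<in> Cinf (length hs)" "set hs \<subseteq> Cinf (length cs)"
    obtain U ss where U: "openin (topo X) U" "x \<in> U" and ss: "set ss \<subseteq> even_part (sec X U)" "cs = map (germ X x U) ss"
      using germs_list_rep[OF P(2) x cs(1)] by blast
    interpret S: cinf_superring "sec X U" by (rule sr[OF U(1)])
    have h: "sop (stalk X x) h cs = germ X x U (sop (sec X U) h ss)" if "h \<in> Cinf (length cs)" for h
      using that ss by (simp add: stalk_sop[OF U])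
    have "sop (stalk X x) (\<lambda>x. g (\<lambda>i. (hs ! i) x)) cs = germ X x U (sop (sec X U) (\<lambda>x. g (\<lambda>i. (hs ! i) x)) ss)"
      unfolding ss(2) by (rule stalk_sop[OF U ss(1)]) (use cs ss(2) in auto)
    note comp = this
    have hs: "map (\<lambda>h. sop (stalk X x) h cs) hs = map (germ X x U) (map (\<lambda>h. sop (sec X U) h ss) hs)"
      using cs(3) by (auto simp: h)
    have hs': "set (map (\<lambda>h. sop (sec X U) h ss) hs) \<subseteq> even_part (sec X U)"
      using cs(3) ss by auto
    have "sop (stalk X x) g (map (\<lambda>h. sop (stalk X x) h cs) hs)
        = germ X x U (sop (sec X U) g (map (\<lambda>h. sop (sec X U) h ss) hs))"
      unfolding hs using cs(2) by (intro stalk_sop[OF U hs']) simp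
    with comp show "sop (stalk X x) (\<lambda>x. g (\<lambda>i. (hs ! i) x)) cs = sop (stalk X x) g (map (\<lambda>h. sop (stalk X x) h cs) hs)"
      using S.sop_comp[OF ss(1) cs(2)] cs(3) ss(2) by simp
  qed
qed

end

section \<open>Local superrings and values at points\<close>

text \<open>An ideal that contains an element with nonzero value contains a unit, so every proper
  ideal lies in the kernel of \<open>w\<close>. The constants \<open>\<kappa>\<close> split
  \<open>w\<close>, which identifies the quotient with the reals.\<close>

lemma kernel_maximal:
  fixes T (structure) and w :: "'a \<Rightarrow> real"
  assumes "ring T"
    and add: "\<And>a b. \<lbrakk>a \<in> carrier T; b \<in> carrier T\<rbrakk> \<Longrightarrow> w (a \<oplus> b) = w a + w b"
    and mult: "\<And>a b. \<lbrakk>a \<in> carrier T; b \<in> carrier T\<rbrakk> \<Longrightarrow> w (a \<otimes> b) = w a * w b"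
    and one: "w \<one> = 1"
    and unit: "\<And>a. \<lbrakk>a \<in> carrier T; w a \<noteq> 0\<rbrakk> \<Longrightarrow> \<exists>b\<in>carrier T. a \<otimes> b = \<one>"
    and const: "\<And>r. \<kappa> r \<in> carrier T" "\<And>r. w (\<kappa> r) = r"
  defines "M \<equiv> {a \<in> carrier T. w a = 0}"
  shows "maximalideal M T" and "maximalideal M' T \<Longrightarrow> M' = M"
    and "bij_betw (\<lambda>r. M +> \<kappa> r) UNIV (carrier (T Quot M))"
proof -
  interpret ring T by fact
  have zero: "w \<zero> = 0" using add[of \<zero> \<zero>] by simp
  have minus: "w (\<ominus> a) = - w a" if "a \<in> carrier T" for a
    using add[of "\<ominus> a" a] that by (simp add: l_neg zero)
  have ideal: "ideal M T"
  proof (rule idealI[OF ring_axioms])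
    show "subgroup M (add_monoid T)"
    proof (rule subgroup.intro)
      fix a assume "a \<in> M"
      then have "\<ominus> a \<in> M" using minus by (simp add: M_def)
      then show "inv\<^bsub>add_monoid T\<^esub> a \<in> M" by (simp add: a_inv_def)
    qed (auto simp: M_def add zero)
  qed (auto simp: M_def mult)
  have no_unit: "I = carrier T" if I: "ideal I T" and a: "a \<in> I" "w a \<noteq> 0" for I a
  proof -
    interpret I: ideal I T by fact
    have "a \<in> carrier T" using a I.a_subset by auto
    then obtain b where "b \<in> carrier T" "a \<otimes> b = \<one>" using unit a by blast
    then have "\<one> \<in> I" using I.I_r_closed[OF a(1)] by metis
    then show ?thesis by (rule I.one_imp_carrier)
  qed
  show max: "maximalideal M T"
  proof (rule maximalidealI[OF ideal])
    have "\<one> \<notin> M" using one by (simp add: M_def)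
    then show "carrier T \<noteq> M" using one_closed by blast
    fix I assume I: "ideal I T" "M \<subseteq> I" "I \<subseteq> carrier T"
    show "I = M \<or> I = carrier T"
      using no_unit[OF I(1)] I(2,3) unfolding M_def by blast
  qed
  show "M' = M" if M': "maximalideal M' T"
  proof -
    interpret M': maximalideal M' T by fact
    have "M' \<subseteq> M"
      using no_unit[OF M'.ideal_axioms] M'.I_notcarr M'.a_subset unfolding M_def by blast
    then show ?thesis
      using M'.I_maximal[OF ideal] maximalideal.I_notcarr[OF max] by (auto simp: M_def)
  qed
  interpret M: ideal M T by (rule ideal)
  \<comment> \<open>Subtracting the constant with the same value moves \<open>a\<close> into the
    kernel, so each coset contains a constant.\<close>
  have coset: "M +> a = M +> \<kappa> (w a)" if a: "a \<in> carrier T" for a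
  proof -
    have "w (a \<ominus> \<kappa> (w a)) = 0"
      unfolding minus_eq using add[of a "\<ominus> \<kappa> (w a)"] minus[OF const(1)[of "w a"]] const a by simp
    moreover have "a \<ominus> \<kappa> (w a) \<in> carrier T" using a const(1) by simp
    ultimately have "a \<ominus> \<kappa> (w a) \<in> M" by (simp only: M_def mem_Collect_eq)
    then have "a \<in> M +> \<kappa> (w a)" using M.a_rcos_module_minus[OF ring_axioms const(1) a] by simp
    then show ?thesis by (rule M.a_repr_independence'[OF _ const(1), symmetric])
  qed
  show "bij_betw (\<lambda>r. M +> \<kappa> r) UNIV (carrier (T Quot M))"
    unfolding bij_betw_def
  proof
    show "inj (\<lambda>r. M +> \<kappa> r)"
    proof (rule injI)
      fix r s assume eq: "M +> \<kappa> r = M +> \<kappa> s"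
      have "\<kappa> r \<in> M +> \<kappa> s" using M.a_rcos_self[OF const(1), of r] by (simp only: eq)
      then obtain m where m: "m \<in> M" "\<kappa> r = m \<oplus> \<kappa> s" by (auto simp: a_r_coset_def')
      have mc: "m \<in> carrier T" "w m = 0" using m(1) unfolding M_def by blast+
      have "w (\<kappa> r) = w m + w (\<kappa> s)" unfolding m(2) by (rule add[OF mc(1) const(1)])
      then show "r = s" by (simp only: mc const add_0)
    qed
    show "range (\<lambda>r. M +> \<kappa> r) = carrier (T Quot M)"
    proof (intro equalityI subsetI)
      show "K \<in> carrier (T Quot M)" if "K \<in> range (\<lambda>r. M +> \<kappa> r)" for K
        using that const(1) by (auto simp: FactRing_def A_RCOSETS_def')
      fix K assume "K \<in> carrier (T Quot M)"
      then obtain a where "a \<in> carrier T" "K = M +> a" by (auto simp: FactRing_def A_RCOSETS_def')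
      then show "K \<in> range (\<lambda>r. M +> \<kappa> r)" using coset[of a] by (simp only:) (rule rangeI)
    qed
  qed
qed

context cinf_superring begin

lemma odd_square_double: "m \<in> odd_part R \<Longrightarrow> m \<otimes> m \<oplus> m \<otimes> m = \<zero>"
  using odd_anticomm[of m m] by (metis l_neg m_closed base.odd_carr)

text \<open>
  The value \<open>v\<close> kills products of odd elements since these square to zero; hence it extends to the
  superreduced ring.
\<close>

theorem local_csringI:
  fixes v :: "'a \<Rightarrow> real"
  assumes add: "\<And>a b. \<lbrakk>a \<in> even_part R; b \<in> even_part R\<rbrakk> \<Longrightarrow> v (a \<oplus> b) = v a + v b"
    and mult: "\<And>a b. \<lbrakk>a \<in> even_part R; b \<in> even_part R\<rbrakk> \<Longrightarrow> v (a \<otimes> b) = v a * v b"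
    and const: "\<And>r. v (sop R (\<lambda>_. r) []) = r"
    and unit: "\<And>a. \<lbrakk>a \<in> even_part R; v a \<noteq> 0\<rbrakk> \<Longrightarrow> \<exists>b\<in>even_part R. a \<otimes> b = \<one>"
  shows "local_csring R"
proof -
  define J where "J = Idl\<^bsub>R\<^esub> (odd_part R)"
  define P where "P = superreduced R"
  define T where "T = ring_of P"
  have J: "ideal J R" "odd_part R \<subseteq> J"
    unfolding J_def using genideal_ideal[OF odd_subset] genideal_self[OF odd_subset] by auto
  interpret J: ideal J R by (rule J)
  interpret Q: ring "R Quot J" by (rule J.quotient_is_ring)
  have zero: "v \<zero> = 0" using add[of \<zero> \<zero>] by simp
  have minus: "v (\<ominus> a) = - v a" if "a \<in> even_part R" for a
    using add[of "\<ominus> a" a] that by (simp add: l_neg zero)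
  \<comment> \<open>Twice the value is 0 by anticommutativity, and values are real numbers.\<close>
  have sq: "v (m \<otimes> m) = 0" if "m \<in> odd_part R" for m
    using add[of "m \<otimes> m" "m \<otimes> m"] odd_square_double[OF that] that zero by simp
  have oo: "v (m \<otimes> n) = 0" if "m \<in> odd_part R" "n \<in> odd_part R" for m n
  proof -
    have "(m \<otimes> n) \<otimes> (m \<otimes> n) = m \<otimes> (n \<otimes> m) \<otimes> n" using that by (simp add: m_assoc)
    also have "n \<otimes> m = \<ominus> (m \<otimes> n)" by (rule odd_anticomm[OF that(2,1)])
    also have "m \<otimes> \<ominus> (m \<otimes> n) \<otimes> n = \<ominus> ((m \<otimes> m) \<otimes> (n \<otimes> n))" using that by (simp add: m_assoc r_minus l_minus)
    finally have "v ((m \<otimes> n) \<otimes> (m \<otimes> n)) = - (v (m \<otimes> m) * v (n \<otimes> n))"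
      using that by (simp add: minus mult)
    then have "v (m \<otimes> n) * v (m \<otimes> n) = 0"
      using that by (simp add: mult sq)
    then show ?thesis by simp
  qed
  \<comment> \<open>\<open>K\<close> is a two-sided ideal because \<open>v\<close> kills products of
    odd elements. It contains the odd part, hence \<open>J\<close>, so \<open>v\<close> vanishes on
    even elements of \<open>J\<close> and depends only on the coset.\<close>
  define K where "K = {a \<in> carrier R. v (even_comp R a) = 0}"
  have K: "b \<oplus> m \<in> K \<longleftrightarrow> v b = 0" if "b \<in> even_part R" "m \<in> odd_part R" for b m
    using that base.comps[OF that] by (simp add: K_def)
  have K_ex: "\<exists>b m. b \<in> even_part R \<and> m \<in> odd_part R \<and> a = b \<oplus> m \<and> v b = 0" if "a \<in> K" for a
  proof -
    have "a \<in> carrier R" using that by (simp add: K_def)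
    then obtain b m where "b \<in> even_part R" "m \<in> odd_part R" "a = b \<oplus> m" by (rule base.decomp_ex)
    then show ?thesis using K that by blast
  qed
  have "ideal K R"
  proof (rule idealI[OF ring_axioms])
    show "subgroup K (add_monoid R)"
    proof (rule subgroup.intro)
      show "K \<subseteq> carrier (add_monoid R)" by (auto simp: K_def)
      show "\<one>\<^bsub>add_monoid R\<^esub> \<in> K" using K[of \<zero> \<zero>] by (simp add: zero)
      fix a assume "a \<in> K"
      then obtain b m where bm: "b \<in> even_part R" "m \<in> odd_part R" "a = b \<oplus> m" "v b = 0" using K_ex by blast
      have "\<ominus> a = \<ominus> b \<oplus> \<ominus> m" using bm by (simp add: minus_add)
      then have "\<ominus> a \<in> K" using K[of "\<ominus> b" "\<ominus> m"] bm by (simp add: minus)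
      then show "inv\<^bsub>add_monoid R\<^esub> a \<in> K" by (simp add: a_inv_def)
      fix a' assume "a' \<in> K"
      then obtain c n where cn: "c \<in> even_part R" "n \<in> odd_part R" "a' = c \<oplus> n" "v c = 0" using K_ex by blast
      have "a \<oplus> a' = (b \<oplus> c) \<oplus> (m \<oplus> n)" using bm cn by (simp add: a_ac)
      then show "a \<otimes>\<^bsub>add_monoid R\<^esub> a' \<in> K" using K[of "b \<oplus> c" "m \<oplus> n"] bm cn by (simp add: add)
    qed
    fix a x assume "a \<in> K" "x \<in> carrier R"
    then obtain b m c n where bm: "b \<in> even_part R" "m \<in> odd_part R" "a = b \<oplus> m" "v b = 0"
      and cn: "c \<in> even_part R" "n \<in> odd_part R" "x = c \<oplus> n" using K_ex base.decomp_ex by metis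
    have "x \<otimes> a = (c \<otimes> b \<oplus> n \<otimes> m) \<oplus> (c \<otimes> m \<oplus> n \<otimes> b)" using bm cn by (simp add: l_distr r_distr a_ac)
    then show "x \<otimes> a \<in> K" using K[of "c \<otimes> b \<oplus> n \<otimes> m" "c \<otimes> m \<oplus> n \<otimes> b"] bm cn by (simp add: add mult oo)
    have "a \<otimes> x = (b \<otimes> c \<oplus> m \<otimes> n) \<oplus> (b \<otimes> n \<oplus> m \<otimes> c)" using bm cn by (simp add: l_distr r_distr a_ac)
    then show "a \<otimes> x \<in> K" using K[of "b \<otimes> c \<oplus> m \<otimes> n" "b \<otimes> n \<oplus> m \<otimes> c"] bm cn by (simp add: add mult oo)
  qed
  moreover have "odd_part R \<subseteq> K" using K[of \<zero>] zero by auto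
  ultimately have JK: "J \<subseteq> K" unfolding J_def by (rule genideal_minimal)
  have vJ: "v b = 0" if "b \<in> J" "b \<in> even_part R" for b
    using K[of b \<zero>] JK that by auto
  have coset_eq: "J +> b = J +> c \<longleftrightarrow> b \<ominus> c \<in> J" if "b \<in> carrier R" "c \<in> carrier R" for b c
    using J.a_rcos_module_minus[OF ring_axioms that(2,1)] J.a_rcos_self[OF that(1)]
      J.a_repr_independence'[OF _ that(2), of b] by auto
  have v_coset: "v b = v c" if "b \<in> even_part R" "c \<in> even_part R" "J +> b = J +> c" for b c
  proof -
    have "b \<ominus> c \<in> J" using that coset_eq by simp
    then have "v (b \<ominus> c) = 0" using that by (intro vJ) (auto simp: minus_eq)
    then show ?thesis using that by (simp add: minus_eq add minus)
  qed
  define rep where "rep K = (SOME c. c \<in> K \<inter> even_part R)" for K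
  have rep: "rep K \<in> even_part R \<and> J +> rep K = K" if Kc: "K \<in> carrier (R Quot J)" for K
  proof -
    obtain a where a: "a \<in> carrier R" "K = J +> a" using Kc by (auto simp: FactRing_def A_RCOSETS_def')
    obtain b m where bm: "b \<in> even_part R" "m \<in> odd_part R" "a = b \<oplus> m" using base.decomp_ex[OF a(1)] .
    have "b \<ominus> a = \<ominus> m" using bm by (simp add: minus_eq minus_add a_assoc[symmetric] r_neg)
    then have "b \<ominus> a \<in> J" using bm J(2) J.a_inv_closed by auto
    then have "J +> b = K" using coset_eq a bm by simp
    moreover have "b \<in> J +> b" using bm J.a_rcos_self by simp
    ultimately have "b \<in> K \<inter> even_part R" using bm(1) by blast
    then have r: "rep K \<in> K \<inter> even_part R" unfolding rep_def by (rule someI)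
    then have "rep K \<in> J +> a" unfolding a(2) by blast
    from J.a_repr_independence'[OF this a(1)] show ?thesis using r a(2) by blast
  qed
  have car: "carrier T = carrier (R Quot J)"
    by (simp add: T_def P_def ring_of_def superreduced_def Let_def J_def)
  have cop: "cop P f Ks = J +> sop R f (map rep Ks)" for f Ks
    by (simp add: P_def superreduced_def Let_def J_def rep_def[abs_def])
  have const_P: "cconst P r = J +> sop R (\<lambda>_. r) []" for r by (simp add: cconst_def cop)
  \<comment> \<open>The operations of the superreduced ring are computed on chosen even
    representatives. They agree with those of the quotient ring, which supplies the ring
    axioms.\<close>
  have T_add: "K \<oplus>\<^bsub>T\<^esub> L = K \<oplus>\<^bsub>R Quot J\<^esub> L" if "K \<in> carrier T" "L \<in> carrier T" for K L
    using rep[of K] rep[of L] that unfolding car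
    by (simp add: T_def ring_of_def cop sop_add[unfolded One_nat_def] J.a_rcos_sum[symmetric] FactRing_def)
  have T_mult: "K \<otimes>\<^bsub>T\<^esub> L = K \<otimes>\<^bsub>R Quot J\<^esub> L" if "K \<in> carrier T" "L \<in> carrier T" for K L
    using rep[of K] rep[of L] that J.rcoset_mult_add[of "rep K" "rep L"] unfolding car
    by (simp add: T_def ring_of_def cop sop_mult[unfolded One_nat_def] FactRing_def)
  have T_zero: "\<zero>\<^bsub>T\<^esub> = \<zero>\<^bsub>R Quot J\<^esub>"
    by (simp add: T_def ring_of_def const_P sop_zero FactRing_def J.a_rcos_const J.zero_closed)
  have T_one: "\<one>\<^bsub>T\<^esub> = \<one>\<^bsub>R Quot J\<^esub>"
    by (simp add: T_def ring_of_def const_P sop_one FactRing_def)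
  have ring: "ring T"
  proof (rule ringI)
    show "abelian_group T"
    proof (rule abelian_groupI)
      show "\<exists>y\<in>carrier T. y \<oplus>\<^bsub>T\<^esub> x = \<zero>\<^bsub>T\<^esub>" if "x \<in> carrier T" for x
        using that Q.l_neg[of x] Q.a_inv_closed[of x] T_add by (metis car T_zero)
    qed (simp_all add: T_add T_zero car Q.a_ac)
    show "monoid T" by (rule monoidI) (simp_all add: T_mult T_one car Q.m_assoc)
  qed (simp_all add: T_add T_mult car Q.l_distr Q.r_distr)
  define w where "w K = v (rep K)" for K
  have w: "w (J +> b) = v b" if "b \<in> even_part R" for b
  proof -
    have "J +> b \<in> carrier (R Quot J)" using that by (auto simp: FactRing_def A_RCOSETS_def')
    from rep[OF this] show ?thesis unfolding w_def using that by (intro v_coset) auto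
  qed
  have T_ops: "(J +> b) \<oplus>\<^bsub>T\<^esub> (J +> c) = J +> (b \<oplus> c)" "(J +> b) \<otimes>\<^bsub>T\<^esub> (J +> c) = J +> (b \<otimes> c)"
    "J +> b \<in> carrier T" if "b \<in> carrier R" "c \<in> carrier R" for b c
  proof -
    have *: "J +> b \<in> carrier T" "J +> c \<in> carrier T" using that by (auto simp: car FactRing_def A_RCOSETS_def')
    show "J +> b \<in> carrier T" by fact
    show "(J +> b) \<oplus>\<^bsub>T\<^esub> (J +> c) = J +> (b \<oplus> c)" using that by (simp add: T_add * FactRing_def J.a_rcos_sum)
    show "(J +> b) \<otimes>\<^bsub>T\<^esub> (J +> c) = J +> (b \<otimes> c)" using that by (simp add: T_mult * FactRing_def J.rcoset_mult_add)
  qed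
  have T_rep: "\<exists>b\<in>even_part R. K = J +> b" if "K \<in> carrier T" for K
    using rep[of K] that unfolding car by metis
  have sc: "sop R (\<lambda>_. r) [] \<in> even_part R" for r by simp
  note max = kernel_maximal[OF ring, where w = w and \<kappa> = "cconst P"]
  have hyps: "w (K \<oplus>\<^bsub>T\<^esub> L) = w K + w L" "w (K \<otimes>\<^bsub>T\<^esub> L) = w K * w L" if "K \<in> carrier T" "L \<in> carrier T" for K L
    using T_rep[OF that(1)] T_rep[OF that(2)] by (auto simp: T_ops w add mult)
  have h1: "w \<one>\<^bsub>T\<^esub> = 1"
  proof -
    have "\<one>\<^bsub>T\<^esub> = J +> sop R (\<lambda>_. 1) []" by (simp add: T_def ring_of_def const_P)
    then show ?thesis using w[OF sc, of 1] const by simp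
  qed
  have h2: "\<exists>L\<in>carrier T. K \<otimes>\<^bsub>T\<^esub> L = \<one>\<^bsub>T\<^esub>" if K: "K \<in> carrier T" "w K \<noteq> 0" for K
  proof -
    obtain a where a: "a \<in> even_part R" "K = J +> a" using T_rep K by blast
    then obtain b where b: "b \<in> even_part R" "a \<otimes> b = \<one>" using unit K w by force
    have "K \<otimes>\<^bsub>T\<^esub> (J +> b) = J +> \<one>" using a b by (simp add: T_ops)
    then show ?thesis using T_ops(3)[of b b] b by (intro bexI[of _ "J +> b"]) (auto simp: T_one FactRing_def)
  qed
  have h3: "cconst P r \<in> carrier T" "w (cconst P r) = r" for r
    using T_ops(3)[of "sop R (\<lambda>_. r) []" "sop R (\<lambda>_. r) []"] sc[of r] w[OF sc, of r] const[of r]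
    by (simp_all add: const_P)
  note max = max[OF hyps h1 h2 h3]
  show ?thesis
    unfolding local_csring_def local_cinf_ring_def P_def[symmetric] T_def[symmetric]
    using max by blast
qed

end

lemma cinf_ring_real: "cinf_ring real_cinf"
proof
  fix cs :: "real list" and g and hs :: "((nat \<Rightarrow> real) \<Rightarrow> real) list" assume "g \<in> Cinf (length hs)"
  then have "g (\<lambda>i. (hs ! i) ((!) cs)) = g ((!) (map (\<lambda>h. h ((!) cs)) hs))"
    by (rule Cinf_depends) simp
  then show "cop real_cinf (\<lambda>x. g (\<lambda>i. (hs ! i) x)) cs = cop real_cinf g (map (\<lambda>h. cop real_cinf h cs) hs)"
    by (simp add: real_cinf_def)
qed (simp_all add: real_cinf_def)

context cinf_superring begin

section \<open>Evaluation at real points and local invertibility\<close>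

lemma point_sop: "\<lbrakk>x \<in> points R; set cs \<subseteq> even_part R; f \<in> Cinf (length cs)\<rbrakk> \<Longrightarrow> x (sop R f cs) = f (\<lambda>i. map x cs ! i)"
  using cinf_homD[of x "even_ring R" real_cinf cs f] by (simp add: points_def even_ring_def real_cinf_def)

lemma point_add: "\<lbrakk>x \<in> points R; a \<in> even_part R; b \<in> even_part R\<rbrakk> \<Longrightarrow> x (a \<oplus> b) = x a + x b"
  using point_sop[of x "[a, b]" "\<lambda>x. x 0 + x 1"] Cinf_ring_ops by (simp add: sop_add[unfolded One_nat_def] numeral_2_eq_2)
lemma point_mult: "\<lbrakk>x \<in> points R; a \<in> even_part R; b \<in> even_part R\<rbrakk> \<Longrightarrow> x (a \<otimes> b) = x a * x b"
  using point_sop[of x "[a, b]" "\<lambda>x. x 0 * x 1"] Cinf_ring_ops by (simp add: sop_mult[unfolded One_nat_def] numeral_2_eq_2)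
lemma point_const: "x \<in> points R \<Longrightarrow> x (sop R (\<lambda>_. r) []) = r"
  using point_sop[of x "[]" "\<lambda>_. r"] by simp
lemma point_one: "x \<in> points R \<Longrightarrow> x \<one> = 1" and point_zero: "x \<in> points R \<Longrightarrow> x \<zero> = 0"
  using point_const[of x 1] point_const[of x 0] by (simp_all add: sop_one sop_zero)

text \<open>A point makes the elements that are nonzero there invertible, so by the universal
  property evaluation extends to the localization. Elements of the localization thus have
  well-defined values.\<close>

lemma point_value:
  assumes x: "x \<in> points R"
  obtains \<xi> where "\<xi> \<in> ring_hom (ring_of (cloc (even_ring R) (nonvanishing R x))) (ring_of real_cinf)"
    "\<forall>c\<in>even_part R. \<xi> (fst (loc_at_map R x c)) = x c"
proof -
  have "\<exists>!\<xi>. \<xi> \<in> cinf_hom (cloc (even_ring R) (nonvanishing R x)) real_cinf \<and>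
      (\<forall>c\<in>carrier (even_ring R). \<xi> (cloc_map (even_ring R) (nonvanishing R x) c) = x c)"
  proof (rule cloc_universal[OF even.cinf_ring_axioms _ cinf_ring_real])
    show "x \<in> cinf_hom (even_ring R) real_cinf" using x by (simp add: points_def)
    show "\<exists>d\<in>carrier real_cinf. x s \<otimes>\<^bsub>ring_of real_cinf\<^esub> d = \<one>\<^bsub>ring_of real_cinf\<^esub>"
      if "s \<in> nonvanishing R x" for s
      using that by (intro bexI[of _ "1 / x s"]) (auto simp: nonvanishing_def ring_of_def real_cinf_def cconst_def)
  qed (auto simp: nonvanishing_def even_ring_def)
  then obtain \<xi> where \<xi>: "\<xi> \<in> cinf_hom (cloc (even_ring R) (nonvanishing R x)) real_cinf"
    "\<forall>c\<in>even_part R. \<xi> (cloc_map (even_ring R) (nonvanishing R x) c) = x c" by (auto simp: even_ring_def)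
  show thesis
  proof (rule that[OF cinf_hom_ring_hom[OF cinf_ring_cloc cinf_ring_real \<xi>(1)]])
    show "\<forall>c\<in>even_part R. \<xi> (fst (loc_at_map R x c)) = x c"
    proof
      fix c assume c: "c \<in> even_part R"
      then show "\<xi> (fst (loc_at_map R x c)) = x c"
        using \<xi>(2) loc_at_Pair(1)[OF c zero_odd, of x] by simp
    qed
  qed
qed

lemma point_loc_cong:
  assumes "x \<in> points R" "a \<in> even_part R" "b \<in> even_part R" "loc_at_map R x a = loc_at_map R x b"
  shows "x a = x b"
proof -
  obtain \<xi> where "\<forall>c\<in>even_part R. \<xi> (fst (loc_at_map R x c)) = x c" using point_value[OF assms(1)] by metis
  then show ?thesis using assms(2-4) by metis
qed

text \<open>Evaluation sends units to nonzero reals. As \<open>a\<close> is even, only the even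
  component of \<open>q\<close> enters the even component of the product, so the equation can be
  evaluated there.\<close>

lemma point_unit:
  assumes x: "x \<in> points R" and a: "a \<in> even_part R" and q: "q \<in> carrier (loc_at R x)"
    and eq: "loc_at_map R x a \<otimes>\<^bsub>loc_at R x\<^esub> q = \<one>\<^bsub>loc_at R x\<^esub>"
  shows "x a \<noteq> 0"
proof -
  obtain \<xi> where \<xi>: "\<xi> \<in> ring_hom (ring_of (cloc (even_ring R) (nonvanishing R x))) (ring_of real_cinf)"
    "\<forall>c\<in>even_part R. \<xi> (fst (loc_at_map R x c)) = x c" using point_value[OF x] .
  interpret l: superloc R "nonvanishing R x" by (rule superloc_nonvanishing)
  obtain b u where bu: "q = (b, u)" "b \<in> carrier l.A" "u \<in> carrier (odd_loc R (nonvanishing R x))"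
    using q unfolding l.Q_simps by blast
  have L: "loc_at_map R x a = (l.L a, \<zero>\<^bsub>odd_loc R (nonvanishing R x)\<^esub>)" by (rule l.map_even[OF a])
  have "l.L a \<otimes>\<^bsub>l.A\<^esub> b = \<one>\<^bsub>l.A\<^esub>"
    using eq a bu(2,3) unfolding bu(1) L l.Q_simps by (simp add: l.om_zero)
  then have "\<xi> (l.L a \<otimes>\<^bsub>l.A\<^esub> b) = \<xi> \<one>\<^bsub>l.A\<^esub>" by simp
  then have "\<xi> (l.L a) * \<xi> b = 1"
    using ring_hom_mult[OF \<xi>(1)[folded l.A_def], of "l.L a" b] ring_hom_one[OF \<xi>(1)[folded l.A_def]] a bu(2)
    by (simp add: ring_of_def real_cinf_def cconst_def)
  then show ?thesis using bspec[OF \<xi>(2) a] L by auto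
qed

lemma loc_unit:
  assumes "a \<in> even_part R" "x a \<noteq> 0"
  shows "\<exists>u\<in>carrier (loc_at R x). u \<otimes>\<^bsub>loc_at R x\<^esub> loc_at_map R x a = \<one>\<^bsub>loc_at R x\<^esub>"
proof -
  interpret l: superloc R "nonvanishing R x" by (rule superloc_nonvanishing)
  interpret Q: cinf_superring "loc_at R x" by (rule loc_at_superring)
  obtain u where "u \<in> carrier (loc_at R x)" "loc_at_map R x a \<otimes>\<^bsub>loc_at R x\<^esub> u = \<one>\<^bsub>loc_at R x\<^esub>"
    using l.map_unit[of a] assms by (auto simp: nonvanishing_def)
  then show ?thesis using Q.even_commute[of "loc_at_map R x a" u] loc_simps(5)[OF assms(1), of x] by auto
qed

text \<open>\<open>e\<close> becomes a unit in the localization. An equation that holds after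
  multiplication by \<open>e\<close> therefore holds in the localizations at all points where
  \<open>e\<close> is nonzero, an open set.\<close>

lemma loc_cancel:
  assumes "e \<in> even_part R" "x e \<noteq> 0" "a \<in> carrier R" "b \<in> carrier R" "e \<otimes> a = e \<otimes> b"
  shows "loc_at_map R x a = loc_at_map R x b"
proof -
  interpret Q: cinf_superring "loc_at R x" by (rule loc_at_superring)
  obtain u where u: "u \<in> carrier (loc_at R x)" "u \<otimes>\<^bsub>loc_at R x\<^esub> loc_at_map R x e = \<one>\<^bsub>loc_at R x\<^esub>"
    using loc_unit[of e x, OF assms(1,2)] by blast
  have e: "loc_at_map R x e \<in> carrier (loc_at R x)" using assms(1) by (simp add: loc_simps(1))
  have "loc_at_map R x e \<otimes>\<^bsub>loc_at R x\<^esub> loc_at_map R x a = loc_at_map R x e \<otimes>\<^bsub>loc_at R x\<^esub> loc_at_map R x b"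
    using assms(1,3-5) loc_simps(3)[of e a x] loc_simps(3)[of e b x] by simp
  then have "u \<otimes>\<^bsub>loc_at R x\<^esub> loc_at_map R x e \<otimes>\<^bsub>loc_at R x\<^esub> loc_at_map R x a
      = u \<otimes>\<^bsub>loc_at R x\<^esub> loc_at_map R x e \<otimes>\<^bsub>loc_at R x\<^esub> loc_at_map R x b"
    using u(1) e assms(3,4) by (simp only: Q.m_assoc loc_simps(1))
  then show ?thesis using u assms(3,4) by (simp add: loc_simps(1))
qed

lemma sop_times:
  assumes "set cs \<subseteq> even_part R" "f \<in> Cinf (length cs)" "g \<in> Cinf (length cs)"
  shows "sop R f cs \<otimes> sop R g cs = sop R (\<lambda>z. f z * g z) cs"
  using sop_comp[of cs "\<lambda>x. x 0 * x 1" "[f, g]"] Cinf_ring_ops assms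
  by (simp add: sop_mult[unfolded One_nat_def] numeral_2_eq_2)

lemma sop_plus:
  assumes "set cs \<subseteq> even_part R" "f \<in> Cinf (length cs)" "g \<in> Cinf (length cs)"
  shows "sop R f cs \<oplus> sop R g cs = sop R (\<lambda>z. f z + g z) cs"
  using sop_comp[of cs "\<lambda>x. x 0 + x 1" "[f, g]"] Cinf_ring_ops assms
  by (simp add: sop_add[unfolded One_nat_def] numeral_2_eq_2)

text \<open>
  The witnesses are \<open>d = h(c)\<close> and \<open>e = k(c)\<close> with \<open>h(t) = 1/t\<close> on the support of the bump function
  \<open>k\<close> around \<open>x(c)\<close>.
\<close>

lemma local_inverse:
  assumes x: "x \<in> points R" and c: "c \<in> even_part R" "x c \<noteq> 0"
  obtains d e where "d \<in> even_part R" "e \<in> even_part R" "x e \<noteq> 0" "e \<otimes> (c \<otimes> d) = e \<otimes> \<one>"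
proof -
  define t where "t = (x c)\<^sup>2 / 2"
  define k where "k z = bump ((z 0)\<^sup>2 - t)" for z :: "nat \<Rightarrow> real"
  \<comment> \<open>Equal to \<open>(z 0)\<^sup>2\<close> where that is at least \<open>t\<close>,
    and positive everywhere thanks to the second term. So \<open>h\<close> is smooth on the whole
    line and equals 1/z wherever \<open>k\<close> is nonzero.\<close>
  define w where "w z = (z 0)\<^sup>2 + bump (t - (z 0)\<^sup>2)" for z :: "nat \<Rightarrow> real"
  define h where "h z = z 0 * (1 / w z)" for z :: "nat \<Rightarrow> real"
  have t: "t > 0" using c by (simp add: t_def)
  have p: "(\<lambda>z. z 0) \<in> Cinf 1" by (rule Cinf_proj) simp
  have k: "k \<in> Cinf 1" unfolding k_def by (intro Cinf_bump Cinf_diff Cinf_power p Cinf_const)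
  have w0: "w z \<noteq> 0" for z
  proof (cases "(z 0)\<^sup>2 < t")
    case True
    then show ?thesis using bump_simps(2)[of "t - (z 0)\<^sup>2"] zero_le_power2[of "z 0"] unfolding w_def by linarith
  next
    case False
    then show ?thesis using bump_simps(1)[of "t - (z 0)\<^sup>2"] t unfolding w_def by linarith
  qed
  have "w \<in> Cinf 1" unfolding w_def by (intro Cinf_add Cinf_bump Cinf_diff Cinf_power p Cinf_const)
  then have h: "h \<in> Cinf 1" unfolding h_def using w0 by (intro Cinf_mult Cinf_inverse p)
  have id: "k z * (z 0 * h z) = k z" for z
  proof (cases "(z 0)\<^sup>2 > t")
    case True
    then have "w z = (z 0)\<^sup>2" by (simp add: w_def bump_simps)
    then have "z 0 * h z = 1" using True t by (auto simp: h_def power2_eq_square)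
    then show ?thesis by simp
  qed (simp add: k_def bump_simps)
  have s: "set [c] \<subseteq> even_part R" using c by simp
  have l: "length [c] = 1" by simp
  note st = sop_times[OF s, unfolded l]
  have "sop R k [c] \<otimes> (sop R (\<lambda>z. z 0) [c] \<otimes> sop R h [c]) = sop R k [c]"
    using st[OF p h] st[OF k Cinf_mult[OF p h]] by (simp add: id)
  moreover have "sop R (\<lambda>z. z 0) [c] = c" using sop_proj[OF s, of 0] by simp
  moreover have "x (sop R k [c]) \<noteq> 0"
    using point_sop[OF x s] k l c by (simp add: k_def bump_simps t_def)
  ultimately show thesis
    using that[of "sop R h [c]" "sop R k [c]"] h k s l by simp
qed

end

section \<open>Stalks and global sections of sSpec\<close>

context cinf_superring begin

lemma openin_basic: "c \<in> even_part R \<Longrightarrow> openin (points_topology R) {x \<in> points R. x c \<noteq> 0}"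
  unfolding points_topology_def by (rule topology_generated_by_Basis) blast

text \<open>The generating sets form a basis: the sets given by \<open>c\<close> and
  \<open>d\<close> intersect in the one given by \<open>c \<otimes> d\<close>.\<close>

lemma basic_nhd:
  assumes "openin (points_topology R) V" "x \<in> V"
  shows "\<exists>c\<in>even_part R. x c \<noteq> 0 \<and> {y \<in> points R. y c \<noteq> 0} \<subseteq> V"
proof -
  have "generate_topology_on ((\<lambda>c. {x \<in> points R. x c \<noteq> 0}) ` even_part R) V"
    using assms(1) unfolding points_topology_def openin_topology_generated_by_iff .
  then show ?thesis using assms(2)
  proof induction
    case (Int U V)
    then obtain c d where c: "c \<in> even_part R" "x c \<noteq> 0" "{y \<in> points R. y c \<noteq> 0} \<subseteq> U"
      and d: "d \<in> even_part R" "x d \<noteq> 0" "{y \<in> points R. y d \<noteq> 0} \<subseteq> V" by blast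
    have "x \<in> points R"
    proof -
      have "openin (points_topology R) U"
        using Int.hyps(1) unfolding points_topology_def openin_topology_generated_by_iff .
      from openin_subset[OF this] Int.prems topspace_points[OF cinf_superring_axioms] show ?thesis by auto
    qed
    then have "x (c \<otimes> d) \<noteq> 0" using c d by (simp add: point_mult)
    moreover have "{y \<in> points R. y (c \<otimes> d) \<noteq> 0} \<subseteq> U \<inter> V"
      using c d by (auto simp: point_mult)
    ultimately show ?case using c d by (intro bexI[of _ "c \<otimes> d"] conjI) simp_all
  next
    case (UN K)
    then obtain k where k: "k \<in> K" "x \<in> k" by blast
    from UN.IH[OF k] k(1) show ?case by (elim bexE conjE) (intro bexI conjI, auto)
  next
    case (Basis s)
    then obtain c where "c \<in> even_part R" "s = {x \<in> points R. x c \<noteq> 0}" by blast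
    with Basis.prems show ?case by (intro bexI[of _ c]) auto
  qed simp
qed

lemma open_points: "openin (points_topology R) (points R)"
  using topspace_points[OF cinf_superring_axioms] by (metis openin_topspace)

lemma open_subset_points: "openin (points_topology R) U \<Longrightarrow> U \<subseteq> points R"
  using topspace_points[OF cinf_superring_axioms] openin_subset by metis

text \<open>Germs at \<open>x\<close> have real values, and an even germ with nonzero value is
  invertible by \<open>local_inverse\<close>; these are the hypotheses of
  \<open>local_csringI\<close>.\<close>

theorem sSpec_lc_superspace: "lc_superspace (sSpec R)"
proof (intro lc_superspace.intro lc_superspace_axioms.intro sSpec_sheaf)
  fix x assume "x \<in> topspace (topo (sSpec R))"
  then have x: "x \<in> points R" and xt: "x \<in> topspace (topo (sSpec R))"
    using topspace_points[OF cinf_superring_axioms] by simp_all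
  interpret Sh: csring_sheaf "sSpec R" by (rule sSpec_sheaf)
  interpret P: cinf_superring "stalk (sSpec R) x" by (rule Sh.stalk_superring[OF xt])
  \<comment> \<open>The value at \<open>x\<close> of any ring element with the same image as the
    section in the localization at \<open>x\<close>; \<open>point_loc_cong\<close> gives
    independence of the choices.\<close>
  define v where "v g = (THE r. \<exists>U \<sigma> a. openin (points_topology R) U \<and> x \<in> U \<and>
    \<sigma> \<in> local_sections R (even_part R) U \<and> a \<in> even_part R \<and> \<sigma> x = loc_at_map R x a \<and>
    g = germ (sSpec R) x U \<sigma> \<and> r = x a)" for g
  have car: "\<sigma> \<in> local_sections R (carrier R) U" if "\<sigma> \<in> local_sections R (even_part R) U" for \<sigma> U
    using that local_sections_mono[OF even_subset] by blast
  have v: "v (germ (sSpec R) x U \<sigma>) = x a"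
    if U: "openin (points_topology R) U" "x \<in> U" and s: "\<sigma> \<in> local_sections R (even_part R) U"
      and a: "a \<in> even_part R" "\<sigma> x = loc_at_map R x a" for U \<sigma> a
    unfolding v_def
  proof (rule the_equality)
    fix r assume "\<exists>V \<tau> b. openin (points_topology R) V \<and> x \<in> V \<and>
      \<tau> \<in> local_sections R (even_part R) V \<and> b \<in> even_part R \<and> \<tau> x = loc_at_map R x b \<and>
      germ (sSpec R) x U \<sigma> = germ (sSpec R) x V \<tau> \<and> r = x b"
    then obtain V \<tau> b where V: "openin (points_topology R) V" "x \<in> V" and t: "\<tau> \<in> local_sections R (even_part R) V"
      and b: "b \<in> even_part R" "\<tau> x = loc_at_map R x b"
      and g: "germ (sSpec R) x U \<sigma> = germ (sSpec R) x V \<tau>" and r: "r = x b" by blast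
    obtain W where W: "x \<in> W" "res (sSpec R) U W \<sigma> = res (sSpec R) V W \<tau>"
      using g Sh.germ_eq[of U x \<sigma> V \<tau>] U V car[OF s] car[OF t] by (auto simp: sSpec_sec_simps)
    have "restrict \<sigma> W = restrict \<tau> W" using W(2) by (simp add: sSpec_res[OF car[OF s]] sSpec_res[OF car[OF t]])
    from fun_cong[OF this, of x] have "\<sigma> x = \<tau> x" using W(1) by simp
    then show "r = x a" using point_loc_cong[OF x a(1) b(1)] a b r by simp
  qed (use that in blast)
  have rep: "\<exists>a\<in>even_part R. \<sigma> x = loc_at_map R x a"
    if "\<sigma> \<in> local_sections R (even_part R) U" "x \<in> U" for \<sigma> U
    using local_sectionsD[OF that] that(2) by metis
  have ev: "even_part (stalk (sSpec R) x) = germs (sSpec R) x even_part" by (rule Sh.stalk_parts)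
  have vop: "v (g \<oplus>\<^bsub>stalk (sSpec R) x\<^esub> h) = v g + v h \<and> v (g \<otimes>\<^bsub>stalk (sSpec R) x\<^esub> h) = v g * v h"
    if g: "g \<in> even_part (stalk (sSpec R) x)" and h: "h \<in> even_part (stalk (sSpec R) x)" for g h
  proof -
    obtain U \<sigma> \<tau> where U: "openin (topo (sSpec R)) U" "x \<in> U" and st: "\<sigma> \<in> even_part (sec (sSpec R) U)"
      "g = germ (sSpec R) x U \<sigma>" "\<tau> \<in> even_part (sec (sSpec R) U)" "h = germ (sSpec R) x U \<tau>"
      using Sh.germs_rep2[OF Sh.stable(2) Sh.stable(2) g[unfolded ev] h[unfolded ev]] .
    have U': "openin (points_topology R) U" using U by simp
    interpret S: cinf_superring "sSpec_sec R U" by (rule sSpec_sec_superring[OF U'])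
    have st': "\<sigma> \<in> local_sections R (even_part R) U" "\<tau> \<in> local_sections R (even_part R) U"
      using st by (simp_all add: sSpec_sec_simps)
    obtain a b where ab: "a \<in> even_part R" "\<sigma> x = loc_at_map R x a" "b \<in> even_part R" "\<tau> x = loc_at_map R x b"
      using rep[OF st'(1) U(2)] rep[OF st'(2) U(2)] by blast
    have "\<sigma> \<oplus>\<^bsub>sSpec_sec R U\<^esub> \<tau> \<in> even_part (sSpec_sec R U)" "\<sigma> \<otimes>\<^bsub>sSpec_sec R U\<^esub> \<tau> \<in> even_part (sSpec_sec R U)"
      using st by simp_all
    then have *: "\<sigma> \<oplus>\<^bsub>sSpec_sec R U\<^esub> \<tau> \<in> local_sections R (even_part R) U"
      "\<sigma> \<otimes>\<^bsub>sSpec_sec R U\<^esub> \<tau> \<in> local_sections R (even_part R) U" by (simp_all add: sSpec_sec_simps)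
    have x1: "(\<sigma> \<oplus>\<^bsub>sSpec_sec R U\<^esub> \<tau>) x = loc_at_map R x (a \<oplus> b)"
      "(\<sigma> \<otimes>\<^bsub>sSpec_sec R U\<^esub> \<tau>) x = loc_at_map R x (a \<otimes> b)"
      using ab U(2) loc_simps(2)[of a b x] loc_simps(3)[of a b x] by (simp_all add: sSpec_sec_simps)
    have "v g = x a" "v h = x b" unfolding st using v[OF U' U(2)] st' ab by blast+
    moreover have "g \<oplus>\<^bsub>stalk (sSpec R) x\<^esub> h = germ (sSpec R) x U (\<sigma> \<oplus>\<^bsub>sSpec_sec R U\<^esub> \<tau>)"
      "g \<otimes>\<^bsub>stalk (sSpec R) x\<^esub> h = germ (sSpec R) x U (\<sigma> \<otimes>\<^bsub>sSpec_sec R U\<^esub> \<tau>)"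
      unfolding st(2,4) using Sh.stalk_simps(1,2)[OF U, of \<sigma> \<tau>] st(1,3) by simp_all
    ultimately show ?thesis
      using v[OF U' U(2) *(1) _ x1(1)] v[OF U' U(2) *(2) _ x1(2)] ab point_add[OF x] point_mult[OF x] by simp
  qed
  show "local_csring (stalk (sSpec R) x)"
  proof (rule P.local_csringI[where v = v])
    fix r
    have U: "openin (topo (sSpec R)) (points R)" using open_points by simp
    interpret S: cinf_superring "sSpec_sec R (points R)" by (rule sSpec_sec_superring[OF open_points])
    have "sop (stalk (sSpec R) x) (\<lambda>_. r) (map (germ (sSpec R) x (points R)) [])
      = germ (sSpec R) x (points R) (sop (sec (sSpec R) (points R)) (\<lambda>_. r) [])"
      by (rule Sh.stalk_sop[OF U x]) auto
    moreover have "v \<dots> = x (sop R (\<lambda>_. r) [])"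
    proof (rule v[OF open_points x])
      have "sop (sSpec_sec R (points R)) (\<lambda>_. r) [] \<in> even_part (sSpec_sec R (points R))" by simp
      then show "sop (sec (sSpec R) (points R)) (\<lambda>_. r) [] \<in> local_sections R (even_part R) (points R)"
        by (simp add: sSpec_sec_simps)
      show "sop (sec (sSpec R) (points R)) (\<lambda>_. r) [] x = loc_at_map R x (sop R (\<lambda>_. r) [])"
        using x loc_sop[of "[]" "\<lambda>_. r" x] by (simp add: sSpec_sec_simps)
    qed simp
    ultimately show "v (sop (stalk (sSpec R) x) (\<lambda>_. r) []) = r" using point_const[OF x] by simp
  next
    fix g assume g: "g \<in> even_part (stalk (sSpec R) x)" "v g \<noteq> 0"
    obtain U \<sigma> where U: "openin (topo (sSpec R)) U" "x \<in> U" and s: "\<sigma> \<in> even_part (sec (sSpec R) U)"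
      "g = germ (sSpec R) x U \<sigma>" using g(1) unfolding ev by (rule Sh.germs_rep)
    have s': "\<sigma> \<in> local_sections R (even_part R) U" using s by (simp add: sSpec_sec_simps)
    obtain V a where V: "openin (points_topology R) V" "x \<in> V" "V \<subseteq> U" "a \<in> even_part R"
      "\<forall>y\<in>V. \<sigma> y = loc_at_map R y a" using s' U(2) by (rule local_sectionsD)
    have "x a \<noteq> 0" using g(2) v[OF _ U(2) s' V(4)] U V s by auto
    then obtain d e where de: "d \<in> even_part R" "e \<in> even_part R" "x e \<noteq> 0" "e \<otimes> (a \<otimes> d) = e \<otimes> \<one>"
      using local_inverse[OF x V(4)] by metis
    \<comment> \<open>At every point of \<open>W\<close> the element \<open>e\<close> is nonzero and
      can be cancelled, so \<open>d\<close> inverts the section on a neighbourhood and not only at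
      \<open>x\<close>.\<close>
    define W where "W = V \<inter> {y \<in> points R. y e \<noteq> 0}"
    have W: "openin (points_topology R) W" "x \<in> W" "W \<subseteq> U"
      using V openin_basic[OF de(2)] x de by (auto simp: W_def)
    have W': "openin (topo (sSpec R)) W" using W by simp
    define \<tau> where "\<tau> = (\<lambda>y\<in>W. loc_at_map R y d)"
    have t: "\<tau> \<in> local_sections R (even_part R) W"
      unfolding \<tau>_def by (rule local_sections_const[OF W(1) de(1)]) simp
    have g': "g = germ (sSpec R) x W (restrict \<sigma> W)"
      unfolding s(2) using Sh.germ_res[OF U(1) W' W(3,2), of \<sigma>] car[OF s']
      by (simp add: sSpec_res sSpec_sec_simps)
    have sW: "restrict \<sigma> W \<in> local_sections R (even_part R) W" by (rule local_sections_restrict[OF s' W(1,3)])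
    have "restrict \<sigma> W \<otimes>\<^bsub>sSpec_sec R W\<^esub> \<tau> = \<one>\<^bsub>sSpec_sec R W\<^esub>"
      unfolding sSpec_sec_simps
    proof (rule restrict_ext)
      fix y assume y: "y \<in> W"
      then have "restrict \<sigma> W y \<otimes>\<^bsub>loc_at R y\<^esub> \<tau> y = loc_at_map R y (a \<otimes> d)"
        using V de loc_simps(3)[of a d y] by (auto simp: \<tau>_def W_def)
      also have "\<dots> = loc_at_map R y \<one>"
        using y de V by (intro loc_cancel[of e]) (auto simp: W_def)
      finally show "restrict \<sigma> W y \<otimes>\<^bsub>loc_at R y\<^esub> \<tau> y = \<one>\<^bsub>loc_at R y\<^esub>" by (simp add: loc_simps(4))
    qed
    then have "g \<otimes>\<^bsub>stalk (sSpec R) x\<^esub> germ (sSpec R) x W \<tau> = \<one>\<^bsub>stalk (sSpec R) x\<^esub>"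
      unfolding g' using Sh.stalk_simps(2,3)[OF W' W(2)] car[OF sW] car[OF t] by (simp add: sSpec_sec_simps(1))
    moreover have "germ (sSpec R) x W \<tau> \<in> even_part (stalk (sSpec R) x)"
      unfolding ev using t by (intro Sh.germ_in_germs W' W) (simp add: sSpec_sec_simps)
    ultimately show "\<exists>h\<in>even_part (stalk (sSpec R) x). g \<otimes>\<^bsub>stalk (sSpec R) x\<^esub> h = \<one>\<^bsub>stalk (sSpec R) x\<^esub>" by blast
  qed (use vop in blast)+
qed

section \<open>Sections induced by elements of the ring\<close>

definition global :: "('a \<Rightarrow> real) set \<Rightarrow> 'a \<Rightarrow> ('a \<Rightarrow> real) \<Rightarrow> 'a sloc" where
  "global U = (\<lambda>a\<in>carrier R. \<lambda>x\<in>U. loc_at_map R x a)"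

lemma global_simps: "\<lbrakk>a \<in> carrier R; x \<in> U\<rbrakk> \<Longrightarrow> global U a x = loc_at_map R x a"
  "a \<in> carrier R \<Longrightarrow> global U a = (\<lambda>x\<in>U. loc_at_map R x a)"
  by (simp_all add: global_def)

lemma global_local: "\<lbrakk>openin (points_topology R) U; A \<subseteq> carrier R; a \<in> A\<rbrakk> \<Longrightarrow> global U a \<in> local_sections R A U"
  using local_sections_const[of R U a A "\<lambda>x. loc_at_map R x a"] by (auto simp: global_def)

lemma global_hom:
  assumes U: "openin (points_topology R) U" shows "global U \<in> csring_hom R (sSpec_sec R U)"
proof (rule csring_homI[OF cinf_superring_axioms sSpec_sec_superring[OF U]])
  show "global U a \<in> carrier (sSpec_sec R U)" if "a \<in> carrier R" for a
    using global_local[OF U _ that] by (simp add: sSpec_sec_simps)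
  show "global U a \<in> even_part (sSpec_sec R U)" if "a \<in> even_part R" for a
    using global_local[OF U even_subset that] by (simp add: sSpec_sec_simps)
  show "global U a \<in> odd_part (sSpec_sec R U)" if "a \<in> odd_part R" for a
    using global_local[OF U odd_subset that] by (simp add: sSpec_sec_simps)
  fix f cs assume *: "set cs \<subseteq> even_part R" "f \<in> Cinf (length cs)"
  have m: "map (\<lambda>\<sigma>. \<sigma> x) (map (global U) cs) = map (loc_at_map R x) cs" if "x \<in> U" for x
    using * that by (auto simp: global_simps)
  show "global U (sop R f cs) = sop (sSpec_sec R U) f (map (global U) cs)"
    unfolding sSpec_sec_simps(8) global_simps(2)[OF base.even_carr[OF sop_closed[OF *]]]
    by (intro restrict_ext) (simp only: m loc_sop[OF *])
qed (auto simp: global_def sSpec_sec_simps loc_simps intro!: restrict_ext)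

end

section \<open>The functor on morphisms\<close>

lemma points_map_point:
  assumes R: "cinf_superring R" and S: "cinf_superring S" and \<phi>: "\<phi> \<in> csring_hom R S" and y: "y \<in> points S"
  shows "points_map R S \<phi> y \<in> points R" "a \<in> even_part R \<Longrightarrow> points_map R S \<phi> y a = y (\<phi> a)"
proof -
  interpret R: cinf_superring R by fact
  interpret S: cinf_superring S by fact
  show "points_map R S \<phi> y a = y (\<phi> a)" if "a \<in> even_part R" for a
    using that y by (simp add: points_map_def compose_def)
  have "compose (even_part R) y \<phi> \<in> points R"
    unfolding points_def cinf_hom_def
  proof (intro CollectI conjI allI impI)
    show "compose (even_part R) y \<phi> \<in> carrier (even_ring R) \<rightarrow>\<^sub>E carrier real_cinf"
      by (auto simp: compose_def real_cinf_def)
    fix f cs assume "set cs \<subseteq> carrier (even_ring R)" "f \<in> Cinf (length cs)"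
    then have cs: "set cs \<subseteq> even_part R" "f \<in> Cinf (length cs)" by simp_all
    have ev: "set (map \<phi> cs) \<subseteq> even_part S" using cs csring_homD(7)[OF \<phi>] by auto
    have m: "map (compose (even_part R) y \<phi>) cs = map y (map \<phi> cs)"
      using cs by (auto simp: compose_def)
    have "y (\<phi> (sop R f cs)) = f (\<lambda>i. map y (map \<phi> cs) ! i)"
      using S.point_sop[OF y ev] csring_hom_sop[OF R \<phi> cs] cs by simp
    then show "compose (even_part R) y \<phi> (cop (even_ring R) f cs)
      = cop real_cinf f (map (compose (even_part R) y \<phi>) cs)"
      unfolding m using cs by (simp add: compose_def even_ring_def real_cinf_def)
  qed
  then show "points_map R S \<phi> y \<in> points R" using y by (simp add: points_map_def)
qed

text \<open>An element that is nonzero at the image point is sent by \<open>\<phi>\<close> to one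
  that is nonzero at \<open>y\<close>, hence to a unit of the localization. The universal property
  then makes the definite description meaningful.\<close>

lemma localized_hom:
  assumes R: "cinf_superring R" and S: "cinf_superring S" and \<phi>: "\<phi> \<in> csring_hom R S" and y: "y \<in> points S"
  shows "localized_hom R S \<phi> y \<in> csring_hom (loc_at R (points_map R S \<phi> y)) (loc_at S y)"
    "a \<in> carrier R \<Longrightarrow> localized_hom R S \<phi> y (loc_at_map R (points_map R S \<phi> y) a) = loc_at_map S y (\<phi> a)"
proof -
  interpret R: cinf_superring R by fact
  interpret S: cinf_superring S by fact
  interpret Q: cinf_superring "loc_at S y" by (rule S.loc_at_superring)
  note x = points_map_point[OF R S \<phi> y]
  let ?\<psi> = "compose (carrier R) (loc_at_map S y) \<phi>"
  have psi: "?\<psi> \<in> csring_hom R (loc_at S y)"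
    by (rule csring_hom_compose[OF R S S.loc_at_superring S.loc_at_map_hom \<phi>])
  have "\<exists>!\<xi>. \<xi> \<in> csring_hom (loc_at R (points_map R S \<phi> y)) (loc_at S y) \<and>
      (\<forall>a\<in>carrier R. \<xi> (loc_at_map R (points_map R S \<phi> y) a) = ?\<psi> a)"
  proof (rule sloc_universal[OF R _ S.loc_at_superring psi])
    fix s assume "s \<in> nonvanishing R (points_map R S \<phi> y)"
    then have s: "s \<in> even_part R" "y (\<phi> s) \<noteq> 0" using x by (auto simp: nonvanishing_def)
    have e: "\<phi> s \<in> even_part S" using csring_homD(7)[OF \<phi>] s by blast
    obtain u where "u \<in> carrier (loc_at S y)" "u \<otimes>\<^bsub>loc_at S y\<^esub> loc_at_map S y (\<phi> s) = \<one>\<^bsub>loc_at S y\<^esub>"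
      using S.loc_unit[of "\<phi> s" y, OF e s(2)] by blast
    then show "\<exists>d\<in>carrier (loc_at S y). ?\<psi> s \<otimes>\<^bsub>loc_at S y\<^esub> d = \<one>\<^bsub>loc_at S y\<^esub>"
      using Q.even_commute[OF S.loc_simps(5)[OF e]] s(1) by (auto simp: compose_def)
  qed (auto simp: nonvanishing_def)
  moreover have "(\<forall>a\<in>carrier R. \<xi> (loc_at_map R (points_map R S \<phi> y) a) = ?\<psi> a) \<longleftrightarrow>
      (\<forall>a\<in>carrier R. \<xi> (loc_at_map R (points_map R S \<phi> y) a) = loc_at_map S y (\<phi> a))" for \<xi>
    by (auto simp: compose_def)
  ultimately have ex: "\<exists>!\<xi>. \<xi> \<in> csring_hom (loc_at R (points_map R S \<phi> y)) (loc_at S y) \<and>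
      (\<forall>a\<in>carrier R. \<xi> (loc_at_map R (points_map R S \<phi> y) a) = loc_at_map S y (\<phi> a))" by simp
  from theI'[OF ex]
  show "localized_hom R S \<phi> y \<in> csring_hom (loc_at R (points_map R S \<phi> y)) (loc_at S y)"
    "a \<in> carrier R \<Longrightarrow> localized_hom R S \<phi> y (loc_at_map R (points_map R S \<phi> y) a) = loc_at_map S y (\<phi> a)"
    unfolding localized_hom_def Let_def by blast+
qed

text \<open>The preimage of the basic set of \<open>c\<close> is the basic set of
  \<open>\<phi> c\<close>.\<close>

lemma points_map_continuous:
  assumes R: "cinf_superring R" and S: "cinf_superring S" and \<phi>: "\<phi> \<in> csring_hom R S"
  shows "continuous_map (points_topology S) (points_topology R) (points_map R S \<phi>)"
  unfolding points_topology_def[of R]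
proof (rule continuous_on_generated_topo)
  interpret R: cinf_superring R by fact
  interpret S: cinf_superring S by fact
  note x = points_map_point[OF R S \<phi>] and top = topspace_points[OF S]
  show "openin (points_topology S) (points_map R S \<phi> -` U \<inter> topspace (points_topology S))"
    if U: "U \<in> (\<lambda>c. {x \<in> points R. x c \<noteq> 0}) ` even_part R" for U
  proof -
    obtain c where c: "c \<in> even_part R" "U = {x \<in> points R. x c \<noteq> 0}" using U by blast
    have "points_map R S \<phi> -` U \<inter> topspace (points_topology S) = {y \<in> points S. y (\<phi> c) \<noteq> 0}"
      unfolding top c(2)
    proof (rule Set.set_eqI)
      fix y
      show "y \<in> points_map R S \<phi> -` {x \<in> points R. x c \<noteq> 0} \<inter> points S \<longleftrightarrow> y \<in> {y \<in> points S. y (\<phi> c) \<noteq> 0}"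
        using x(1)[of y] x(2)[of y c] c(1) by (cases "y \<in> points S") simp_all
    qed
    then show ?thesis using S.openin_basic[of "\<phi> c"] csring_homD(7)[OF \<phi> c(1)] by simp
  qed
  show "points_map R S \<phi> ` topspace (points_topology S) \<subseteq> \<Union> ((\<lambda>c. {x \<in> points R. x c \<noteq> 0}) ` even_part R)"
  proof
    fix z assume "z \<in> points_map R S \<phi> ` topspace (points_topology S)"
    then have "z \<in> points R" unfolding top using x(1) by blast
    then have "z \<in> {x \<in> points R. x \<one>\<^bsub>R\<^esub> \<noteq> 0}" by (simp add: R.point_one)
    then show "z \<in> \<Union> ((\<lambda>c. {x \<in> points R. x c \<noteq> 0}) ` even_part R)"
      by (rule UN_I[OF R.one_even])
  qed
qed

lemma openin_preim:
  assumes "continuous_map (topo X) (topo Y) f" "openin (topo Y) V"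
  shows "openin (topo X) (preim X f V)"
  using openin_continuous_map_preimage[OF assms] by (simp add: preim_def)

context
  fixes R :: "'a csring" and S :: "'b csring" and \<phi> :: "'a \<Rightarrow> 'b"
  assumes R: "cinf_superring R" and S: "cinf_superring S" and \<phi>: "\<phi> \<in> csring_hom R S"
begin

interpretation R: cinf_superring R by (rule R)
interpretation S: cinf_superring S by (rule S)

text \<open>If \<open>a\<close> induces the section on \<open>V\<close>, then
  \<open>\<phi> a\<close> induces its image on the preimage of \<open>V\<close>.\<close>

lemma localized_sections:
  assumes U: "openin (points_topology R) U" and \<sigma>: "\<sigma> \<in> local_sections R A U"
    and A: "A \<subseteq> carrier R" "\<phi> ` A \<subseteq> B"
  shows "(\<lambda>y\<in>preim (sSpec S) (points_map R S \<phi>) U. localized_hom R S \<phi> y (\<sigma> (points_map R S \<phi> y)))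
    \<in> local_sections S B (preim (sSpec S) (points_map R S \<phi>) U)"
proof (rule local_sectionsI)
  let ?f = "points_map R S \<phi>"
  have pre: "preim (sSpec S) ?f V = {y \<in> points S. ?f y \<in> V}" for V
    using topspace_points[OF S] by (simp add: preim_def)
  fix y assume "y \<in> preim (sSpec S) ?f U"
  then have y: "y \<in> points S" "?f y \<in> U" by (simp_all add: pre)
  from \<sigma> y(2) obtain V a where V: "openin (points_topology R) V" "?f y \<in> V" "V \<subseteq> U" "a \<in> A"
    "\<forall>x\<in>V. \<sigma> x = loc_at_map R x a" by (rule local_sectionsD)
  have o: "openin (points_topology S) (preim (sSpec S) ?f V)"
    using openin_preim[of "sSpec S" "sSpec R" ?f V] points_map_continuous[OF R S \<phi>] V(1) by simp
  have a: "a \<in> carrier R" using A V by blast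
  have "localized_hom R S \<phi> z (\<sigma> (?f z)) = loc_at_map S z (\<phi> a)" if "z \<in> preim (sSpec S) ?f V" for z
  proof -
    have "z \<in> points S" "?f z \<in> V" using that by (simp_all add: pre)
    then show ?thesis using V(5) localized_hom(2)[OF R S \<phi> _ a, of z] by simp
  qed
  moreover have "preim (sSpec S) ?f V \<subseteq> preim (sSpec S) ?f U" using V(3) by (auto simp: pre)
  moreover have "\<phi> a \<in> B" using A V by blast
  moreover have "y \<in> preim (sSpec S) ?f V" using y V by (simp add: pre)
  ultimately show "\<exists>V a. openin (points_topology S) V \<and> y \<in> V \<and> V \<subseteq> preim (sSpec S) ?f U \<and> a \<in> B \<and>
      (\<forall>z\<in>V. (\<lambda>y\<in>preim (sSpec S) ?f U. localized_hom R S \<phi> y (\<sigma> (?f y))) z = loc_at_map S z a)"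
    using o by (intro exI[of _ "preim (sSpec S) ?f V"] exI[of _ "\<phi> a"]) auto
qed simp

lemma sSpec_map_hom: "sSpec_map R S \<phi> \<in> superspace_hom (sSpec S) (sSpec R)"
proof -
  let ?f = "points_map R S \<phi>"
  let ?fs = "snd (sSpec_map R S \<phi>)"
  let ?W = "preim (sSpec S) ?f"
  have pre: "preim (sSpec S) ?f V = {y \<in> points S. ?f y \<in> V}" for V
    using topspace_points[OF S] by (simp add: preim_def)
  have fs: "?fs V \<sigma> = (\<lambda>y\<in>?W V. localized_hom R S \<phi> y (\<sigma> (?f y)))"
    if "openin (points_topology R) V" "\<sigma> \<in> local_sections R (carrier R) V" for V \<sigma>
    using that by (simp add: sSpec_map_def R.sSpec_sec_simps)
  have o: "openin (points_topology S) (?W V)" if "openin (points_topology R) V" for V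
    using openin_preim[of "sSpec S" "sSpec R" ?f V] points_map_continuous[OF R S \<phi>] that by simp
  have hom: "?fs V \<in> csring_hom (sSpec_sec R V) (sSpec_sec S (?W V))" if V: "openin (points_topology R) V" for V
  proof (rule csring_homI[OF R.sSpec_sec_superring[OF V] S.sSpec_sec_superring[OF o[OF V]]])
    interpret RV: cinf_superring "sSpec_sec R V" by (rule R.sSpec_sec_superring[OF V])
    note h = csring_homD[OF localized_hom(1)[OF R S \<phi>]]
    show "?fs V \<in> extensional (carrier (sSpec_sec R V))" using V by (simp add: sSpec_map_def)
    have fs': "?fs V \<sigma> = (\<lambda>y\<in>?W V. localized_hom R S \<phi> y (\<sigma> (?f y)))" if "\<sigma> \<in> carrier (sSpec_sec R V)" for \<sigma>
      using fs[OF V] that by (simp add: R.sSpec_sec_simps)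
    have in_loc: "\<sigma> (?f y) \<in> carrier (loc_at R (?f y))" "y \<in> points S" "?f y \<in> V"
      if "\<sigma> \<in> carrier (sSpec_sec R V)" "y \<in> ?W V" for \<sigma> y
      using R.local_sections_in(1)[of \<sigma> V "?f y"] that by (simp_all add: R.sSpec_sec_simps pre)
    { fix \<sigma> assume "\<sigma> \<in> carrier (sSpec_sec R V)"
      then show "?fs V \<sigma> \<in> carrier (sSpec_sec S (?W V))"
        using localized_sections[OF V, of \<sigma> "carrier R" "carrier S"] fs' csring_homD(3)[OF \<phi>]
        by (auto simp: R.sSpec_sec_simps S.sSpec_sec_simps) }
    { fix \<sigma> assume "\<sigma> \<in> even_part (sSpec_sec R V)"
      then show "?fs V \<sigma> \<in> even_part (sSpec_sec S (?W V))"
        using localized_sections[OF V, of \<sigma> "even_part R" "even_part S"] fs'[of \<sigma>] R.even_subset csring_homD(7)[OF \<phi>]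
          RV.even_subset by (auto simp: R.sSpec_sec_simps(2) S.sSpec_sec_simps(2)) }
    { fix \<sigma> assume "\<sigma> \<in> odd_part (sSpec_sec R V)"
      then show "?fs V \<sigma> \<in> odd_part (sSpec_sec S (?W V))"
        using localized_sections[OF V, of \<sigma> "odd_part R" "odd_part S"] fs'[of \<sigma>] R.odd_subset csring_homD(8)[OF \<phi>]
          RV.odd_subset by (auto simp: R.sSpec_sec_simps(3) S.sSpec_sec_simps(3)) }
    { fix \<sigma> \<tau> assume *: "\<sigma> \<in> carrier (sSpec_sec R V)" "\<tau> \<in> carrier (sSpec_sec R V)"
      show "?fs V (\<sigma> \<oplus>\<^bsub>sSpec_sec R V\<^esub> \<tau>) = ?fs V \<sigma> \<oplus>\<^bsub>sSpec_sec S (?W V)\<^esub> ?fs V \<tau>"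
        unfolding fs'[OF *(1)] fs'[OF *(2)] fs'[OF RV.a_closed[OF *]] S.sSpec_sec_simps(4)
        using in_loc[OF *(1)] in_loc[OF *(2)] h(4)
        by (intro restrict_ext) (simp add: R.sSpec_sec_simps(4))
      show "?fs V (\<sigma> \<otimes>\<^bsub>sSpec_sec R V\<^esub> \<tau>) = ?fs V \<sigma> \<otimes>\<^bsub>sSpec_sec S (?W V)\<^esub> ?fs V \<tau>"
        unfolding fs'[OF *(1)] fs'[OF *(2)] fs'[OF RV.m_closed[OF *]] S.sSpec_sec_simps(5)
        using in_loc[OF *(1)] in_loc[OF *(2)] h(5)
        by (intro restrict_ext) (simp add: R.sSpec_sec_simps(5)) }
    show "?fs V \<one>\<^bsub>sSpec_sec R V\<^esub> = \<one>\<^bsub>sSpec_sec S (?W V)\<^esub>"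
      unfolding fs'[OF RV.one_closed] S.sSpec_sec_simps(6)
      using in_loc[OF RV.one_closed] h(6) by (intro restrict_ext) (simp add: R.sSpec_sec_simps(6))
    fix g \<sigma>s assume *: "set \<sigma>s \<subseteq> even_part (sSpec_sec R V)" "g \<in> Cinf (length \<sigma>s)"
    then have c: "sop (sSpec_sec R V) g \<sigma>s \<in> carrier (sSpec_sec R V)" by simp
    show "?fs V (sop (sSpec_sec R V) g \<sigma>s) = sop (sSpec_sec S (?W V)) g (map (?fs V) \<sigma>s)"
      unfolding fs'[OF c] S.sSpec_sec_simps(8)
    proof (rule restrict_ext)
      fix y assume y: "y \<in> ?W V"
      have fy: "y \<in> points S" "?f y \<in> V" using y by (simp_all add: pre)
      have ev: "set (map (\<lambda>\<sigma>. \<sigma> (?f y)) \<sigma>s) \<subseteq> even_part (loc_at R (?f y))"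
        using *(1) R.local_sections_in(2)[OF _ fy(2)] by (auto simp: R.sSpec_sec_simps)
      have m: "map (\<lambda>\<sigma>. \<sigma> y) (map (?fs V) \<sigma>s) = map (localized_hom R S \<phi> y) (map (\<lambda>\<sigma>. \<sigma> (?f y)) \<sigma>s)"
        using *(1) y fs' RV.even_subset by auto
      show "localized_hom R S \<phi> y (sop (sSpec_sec R V) g \<sigma>s (?f y))
          = sop (loc_at S y) g (map (\<lambda>\<sigma>. \<sigma> y) (map (?fs V) \<sigma>s))"
        unfolding m
        using csring_hom_sop[OF R.loc_at_superring localized_hom(1)[OF R S \<phi> fy(1)] ev, of g] *(2) fy(2)
        by (simp add: R.sSpec_sec_simps(8) del: map_map)
    qed
  qed
  have nat: "?fs W (res (sSpec R) V W s) = res (sSpec S) (?W V) (?W W) (?fs V s)"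
    if V: "openin (points_topology R) V" and W: "openin (points_topology R) W" and WV: "W \<subseteq> V"
      and s: "s \<in> local_sections R (carrier R) V" for V W s
  proof -
    have r: "restrict s W \<in> local_sections R (carrier R) W" by (rule R.local_sections_restrict[OF s W WV])
    have c: "?fs V s \<in> local_sections S (carrier S) (?W V)"
      using csring_homD(3)[OF hom[OF V], of s] s by (simp add: R.sSpec_sec_simps S.sSpec_sec_simps)
    have sub: "?W W \<subseteq> ?W V" using WV by (auto simp: pre)
    have "res (sSpec S) (?W V) (?W W) (?fs V s) = restrict (?fs V s) (?W W)" by (rule S.sSpec_res[OF c])
    then show ?thesis
      unfolding R.sSpec_res[OF s] fs[OF W r] fs[OF V s]
      using sub by (auto simp: fun_eq_iff restrict_def pre)
  qed
  have "?f \<in> extensional (topspace (topo (sSpec S)))" "?fs \<in> extensional {V. openin (topo (sSpec R)) V}"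
    using topspace_points[OF S] by (simp_all add: points_map_def sSpec_map_def)
  then have "(?f, ?fs) \<in> superspace_hom (sSpec S) (sSpec R)"
    unfolding superspace_hom_def using points_map_continuous[OF R S \<phi>] hom nat
    by (simp add: R.sSpec_sec_simps(1))
  moreover have "(?f, ?fs) = sSpec_map R S \<phi>" by (simp add: sSpec_map_def)
  ultimately show ?thesis by (simp only:)
qed

end

section \<open>Functoriality\<close>

lemma sSpec_map_id:
  assumes R: "cinf_superring R" shows "sSpec_map R R (\<lambda>a\<in>carrier R. a) = superspace_id (sSpec R)"
proof -
  interpret R: cinf_superring R by (rule R)
  let ?i = "\<lambda>a\<in>carrier R. a"
  note i = csring_hom_id[OF R]
  have f: "points_map R R ?i = (\<lambda>x\<in>points R. x)"
  proof (rule extensionalityI[of _ "points R"])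
    fix x assume x: "x \<in> points R"
    have "points_map R R ?i x = x"
    proof (rule extensionalityI[of _ "even_part R"])
      show "points_map R R ?i x \<in> extensional (even_part R)" using x by (simp add: points_map_def)
      show "x \<in> extensional (even_part R)"
        using x by (auto simp: points_def cinf_hom_def even_ring_def PiE_def)
    qed (use x in \<open>simp add: points_map_def compose_def\<close>)
    then show "points_map R R ?i x = (\<lambda>x\<in>points R. x) x" using x by simp
  qed (simp_all add: points_map_def)
  have "(\<lambda>\<sigma>\<in>carrier (sSpec_sec R U). \<lambda>y\<in>preim (sSpec R) (points_map R R ?i) U.
      localized_hom R R ?i y (\<sigma> (points_map R R ?i y))) = (\<lambda>\<sigma>\<in>carrier (sSpec_sec R U). \<sigma>)"
    if U: "openin (points_topology R) U" for U
  proof (rule restrict_ext)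
    have pre: "preim (sSpec R) (points_map R R ?i) U = U"
      using R.open_subset_points[OF U] topspace_points[OF R] by (auto simp: preim_def f)
    fix \<sigma> assume \<sigma>: "\<sigma> \<in> carrier (sSpec_sec R U)"
    then have \<sigma>': "\<sigma> \<in> local_sections R (carrier R) U" by (simp add: R.sSpec_sec_simps)
    show "(\<lambda>y\<in>preim (sSpec R) (points_map R R ?i) U. localized_hom R R ?i y (\<sigma> (points_map R R ?i y))) = \<sigma>"
      unfolding pre
    proof (rule extensionalityI[of _ U])
      show "\<sigma> \<in> extensional U" using \<sigma>' by (simp add: local_sections_def)
      fix y assume y: "y \<in> U"
      then have yp: "y \<in> points R" using R.open_subset_points[OF U] by blast
      from \<sigma>' y obtain V a where "y \<in> V" and a: "a \<in> carrier R" "\<forall>y\<in>V. \<sigma> y = loc_at_map R y a" by (rule local_sectionsD)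
      then have "\<sigma> y = loc_at_map R y a" by blast
      then show "(\<lambda>y\<in>U. localized_hom R R ?i y (\<sigma> (points_map R R ?i y))) y = \<sigma> y"
        using localized_hom(2)[OF R R i yp a(1)] y yp a(1) by (simp add: f)
    qed simp
  qed
  then show ?thesis
    unfolding sSpec_map_def superspace_id_def using topspace_points[OF R]
    by (simp add: f[symmetric] cong: restrict_cong)
qed

text \<open>At each point a section is the image of some ring element \<open>a\<close>, and both
  localized morphisms send this image to that of \<open>\<psi> (\<phi> a)\<close>.\<close>

lemma sSpec_map_comp:
  assumes R: "cinf_superring R" and S: "cinf_superring S" and T: "cinf_superring T"
    and \<phi>: "\<phi> \<in> csring_hom R S" and \<psi>: "\<psi> \<in> csring_hom S T"
  shows "sSpec_map R T (compose (carrier R) \<psi> \<phi>) =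
    superspace_comp (sSpec T) (sSpec S) (sSpec R) (sSpec_map R S \<phi>) (sSpec_map S T \<psi>)"
proof -
  interpret R: cinf_superring R by (rule R)
  interpret S: cinf_superring S by (rule S)
  interpret T: cinf_superring T by (rule T)
  let ?\<eta> = "compose (carrier R) \<psi> \<phi>"
  let ?f = "points_map R S \<phi>" and ?g = "points_map S T \<psi>" and ?h = "points_map R T ?\<eta>"
  note \<eta> = csring_hom_compose[OF R S T \<psi> \<phi>]
  have fg: "?h z = ?f (?g z)" if z: "z \<in> points T" for z
  proof (rule extensionalityI[of _ "even_part R"])
    note y = points_map_point[OF S T \<psi> z]
    show "?h z \<in> extensional (even_part R)" "?f (?g z) \<in> extensional (even_part R)"
      using z y(1) by (simp_all add: points_map_def[of R])
    fix a assume a: "a \<in> even_part R"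
    show "?h z a = ?f (?g z) a"
      using points_map_point(2)[OF R T \<eta> z a] points_map_point(2)[OF R S \<phi> y(1) a] y(2)[OF csring_homD(7)[OF \<phi> a]] a
      by (simp add: compose_def)
  qed
  have 1: "?h = compose (topspace (topo (sSpec T))) ?f ?g"
  proof (rule extensionalityI[of _ "points T"])
    show "compose (topspace (topo (sSpec T))) ?f ?g \<in> extensional (points T)" using topspace_points[OF T] by simp
    fix z assume "z \<in> points T"
    then show "?h z = compose (topspace (topo (sSpec T))) ?f ?g z" using topspace_points[OF T] fg by (simp add: compose_def)
  qed (simp add: points_map_def)
  have pre: "preim (sSpec T) ?g (preim (sSpec S) ?f W) = preim (sSpec T) ?h W" for W
    using topspace_points[OF T] topspace_points[OF S] points_map_point(1)[OF S T \<psi>] fg by (auto simp: preim_def)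
  have 2: "snd (sSpec_map R T ?\<eta>) W = compose (carrier (sSpec_sec R W))
      (snd (sSpec_map S T \<psi>) (preim (sSpec S) ?f W)) (snd (sSpec_map R S \<phi>) W)"
    if W: "openin (points_topology R) W" for W
  proof (rule extensionalityI[of _ "carrier (sSpec_sec R W)"])
    have o: "openin (points_topology S) (preim (sSpec S) ?f W)"
      using openin_preim[of "sSpec S" "sSpec R" ?f W] points_map_continuous[OF R S \<phi>] W by simp
    show "snd (sSpec_map R T ?\<eta>) W \<in> extensional (carrier (sSpec_sec R W))" using W by (simp add: sSpec_map_def)
    fix \<sigma> assume \<sigma>: "\<sigma> \<in> carrier (sSpec_sec R W)"
    then have \<sigma>': "\<sigma> \<in> local_sections R (carrier R) W" by (simp add: R.sSpec_sec_simps)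
    have "snd (sSpec_map R S \<phi>) W \<sigma> \<in> carrier (sSpec_sec S (preim (sSpec S) ?f W))"
      using localized_sections[OF R S \<phi> W \<sigma>', of "carrier S"] csring_homD(3)[OF \<phi>] W \<sigma>
      by (auto simp: sSpec_map_def S.sSpec_sec_simps)
    then have "compose (carrier (sSpec_sec R W)) (snd (sSpec_map S T \<psi>) (preim (sSpec S) ?f W)) (snd (sSpec_map R S \<phi>) W) \<sigma>
      = (\<lambda>z\<in>preim (sSpec T) ?h W. localized_hom S T \<psi> z (snd (sSpec_map R S \<phi>) W \<sigma> (?g z)))"
      using \<sigma> o by (simp add: compose_def sSpec_map_def[of S T] pre)
    also have "\<dots> = (\<lambda>z\<in>preim (sSpec T) ?h W. localized_hom R T ?\<eta> z (\<sigma> (?h z)))"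
    proof (rule restrict_ext)
      fix z assume "z \<in> preim (sSpec T) ?h W"
      then have z: "z \<in> points T" "?h z \<in> W" using topspace_points[OF T] by (simp_all add: preim_def)
      note y = points_map_point(1)[OF S T \<psi> z(1)]
      have gz: "?g z \<in> preim (sSpec S) ?f W" using y z fg topspace_points[OF S] by (simp add: preim_def)
      from \<sigma>' z(2) obtain V a where "?h z \<in> V" and a: "a \<in> carrier R" "\<forall>y\<in>V. \<sigma> y = loc_at_map R y a" by (rule local_sectionsD)
      then have s: "\<sigma> (?h z) = loc_at_map R (?h z) a" by blast
      have "snd (sSpec_map R S \<phi>) W \<sigma> (?g z) = localized_hom R S \<phi> (?g z) (\<sigma> (?h z))"
        using W \<sigma> gz fg[OF z(1)] by (simp add: sSpec_map_def)
      also have "\<dots> = loc_at_map S (?g z) (\<phi> a)"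
        unfolding s using localized_hom(2)[OF R S \<phi> y a(1)] by (simp only: fg[OF z(1)])
      finally show "localized_hom S T \<psi> z (snd (sSpec_map R S \<phi>) W \<sigma> (?g z)) = localized_hom R T ?\<eta> z (\<sigma> (?h z))"
        using localized_hom(2)[OF S T \<psi> z(1) csring_homD(3)[OF \<phi> a(1)]] localized_hom(2)[OF R T \<eta> z(1) a(1)] s a(1)
        by (simp add: compose_def)
    qed
    also have "\<dots> = snd (sSpec_map R T ?\<eta>) W \<sigma>" using W \<sigma> by (simp add: sSpec_map_def)
    finally show "snd (sSpec_map R T ?\<eta>) W \<sigma> = compose (carrier (sSpec_sec R W))
      (snd (sSpec_map S T \<psi>) (preim (sSpec S) ?f W)) (snd (sSpec_map R S \<phi>) W) \<sigma>" ..
  qed simp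
  have "snd (sSpec_map R T ?\<eta>) = (\<lambda>W\<in>{W. openin (topo (sSpec R)) W}. compose (carrier (sec (sSpec R) W))
      (snd (sSpec_map S T \<psi>) (preim (sSpec S) ?f W)) (snd (sSpec_map R S \<phi>) W))"
    by (rule extensionalityI[of _ "{W. openin (points_topology R) W}"]) (simp_all add: 2, simp add: sSpec_map_def)
  moreover have "fst (sSpec_map R T ?\<eta>) = ?h" by (simp add: sSpec_map_def)
  moreover have e: "sSpec_map R S \<phi> = (?f, snd (sSpec_map R S \<phi>))" "sSpec_map S T \<psi> = (?g, snd (sSpec_map S T \<psi>))"
    by (simp_all add: sSpec_map_def)
  have "superspace_comp (sSpec T) (sSpec S) (sSpec R) (sSpec_map R S \<phi>) (sSpec_map S T \<psi>) =
     (compose (topspace (topo (sSpec T))) ?f ?g,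
      \<lambda>W\<in>{W. openin (topo (sSpec R)) W}. compose (carrier (sec (sSpec R) W))
        (snd (sSpec_map S T \<psi>) (preim (sSpec S) ?f W)) (snd (sSpec_map R S \<phi>) W))"
    by (subst e(1), subst e(2)) (simp only: superspace_comp_def prod.case)
  ultimately show ?thesis using 1 by (metis prod.collapse)
qed

section \<open>Faithfulness and fullness\<close>

text \<open>Used with \<open>\<gamma>\<close> the map from \<open>S\<close> to its global sections.
  The inverse of a bijective morphism is graded because \<open>\<gamma>\<close> reflects parity, and
  it preserves the operations because \<open>\<gamma>\<close> is injective.\<close>

lemma csring_hom_lift:
  assumes R: "cinf_superring R" and S: "cinf_superring S"
    and \<gamma>: "\<gamma> \<in> csring_hom S T" and inj: "inj_on \<gamma> (carrier S)" and surj: "carrier T \<subseteq> \<gamma> ` carrier S"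
    and even: "\<And>a. \<lbrakk>a \<in> carrier S; \<gamma> a \<in> even_part T\<rbrakk> \<Longrightarrow> a \<in> even_part S"
    and odd: "\<And>a. \<lbrakk>a \<in> carrier S; \<gamma> a \<in> odd_part T\<rbrakk> \<Longrightarrow> a \<in> odd_part S"
    and \<eta>: "\<eta> \<in> csring_hom R T"
  shows "\<exists>\<phi>\<in>csring_hom R S. \<forall>a\<in>carrier R. \<gamma> (\<phi> a) = \<eta> a"
proof -
  interpret R: cinf_superring R by (rule R)
  interpret S: cinf_superring S by (rule S)
  define \<phi> where "\<phi> = (\<lambda>a\<in>carrier R. inv_into (carrier S) \<gamma> (\<eta> a))"
  have p: "\<phi> a \<in> carrier S" "\<gamma> (\<phi> a) = \<eta> a" if "a \<in> carrier R" for a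
  proof -
    have "\<eta> a \<in> \<gamma> ` carrier S" using csring_homD(3)[OF \<eta> that] surj by blast
    then show "\<phi> a \<in> carrier S" "\<gamma> (\<phi> a) = \<eta> a"
      using that inv_into_into[of "\<eta> a" \<gamma>] f_inv_into_f[of "\<eta> a" \<gamma>] by (simp_all add: \<phi>_def)
  qed
  have eq: "a = b" if "a \<in> carrier S" "b \<in> carrier S" "\<gamma> a = \<gamma> b" for a b
    using inj that by (auto dest: inj_onD)
  have "\<phi> \<in> csring_hom R S"
  proof (rule csring_homI[OF R S])
    show "\<phi> \<in> extensional (carrier R)" by (simp add: \<phi>_def)
    show "\<phi> (a \<oplus>\<^bsub>R\<^esub> b) = \<phi> a \<oplus>\<^bsub>S\<^esub> \<phi> b" "\<phi> (a \<otimes>\<^bsub>R\<^esub> b) = \<phi> a \<otimes>\<^bsub>S\<^esub> \<phi> b"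
      if "a \<in> carrier R" "b \<in> carrier R" for a b
      using that by (auto intro!: eq simp: p csring_homD(4,5)[OF \<gamma>] csring_homD(4,5)[OF \<eta>])
    show "\<phi> \<one>\<^bsub>R\<^esub> = \<one>\<^bsub>S\<^esub>"
      by (rule eq) (simp_all add: p csring_homD(6)[OF \<gamma>] csring_homD(6)[OF \<eta>])
    show ev: "\<phi> a \<in> even_part S" if a: "a \<in> even_part R" for a
    proof -
      have ac: "a \<in> carrier R" using a by simp
      show ?thesis by (rule even[OF p(1)[OF ac]]) (simp only: p(2)[OF ac] csring_homD(7)[OF \<eta> a])
    qed
    show "\<phi> a \<in> odd_part S" if a: "a \<in> odd_part R" for a
    proof -
      have ac: "a \<in> carrier R" using a by simp
      show ?thesis by (rule odd[OF p(1)[OF ac]]) (simp only: p(2)[OF ac] csring_homD(8)[OF \<eta> a])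
    qed
    fix f cs assume cs: "set cs \<subseteq> even_part R" "f \<in> Cinf (length cs)"
    have ev': "set (map \<phi> cs) \<subseteq> even_part S" using cs ev by auto
    have m: "map \<gamma> (map \<phi> cs) = map \<eta> cs" using cs p by (auto simp: subset_iff)
    have "\<gamma> (\<phi> (sop R f cs)) = sop T f (map \<eta> cs)"
      using cs by (simp add: p csring_hom_sop[OF R \<eta>])
    also have "\<dots> = \<gamma> (sop S f (map \<phi> cs))"
      using csring_hom_sop[OF S \<gamma> ev', of f] cs(2) unfolding m by simp
    finally show "\<phi> (sop R f cs) = sop S f (map \<phi> cs)"
      using cs ev' p(1) by (intro eq) auto
  qed (use p in simp)
  with p show ?thesis by blast
qed

lemma fairD:
  assumes "fair S"
  shows "cinf_superring S" "finitely_generated S"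
    "\<lbrakk>a \<in> carrier S; \<And>x. x \<in> points S \<Longrightarrow> loc_at_map S x a = \<zero>\<^bsub>loc_at S x\<^esub>\<rbrakk> \<Longrightarrow> a = \<zero>\<^bsub>S\<^esub>"
  using assms unfolding fair_def by blast+

lemma fair_eqI:
  assumes S: "fair S" and ab: "a \<in> carrier S" "b \<in> carrier S"
    and eq: "\<And>x. x \<in> points S \<Longrightarrow> loc_at_map S x a = loc_at_map S x b"
  shows "a = b"
proof -
  interpret S: cinf_superring S by (rule fairD(1)[OF S])
  have "a \<oplus>\<^bsub>S\<^esub> \<ominus>\<^bsub>S\<^esub> b = \<zero>\<^bsub>S\<^esub>"
  proof (rule fairD(3)[OF S])
    fix x assume x: "x \<in> points S"
    interpret Q: cinf_superring "loc_at S x" by (rule S.loc_at_superring)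
    show "loc_at_map S x (a \<oplus>\<^bsub>S\<^esub> \<ominus>\<^bsub>S\<^esub> b) = \<zero>\<^bsub>loc_at S x\<^esub>"
      using ab eq[OF x] S.loc_simps(1)[OF ab(2), of x] by (simp add: S.loc_simps(2) S.loc_uminus Q.r_neg)
  qed (use ab in simp)
  then show ?thesis using S.minus_equality[of a "\<ominus>\<^bsub>S\<^esub> b"] ab by simp
qed

text \<open>An element whose images are all even has the same images as its even component, so
  fairness identifies the two; likewise for odd.\<close>

lemma fair_parity:
  assumes S: "fair S" and a: "a \<in> carrier S"
  shows "(\<And>x. x \<in> points S \<Longrightarrow> loc_at_map S x a \<in> even_part (loc_at S x)) \<Longrightarrow> a \<in> even_part S"
    and "(\<And>x. x \<in> points S \<Longrightarrow> loc_at_map S x a \<in> odd_part (loc_at S x)) \<Longrightarrow> a \<in> odd_part S"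
proof -
  interpret S: cinf_superring S by (rule fairD(1)[OF S])
  obtain b m where bm: "b \<in> even_part S" "m \<in> odd_part S" "a = b \<oplus>\<^bsub>S\<^esub> m" using S.base.decomp_ex[OF a] .
  note P = S.loc_at_Pair[OF bm(1,2), folded bm(3)]
  { assume e: "\<And>x. x \<in> points S \<Longrightarrow> loc_at_map S x a \<in> even_part (loc_at S x)"
    have "a = b"
    proof (rule fair_eqI[OF S a])
      fix x assume "x \<in> points S"
      from e[OF this] show "loc_at_map S x a = loc_at_map S x b"
        unfolding S.loc_at_parts using P(2)[of x] by (simp add: prod_eq_iff)
    qed (use bm in simp)
    then show "a \<in> even_part S" using bm by simp }
  { assume e: "\<And>x. x \<in> points S \<Longrightarrow> loc_at_map S x a \<in> odd_part (loc_at S x)"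
    have "a = m"
    proof (rule fair_eqI[OF S a])
      fix x assume "x \<in> points S"
      from e[OF this] show "loc_at_map S x a = loc_at_map S x m"
        unfolding S.loc_at_parts using P(3)[of x] by (simp add: prod_eq_iff)
    qed (use bm in simp)
    then show "a \<in> odd_part S" using bm by simp }
qed

text \<open>The image of the global section induced by \<open>a\<close> has at \<open>y\<close> the
  value \<open>loc_at_map S y (\<phi> a)\<close>, and fairness recovers \<open>\<phi> a\<close> from
  these values.\<close>

lemma sSpec_map_faithful:
  assumes R: "cinf_superring R" and S: "fair S"
    and \<phi>: "\<phi> \<in> csring_hom R S" and \<psi>: "\<psi> \<in> csring_hom R S" and eq: "sSpec_map R S \<phi> = sSpec_map R S \<psi>"
  shows "\<phi> = \<psi>"
proof (rule extensionalityI[of _ "carrier R"])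
  interpret R: cinf_superring R by (rule R)
  note Sr = fairD(1)[OF S]
  interpret S: cinf_superring S by (rule Sr)
  show "\<phi> \<in> extensional (carrier R)" "\<psi> \<in> extensional (carrier R)" using csring_homD(1) \<phi> \<psi> by blast+
  fix a assume a: "a \<in> carrier R"
  have val: "snd (sSpec_map R S \<xi>) (points R) (R.global (points R) a) y = loc_at_map S y (\<xi> a)"
    if "\<xi> \<in> csring_hom R S" "y \<in> points S" for \<xi> y
  proof -
    note p = points_map_point(1)[OF R Sr that]
    have "R.global (points R) a \<in> carrier (sSpec_sec R (points R))"
      using csring_homD(3)[OF R.global_hom[OF R.open_points] a] .
    moreover have "y \<in> preim (sSpec S) (points_map R S \<xi>) (points R)"
      using that p topspace_points[OF Sr] by (simp add: preim_def)
    ultimately show ?thesis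
      using R.open_points localized_hom(2)[OF R Sr that a] p a by (simp add: sSpec_map_def R.global_simps(1))
  qed
  show "\<phi> a = \<psi> a"
    using val[OF \<phi>] val[OF \<psi>] eq csring_homD(3)[OF \<phi> a] csring_homD(3)[OF \<psi> a] by (intro fair_eqI[OF S]) simp_all
qed

text \<open>
  If \<open>f(y)(c) \<noteq> 0\<close> then \<open>c\<close> is invertible near \<open>f(y)\<close>, so its image is invertible at \<open>y\<close>; subtracting
  constants, this determines \<open>f\<close> from the global sections.
\<close>

theorem sSpec_map_full:
  assumes R: "cinf_superring R" and S: "fair S"
    and surj: "\<And>\<sigma>. \<sigma> \<in> local_sections S (carrier S) (points S) \<Longrightarrow>
      \<exists>a\<in>carrier S. \<forall>y\<in>points S. \<sigma> y = loc_at_map S y a"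
    and F: "(f, fs) \<in> superspace_hom (sSpec S) (sSpec R)"
  shows "\<exists>\<phi>\<in>csring_hom R S. sSpec_map R S \<phi> = (f, fs)"
proof -
  interpret R: cinf_superring R by (rule R)
  note Sr = fairD(1)[OF S]
  interpret S: cinf_superring S by (rule Sr)
  let ?W = "preim (sSpec S) f"
  have tS: "topspace (points_topology S) = points S" and tR: "topspace (points_topology R) = points R"
    by (rule topspace_points; fact)+
  have f_ext: "f \<in> extensional (points S)" and cont: "continuous_map (points_topology S) (points_topology R) f"
    and fs_ext: "fs \<in> extensional {V. openin (points_topology R) V}"
    and hom: "\<And>V. openin (points_topology R) V \<Longrightarrow> fs V \<in> csring_hom (sSpec_sec R V) (sSpec_sec S (?W V))"
    and nat: "\<And>V W s. \<lbrakk>openin (points_topology R) V; openin (points_topology R) W; W \<subseteq> V; s \<in> local_sections R (carrier R) V\<rbrakk>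
      \<Longrightarrow> fs W (res (sSpec R) V W s) = res (sSpec S) (?W V) (?W W) (fs V s)"
    using F unfolding superspace_hom_def by (auto simp: tS R.sSpec_sec_simps(1))
  have f_points: "f y \<in> points R" if "y \<in> points S" for y
    using continuous_map_image_subset_topspace[OF cont] that unfolding tS tR by blast
  have pre: "?W V = {y \<in> points S. f y \<in> V}" for V by (simp add: preim_def tS)
  have preR: "?W (points R) = points S" using f_points by (auto simp: pre)
  have oW: "openin (points_topology S) (?W V)" if "openin (points_topology R) V" for V
    using openin_preim[of "sSpec S" "sSpec R" f V] cont that by simp
  let ?\<gamma> = "S.global (points S)"
  let ?\<eta> = "compose (carrier R) (fs (points R)) (R.global (points R))"
  have top: "fs (points R) \<in> csring_hom (sSpec_sec R (points R)) (sSpec_sec S (points S))"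
    using hom[OF R.open_points] by (simp only: preR)
  have "\<exists>\<phi>\<in>csring_hom R S. \<forall>a\<in>carrier R. ?\<gamma> (\<phi> a) = ?\<eta> a"
  proof (rule csring_hom_lift[OF R Sr S.global_hom[OF S.open_points]])
    show "inj_on ?\<gamma> (carrier S)"
    proof (rule inj_onI, rule fair_eqI[OF S])
      fix a b x assume ab: "a \<in> carrier S" "b \<in> carrier S" "?\<gamma> a = ?\<gamma> b" and x: "x \<in> points S"
      show "loc_at_map S x a = loc_at_map S x b"
        using fun_cong[OF ab(3), of x] ab(1,2) x by (simp add: S.global_simps(1))
    qed
    show "carrier (sSpec_sec S (points S)) \<subseteq> ?\<gamma> ` carrier S"
    proof
      fix \<sigma> assume "\<sigma> \<in> carrier (sSpec_sec S (points S))"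
      then have \<sigma>: "\<sigma> \<in> local_sections S (carrier S) (points S)" by (simp add: S.sSpec_sec_simps)
      then obtain a where a: "a \<in> carrier S" "\<forall>y\<in>points S. \<sigma> y = loc_at_map S y a" using surj by blast
      have "\<sigma> = ?\<gamma> a"
        by (rule local_sections_ext[OF \<sigma> S.global_local[OF S.open_points subset_refl a(1)]])
          (use a in \<open>simp add: S.global_simps(1)\<close>)
      then show "\<sigma> \<in> ?\<gamma> ` carrier S" using a(1) by blast
    qed
    show "a \<in> even_part S" if "a \<in> carrier S" "?\<gamma> a \<in> even_part (sSpec_sec S (points S))" for a
      using S.local_sections_in(2)[of "?\<gamma> a" "points S"] that
      by (intro fair_parity(1)[OF S]) (simp_all add: S.sSpec_sec_simps(2) S.global_simps(1))
    show "a \<in> odd_part S" if "a \<in> carrier S" "?\<gamma> a \<in> odd_part (sSpec_sec S (points S))" for a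
      using S.local_sections_in(3)[of "?\<gamma> a" "points S"] that
      by (intro fair_parity(2)[OF S]) (simp_all add: S.sSpec_sec_simps(3) S.global_simps(1))
    show "?\<eta> \<in> csring_hom R (sSpec_sec S (points S))"
      by (rule csring_hom_compose[OF R R.sSpec_sec_superring[OF R.open_points] S.sSpec_sec_superring[OF S.open_points]
        top R.global_hom[OF R.open_points]])
  qed
  then obtain \<phi> where \<phi>: "\<phi> \<in> csring_hom R S" and \<phi>_eq: "\<And>a. a \<in> carrier R \<Longrightarrow> ?\<gamma> (\<phi> a) = fs (points R) (R.global (points R) a)"
    by (auto simp: compose_def)
  \<comment> \<open>Naturality for the inclusion of \<open>V\<close> in \<open>points R\<close>: the
    comparison on global sections passes to every open set.\<close>
  have key: "fs V (R.global V a) y = loc_at_map S y (\<phi> a)"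
    if V: "openin (points_topology R) V" and a: "a \<in> carrier R" and y: "y \<in> ?W V" for V a y
  proof -
    have sub: "V \<subseteq> points R" by (rule R.open_subset_points[OF V])
    have g: "R.global (points R) a \<in> local_sections R (carrier R) (points R)"
      by (rule R.global_local[OF R.open_points subset_refl a])
    have gS: "?\<gamma> (\<phi> a) \<in> local_sections S (carrier S) (points S)"
      by (rule S.global_local[OF S.open_points subset_refl csring_homD(3)[OF \<phi> a]])
    have "res (sSpec R) (points R) V (R.global (points R) a) = R.global V a"
      unfolding R.sSpec_res[OF g] using sub a by (auto simp: R.global_simps(2) fun_eq_iff restrict_def)
    then have "fs V (R.global V a) = res (sSpec S) (points S) (?W V) (?\<gamma> (\<phi> a))"
      using nat[OF R.open_points V sub g] unfolding preR \<phi>_eq[OF a] by simp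
    also have "\<dots> = restrict (?\<gamma> (\<phi> a)) (?W V)" by (rule S.sSpec_res[OF gS])
    finally show ?thesis using y csring_homD(3)[OF \<phi> a] by (simp add: S.global_simps(1) pre)
  qed
  have nz: "y (\<phi> c) \<noteq> 0" if y: "y \<in> points S" and c: "c \<in> even_part R" "f y c \<noteq> 0" for y c
  proof -
    obtain d e where de: "d \<in> even_part R" "e \<in> even_part R" "f y e \<noteq> 0" "e \<otimes>\<^bsub>R\<^esub> (c \<otimes>\<^bsub>R\<^esub> d) = e \<otimes>\<^bsub>R\<^esub> \<one>\<^bsub>R\<^esub>"
      using R.local_inverse[OF f_points[OF y] c] .
    define U where "U = {x \<in> points R. x e \<noteq> 0}"
    have U: "openin (points_topology R) U" unfolding U_def by (rule R.openin_basic[OF de(2)])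
    have yU: "y \<in> ?W U" using y f_points de by (simp add: pre U_def)
    note gh = csring_homD[OF R.global_hom[OF U]] and fh = csring_homD[OF hom[OF U]]
    have cd: "c \<in> carrier R" "d \<in> carrier R" using c de by simp_all
    have "R.global U (c \<otimes>\<^bsub>R\<^esub> d) = R.global U \<one>\<^bsub>R\<^esub>"
      using cd de by (auto simp: R.global_simps(2) U_def intro!: restrict_ext R.loc_cancel[of e])
    then have "R.global U c \<otimes>\<^bsub>sSpec_sec R U\<^esub> R.global U d = \<one>\<^bsub>sSpec_sec R U\<^esub>"
      using gh(5)[OF cd] gh(6) by simp
    then have "fs U (R.global U c) \<otimes>\<^bsub>sSpec_sec S (?W U)\<^esub> fs U (R.global U d) = \<one>\<^bsub>sSpec_sec S (?W U)\<^esub>"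
      using fh(5)[OF gh(3)[OF cd(1)] gh(3)[OF cd(2)]] fh(6) by simp
    from fun_cong[OF this, of y]
    have "loc_at_map S y (\<phi> c) \<otimes>\<^bsub>loc_at S y\<^esub> loc_at_map S y (\<phi> d) = \<one>\<^bsub>loc_at S y\<^esub>"
      using yU by (simp add: S.sSpec_sec_simps key[OF U] cd)
    then show ?thesis
      using S.point_unit[OF y csring_homD(7)[OF \<phi> c(1)] S.loc_simps(1)[OF csring_homD(3)[OF \<phi> cd(2)]]] by blast
  qed
  have f_eq: "f y c = y (\<phi> c)" if y: "y \<in> points S" and c: "c \<in> even_part R" for y c
  proof (rule ccontr)
    assume ne: "f y c \<noteq> y (\<phi> c)"
    define k where "k = sop R (\<lambda>_. - y (\<phi> c)) []"
    have k: "k \<in> even_part R" by (simp add: k_def)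
    have \<phi>k: "\<phi> k = sop S (\<lambda>_. - y (\<phi> c)) []" using csring_hom_sop[OF R \<phi>, of "[]" "\<lambda>_. - y (\<phi> c)"] by (simp add: k_def)
    have "f y (c \<oplus>\<^bsub>R\<^esub> k) = f y c - y (\<phi> c)"
      using R.point_add[OF f_points[OF y] c k] R.point_const[OF f_points[OF y]] by (simp add: k_def)
    then have "y (\<phi> (c \<oplus>\<^bsub>R\<^esub> k)) \<noteq> 0" using nz[OF y, of "c \<oplus>\<^bsub>R\<^esub> k"] c k ne by simp
    moreover have "y (\<phi> (c \<oplus>\<^bsub>R\<^esub> k)) = 0"
      using csring_homD(4)[OF \<phi>, of c k] c k S.point_add[OF y csring_homD(7)[OF \<phi> c] csring_homD(7)[OF \<phi> k]]
        S.point_const[OF y] by (simp add: \<phi>k)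
    ultimately show False by simp
  qed
  have f: "points_map R S \<phi> = f"
  proof (rule extensionalityI[of _ "points S"])
    fix y assume y: "y \<in> points S"
    show "points_map R S \<phi> y = f y"
    proof (rule extensionalityI[of _ "even_part R"])
      show "points_map R S \<phi> y \<in> extensional (even_part R)" using y by (simp add: points_map_def)
      show "f y \<in> extensional (even_part R)"
        using f_points[OF y] by (auto simp: points_def cinf_hom_def even_ring_def PiE_def)
    qed (use f_eq[OF y] points_map_point(2)[OF R Sr \<phi> y] in simp)
  qed (use f_ext in \<open>simp_all add: points_map_def\<close>)
  have "(\<lambda>U\<in>{U. openin (points_topology R) U}. \<lambda>\<sigma>\<in>carrier (sSpec_sec R U). \<lambda>y\<in>?W U. localized_hom R S \<phi> y (\<sigma> (f y))) = fs"
  proof (rule extensionalityI[of _ "{U. openin (points_topology R) U}"], simp, rule fs_ext)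
    fix V assume "V \<in> {U. openin (points_topology R) U}"
    then have V: "openin (points_topology R) V" by simp
    have "(\<lambda>\<sigma>\<in>carrier (sSpec_sec R V). \<lambda>y\<in>?W V. localized_hom R S \<phi> y (\<sigma> (f y))) = fs V"
    proof (rule extensionalityI[of _ "carrier (sSpec_sec R V)"], simp)
      show "fs V \<in> extensional (carrier (sSpec_sec R V))" by (rule csring_homD(1)[OF hom[OF V]])
      fix \<sigma> assume \<sigma>c: "\<sigma> \<in> carrier (sSpec_sec R V)"
      then have \<sigma>: "\<sigma> \<in> local_sections R (carrier R) V" by (simp add: R.sSpec_sec_simps)
      have fsV: "fs V \<sigma> \<in> local_sections S (carrier S) (?W V)"
        using csring_homD(3)[OF hom[OF V] \<sigma>c] by (simp add: S.sSpec_sec_simps)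
      have "(\<lambda>y\<in>?W V. localized_hom R S \<phi> y (\<sigma> (f y))) = fs V \<sigma>"
      proof (rule extensionalityI[of _ "?W V"], simp)
        show "fs V \<sigma> \<in> extensional (?W V)" using fsV by (simp add: local_sections_def)
        fix y assume y: "y \<in> ?W V"
        then have yS: "y \<in> points S" "f y \<in> V" by (simp_all add: pre)
        from \<sigma> yS(2) obtain W a where W: "openin (points_topology R) W" "f y \<in> W" "W \<subseteq> V" and a: "a \<in> carrier R"
          "\<forall>x\<in>W. \<sigma> x = loc_at_map R x a" by (rule local_sectionsD)
        have yW: "y \<in> ?W W" using yS W by (simp add: pre)
        \<comment> \<open>Near \<open>f y\<close> the section is induced by the single element
          \<open>a\<close>, so naturality for \<open>W\<close> inside \<open>V\<close> reduces the
          claim to \<open>key\<close>.\<close>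
        have "res (sSpec R) V W \<sigma> = R.global W a"
          unfolding R.sSpec_res[OF \<sigma>] R.global_simps(2)[OF a(1)] using a(2) by (intro restrict_ext) simp
        then have "fs W (R.global W a) = restrict (fs V \<sigma>) (?W W)"
          using nat[OF V W(1,3) \<sigma>] S.sSpec_res[OF fsV] by simp
        from fun_cong[OF this, of y] have "fs V \<sigma> y = loc_at_map S y (\<phi> a)"
          using key[OF W(1) a(1) yW] yW by simp
        moreover have "localized_hom R S \<phi> y (\<sigma> (f y)) = loc_at_map S y (\<phi> a)"
          using localized_hom(2)[OF R Sr \<phi> yS(1) a(1)] a(2) W(2) by (simp add: f)
        ultimately show "(\<lambda>y\<in>?W V. localized_hom R S \<phi> y (\<sigma> (f y))) y = fs V \<sigma> y" using y by simp
      qed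
      then show "(\<lambda>\<sigma>\<in>carrier (sSpec_sec R V). \<lambda>y\<in>?W V. localized_hom R S \<phi> y (\<sigma> (f y))) \<sigma> = fs V \<sigma>"
        using \<sigma>c by simp
    qed
    then show "(\<lambda>U\<in>{U. openin (points_topology R) U}. \<lambda>\<sigma>\<in>carrier (sSpec_sec R U). \<lambda>y\<in>?W U. localized_hom R S \<phi> y (\<sigma> (f y))) V = fs V"
      using V by simp
  qed
  then have "sSpec_map R S \<phi> = (f, fs)" by (simp add: sSpec_map_def f)
  with \<phi> show ?thesis by blast
qed

section \<open>Global sections of finitely generated superrings\<close>

text \<open>The coordinate functions have no nilpotent part, so only the term of the empty index
  list survives. Thus every \<open>f\<close> is its own operation applied to the
  coordinates.\<close>

lemma gtaylor_coordinates:
  assumes f: "f \<in> Cinf m"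
  shows "gtaylor n f (map (\<lambda>i. body_fun (\<lambda>x. x i)) [0..<m]) = body_fun f"
proof (intro ext)
  fix K x
  let ?Fs = "map (\<lambda>i. body_fun (\<lambda>x. x i)) [0..<m]"
  let ?A = "{is. set is \<subseteq> {..<length ?Fs} \<and> length is \<le> n}"
  let ?t = "\<lambda>is. pderivs is f (\<lambda>i. (?Fs ! i) {} x) / fact (length is) *
       foldr (\<lambda>i. gmult ((?Fs ! i)({} := (\<lambda>_. 0)))) is gone K x"
  have zero: "?t is = 0" if "is \<in> ?A - {[]}" for "is"
  proof -
    obtain j js where j: "is = j # js" using \<open>is \<in> ?A - {[]}\<close> by (cases "is") auto
    then have "j < m" using \<open>is \<in> ?A - {[]}\<close> by simp
    then have "(?Fs ! j)({} := (\<lambda>_. 0)) = (\<lambda>K x. 0)" by (auto simp: body_fun_def)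
    then show ?thesis by (simp add: j gmult_def)
  qed
  have "gtaylor n f ?Fs K x = sum ?t ?A" by (simp add: gtaylor_def)
  also have "\<dots> = sum ?t {[]}"
    by (rule sum.mono_neutral_right) (use finite_lists_length_le[of "{..<length ?Fs}" n] zero in auto)
  also have "\<dots> = f (\<lambda>i. (?Fs ! i) {} x) * gone K x" by simp
  also have "f (\<lambda>i. (?Fs ! i) {} x) = f x"
    using f by (rule Cinf_depends) (simp add: body_fun_def)
  finally show "gtaylor n f ?Fs K x = body_fun f K x" by (simp add: body_fun_def gone_def)
qed

lemma gmult_even:
  assumes "F \<in> even_part (Cinf_super m n)" "G \<in> even_part (Cinf_super m n)"
  shows "gmult F G \<in> even_part (Cinf_super m n)"
proof -
  have F: "F \<in> carrier (Cinf_super m n)" "\<And>I. odd (card I) \<Longrightarrow> F I = (\<lambda>_. 0)"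
    and G: "G \<in> carrier (Cinf_super m n)" "\<And>I. odd (card I) \<Longrightarrow> G I = (\<lambda>_. 0)"
    using assms unfolding Cinf_super_simps(6) by blast+
  have "gmult F G K = (\<lambda>_. 0)" if K: "odd (card K)" for K
    unfolding gmult_def
  proof (intro ext sum.neutral ballI)
    fix x I assume I: "I \<in> Pow K"
    \<comment> \<open>Infinite sets have cardinality 0 by convention, which is even.\<close>
    have "finite K" using K by (metis card.infinite even_zero)
    then have "card I + card (K - I) = card K" using I by (metis Pow_iff card_Diff_subset card_mono finite_subset le_add_diff_inverse)
    then have "odd (card I) \<or> odd (card (K - I))" using K by presburger
    then show "reorder_sign I (K - I) * F I x * G (K - I) x = 0" using F(2) G(2) by auto
  qed
  then show ?thesis unfolding Cinf_super_simps(6) using gmult_closed[OF F(1) G(1)] by blast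
qed

lemma gmult_body: "gmult F G {} x = F {} x * G {} x"
  by (simp add: gmult_def reorder_sign_def)

text \<open>Each factor without body raises the degree by at least one, so the k-th power has no
  component at sets with fewer than k elements, while only subsets of \<open>{..<n}\<close>
  occur.\<close>

lemma gmult_power_nilpotent:
  assumes F: "F \<in> carrier (Cinf_super m n)" "F {} = (\<lambda>_. 0)"
  shows "(gmult F ^^ Suc n) gone = (\<lambda>K x. 0)"
proof -
  have one: "gone \<in> carrier (Cinf_super m n)"
    using body_fun_closed[of "\<lambda>_. 1" m n] unfolding body_fun_one[of m n] Cinf_super_simps(3) by simp
  have c: "(gmult F ^^ k) gone \<in> carrier (Cinf_super m n)" for k
    by (induction k) (simp_all add: one gmult_closed[OF F(1)])
  have z: "(gmult F ^^ k) gone K = (\<lambda>_. 0)" if "card K < k" "finite K" for k K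
    using that
  proof (induction k arbitrary: K)
    case (Suc k)
    have "reorder_sign I (K - I) * F I x * (gmult F ^^ k) gone (K - I) x = 0" if I: "I \<in> Pow K" for I x
    proof (cases "I = {}")
      case True
      then show ?thesis by (simp add: F(2))
    next
      case False
      then have "K - I \<subset> K" using I by blast
      then have "card (K - I) < card K" using Suc.prems by (intro psubset_card_mono)
      then have "(gmult F ^^ k) gone (K - I) = (\<lambda>_. 0)" using Suc.prems by (intro Suc.IH) auto
      then show ?thesis by simp
    qed
    then show ?case unfolding funpow.simps o_def gmult_def[of F] by (intro ext sum.neutral ballI)
  qed simp
  have "(gmult F ^^ Suc n) gone K = (\<lambda>_. 0)" for K
  proof (cases "K \<subseteq> {..<n}")
    case True
    then have "finite K" "card K \<le> n" using finite_subset card_mono[of "{..<n}" K] by auto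
    then show ?thesis by (intro z) auto
  next
    case False
    then show ?thesis using c[of "Suc n"] unfolding Cinf_super_simps(1) by blast
  qed
  then show ?thesis by blast
qed

lemma even_odd_split:
  assumes "F \<in> carrier (Cinf_super m n)"
  defines "Fe \<equiv> \<lambda>I. if even (card I) then F I else (\<lambda>_. 0)"
    and "Fo \<equiv> \<lambda>I. if even (card I) then (\<lambda>_. 0) else F I"
  shows "Fe \<in> even_part (Cinf_super m n)" "Fo \<in> odd_part (Cinf_super m n)"
  using assms by (auto simp: Cinf_super_simps fun_eq_iff)

locale presented = cinf_superring S for S :: "'a csring" (structure) +
  fixes m n :: nat and \<Phi> :: "grassmann \<Rightarrow> 'a"
  assumes \<Phi>: "\<Phi> \<in> csring_hom (Cinf_super m n) S" and onto: "\<Phi> ` carrier (Cinf_super m n) = carrier S"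
begin

abbreviation "E \<equiv> Cinf_super m n"

definition "coords = map (\<lambda>i. \<Phi> (body_fun (\<lambda>x. x i))) [0..<m]"
text \<open>The point of R^m at which \<open>y\<close> evaluates bodies; 0 is a default for the
  coordinates that smooth functions on R^m ignore.\<close>

definition "pt y i = (if i < m then y (\<Phi> (body_fun (\<lambda>x. x i))) else (0::real))"

lemmas \<Phi>_simps = csring_homD(3,4,5,7,8)[OF \<Phi>, unfolded Cinf_super_simps(2,5)]

lemma E_even: "F \<in> even_part E \<Longrightarrow> F \<in> carrier E" by (simp add: Cinf_super_simps(6))
lemma E_odd: "F \<in> odd_part E \<Longrightarrow> F \<in> carrier E" by (simp add: Cinf_super_simps(7))

lemma coords: "set coords \<subseteq> even_part S" "length coords = m"
proof -
  have "\<Phi> (body_fun (\<lambda>x. x i)) \<in> even_part S" if "i < m" for i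
    using \<Phi>_simps(4)[OF body_fun_even[OF Cinf_proj[OF that]]] .
  then show "set coords \<subseteq> even_part S" by (auto simp: coords_def)
qed (simp add: coords_def)

text \<open>By \<open>gtaylor_coordinates\<close>, \<open>body_fun f\<close> is the operation of
  \<open>f\<close> on the coordinates, and \<open>\<Phi>\<close> commutes with operations.\<close>

lemma \<Phi>_body: assumes f: "f \<in> Cinf m" shows "\<Phi> (body_fun f) = sop S f coords"
proof -
  let ?Fs = "map (\<lambda>i. body_fun (\<lambda>x. x i)) [0..<m]"
  have Fs: "set ?Fs \<subseteq> even_part E" using body_fun_even[OF Cinf_proj] by auto
  have c: "restrict \<Phi> (even_part E) \<in> cinf_hom (even_ring E) (even_ring S)"
    using \<Phi> by (simp add: csring_hom_def)
  have "restrict \<Phi> (even_part E) (cop (even_ring E) f ?Fs) = cop (even_ring S) f (map (restrict \<Phi> (even_part E)) ?Fs)"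
    using cinf_homD[OF c, of ?Fs f] Fs f by (simp add: even_ring_def)
  moreover have "map (restrict \<Phi> (even_part E)) ?Fs = coords"
    using Fs by (auto simp: coords_def)
  ultimately show ?thesis
    using body_fun_even[OF f, of n] by (simp add: even_ring_def Cinf_super_simps(8) gtaylor_coordinates[OF f])
qed

lemma zero_E: "(\<lambda>K x. 0) \<in> even_part E" by (simp add: Cinf_super_simps(1,6))

lemma \<Phi>_zero: "\<Phi> (\<lambda>K x. 0) = \<zero>"
proof -
  have "\<Phi> (\<lambda>K x. 0 + 0) = \<Phi> (\<lambda>K x. 0) \<oplus> \<Phi> (\<lambda>K x. 0)"
    by (rule \<Phi>_simps(2)) (rule E_even[OF zero_E])+
  with \<Phi>_simps(1)[OF E_even[OF zero_E]] show ?thesis by (simp add: add.l_cancel_one')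
qed

text \<open>The powers of \<open>F\<close> are carried to the powers of a real number, one of which
  is 0.\<close>

lemma point_nilpotent:
  assumes y: "y \<in> points S" and F: "F \<in> even_part E" "F {} = (\<lambda>_. 0)"
  shows "y (\<Phi> F) = 0"
proof -
  have one: "gone \<in> even_part E"
    using body_fun_even[of "\<lambda>_. 1" m n] unfolding body_fun_one[of m n] Cinf_super_simps(3) by simp
  have "(gmult F ^^ k) gone \<in> even_part E \<and> y (\<Phi> ((gmult F ^^ k) gone)) = y (\<Phi> F) ^ k" for k
  proof (induction k)
    case 0
    have "\<Phi> gone = \<one>" using csring_homD(6)[OF \<Phi>] by (simp add: Cinf_super_simps(3))
    then show ?case using one point_one[OF y] by simp
  next
    case (Suc k)
    then have k: "(gmult F ^^ k) gone \<in> even_part E" by blast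
    show ?case
      using Suc gmult_even[OF F(1) k] point_mult[OF y \<Phi>_simps(4)[OF F(1)] \<Phi>_simps(4)[OF k]]
        \<Phi>_simps(3)[OF E_even[OF F(1)] E_even[OF k]] by simp
  qed
  from this[of "Suc n"] have "y (\<Phi> F) ^ Suc n = y (\<Phi> (\<lambda>K x. 0))"
    using gmult_power_nilpotent[OF E_even[OF F(1)] F(2)] by simp
  then show ?thesis using point_zero[OF y] by (auto simp: \<Phi>_zero)
qed

text \<open>\<open>F\<close> is its body plus a nilpotent even element, and the latter has value
  0.\<close>

lemma point_value_body:
  assumes y: "y \<in> points S" and F: "F \<in> even_part E" shows "y (\<Phi> F) = F {} (pt y)"
proof -
  have f: "F {} \<in> Cinf m" using F by (simp add: Cinf_super_simps)
  define N where "N = F({} := (\<lambda>_. 0))"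
  have N: "N \<in> even_part E" using F by (auto simp: N_def Cinf_super_simps)
  note b = body_fun_even[OF f, of n]
  have "F = (\<lambda>K x. body_fun (F {}) K x + N K x)" by (auto simp: N_def body_fun_def fun_eq_iff)
  then have "\<Phi> F = \<Phi> (body_fun (F {})) \<oplus> \<Phi> N" using \<Phi>_simps(2)[OF E_even[OF b] E_even[OF N]] by simp
  then have "y (\<Phi> F) = y (\<Phi> (body_fun (F {})))"
    using point_add[OF y \<Phi>_simps(4)[OF b] \<Phi>_simps(4)[OF N]] point_nilpotent[OF y N] by (simp add: N_def)
  also have "\<dots> = F {} (\<lambda>i. map y coords ! i)"
    using point_sop[OF y coords(1), of "F {}"] f coords(2) by (simp add: \<Phi>_body)
  also have "\<dots> = F {} (pt y)"
    using f by (rule Cinf_depends) (simp add: coords_def pt_def)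
  finally show ?thesis .
qed

text \<open>The even component of any preimage is a preimage as well, by uniqueness of the
  decomposition in \<open>S\<close>.\<close>

lemma even_onto: assumes c: "c \<in> even_part S" obtains F where "F \<in> even_part E" "\<Phi> F = c"
proof -
  have "c \<in> \<Phi> ` carrier E" using c by (simp only: onto base.even_carr)
  then obtain F where F: "F \<in> carrier E" "\<Phi> F = c" by (elim imageE) simp
  define Fe where "Fe = (\<lambda>I. if even (card I) then F I else (\<lambda>_. 0))"
  define Fo where "Fo = (\<lambda>I. if even (card I) then (\<lambda>_. 0) else F I)"
  note s = even_odd_split[OF F(1), folded Fe_def Fo_def]
  have "F = (\<lambda>K x. Fe K x + Fo K x)" by (simp add: Fe_def Fo_def fun_eq_iff)
  then have "c \<oplus> \<zero> = \<Phi> Fe \<oplus> \<Phi> Fo"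
    using \<Phi>_simps(2)[OF E_even[OF s(1)] E_odd[OF s(2)]] F(2) c by simp
  then have "c = \<Phi> Fe" using base.decomp_unique[OF c zero_odd \<Phi>_simps(4)[OF s(1)] \<Phi>_simps(5)[OF s(2)]] by blast
  then show thesis using that[OF s(1)] by simp
qed

text \<open>A function that is nonzero at \<open>pt y\<close> has an image in \<open>S\<close> that
  is nonzero at \<open>y\<close>, hence a unit in the localization at \<open>y\<close>.\<close>

lemma germ_hom_loc:
  assumes y: "y \<in> points S"
  shows "germ_hom (loc_at S y) m n (\<lambda>F. loc_at_map S y (\<Phi> F)) (pt y)"
proof -
  interpret Q: cinf_superring "loc_at S y" by (rule loc_at_superring)
  show ?thesis
  proof
    have "loc_at_map S y \<circ> \<Phi> \<in> ring_hom E (loc_at S y)"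
      using csring_homD(2)[OF \<Phi>] csring_homD(2)[OF loc_at_map_hom] by (rule ring_hom_trans)
    then show "(\<lambda>F. loc_at_map S y (\<Phi> F)) \<in> ring_hom E (loc_at S y)" by (simp add: o_def)
    fix b assume b: "b \<in> Cinf m" "b (pt y) \<noteq> 0"
    note e = body_fun_even[OF b(1), of n]
    have "y (\<Phi> (body_fun b)) \<noteq> 0" using point_value_body[OF y e] b(2) by (simp add: body_fun_def)
    then show "\<exists>u\<in>carrier (loc_at S y). u \<otimes>\<^bsub>loc_at S y\<^esub> loc_at_map S y (\<Phi> (body_fun b)) = \<one>\<^bsub>loc_at S y\<^esub>"
      by (rule loc_unit[of "\<Phi> (body_fun b)" y, OF \<Phi>_simps(4)[OF e]])
  qed
qed

text \<open>
  A ring homomorphism \<open>\<psi>\<close> to the reals is a morphism of C-infinity rings:  if \<open>\<psi>(f(c)) = r\<close> differs from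
  \<open>f(\<psi>(c))\<close>, the function \<open>(f - r)\<^sup>2 + \<Sum> (x\<^sub>i - \<psi>(c\<^sub>i))\<^sup>2\<close> has no zeros, so its value at \<open>c\<close> is a unit
  in the kernel of \<open>\<psi>\<close>.
\<close>

lemma ring_hom_point:
  assumes ext: "\<psi> \<in> extensional (even_part S)"
    and add: "\<And>a b. \<lbrakk>a \<in> even_part S; b \<in> even_part S\<rbrakk> \<Longrightarrow> \<psi> (a \<oplus> b) = \<psi> a + \<psi> b"
    and mult: "\<And>a b. \<lbrakk>a \<in> even_part S; b \<in> even_part S\<rbrakk> \<Longrightarrow> \<psi> (a \<otimes> b) = \<psi> a * \<psi> b"
    and const: "\<And>r. \<psi> (sop S (\<lambda>_. r) []) = r"
  shows "\<psi> \<in> points S"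
proof -
  have "\<psi> (sop S f cs) = f (\<lambda>i. map \<psi> cs ! i)" if cs: "set cs \<subseteq> even_part S" and f: "f \<in> Cinf (length cs)" for f cs
  proof (rule ccontr)
    assume ne: "\<psi> (sop S f cs) \<noteq> f (\<lambda>i. map \<psi> cs ! i)"
    define r where "r = \<psi> (sop S f cs)"
    define k where "k = length cs"
    define V where "V g = \<psi> (sop S g cs)" for g
    have V_add: "V (\<lambda>z. g z + h z) = V g + V h" and V_mult: "V (\<lambda>z. g z * h z) = V g * V h"
      if "g \<in> Cinf k" "h \<in> Cinf k" for g h
      using that cs sop_plus[OF cs, of g h] sop_times[OF cs, of g h] add[of "sop S g cs" "sop S h cs"]
        mult[of "sop S g cs" "sop S h cs"] by (simp_all add: V_def k_def)
    \<comment> \<open>A constant of any arity is a composite with the empty list of functions, which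
      reduces it to the nullary constants of the hypothesis.\<close>
    have V_const: "V (\<lambda>_. c) = c" for c
      using sop_comp[OF cs, of "\<lambda>_. c" "[]"] const by (simp add: V_def)
    have V_proj: "V (\<lambda>z. z i) = \<psi> (cs ! i)" if "i < k" for i
      using sop_proj[OF cs, of i] that by (simp add: V_def k_def)
    have V_f: "V f = r" by (simp add: V_def r_def)
    note f' = f[folded k_def]
    define sq where "sq g c = (\<lambda>z. (g z + - c) * (g z + - c))" for g :: "(nat \<Rightarrow> real) \<Rightarrow> real" and c
    have sq: "sq g c \<in> Cinf k" "V (sq g c) = (V g - c) * (V g - c)" if "g \<in> Cinf k" for g c
    proof -
      have 1: "(\<lambda>z. g z + - c) \<in> Cinf k" using that by (intro Cinf_add Cinf_const)
      show "sq g c \<in> Cinf k" unfolding sq_def using 1 by (intro Cinf_mult)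
      show "V (sq g c) = (V g - c) * (V g - c)"
        unfolding sq_def using V_mult[OF 1 1] V_add[OF that Cinf_const[of "- c"]] by (simp add: V_const)
    qed
    define d where "d j z = (\<Sum>i<j. sq (\<lambda>z. z i) (\<psi> (cs ! i)) z)" for j z
    have p: "(\<lambda>z. z i) \<in> Cinf k" if "i < k" for i using that by (rule Cinf_proj)
    have d: "d j \<in> Cinf k \<and> V (d j) = 0" if "j \<le> k" for j
      using that
    proof (induction j)
      case 0
      then show ?case using V_const[of 0] by (simp add: d_def)
    next
      case (Suc j)
      then have j: "d j \<in> Cinf k" "V (d j) = 0" "j < k" by auto
      have "d (Suc j) = (\<lambda>z. d j z + sq (\<lambda>z. z j) (\<psi> (cs ! j)) z)" by (simp add: d_def fun_eq_iff)
      then show ?case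
        using Cinf_add[OF j(1) sq(1)[OF p[OF j(3)]]] V_add[OF j(1) sq(1)[OF p[OF j(3)]]] j sq(2)[OF p[OF j(3)]] V_proj[OF j(3)]
        by simp
    qed
    define g where "g z = sq f r z + d k z" for z
    have g: "g \<in> Cinf k" "V g = 0"
      using Cinf_add[OF sq(1)[OF f', of r], of "d k"] V_add[OF sq(1)[OF f', of r], of "d k"] d[of k] sq(2)[OF f', of r] V_f
      by (simp_all add: g_def[abs_def])
    have "g z \<noteq> 0" for z
    proof
      assume "g z = 0"
      moreover have "sq f r z \<ge> 0" by (simp add: sq_def)
      moreover have nn: "sq (\<lambda>z. z i) (\<psi> (cs ! i)) z \<ge> 0" for i by (simp add: sq_def)
      then have "d k z \<ge> 0" unfolding d_def by (intro sum_nonneg) auto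
      ultimately have 0: "sq f r z = 0" "d k z = 0" unfolding g_def by linarith+
      have "sq (\<lambda>z. z i) (\<psi> (cs ! i)) z = 0" if "i < k" for i
        using 0(2) nn that sum_nonneg_eq_0_iff[of "{..<k}" "\<lambda>i. sq (\<lambda>z. z i) (\<psi> (cs ! i)) z"] unfolding d_def by auto
      then have "z i = map \<psi> cs ! i" if "i < length cs" for i using that by (simp add: sq_def k_def)
      then have "f z = f (\<lambda>i. map \<psi> cs ! i)" using Cinf_depends[OF f, of z "\<lambda>i. map \<psi> cs ! i"] by blast
      moreover have "f z = r" using 0(1) by (simp add: sq_def)
      ultimately show False using ne by (simp add: r_def)
    qed
    then have inv: "(\<lambda>z. 1 / g z) \<in> Cinf k" and one: "(\<lambda>z. g z * (1 / g z)) = (\<lambda>_. 1)"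
      using Cinf_inverse[OF g(1)] by auto
    have "V (\<lambda>z. g z * (1 / g z)) = V g * V (\<lambda>z. 1 / g z)" by (rule V_mult[OF g(1) inv])
    then show False unfolding one g(2) V_const by simp
  qed
  then show ?thesis
    using ext by (auto simp: points_def cinf_hom_def even_ring_def real_cinf_def PiE_def)
qed

text \<open>Evaluating bodies at \<open>q\<close> kills the even kernel, so it factors through the
  even part of \<open>S\<close>. The result is a ring homomorphism to the reals and hence a point by
  \<open>ring_hom_point\<close>.\<close>

lemma zero_set:
  assumes q: "\<And>F. \<lbrakk>F \<in> even_part E; \<Phi> F = \<zero>\<rbrakk> \<Longrightarrow> F {} q = 0"
  shows "\<exists>y\<in>points S. \<forall>i<m. pt y i = q i"
proof -
  have wd: "F {} q = G {} q" if F: "F \<in> even_part E" and G: "G \<in> even_part E" and eq: "\<Phi> F = \<Phi> G" for F G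
  proof -
    \<comment> \<open>The constant -1 expresses the difference of \<open>F\<close> and
      \<open>G\<close> through addition and multiplication, the operations that
      \<open>\<Phi>\<close> is known to preserve.\<close>
    define k where "k = body_fun (\<lambda>_. - 1)"
    have k: "k \<in> even_part E" unfolding k_def by (rule body_fun_even) simp
    have kG: "gmult k H = (\<lambda>K x. - 1 * H K x)" if "H \<in> even_part E" for H
      unfolding k_def by (rule gmult_body_fun[OF E_even[OF that]])
    have D: "(\<lambda>K x. F K x + gmult k G K x) \<in> even_part E"
      using F G gmult_even[OF k G] Cinf_add by (auto simp: Cinf_super_simps)
    have "\<Phi> (\<lambda>K x. F K x + gmult k G K x) = \<Phi> F \<oplus> \<Phi> k \<otimes> \<Phi> F"
      using \<Phi>_simps(2)[OF E_even[OF F] E_even[OF gmult_even[OF k G]]] \<Phi>_simps(3)[OF E_even[OF k] E_even[OF G]]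
      by (simp add: eq)
    also have "\<dots> = \<Phi> (\<lambda>K x. F K x + gmult k F K x)"
      using \<Phi>_simps(2)[OF E_even[OF F] E_even[OF gmult_even[OF k F]]] \<Phi>_simps(3)[OF E_even[OF k] E_even[OF F]] by simp
    also have "\<dots> = \<zero>" using \<Phi>_zero by (simp add: kG[OF F])
    finally have "F {} q + gmult k G {} q = 0" using q[OF D] by simp
    then show ?thesis by (simp add: kG[OF G])
  qed
  define \<psi> where "\<psi> = (\<lambda>c\<in>even_part S. (SOME F. F \<in> even_part E \<and> \<Phi> F = c) {} q)"
  have \<psi>: "\<psi> (\<Phi> F) = F {} q" if F: "F \<in> even_part E" for F
  proof -
    define G where "G = (SOME G. G \<in> even_part E \<and> \<Phi> G = \<Phi> F)"
    have "G \<in> even_part E \<and> \<Phi> G = \<Phi> F" unfolding G_def by (rule someI[of _ F]) (use F in simp)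
    then have "G {} q = F {} q" using wd F by blast
    then show ?thesis using \<Phi>_simps(4)[OF F] by (simp add: \<psi>_def G_def)
  qed
  have "\<psi> \<in> points S"
  proof (rule ring_hom_point)
    show "\<psi> \<in> extensional (even_part S)" by (simp add: \<psi>_def)
    fix a b assume "a \<in> even_part S" "b \<in> even_part S"
    then obtain F G where F: "F \<in> even_part E" "\<Phi> F = a" and G: "G \<in> even_part E" "\<Phi> G = b" by (metis even_onto)
    have FG: "(\<lambda>K x. F K x + G K x) \<in> even_part E" using F(1) G(1) Cinf_add by (auto simp: Cinf_super_simps)
    show "\<psi> (a \<oplus> b) = \<psi> a + \<psi> b"
      using \<psi>[OF FG] \<psi>[OF F(1)] \<psi>[OF G(1)] \<Phi>_simps(2)[OF E_even[OF F(1)] E_even[OF G(1)]] F(2) G(2) by simp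
    show "\<psi> (a \<otimes> b) = \<psi> a * \<psi> b"
      using \<psi>[OF gmult_even[OF F(1) G(1)]] \<psi>[OF F(1)] \<psi>[OF G(1)] \<Phi>_simps(3)[OF E_even[OF F(1)] E_even[OF G(1)]] F(2) G(2)
      by (simp add: gmult_body)
  next
    fix r
    have "sop S (\<lambda>_. r) [] = \<Phi> (body_fun (\<lambda>_. r))"
      using sop_comp[OF coords(1), of "\<lambda>_. r" "[]"] \<Phi>_body[of "\<lambda>_. r"] by simp
    then show "\<psi> (sop S (\<lambda>_. r) []) = r" using \<psi>[OF body_fun_even[of "\<lambda>_. r"]] by (simp add: body_fun_def)
  qed
  moreover have "pt \<psi> i = q i" if "i < m" for i
    using that \<psi>[OF body_fun_even[OF Cinf_proj[OF that]]] by (simp add: pt_def body_fun_def)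
  ultimately show ?thesis by blast
qed

text \<open>Each \<open>q\<close> gets a function \<open>B q\<close> that is nonzero at
  \<open>q\<close> and an element \<open>C q\<close> that represents \<open>\<sigma>\<close> at all
  points where \<open>B q\<close> is nonzero. \<open>Cinf_super_glue\<close> merges the
  \<open>C q\<close>.\<close>

theorem global_sections:
  assumes \<sigma>: "\<sigma> \<in> local_sections S (carrier S) (points S)"
  shows "\<exists>a\<in>carrier S. \<forall>y\<in>points S. \<sigma> y = loc_at_map S y a"
proof -
  have "\<exists>B C. B \<in> Cinf m \<and> B q \<noteq> 0 \<and> C \<in> carrier E \<and>
      (\<forall>y\<in>points S. B (pt y) \<noteq> 0 \<longrightarrow> loc_at_map S y (\<Phi> C) = \<sigma> y)" for q
  proof (cases "\<forall>F\<in>even_part E. \<Phi> F = \<zero> \<longrightarrow> F {} q = 0")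
    case True
    then obtain y0 where y0: "y0 \<in> points S" "\<forall>i<m. pt y0 i = q i" using zero_set[of q] by blast
    obtain V a where V: "openin (points_topology S) V" "y0 \<in> V" "a \<in> carrier S" "\<forall>y\<in>V. \<sigma> y = loc_at_map S y a"
      using local_sectionsD[OF \<sigma> y0(1)] by metis
    \<comment> \<open>A basic neighbourhood inside \<open>V\<close> turns openness into a condition
      on bodies: with \<open>F\<close> a preimage of \<open>c\<close>, its points are those where
      the body of \<open>F\<close> is nonzero. This body serves as \<open>B\<close>.\<close>
    obtain c where c: "c \<in> even_part S" "y0 c \<noteq> 0" "{y \<in> points S. y c \<noteq> 0} \<subseteq> V" using basic_nhd[OF V(1,2)] by blast
    obtain F where F: "F \<in> even_part E" "\<Phi> F = c" using even_onto[OF c(1)] .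
    have "a \<in> \<Phi> ` carrier E" using V(3) by (simp only: onto)
    then obtain C where C: "C \<in> carrier E" "\<Phi> C = a" by (elim imageE) simp
    have f: "F {} \<in> Cinf m" using F(1) by (simp add: Cinf_super_simps)
    have val: "y c = F {} (pt y)" if "y \<in> points S" for y using point_value_body[OF that F(1)] F(2) by simp
    have "F {} q = F {} (pt y0)" using f by (rule Cinf_depends) (use y0 in simp)
    then have "F {} q \<noteq> 0" using val[OF y0(1)] c(2) by simp
    moreover have "loc_at_map S y (\<Phi> C) = \<sigma> y" if "y \<in> points S" "F {} (pt y) \<noteq> 0" for y
    proof -
      have "y \<in> V" using val[OF that(1)] that c(3) by auto
      then show ?thesis using V(4) C(2) by simp
    qed
    ultimately show ?thesis using f C(1) by blast
  next
    \<comment> \<open>\<open>F\<close> lies in the kernel, so its body vanishes at all points of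
      \<open>S\<close> and the condition on \<open>C\<close> is void; \<open>F\<close> itself is
      taken for \<open>C\<close>.\<close>
    case False
    then obtain F where F: "F \<in> even_part E" "\<Phi> F = \<zero>" "F {} q \<noteq> 0" by blast
    have "F {} \<in> Cinf m" using F(1) by (simp add: Cinf_super_simps)
    moreover have "F {} (pt y) = 0" if "y \<in> points S" for y
      using point_value_body[OF that F(1)] F(2) point_zero[OF that] by simp
    ultimately show ?thesis using F(1,3) E_even by (intro exI[of _ "F {}"] exI[of _ F]) simp
  qed
  then obtain B C where BC: "\<And>q. B q \<in> Cinf m" "\<And>q. B q q \<noteq> 0" "\<And>q. C q \<in> carrier E"
      "\<And>q y. \<lbrakk>y \<in> points S; B q (pt y) \<noteq> 0\<rbrakk> \<Longrightarrow> loc_at_map S y (\<Phi> (C q)) = \<sigma> y" by metis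
  obtain F where F: "F \<in> carrier E" and glue: "\<forall>(P :: 'a sloc csring) h p s. germ_hom P m n h p \<longrightarrow>
      s \<in> carrier P \<longrightarrow> (\<forall>q. B q p \<noteq> 0 \<longrightarrow> h (C q) = s) \<longrightarrow> h F = s"
    using Cinf_super_glue[where B = B and C = C, OF BC(1-3)] by (elim bexE)
  have "\<sigma> y = loc_at_map S y (\<Phi> F)" if y: "y \<in> points S" for y
  proof -
    have "(\<forall>q. B q (pt y) \<noteq> 0 \<longrightarrow> loc_at_map S y (\<Phi> (C q)) = \<sigma> y) \<longrightarrow> loc_at_map S y (\<Phi> F) = \<sigma> y"
      using glue[THEN spec, of "loc_at S y", THEN spec, of "\<lambda>F. loc_at_map S y (\<Phi> F)", THEN spec, of "pt y",
        THEN spec, of "\<sigma> y"] germ_hom_loc[OF y] local_sections_in(1)[OF \<sigma> y] by blast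
    then show ?thesis using BC(4)[OF y] by simp
  qed
  then show ?thesis using \<Phi>_simps(1)[OF F] by blast
qed

end

text \<open>Naturality in both variables is a single equation, with \<open>\<alpha>\<close> varying
  the source and \<open>\<beta>\<close> the target; it is functoriality applied twice. Surjectivity
  rests on a presentation of \<open>S\<close>, which provides
  \<open>global_sections\<close>.\<close>

theorem corollary4p37:
  fixes R :: "'a csring" and S :: "'b csring"
  assumes "fair R" and "fair S"
  shows "lc_superspace (sSpec R) \<and> lc_superspace (sSpec S) \<and>
    bij_betw (sSpec_map R S) (csring_hom R S) (superspace_hom (sSpec S) (sSpec R)) \<and>
    sSpec_map R R (\<lambda>a\<in>carrier R. a) = superspace_id (sSpec R) \<and>
    (\<forall>(R' :: 'c csring) (S' :: 'd csring). fair R' \<longrightarrow> fair S' \<longrightarrow>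
       (\<forall>\<alpha>\<in>csring_hom R' R. \<forall>\<beta>\<in>csring_hom S S'. \<forall>\<phi>\<in>csring_hom R S.
          sSpec_map R' S' (compose (carrier R') \<beta> (compose (carrier R') \<phi> \<alpha>)) =
          superspace_comp (sSpec S') (sSpec S) (sSpec R')
            (superspace_comp (sSpec S) (sSpec R) (sSpec R') (sSpec_map R' R \<alpha>) (sSpec_map R S \<phi>))
            (sSpec_map S S' \<beta>)))"
proof -
  note Rr = fairD(1)[OF assms(1)] and Sr = fairD(1)[OF assms(2)]
  obtain m n \<Phi> where "\<Phi> \<in> csring_hom (Cinf_super m n) S" "\<Phi> ` carrier (Cinf_super m n) = carrier S"
    using fairD(2)[OF assms(2)] unfolding finitely_generated_def by blast
  then interpret presented S m n \<Phi>
    using Sr by (simp add: presented_def presented_axioms_def)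
  have "bij_betw (sSpec_map R S) (csring_hom R S) (superspace_hom (sSpec S) (sSpec R))"
    unfolding bij_betw_def
  proof
    show "inj_on (sSpec_map R S) (csring_hom R S)"
      by (rule inj_onI) (rule sSpec_map_faithful[OF Rr assms(2)])
    show "sSpec_map R S ` csring_hom R S = superspace_hom (sSpec S) (sSpec R)"
    proof (intro equalityI subsetI)
      fix F assume "F \<in> superspace_hom (sSpec S) (sSpec R)"
      then show "F \<in> sSpec_map R S ` csring_hom R S"
        using sSpec_map_full[OF Rr assms(2) global_sections, of "fst F" "snd F"] by force
    qed (use sSpec_map_hom[OF Rr Sr] in blast)
  qed
  moreover have "sSpec_map R' S' (compose (carrier R') \<beta> (compose (carrier R') \<phi> \<alpha>)) =
          superspace_comp (sSpec S') (sSpec S) (sSpec R')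
            (superspace_comp (sSpec S) (sSpec R) (sSpec R') (sSpec_map R' R \<alpha>) (sSpec_map R S \<phi>))
            (sSpec_map S S' \<beta>)"
    if "fair R'" "fair S'" and \<alpha>: "\<alpha> \<in> csring_hom R' R" and \<beta>: "\<beta> \<in> csring_hom S S'" and \<phi>: "\<phi> \<in> csring_hom R S"
    for R' :: "'c csring" and S' :: "'d csring" and \<alpha> \<beta> \<phi>
  proof -
    note R' = fairD(1)[OF \<open>fair R'\<close>] and S' = fairD(1)[OF \<open>fair S'\<close>]
    show ?thesis
      unfolding sSpec_map_comp[OF R' Rr Sr \<alpha> \<phi>, symmetric]
      by (rule sSpec_map_comp[OF R' Sr S' csring_hom_compose[OF R' Rr Sr \<phi> \<alpha>] \<beta>])
  qed
  ultimately show ?thesis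
    using cinf_superring.sSpec_lc_superspace[OF Rr] cinf_superring.sSpec_lc_superspace[OF Sr] sSpec_map_id[OF Rr]
    by blast
qed

end
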